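(* Let $k>0$, let $B\subseteq\mathbb{R}^3$ be an open ball, and let $A=\{f\in L^\infty(B;\mathbb{C}):\operatorname{Im}(f)\ge\lambda\text{ in }B\text{ for some }\lambda>0\}$. For $n\in A$ let $F(n)=u_n^\infty\in L^2(S^2\times S^2)$ be the far-field pattern at wavenumber $k$ associated with the refractive index $n$ extended by $1$ to the whole $\mathbb{R}^3$. Let $W$ be a finite-dimensional subspace of $L^\infty(B;\mathbb{C})$ and $K$ a convex and compact subset of $W\cap A$. Let $Q_N\colon L^2(S^2\times S^2)\to L^2(S^2\times S^2)$, $N\in\mathbb{N}$, be bounded linear maps such that $Q_N=Q_N^*$ and $Q_N\to I_{L^2(S^2\times S^2)}$ strongly as $N\to+\infty$. Let $C>0$ be a constant such that $$\|n_1-n_2\|_{L^\infty(B)}\le C\,\|u^\infty_{n_1}-u^\infty_{n_2}\|_{L^2(S^2\times S^2)},\qquad n_1,n_2\in K.$$ Then there exists $N\in\mathbb{N}$ such that $$\|n_1-n_2\|_{L^\infty(B)}\le 2C\,\|Q_N(u^\infty_{n_1})-Q_N(u^\infty_{n_2})\|_{L^2(S^2\times S^2)},\qquad n_1,n_2\in K;$$ explicitly, there exists $N$ satisfying $$\sup_{\xi\in K}\|(I_{L^2(S^2\times S^2)}-Q_N)F'(\xi)\|_{W\to L^2(S^2\times S^2)}\le\frac{1}{2C},$$ and any such $N$ has this property.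
   Context: $S^2$ is the unit sphere in $\mathbb{R}^3$. For a refractive index $n\in L^\infty(\mathbb{R}^3;\mathbb{C})$ with $\operatorname{Im}(n)\ge 0$ and $\operatorname{supp}(1-n)\subseteq\overline B$, and a direction $d\in S^2$, consider the incident wave $u^i(x)=e^{\mathrm{i}kx\cdot d}$ (which solves $\Delta u^i+k^2u^i=0$ in $\mathbb{R}^3$) and the total field $u=u^i+u^s$ solving $$\Delta u+k^2n(x)u=0\quad\text{in }\mathbb{R}^3,$$ where $u^s$ satisfies the Sommerfeld radiation condition $$\lim_{R\to+\infty}\int_{\partial B_R}\Bigl|\frac{\partial u^s(y)}{\partial r}-\mathrm{i}ku^s(y)\Bigr|^2ds(y)=0,\qquad r=|y|,$$ with $B_R$ the ball of radius $R$ centered at the origin. The far-field pattern is $$u_n^\infty(\hat x,d)=\frac{1}{4\pi}\int_{\partial B_R}\Bigl(u^s(y)\frac{\partial e^{-\mathrm{i}k\hat x\cdot y}}{\partial r}-\frac{\partial u^s}{\partial r}(y)\,e^{-\mathrm{i}k\hat x\cdot y}\Bigr)ds(y),\qquad\hat x\in S^2,$$ where $R>0$ is large enough that $\overline B\subseteq B_R$. $F'(\xi)$ denotes the Fréchet derivative of $F\colon A\to L^2(S^2\times S^2)$ at $\xi$, $W$ carries the $L^\infty(B)$ norm, and $\|\cdot\|_{W\to L^2(S^2\times S^2)}$ is the operator norm of the restriction to $W$. Strong convergence means pointwise convergence in norm. (A constant $C$ as in the statement is known to exist.) *)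

theory Defs
  imports "HOL-Analysis.Analysis"
begin

section \<open>Complex vector spaces\<close>

class complex_vec = real_vector +
  fixes scaleC :: "complex \<Rightarrow> 'a \<Rightarrow> 'a" (infixr \<open>*\<^sub>C\<close> 75)
  assumes scaleC_add_right: "a *\<^sub>C (x + y) = a *\<^sub>C x + a *\<^sub>C y"
    and scaleC_add_left: "(a + b) *\<^sub>C x = a *\<^sub>C x + b *\<^sub>C x"
    and scaleC_scaleC: "a *\<^sub>C (b *\<^sub>C x) = (a * b) *\<^sub>C x"
    and scaleC_of_real: "complex_of_real r *\<^sub>C x = r *\<^sub>R x"

global_interpretation cvec: vector_space "scaleC :: complex \<Rightarrow> 'a \<Rightarrow> 'a :: complex_vec"
proof
  show "1 *\<^sub>C x = x" for x :: 'a
    using scaleC_of_real[of 1 x] by simp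
qed (simp_all add: scaleC_add_right scaleC_add_left scaleC_scaleC)


section \<open>The space of essentially bounded functions on three-space\<close>

definition linf_fun :: "(real^3 \<Rightarrow> complex) \<Rightarrow> bool" where
  "linf_fun f \<longleftrightarrow> f \<in> borel_measurable lborel \<and> (\<exists>c. AE x in lborel. norm (f x) \<le> c)"

definition linf_rel :: "(real^3 \<Rightarrow> complex) \<Rightarrow> (real^3 \<Rightarrow> complex) \<Rightarrow> bool" where
  "linf_rel f g \<longleftrightarrow> linf_fun f \<and> linf_fun g \<and> (AE x in lborel. f x = g x)"

lemma linf_fun_zero: "linf_fun (\<lambda>x. 0)"
  unfolding linf_fun_def by (auto intro!: exI[of _ 0])

lemma linf_fun_add:
  assumes "linf_fun f" "linf_fun g"
  shows "linf_fun (\<lambda>x. f x + g x)"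
proof -
  obtain c where c: "AE x in lborel. norm (f x) \<le> c"
    using assms(1) unfolding linf_fun_def by blast
  obtain d where d: "AE x in lborel. norm (g x) \<le> d"
    using assms(2) unfolding linf_fun_def by blast
  have "AE x in lborel. norm (f x + g x) \<le> c + d"
    using c d by eventually_elim (rule norm_triangle_mono)
  then show ?thesis
    using assms unfolding linf_fun_def by auto
qed

lemma linf_relI: "linf_fun f \<Longrightarrow> (\<And>x. f x = g x) \<Longrightarrow> linf_rel f g"
  by (drule ext) (simp add: linf_rel_def)

lemma linf_fun_mult:
  assumes "linf_fun f"
  shows "linf_fun (\<lambda>x. a * f x)"
proof -
  obtain c where c: "AE x in lborel. norm (f x) \<le> c"
    using assms unfolding linf_fun_def by blast
  have "AE x in lborel. norm (a * f x) \<le> norm a * c"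
    using c by eventually_elim (auto simp: norm_mult intro: mult_left_mono)
  then show ?thesis
    using assms unfolding linf_fun_def by auto
qed

lemma linf_fun_uminus: "linf_fun f \<Longrightarrow> linf_fun (\<lambda>x. - f x)"
  using linf_fun_mult[of f "-1"] by simp

lemma linf_fun_diff: "linf_fun f \<Longrightarrow> linf_fun g \<Longrightarrow> linf_fun (\<lambda>x. f x - g x)"
  using linf_fun_add[of f "\<lambda>x. - g x"] linf_fun_uminus[of g] by simp

lemma linf_fun_scaleR: "linf_fun f \<Longrightarrow> linf_fun (\<lambda>x. r *\<^sub>R f x)"
  using linf_fun_mult[of f "of_real r"] by (simp add: scaleR_conv_of_real)

quotient_type linf = "real^3 \<Rightarrow> complex" / partial: linf_rel
proof (rule part_equivpI)
  show "\<exists>x. linf_rel x x"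
    using linf_fun_zero unfolding linf_rel_def by auto
  show "symp linf_rel"
    unfolding linf_rel_def by (rule sympI) (auto elim: eventually_mono)
  show "transp linf_rel"
    unfolding linf_rel_def by (rule transpI) (auto elim: eventually_elim2)
qed

definition esssup_norm :: "(real^3 \<Rightarrow> complex) \<Rightarrow> real" where
  "esssup_norm f = Inf {c. 0 \<le> c \<and> (AE x in lborel. norm (f x) \<le> c)}"

lemma esssup_norm_cong:
  assumes "AE x in lborel. f x = g x"
  shows "esssup_norm f = esssup_norm g"
proof -
  have "(AE x in lborel. norm (f x) \<le> c) \<longleftrightarrow> (AE x in lborel. norm (g x) \<le> c)" for c
    by (rule eventually_subst) (use assms in eventually_elim, simp)
  then show ?thesis
    unfolding esssup_norm_def by simp
qed

lemma esssup_norm_set_nonempty: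
  assumes "linf_fun f"
  shows "{c. 0 \<le> c \<and> (AE x in lborel. norm (f x) \<le> c)} \<noteq> {}"
proof -
  obtain c where c: "AE x in lborel. norm (f x) \<le> c"
    using assms unfolding linf_fun_def by blast
  have "AE x in lborel. norm (f x) \<le> max 0 c"
    using c by eventually_elim auto
  then show ?thesis
    by (auto intro!: exI[of _ "max 0 c"])
qed

lemma esssup_norm_nonneg: "linf_fun f \<Longrightarrow> 0 \<le> esssup_norm f"
  unfolding esssup_norm_def by (intro cInf_greatest esssup_norm_set_nonempty) auto

lemma esssup_norm_leI:
  assumes "0 \<le> c" "AE x in lborel. norm (f x) \<le> c"
  shows "esssup_norm f \<le> c"
  unfolding esssup_norm_def using assms by (intro cInf_lower bdd_belowI[of _ 0]) auto

lemma esssup_norm_AE: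
  assumes "linf_fun f"
  shows "AE x in lborel. norm (f x) \<le> esssup_norm f"
proof -
  let ?S = "{c. 0 \<le> c \<and> (AE x in lborel. norm (f x) \<le> c)}"
  have "AE x in lborel. norm (f x) \<le> esssup_norm f + inverse (real (Suc m))" for m
  proof -
    have "Inf ?S < esssup_norm f + inverse (real (Suc m))"
      unfolding esssup_norm_def by simp
    then obtain c where c: "c \<in> ?S" "c < esssup_norm f + inverse (real (Suc m))"
      using cInf_lessD[OF esssup_norm_set_nonempty[OF assms]] by blast
    have "AE x in lborel. norm (f x) \<le> c"
      using c(1) by simp
    then show ?thesis
      by eventually_elim (use c(2) in linarith)
  qed
  then have "AE x in lborel. \<forall>m. norm (f x) \<le> esssup_norm f + inverse (real (Suc m))"
    by (simp add: AE_all_countable)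
  then show ?thesis
  proof eventually_elim
    case (elim x)
    show ?case
    proof (rule field_le_epsilon)
      fix e :: real
      assume "0 < e"
      then obtain m where "inverse (real (Suc m)) < e"
        using reals_Archimedean by blast
      then show "norm (f x) \<le> esssup_norm f + e"
        using elim[rule_format, of m] by linarith
    qed
  qed
qed

lemma esssup_norm_eq_0:
  assumes "linf_fun f"
  shows "esssup_norm f = 0 \<longleftrightarrow> (AE x in lborel. f x = 0)"
proof
  assume f: "esssup_norm f = 0"
  show "AE x in lborel. f x = 0"
    using esssup_norm_AE[OF assms] by eventually_elim (use f in simp)
next
  assume "AE x in lborel. f x = 0"
  then have "AE x in lborel. norm (f x) \<le> 0"
    by simp
  then show "esssup_norm f = 0"
    using esssup_norm_leI[of 0 f] esssup_norm_nonneg[OF assms] by simp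
qed

instantiation linf :: complex_vec
begin

lift_definition zero_linf :: linf is "\<lambda>x. 0"
  by (simp add: linf_rel_def linf_fun_zero)

lift_definition plus_linf :: "linf \<Rightarrow> linf \<Rightarrow> linf" is "\<lambda>f g x. f x + g x"
  unfolding linf_rel_def by (auto intro: linf_fun_add elim: eventually_elim2)

lift_definition uminus_linf :: "linf \<Rightarrow> linf" is "\<lambda>f x. - f x"
  unfolding linf_rel_def by (auto intro: linf_fun_uminus elim: eventually_mono)

lift_definition minus_linf :: "linf \<Rightarrow> linf \<Rightarrow> linf" is "\<lambda>f g x. f x - g x"
  unfolding linf_rel_def by (auto intro: linf_fun_diff elim: eventually_elim2)

lift_definition scaleR_linf :: "real \<Rightarrow> linf \<Rightarrow> linf" is "\<lambda>r f x. r *\<^sub>R f x"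
  unfolding linf_rel_def by (auto intro: linf_fun_scaleR elim: eventually_mono)

lift_definition scaleC_linf :: "complex \<Rightarrow> linf \<Rightarrow> linf" is "\<lambda>a f x. a * f x"
  unfolding linf_rel_def by (auto intro: linf_fun_mult elim: eventually_mono)

instance
  by standard
    (transfer, rule linf_relI,
      (intro linf_fun_zero linf_fun_add linf_fun_uminus linf_fun_diff linf_fun_mult linf_fun_scaleR;
        simp add: linf_rel_def),
      simp add: algebra_simps scaleR_conv_of_real)+

end

instantiation linf :: real_normed_vector
begin

lift_definition norm_linf :: "linf \<Rightarrow> real" is esssup_norm
  unfolding linf_rel_def by (auto intro: esssup_norm_cong)

definition dist_linf :: "linf \<Rightarrow> linf \<Rightarrow> real" where
  "dist_linf f g = norm (f - g)"

definition sgn_linf :: "linf \<Rightarrow> linf" where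
  "sgn_linf f = f /\<^sub>R norm f"

definition uniformity_linf :: "(linf \<times> linf) filter" where
  "uniformity_linf = (INF e\<in>{0 <..}. principal {(f, g). dist f g < e})"

definition open_linf :: "linf set \<Rightarrow> bool" where
  "open_linf U \<longleftrightarrow> (\<forall>f\<in>U. eventually (\<lambda>(f', g). f' = f \<longrightarrow> g \<in> U) uniformity)"

instance
proof
  show "(norm f = 0) = (f = 0)" for f :: linf
    by transfer (simp add: linf_rel_def linf_fun_zero esssup_norm_eq_0)
  show "norm (f + g) \<le> norm f + norm g" for f g :: linf
  proof (transfer, unfold linf_rel_def, safe)
    fix f g
    assume fg: "linf_fun f" "linf_fun g"
    have "AE x in lborel. norm (f x + g x) \<le> esssup_norm f + esssup_norm g"
      using esssup_norm_AE[OF fg(1)] esssup_norm_AE[OF fg(2)]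
      by eventually_elim (rule norm_triangle_mono)
    then show "esssup_norm (\<lambda>x. f x + g x) \<le> esssup_norm f + esssup_norm g"
      using fg by (intro esssup_norm_leI add_nonneg_nonneg esssup_norm_nonneg)
  qed
  show "norm (r *\<^sub>R f) = \<bar>r\<bar> * norm f" for r and f :: linf
  proof (transfer, unfold linf_rel_def, safe)
    fix r :: real and f
    assume f: "linf_fun f"
    have le: "esssup_norm (\<lambda>x. s *\<^sub>R g x) \<le> \<bar>s\<bar> * esssup_norm g" if "linf_fun g" for s g
    proof (rule esssup_norm_leI)
      show "AE x in lborel. norm (s *\<^sub>R g x) \<le> \<bar>s\<bar> * esssup_norm g"
        using esssup_norm_AE[OF that] by eventually_elim (simp add: mult_left_mono)
    qed (simp add: esssup_norm_nonneg that)
    show "esssup_norm (\<lambda>x. r *\<^sub>R f x) = \<bar>r\<bar> * esssup_norm f"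
    proof (cases "r = 0")
      case True
      then show ?thesis
        using le[OF f, of 0] esssup_norm_nonneg[OF linf_fun_zero] by simp
    next
      case False
      have "\<bar>r\<bar> * esssup_norm f = \<bar>r\<bar> * esssup_norm (\<lambda>x. inverse r *\<^sub>R (r *\<^sub>R f x))"
        using False by simp
      also have "\<dots> \<le> \<bar>r\<bar> * (\<bar>inverse r\<bar> * esssup_norm (\<lambda>x. r *\<^sub>R f x))"
        by (intro mult_left_mono le linf_fun_scaleR f) simp
      also have "\<dots> = esssup_norm (\<lambda>x. r *\<^sub>R f x)"
        using False by (simp add: abs_mult[symmetric] mult.assoc[symmetric])
      finally show ?thesis
        using le[OF f, of r] by simp
    qed
  qed
qed (simp_all add: dist_linf_def sgn_linf_def uniformity_linf_def open_linf_def)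

end

text \<open>
  The space of essentially bounded functions on \<open>B\<close> is identified, isometrically, with the
  subspace of those classes on the whole space that vanish almost everywhere outside \<open>B\<close>.
\<close>

definition Linf_on :: "(real^3) set \<Rightarrow> linf set" where
  "Linf_on B = {f. AE x in lborel. x \<notin> B \<longrightarrow> rep_linf f x = 0}"


section \<open>Surface measure and square-integrable functions on pairs of directions\<close>

text \<open>
  The surface measure of the unit sphere, as three times the cone measure: the area of a Borel
  set \<open>E\<close> of directions is three times the volume of \<open>{t * w | 0 < t < 1, w \<in> E}\<close>.
\<close>

definition S2_measure :: "(real^3) measure" where
  "S2_measure = scale_measure 3
    (distr (restrict_space lborel (ball 0 1 - {0})) (restrict_space borel (sphere 0 1))
      (\<lambda>x. x /\<^sub>R norm x))"

abbreviation S2S2 :: "((real^3) \<times> (real^3)) measure" where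
  "S2S2 \<equiv> S2_measure \<Otimes>\<^sub>M S2_measure"

definition l2_fun :: "((real^3) \<times> (real^3) \<Rightarrow> complex) \<Rightarrow> bool" where
  "l2_fun f \<longleftrightarrow> f \<in> borel_measurable S2S2 \<and> integrable S2S2 (\<lambda>p. (norm (f p))\<^sup>2)"

definition l2_rel :: "((real^3) \<times> (real^3) \<Rightarrow> complex) \<Rightarrow> ((real^3) \<times> (real^3) \<Rightarrow> complex) \<Rightarrow> bool" where
  "l2_rel f g \<longleftrightarrow> l2_fun f \<and> l2_fun g \<and> (AE p in S2S2. f p = g p)"

lemma l2_fun_zero: "l2_fun (\<lambda>p. 0)"
  unfolding l2_fun_def by simp

lemma l2_relI: "l2_fun f \<Longrightarrow> (\<And>x. f x = g x) \<Longrightarrow> l2_rel f g"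
  by (drule ext) (simp add: l2_rel_def)

lemma l2_fun_mult: "l2_fun f \<Longrightarrow> l2_fun (\<lambda>p. a * f p)"
  unfolding l2_fun_def by (auto simp: norm_mult power_mult_distrib)

lemma l2_fun_uminus: "l2_fun f \<Longrightarrow> l2_fun (\<lambda>p. - f p)"
  using l2_fun_mult[of f "-1"] by simp

lemma l2_fun_scaleR: "l2_fun f \<Longrightarrow> l2_fun (\<lambda>p. r *\<^sub>R f p)"
  using l2_fun_mult[of f "of_real r"] by (simp add: scaleR_conv_of_real)

lemma l2_integrable_mult_cnj:
  assumes "l2_fun f" "l2_fun g"
  shows "integrable S2S2 (\<lambda>p. f p * cnj (g p))"
proof (rule Bochner_Integration.integrable_bound)
  show "integrable S2S2 (\<lambda>p. (norm (f p))\<^sup>2 + (norm (g p))\<^sup>2)"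
    using assms unfolding l2_fun_def by auto
  have [measurable]: "f \<in> borel_measurable S2S2" "g \<in> borel_measurable S2S2"
    using assms unfolding l2_fun_def by auto
  have "(\<lambda>p. cnj (g p)) \<in> borel_measurable S2S2"
    by (rule borel_measurable_continuous_on[where f = cnj]) (auto intro: continuous_intros)
  then show "(\<lambda>p. f p * cnj (g p)) \<in> borel_measurable S2S2"
    by measurable
  have "norm (f p * cnj (g p)) \<le> (norm (f p))\<^sup>2 + (norm (g p))\<^sup>2" for p
  proof -
    have "2 * (norm (f p) * norm (g p)) \<le> (norm (f p))\<^sup>2 + (norm (g p))\<^sup>2"
      using sum_squares_bound[of "norm (f p)" "norm (g p)"] by (simp add: mult.assoc)
    moreover have "0 \<le> norm (f p) * norm (g p)"
      by simp
    ultimately show ?thesis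
      unfolding norm_mult complex_mod_cnj by linarith
  qed
  then show "AE p in S2S2. norm (f p * cnj (g p)) \<le> norm ((norm (f p))\<^sup>2 + (norm (g p))\<^sup>2)"
    by (intro AE_I2) simp
qed

lemma l2_fun_add:
  assumes "l2_fun f" "l2_fun g"
  shows "l2_fun (\<lambda>p. f p + g p)"
proof -
  have [measurable]: "f \<in> borel_measurable S2S2" "g \<in> borel_measurable S2S2"
    using assms unfolding l2_fun_def by auto
  have "integrable S2S2 (\<lambda>p. (norm (f p))\<^sup>2 + (norm (g p))\<^sup>2 + 2 * Re (f p * cnj (g p)))"
    using assms l2_integrable_mult_cnj[OF assms] unfolding l2_fun_def
    by (intro Bochner_Integration.integrable_add integrable_mult_right integrable_Re) simp_all
  moreover have "(norm (f p))\<^sup>2 + (norm (g p))\<^sup>2 + 2 * Re (f p * cnj (g p))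
      = (norm (f p + g p))\<^sup>2" for p
    unfolding cmod_power2 by (simp add: power2_eq_square algebra_simps)
  ultimately show ?thesis
    unfolding l2_fun_def by simp
qed

lemma l2_fun_diff: "l2_fun f \<Longrightarrow> l2_fun g \<Longrightarrow> l2_fun (\<lambda>p. f p - g p)"
  using l2_fun_add[of f "\<lambda>p. - g p"] l2_fun_uminus[of g] by simp

quotient_type l2 = "(real^3) \<times> (real^3) \<Rightarrow> complex" / partial: l2_rel
proof (rule part_equivpI)
  show "\<exists>x. l2_rel x x"
    using l2_fun_zero unfolding l2_rel_def by auto
  show "symp l2_rel"
    unfolding l2_rel_def by (rule sympI) (auto elim: eventually_mono)
  show "transp l2_rel"
    unfolding l2_rel_def by (rule transpI) (auto elim: eventually_elim2)
qed

instantiation l2 :: complex_vec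
begin

lift_definition zero_l2 :: l2 is "\<lambda>x. 0"
  by (simp add: l2_rel_def l2_fun_zero)

lift_definition plus_l2 :: "l2 \<Rightarrow> l2 \<Rightarrow> l2" is "\<lambda>f g x. f x + g x"
  unfolding l2_rel_def by (auto intro: l2_fun_add elim: eventually_elim2)

lift_definition uminus_l2 :: "l2 \<Rightarrow> l2" is "\<lambda>f x. - f x"
  unfolding l2_rel_def by (auto intro: l2_fun_uminus elim: eventually_mono)

lift_definition minus_l2 :: "l2 \<Rightarrow> l2 \<Rightarrow> l2" is "\<lambda>f g x. f x - g x"
  unfolding l2_rel_def by (auto intro: l2_fun_diff elim: eventually_elim2)

lift_definition scaleR_l2 :: "real \<Rightarrow> l2 \<Rightarrow> l2" is "\<lambda>r f x. r *\<^sub>R f x"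
  unfolding l2_rel_def by (auto intro: l2_fun_scaleR elim: eventually_mono)

lift_definition scaleC_l2 :: "complex \<Rightarrow> l2 \<Rightarrow> l2" is "\<lambda>a f x. a * f x"
  unfolding l2_rel_def by (auto intro: l2_fun_mult elim: eventually_mono)

instance
  by standard
    (transfer, rule l2_relI,
      (intro l2_fun_zero l2_fun_add l2_fun_uminus l2_fun_diff l2_fun_mult l2_fun_scaleR;
        simp add: l2_rel_def),
      simp add: algebra_simps scaleR_conv_of_real)+

end

lift_definition cinner_l2 :: "l2 \<Rightarrow> l2 \<Rightarrow> complex" is "\<lambda>f g. \<integral>p. f p * cnj (g p) \<partial>S2S2"
proof -
  fix f f' g g'
  assume ff: "l2_rel f f'" and gg: "l2_rel g g'"
  show "(\<integral>p. f p * cnj (g p) \<partial>S2S2) = (\<integral>p. f' p * cnj (g' p) \<partial>S2S2)"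
  proof (rule integral_cong_AE)
    show "AE p in S2S2. f p * cnj (g p) = f' p * cnj (g' p)"
      using ff gg unfolding l2_rel_def by (auto elim: eventually_elim2)
  qed (use ff gg l2_integrable_mult_cnj in \<open>auto simp: l2_rel_def\<close>)
qed

instantiation l2 :: real_inner
begin

definition inner_l2 :: "l2 \<Rightarrow> l2 \<Rightarrow> real" where
  "inner_l2 f g = Re (cinner_l2 f g)"

lift_definition norm_l2 :: "l2 \<Rightarrow> real" is "\<lambda>f. sqrt (\<integral>p. (norm (f p))\<^sup>2 \<partial>S2S2)"
proof -
  fix f f'
  assume ff: "l2_rel f f'"
  have "(\<integral>p. (norm (f p))\<^sup>2 \<partial>S2S2) = (\<integral>p. (norm (f' p))\<^sup>2 \<partial>S2S2)"
  proof (rule integral_cong_AE)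
    show "AE p in S2S2. (norm (f p))\<^sup>2 = (norm (f' p))\<^sup>2"
      using ff unfolding l2_rel_def by (auto elim: eventually_mono)
  qed (use ff in \<open>auto simp: l2_rel_def l2_fun_def\<close>)
  then show "sqrt (\<integral>p. (norm (f p))\<^sup>2 \<partial>S2S2) = sqrt (\<integral>p. (norm (f' p))\<^sup>2 \<partial>S2S2)"
    by simp
qed

definition dist_l2 :: "l2 \<Rightarrow> l2 \<Rightarrow> real" where
  "dist_l2 f g = norm (f - g)"

definition sgn_l2 :: "l2 \<Rightarrow> l2" where
  "sgn_l2 f = f /\<^sub>R norm f"

definition uniformity_l2 :: "(l2 \<times> l2) filter" where
  "uniformity_l2 = (INF e\<in>{0 <..}. principal {(f, g). dist f g < e})"

definition open_l2 :: "l2 set \<Rightarrow> bool" where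
  "open_l2 U \<longleftrightarrow> (\<forall>f\<in>U. eventually (\<lambda>(f', g). f' = f \<longrightarrow> g \<in> U) uniformity)"

lemma cinner_l2_self: "cinner_l2 f f = of_real ((norm f)\<^sup>2)"
proof (transfer, unfold l2_rel_def, safe)
  fix f
  have "(\<integral>p. f p * cnj (f p) \<partial>S2S2) = (\<integral>p. of_real ((norm (f p))\<^sup>2) \<partial>S2S2)"
    by (intro Bochner_Integration.integral_cong refl)
      (metis complex_norm_square)
  also have "\<dots> = of_real (\<integral>p. (norm (f p))\<^sup>2 \<partial>S2S2)"
    by (rule integral_complex_of_real)
  also have "\<dots> = of_real ((sqrt (\<integral>p. (norm (f p))\<^sup>2 \<partial>S2S2))\<^sup>2)"
    by (subst real_sqrt_pow2) (auto intro: Bochner_Integration.integral_nonneg)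
  finally show "(\<integral>p. f p * cnj (f p) \<partial>S2S2) =
    of_real ((sqrt (\<integral>p. (norm (f p))\<^sup>2 \<partial>S2S2))\<^sup>2)" .
qed

lemma norm_l2_eq_0: "norm f = 0 \<longleftrightarrow> f = (0 :: l2)"
proof (transfer, unfold l2_rel_def)
  fix f
  assume f: "l2_fun f \<and> l2_fun f \<and> (AE p in S2S2. f p = f p)"
  then have "(\<integral>p. (norm (f p))\<^sup>2 \<partial>S2S2) = 0 \<longleftrightarrow> (AE p in S2S2. (norm (f p))\<^sup>2 = 0)"
    by (intro integral_nonneg_eq_0_iff_AE) (auto simp: l2_fun_def)
  then show "sqrt (\<integral>p. (norm (f p))\<^sup>2 \<partial>S2S2) = 0 \<longleftrightarrow>
      l2_fun f \<and> l2_fun (\<lambda>p. 0) \<and> (AE p in S2S2. f p = 0)"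
    using f by (simp add: l2_fun_zero)
qed

instance
proof
  show "inner f g = inner g f" for f g :: l2
  proof -
    have "cinner_l2 f g = cnj (cinner_l2 g f)"
      by transfer (simp flip: Bochner_Integration.integral_cnj add: mult.commute)
    then show ?thesis
      by (simp add: inner_l2_def)
  qed
  show "inner (f + g) h = inner f h + inner g h" for f g h :: l2
  proof -
    have "cinner_l2 (f + g) h = cinner_l2 f h + cinner_l2 g h"
      by transfer (simp add: l2_rel_def distrib_right l2_integrable_mult_cnj)
    then show ?thesis
      by (simp add: inner_l2_def)
  qed
  show "inner (r *\<^sub>R f) g = r * inner f g" for r and f g :: l2
  proof -
    have "cinner_l2 (r *\<^sub>R f) g = r *\<^sub>R cinner_l2 f g"
      by transfer (simp add: l2_rel_def)
    then show ?thesis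
      by (simp add: inner_l2_def)
  qed
  show "0 \<le> inner f f" for f :: l2
    by (simp add: inner_l2_def cinner_l2_self)
  show "(inner f f = 0) = (f = 0)" for f :: l2
    by (simp add: inner_l2_def cinner_l2_self norm_l2_eq_0)
  have "0 \<le> norm f" for f :: l2
    by transfer (auto intro: Bochner_Integration.integral_nonneg)
  then show "norm f = sqrt (inner f f)" for f :: l2
    by (simp add: inner_l2_def cinner_l2_self)
qed (simp_all add: dist_l2_def sgn_l2_def uniformity_l2_def open_l2_def)

end


section \<open>Scattering by an inhomogeneous medium\<close>

definition pderiv_at :: "3 \<Rightarrow> (real^3 \<Rightarrow> complex) \<Rightarrow> real^3 \<Rightarrow> complex" where
  "pderiv_at i f x = frechet_derivative f (at x) (axis i 1)"

definition rderiv :: "(real^3 \<Rightarrow> complex) \<Rightarrow> real^3 \<Rightarrow> complex" where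
  "rderiv f x = frechet_derivative f (at x) (x /\<^sub>R norm x)"

definition C1_on :: "(real^3) set \<Rightarrow> (real^3 \<Rightarrow> complex) \<Rightarrow> bool" where
  "C1_on S f \<longleftrightarrow>
    (\<forall>x\<in>S. f differentiable (at x)) \<and> (\<forall>i. continuous_on S (pderiv_at i f))"

definition test_fun :: "(real^3 \<Rightarrow> complex) \<Rightarrow> bool" where
  "test_fun \<phi> \<longleftrightarrow> C1_on UNIV \<phi> \<and> compact (closure {x. \<phi> x \<noteq> 0})"

definition L2loc :: "(real^3 \<Rightarrow> complex) \<Rightarrow> bool" where
  "L2loc f \<longleftrightarrow> f \<in> borel_measurable lborel \<and>
    (\<forall>S. compact S \<longrightarrow> set_integrable lborel S (\<lambda>x. (norm (f x))\<^sup>2))"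

text \<open>
  Membership in the local Sobolev space of order one, with weak gradient \<open>g\<close>. Compactly supported
  \<open>C\<^sup>1\<close> test functions define the same weak derivatives as smooth ones, by density.
\<close>

definition H1loc :: "(real^3 \<Rightarrow> complex) \<Rightarrow> (3 \<Rightarrow> real^3 \<Rightarrow> complex) \<Rightarrow> bool" where
  "H1loc u g \<longleftrightarrow> L2loc u \<and> (\<forall>i. L2loc (g i)) \<and>
    (\<forall>\<phi> i. test_fun \<phi> \<longrightarrow>
      (\<integral>x. u x * pderiv_at i \<phi> x \<partial>lborel) = - (\<integral>x. g i x * \<phi> x \<partial>lborel))"

text \<open>
  As \<open>n\<close> is only bounded and measurable, \<open>\<Delta>u + k\<^sup>2 n u = 0\<close> is meant in the weak sense.
\<close>

definition helmholtz_solution :: "real \<Rightarrow> (real^3 \<Rightarrow> complex) \<Rightarrow> (real^3 \<Rightarrow> complex) \<Rightarrow> bool" where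
  "helmholtz_solution k n u \<longleftrightarrow> (\<exists>g. H1loc u g \<and>
    (\<forall>\<phi>. test_fun \<phi> \<longrightarrow>
      (\<integral>x. (\<Sum>i\<in>UNIV. g i x * pderiv_at i \<phi> x) \<partial>lborel) =
      of_real (k\<^sup>2) * (\<integral>x. n x * u x * \<phi> x \<partial>lborel)))"

definition sphere_integral ::
    "real \<Rightarrow> (real^3 \<Rightarrow> 'b::{banach, second_countable_topology}) \<Rightarrow> 'b" where
  "sphere_integral R f = R\<^sup>2 *\<^sub>R (\<integral>w. f (R *\<^sub>R w) \<partial>S2_measure)"

definition sommerfeld :: "real \<Rightarrow> (real^3 \<Rightarrow> complex) \<Rightarrow> bool" where
  "sommerfeld k us \<longleftrightarrow>
    ((\<lambda>R. sphere_integral R (\<lambda>y. (norm (rderiv us y - \<i> * of_real k * us y))\<^sup>2)) \<longlongrightarrow> 0) at_top"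

definition plane_wave :: "real \<Rightarrow> real^3 \<Rightarrow> real^3 \<Rightarrow> complex" where
  "plane_wave k d x = exp (\<i> * of_real (k * (x \<bullet> d)))"

text \<open>
  A solution in the Sobolev sense is only determined up to null sets. Where the medium is
  homogeneous it has a smooth representative, which is the one meant by the traces and normal
  derivatives on spheres; this is why continuous differentiability off \<open>closure B\<close> is required.
\<close>

definition scattered_field ::
    "real \<Rightarrow> (real^3) set \<Rightarrow> (real^3 \<Rightarrow> complex) \<Rightarrow> real^3 \<Rightarrow> (real^3 \<Rightarrow> complex) \<Rightarrow> bool" where
  "scattered_field k B n d us \<longleftrightarrow>
    helmholtz_solution k n (\<lambda>x. plane_wave k d x + us x) \<and>
    C1_on (- closure B) us \<and> sommerfeld k us"

definition far_field_of :: "real \<Rightarrow> real \<Rightarrow> (real^3 \<Rightarrow> complex) \<Rightarrow> real^3 \<Rightarrow> complex" where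
  "far_field_of k R us xh =
    of_real (1 / (4 * pi)) * sphere_integral R (\<lambda>y.
      us y * rderiv (\<lambda>z. exp (- \<i> * of_real (k * (xh \<bullet> z)))) y
      - rderiv us y * exp (- \<i> * of_real (k * (xh \<bullet> y))))"

text \<open>
  The scattered field is unique off \<open>closure B\<close>, and the boundary integral does not depend on the
  radius of a sphere enclosing \<open>closure B\<close>, so both choices below are immaterial.
\<close>

definition far_field ::
    "real \<Rightarrow> (real^3) set \<Rightarrow> (real^3 \<Rightarrow> complex) \<Rightarrow> real^3 \<Rightarrow> real^3 \<Rightarrow> complex" where
  "far_field k B n xh d =
    far_field_of k (SOME R. 0 < R \<and> closure B \<subseteq> ball 0 R) (SOME us. scattered_field k B n d us) xh"

definition extend_by_one :: "(real^3) set \<Rightarrow> linf \<Rightarrow> real^3 \<Rightarrow> complex" where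
  "extend_by_one B f x = (if x \<in> B then rep_linf f x else 1)"

definition admissible :: "(real^3) set \<Rightarrow> linf set" where
  "admissible B = {f \<in> Linf_on B. \<exists>m>0. AE x in lborel. x \<in> B \<longrightarrow> m \<le> Im (rep_linf f x)}"

definition far_field_map :: "real \<Rightarrow> (real^3) set \<Rightarrow> linf \<Rightarrow> l2" where
  "far_field_map k B f = abs_l2 (\<lambda>(xh, d). far_field k B (extend_by_one B f) xh d)"

text \<open>
  The admissible set is relatively open in \<open>Linf_on B\<close>, so the derivative within it is uniquely
  determined on \<open>Linf_on B\<close>, and only there.
\<close>

definition far_field_deriv :: "real \<Rightarrow> (real^3) set \<Rightarrow> linf \<Rightarrow> linf \<Rightarrow> l2" where
  "far_field_deriv k B f = frechet_derivative (far_field_map k B) (at f within admissible B)"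

text \<open>Operator norm of the restriction to \<open>W\<close>, with value \<open>\<infinity>\<close> if it is unbounded.\<close>

definition opnorm_on :: "'a::real_normed_vector set \<Rightarrow> ('a \<Rightarrow> 'b::real_normed_vector) \<Rightarrow> ennreal" where
  "opnorm_on W T = (SUP w\<in>{w \<in> W. norm w \<le> 1}. ennreal (norm (T w)))"

end

theory Submission
 imports Defs "HOL-Real_Asymp.Real_Asymp"
begin

text \<open>
 Write \<open>F\<close> for the far-field map. It is differentiable on the admissible set, and
 its derivative \<open>D\<close> depends continuously on the base point, so the vectors \<open>D \<xi> w\<close> with \<open>\<xi>\<close> in the compact
 set \<open>K\<close> and \<open>w\<close> in the unit ball of the finite-dimensional space \<open>W\<close> lie in a compact set. By the
 uniform boundedness principle strong convergence is uniform on compact sets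
 (\<open>strong_convergence_uniform_on_compact\<close>), so some \<open>Q N\<close> moves all of these vectors by at most
 \<open>1 / (2 * C)\<close>. For any such \<open>N\<close> the mean value inequality along the segment between two points of the
 convex set \<open>K\<close> gives \<open>norm ((F n1 - Q N (F n1)) - (F n2 - Q N (F n2))) \<le> norm (n1 - n2) / (2 * C)\<close>; in the
 assumed stability estimate this costs one half of \<open>norm (n1 - n2)\<close>, which is absorbed on the left.

 The work is in the differentiability of \<open>F\<close>. The total field in \<open>B\<close> solves the Lippmann--Schwinger
 equation \<open>u - k\<^sup>2 G (a u) = u\<^sup>i\<close>, where \<open>G\<close> is the volume potential of the outgoing fundamental solution
 cut off to \<open>B\<close> and \<open>a\<close> is the contrast \<open>n - 1\<close>. Off \<open>B\<close>, where \<open>G\<close> ignores it, the contrast is given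
 the value \<open>\<i>\<close>, so that \<open>Im a\<close> has a positive lower bound on the whole space. Multiplying the operator by
 \<open>\<i> * cnj a\<close> makes it coercive, because \<open>Im (G f, f)\<close> is nonnegative (\<open>pot_positive\<close>), and
 Lax--Milgram inverts it (\<open>ls_op_invertible\<close>). The operator is affine in
 \<open>n\<close>, so its inverse is differentiable, and \<open>F\<close> is a fixed bounded linear image of it.

 Two facts tie this to the scattering problem. The potential of \<open>k\<^sup>2 (n - 1) u\<close> is a scattered field
 (\<open>scattered_field_exists\<close>). Conversely every scattered field is that potential: the difference solves the
 Helmholtz equation in the whole space and radiates, hence vanishes (\<open>radiating_entire_zero\<close>). Green's
 identity on a large sphere turns the far field into the pairing of the source with a plane wave
 (\<open>far_field_of_eq_integral\<close>).

 Weak solutions are paired only with \<open>C\<^sup>1\<close> test functions. Spheres are therefore replaced by thin shells,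
 the gradients of radial cutoffs, and the singular kernel by \<open>exp (\<i> k t) / (4 pi t)\<close> with
 \<open>t = sqrt (r\<^sup>2 + \<epsilon>\<^sup>2)\<close>, which is smooth and solves the Helmholtz equation up to an approximate identity.
\<close>

text \<open>Analogous to \<open>LBINT\<close>, for integrals of nonnegative extended functions.\<close>

abbreviation nn_lborel :: "('a::euclidean_space \<Rightarrow> ennreal) \<Rightarrow> ennreal" (binder "NN " 10)
 where "nn_lborel f \<equiv> nn_integral lborel f"

text \<open>The unqualified names would denote the facts on gauge integrals.\<close>

lemmas integrable_add = Bochner_Integration.integrable_add
lemmas integrable_bound = Bochner_Integration.integrable_bound
lemmas integrable_cong = Bochner_Integration.integrable_cong
lemmas integrable_diff = Bochner_Integration.integrable_diff
lemmas integrable_sum = Bochner_Integration.integrable_sum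
lemmas integral_Im = Bochner_Integration.integral_Im
lemmas integral_add = Bochner_Integration.integral_add
lemmas integral_cnj = Bochner_Integration.integral_cnj
lemmas integral_cong = Bochner_Integration.integral_cong
lemmas integral_diff = Bochner_Integration.integral_diff
lemmas integral_minus = Bochner_Integration.integral_minus
lemmas integral_mono = Bochner_Integration.integral_mono
lemmas integral_nonneg = Bochner_Integration.integral_nonneg
lemmas integral_norm_bound_integral = Bochner_Integration.integral_norm_bound_integral
lemmas integral_sum = Bochner_Integration.integral_sum

section \<open>Functional analysis\<close>

text \<open>
 By Baire, one of the closed sets on which all operators are bounded by \<open>m\<close> contains a ball.
\<close>

lemma banach_steinhaus:
 fixes T :: "nat \<Rightarrow> 'a::banach \<Rightarrow> 'b::real_normed_vector"
 assumes bl: "\<And>n. bounded_linear (T n)" and pb: "\<And>x. \<exists>M. \<forall>n. norm (T n x) \<le> M"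
 shows "\<exists>M. \<forall>n x. norm (T n x) \<le> M * norm x"
proof -
 define E where "E m = {x. \<forall>n. norm (T n x) \<le> real m}" for m
 have E_eq: "E m = (\<Inter>n. {x. norm (T n x) \<le> real m})" for m
  by (auto simp: E_def)
 have closedE: "closed (E m)" for m
  unfolding E_eq using bl
  by (intro closed_INT ballI closed_Collect_le continuous_on_norm linear_continuous_on continuous_on_const)
 have UE: "(\<Union>m. E m) = UNIV"
 proof -
  have "\<exists>m. x \<in> E m" for x
  proof -
   obtain M where "\<forall>n. norm (T n x) \<le> M" using pb by blast
   moreover obtain m where "M \<le> real m" using real_arch_simple by blast
   ultimately show ?thesis unfolding E_def by (auto intro: order_trans)
  qed
  then show ?thesis by blast
 qed
 have "\<exists>m. interior (E m) \<noteq> {}"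
 proof (rule ccontr)
  assume "\<nexists>m. interior (E m) \<noteq> {}"
  then have emp: "interior (E m) = {}" for m by blast
  have "euclidean interior_of \<Union>(range E) = {}"
   using Met_TC.metric_Baire_category_alt[where ?'a='a, of "range E"] closedE emp complete_UNIV
   by auto
  then show False using UE by simp
 qed
 then obtain m x0 where "x0 \<in> interior (E m)" by blast
 then obtain r where r: "r > 0" "cball x0 r \<subseteq> E m"
  using mem_interior_cball by blast
 have "norm (T n x) \<le> (2 * real m / r) * norm x" for n x
 proof (cases "x = 0")
  case True
  then show ?thesis using bl[of n] by (simp add: bounded_linear.linear linear_0)
 next
  case False
  interpret bounded_linear "T n" by (rule bl)
  define y where "y = (r / norm x) *\<^sub>R x"
  have "norm y = r" using False r by (simp add: y_def)
  then have "x0 + y \<in> E m" "x0 \<in> E m" using r by (auto simp: dist_norm subset_iff)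
  then have "norm (T n (x0 + y)) \<le> real m" "norm (T n x0) \<le> real m" by (auto simp: E_def)
  moreover have "T n y = T n (x0 + y) - T n x0" by (simp add: add)
  ultimately have "norm (T n y) \<le> real m + real m"
   by (metis add_mono norm_triangle_ineq4 order_trans)
  then have "norm (T n y) \<le> 2 * real m" by simp
  moreover have "T n y = (r / norm x) *\<^sub>R T n x" by (simp add: y_def scale)
  ultimately show ?thesis using False r by (simp add: field_simps)
 qed
 then show ?thesis by blast
qed

text \<open>
 The operators are uniformly bounded, so it suffices to control a finite net. Only the domain has to
 be complete, which allows the compact set to live in a space of operators.
\<close>

lemma strong_convergence_uniform_on_compact:
 fixes T :: "nat \<Rightarrow> 'a::banach \<Rightarrow> 'b::real_normed_vector"
 assumes bl: "\<And>n. bounded_linear (T n)" and conv: "\<And>x. (\<lambda>n. T n x) \<longlonglongrightarrow> L x" and L: "bounded_linear L"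
  and S: "compact S" and e: "e > 0"
 shows "\<exists>N. \<forall>y\<in>S. norm (L y - T N y) \<le> e"
proof -
 have "\<exists>M. \<forall>n. norm (T n x) \<le> M" for x
  using convergent_imp_Bseq[of "\<lambda>n. T n x"] conv[of x] unfolding convergent_def Bseq_def by blast
 from banach_steinhaus[OF bl this] obtain M where M: "norm (T n x) \<le> M * norm x" for n x by blast
 obtain M1 where M1: "M1 > 0" "\<And>x. norm (L x) \<le> norm x * M1" using bounded_linear.pos_bounded[OF L] by blast
 define M' where "M' = \<bar>M\<bar> + M1"
 have MM: "M \<le> M'" unfolding M'_def using M1(1) by linarith
 have M': "norm (T n x) \<le> M' * norm x" for n x
  by (rule order_trans[OF M mult_right_mono[OF MM norm_ge_zero]])
 have M'1: "M' > 0" and LM: "norm (L x) \<le> M' * norm x" for x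
 proof -
  show "M' > 0" using M1(1) by (simp add: M'_def)
  have "norm x * M1 \<le> M' * norm x" by (simp add: M'_def algebra_simps)
  then show "norm (L x) \<le> M' * norm x" using M1(2)[of x] by (rule order_trans[rotated])
 qed
 define d where "d = e / (4 * M')"
 have d: "d > 0" using e M'1 by (simp add: d_def)
 obtain F where F: "finite F" "S \<subseteq> (\<Union>x\<in>F. ball x d)"
  using S d unfolding compact_eq_totally_bounded by blast
 have "\<forall>\<^sub>F n in sequentially. \<forall>x\<in>F. norm (L x - T n x) < e / 2"
 proof (rule eventually_ball_finite[OF F(1)], rule ballI)
  fix x assume "x \<in> F"
  have "(\<lambda>n. norm (L x - T n x)) \<longlonglongrightarrow> norm (L x - L x)"
   by (intro tendsto_intros conv)
  then show "\<forall>\<^sub>F n in sequentially. norm (L x - T n x) < e / 2"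
   using e by (intro order_tendstoD) auto
 qed
 then obtain N where N: "norm (L x - T N x) < e / 2" if "x \<in> F" for x
  by (auto simp: eventually_sequentially)
 have "norm (L y - T N y) \<le> e" if "y \<in> S" for y
 proof -
  interpret bounded_linear "T N" by (rule bl)
  obtain x where x: "x \<in> F" "dist x y < d" using F(2) \<open>y \<in> S\<close> by auto
  interpret L: bounded_linear L by (rule L)
  have xy: "norm (x - y) \<le> d" using x(2) by (simp add: dist_norm)
  have "L y - T N y = (L x - T N x) - (L (x - y) - T N (x - y))" by (simp add: diff L.diff)
  then have "norm (L y - T N y) \<le> norm (L x - T N x) + norm (L (x - y) - T N (x - y))" by (simp only: norm_triangle_ineq4)
  also have "norm (L (x - y) - T N (x - y)) \<le> M' * norm (x - y) + M' * norm (x - y)"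
   by (rule order_trans[OF norm_triangle_ineq4 add_mono[OF LM M']])
  also have "M' * norm (x - y) \<le> M' * d" using xy M'1 by (intro mult_left_mono) auto
  also have "M' * d = e / 4" using M'1 by (simp add: d_def)
  finally show ?thesis using N[OF x(1)] by simp
 qed
 then show ?thesis by blast
qed

text \<open>
 For small \<open>t\<close> the map \<open>x - t (T x - y)\<close> is a contraction: coercivity beats the quadratic term.
\<close>

lemma lax_milgram:
 fixes T :: "'a::{real_inner,complete_space} \<Rightarrow> 'a"
 assumes bl: "bounded_linear T" and l: "l > 0" and coer: "\<And>x. l * (norm x)\<^sup>2 \<le> inner (T x) x"
 shows "\<exists>x. T x = y"
proof -
 interpret bounded_linear T by (rule bl)
 obtain M0 where M0: "norm (T x) \<le> M0 * norm x" for x using bounded by (metis mult.commute)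
 define M where "M = \<bar>M0\<bar> + l"
 have M: "norm (T x) \<le> M * norm x" for x
  by (rule order_trans[OF M0]) (use l in \<open>auto simp: M_def intro!: mult_right_mono\<close>)
 have Ml: "M \<ge> l" "M > 0" using l by (auto simp: M_def)
 define t where "t = l / M\<^sup>2"
 have t: "t > 0" using l Ml by (simp add: t_def)
 define q where "q = sqrt (1 - l\<^sup>2 / M\<^sup>2)"
 have lM: "l\<^sup>2 / M\<^sup>2 \<le> 1" using Ml l by (simp add: power_mono)
 have lM0: "l\<^sup>2 / M\<^sup>2 > 0" using Ml l by simp
 have q: "0 \<le> q" "q < 1" using lM lM0 by (auto simp: q_def)
 have contr: "norm (x - t *\<^sub>R T x) \<le> q * norm x" for x
 proof -
  have "(norm (x - t *\<^sub>R T x))\<^sup>2 = (norm x)\<^sup>2 - 2 * t * inner (T x) x + t\<^sup>2 * (norm (T x))\<^sup>2"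
   unfolding power2_norm_eq_inner
   by (simp add: inner_diff_left inner_diff_right inner_commute algebra_simps power2_eq_square)
  also have "\<dots> \<le> (norm x)\<^sup>2 - 2 * t * (l * (norm x)\<^sup>2) + t\<^sup>2 * (M * norm x)\<^sup>2"
   using coer[of x] M[of x] t by (intro add_mono diff_mono mult_left_mono power_mono) auto
  also have "\<dots> = (1 - l\<^sup>2 / M\<^sup>2) * (norm x)\<^sup>2"
   using Ml by (simp add: t_def field_simps power2_eq_square)
  also have "\<dots> = (q * norm x)\<^sup>2"
   using lM by (simp add: q_def power_mult_distrib)
  finally show ?thesis
   using q by (meson norm_ge_zero power2_le_imp_le mult_nonneg_nonneg)
 qed
 define f where "f x = x - t *\<^sub>R (T x - y)" for x
 have "\<exists>!x. f x = x"
 proof (rule banach_fix_type[OF q], intro allI)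
  fix x z
  have "f x - f z = (x - z) - t *\<^sub>R T (x - z)" by (simp add: f_def diff algebra_simps)
  then show "dist (f x) (f z) \<le> q * dist x z" using contr[of "x - z"] by (simp add: dist_norm)
 qed
 then obtain x where "f x = x" by blast
 then show ?thesis using t by (auto simp: f_def)
qed

text \<open>
 The resolvent identity \<open>S x - S a = - S x L' (x - a) S a\<close> first shows that \<open>S\<close> is locally bounded
 and then, applied twice, that the remainder is quadratic.
\<close>

lemma has_derivative_blinfun_inverse:
 fixes L S :: "'a::real_normed_vector \<Rightarrow> ('h::real_normed_vector \<Rightarrow>\<^sub>L 'h)"
 assumes right: "\<And>x. x \<in> A \<Longrightarrow> L x o\<^sub>L S x = id_blinfun"
  and left: "\<And>x. x \<in> A \<Longrightarrow> S x o\<^sub>L L x = id_blinfun"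
  and L': "bounded_linear L'" and diff: "\<And>x y. L x - L y = L' (x - y)"
  and a: "a \<in> A"
 shows "(S has_derivative (\<lambda>h. - (S a o\<^sub>L (L' h o\<^sub>L S a)))) (at a within A)"
proof -
 obtain c where c: "norm (L' x) \<le> c * norm x" "c > 0" for x
  using bounded_linear.pos_bounded[OF L'] by (metis mult.commute)
 let ?s = "norm (S a)"
 have res: "S x - S a = - (S x o\<^sub>L (L' (x - a) o\<^sub>L S a))" if "x \<in> A" for x
 proof (rule blinfun_eqI)
  fix v
  have "S x (L x (S a v)) = S a v" "L a (S a v) = v"
   using left[OF that] right[OF a] by (metis blinfun_apply_blinfun_compose blinfun_apply_id_blinfun id_apply)+
  then show "(S x - S a) v = (- (S x o\<^sub>L (L' (x - a) o\<^sub>L S a))) v"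
   by (simp add: diff[symmetric] blinfun.bilinear_simps)
 qed
 let ?D = "\<lambda>h. - (S a o\<^sub>L (L' h o\<^sub>L S a))"
 let ?e = "1 / (2 * (c * ?s + 1))"
 have e: "0 < ?e" using c(2) by (simp add: add_nonneg_pos)
 show ?thesis
 proof (rule has_derivativeI_sandwich[OF e])
  show "bounded_linear ?D"
   by (intro bounded_linear_minus bounded_linear_compose[OF bounded_bilinear.bounded_linear_right[OF bounded_bilinear_blinfun_compose]]
     bounded_linear_compose[OF bounded_bilinear.bounded_linear_left[OF bounded_bilinear_blinfun_compose]] L')
  let ?H = "\<lambda>x. 2 * ?s * (c * ?s) * (c * ?s) * norm (x - a)"
  show "(?H \<longlongrightarrow> 0) (at a within A)" by (rule tendsto_eq_intros refl | simp)+
  fix x assume x: "x \<in> A" "x \<noteq> a" "dist x a < ?e"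
  let ?P = "L' (x - a) o\<^sub>L S a"
  have P: "norm ?P \<le> c * ?s * norm (x - a)"
   using order_trans[OF norm_blinfun_compose mult_right_mono[OF c(1)[of "x - a"], of ?s]] by (simp add: mult_ac)
  have 1: "norm (S x - S a) \<le> norm (S x) * norm ?P"
   unfolding res[OF x(1)] by (simp add: norm_blinfun_compose)
  have "norm (x - a) * (2 * (c * ?s + 1)) < 1" using x(3) e by (simp add: dist_norm pos_less_divide_eq)
  moreover have "norm (x - a) * (2 * (c * ?s + 1)) = 2 * (c * ?s * norm (x - a)) + 2 * norm (x - a)" by (simp add: algebra_simps)
  ultimately have "norm ?P \<le> 1 / 2" using P norm_ge_zero[of "x - a"] by linarith
  then have "norm (S x) * norm ?P \<le> norm (S x) * (1 / 2)" by (intro mult_left_mono) auto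
  then have Sx: "norm (S x) \<le> 2 * ?s" using 1 norm_triangle_ineq[of "S x - S a" "S a"] by simp
  have "S x - S a - ?D (x - a) = - ((S x - S a) o\<^sub>L ?P)"
   unfolding bounded_bilinear.diff_left[OF bounded_bilinear_blinfun_compose] using res[OF x(1)] by simp
  then have "norm (S x - S a - ?D (x - a)) \<le> norm (S x - S a) * norm ?P" by (simp add: norm_blinfun_compose)
  also have "\<dots> \<le> (2 * ?s * (c * ?s * norm (x - a))) * (c * ?s * norm (x - a))"
   using order_trans[OF 1 mult_mono[OF Sx P]] P c(2) by (intro mult_mono) auto
  finally show "norm (S x - S a - ?D (x - a)) / norm (x - a) \<le> ?H x"
   using x(2) by (simp add: pos_divide_le_eq mult_ac)
 qed
qed

lemma Cauchy_convergent_fast: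
 fixes X :: "nat \<Rightarrow> 'a::metric_space"
 assumes fast: "\<And>Y :: nat \<Rightarrow> 'a. (\<And>m n. m \<le> n \<Longrightarrow> dist (Y n) (Y m) \<le> (1/2)^m) \<Longrightarrow> convergent Y"
  and X: "Cauchy X"
 shows "convergent X"
proof -
 have "\<exists>N. \<forall>m\<ge>N. \<forall>n\<ge>N. dist (X m) (X n) < (1/2)^k" for k
  using X by (auto intro!: metric_CauchyD[OF X])
 then obtain N where N: "\<And>k m n. m \<ge> N k \<Longrightarrow> n \<ge> N k \<Longrightarrow> dist (X m) (X n) < (1/2)^k" by metis
 define r where "r k = (\<Sum>i\<le>k. N i) + k" for k
 have rm: "strict_mono r" by (rule strict_monoI_Suc) (simp add: r_def)
 have rN: "r k \<ge> N k" for k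
  unfolding r_def by (simp add: member_le_sum trans_le_add1)
 have "convergent (\<lambda>k. X (r k))"
 proof (rule fast)
  fix m n :: nat assume "m \<le> n"
  then have "r n \<ge> r m" using rm by (simp add: strict_mono_less_eq)
  then show "dist (X (r n)) (X (r m)) \<le> (1/2)^m"
   using N[of m "r n" "r m"] rN[of m] by fastforce
 qed
 then obtain l where l: "(X \<circ> r) \<longlonglongrightarrow> l" by (auto simp: convergent_def o_def)
 show ?thesis
  using Cauchy_converges_subseq[OF X rm l] by (auto simp: convergent_def)
qed

lemma riesz_fischer_fast:
 fixes f :: "nat \<Rightarrow> 'a \<Rightarrow> complex"
 assumes [measurable]: "\<And>n. f n \<in> borel_measurable M"
  and fast: "\<And>m n. m \<le> n \<Longrightarrow> (\<integral>\<^sup>+x. ennreal ((norm (f n x - f m x))\<^sup>2) \<partial>M) \<le> ennreal ((1/4)^m)"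
 shows "\<exists>g. g \<in> borel_measurable M \<and> (\<forall>m. (\<integral>\<^sup>+x. ennreal ((norm (g x - f m x))\<^sup>2) \<partial>M) \<le> ennreal ((1/4)^m))"
proof -
 define a where "a n x = (norm (f (Suc n) x - f n x))\<^sup>2" for n x
 have [measurable]: "a n \<in> borel_measurable M" for n unfolding a_def by measurable
 have "(\<integral>\<^sup>+x. (\<Sum>n. ennreal (2^n * a n x)) \<partial>M) = (\<Sum>n. \<integral>\<^sup>+x. ennreal (2^n * a n x) \<partial>M)"
  by (rule nn_integral_suminf) measurable
 also have "\<dots> \<le> (\<Sum>n. ennreal ((1/2)^n))"
 proof (rule suminf_le)
  fix n
  have "(\<integral>\<^sup>+x. ennreal (2^n * a n x) \<partial>M) = ennreal (2^n) * (\<integral>\<^sup>+x. ennreal (a n x) \<partial>M)"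
   by (subst nn_integral_cmult[symmetric]) (auto simp: ennreal_mult a_def)
  also have "\<dots> \<le> ennreal (2^n) * ennreal ((1/4)^n)"
   unfolding a_def by (intro mult_left_mono fast) auto
  also have "\<dots> = ennreal ((1/2)^n)"
   by (simp add: ennreal_mult[symmetric] power_mult_distrib[symmetric])
  finally show "(\<integral>\<^sup>+x. ennreal (2^n * a n x) \<partial>M) \<le> ennreal ((1/2)^n)" .
 qed auto
 also have "\<dots> = ennreal (\<Sum>n. (1/2)^n)"
  by (rule suminf_ennreal2) (auto intro: summable_geometric)
 also have "\<dots> < \<infinity>" by simp
 finally have "AE x in M. (\<Sum>n. ennreal (2^n * a n x)) \<noteq> \<infinity>"
  by (intro nn_integral_PInf_AE) auto
 then have conv: "AE x in M. convergent (\<lambda>n. f n x)"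
 proof eventually_elim
  case (elim x)
  have "summable (\<lambda>n. 2^n * a n x)"
   using elim by (intro summable_suminf_not_top) (auto simp: a_def)
  then have "Bseq (\<lambda>n. 2^n * a n x)"
   using summable_LIMSEQ_zero convergent_imp_Bseq convergent_def by blast
  then obtain C where C: "C > 0" "\<And>n. norm (2^n * a n x) \<le> C" unfolding Bseq_def by blast
  have le: "norm (f (Suc n) x - f n x) \<le> sqrt C * (sqrt (1/2))^n" for n
  proof -
   have "a n x \<le> C * (1/2)^n"
    using C(2)[of n] by (simp add: a_def field_simps)
   then have "sqrt (a n x) \<le> sqrt (C * (1/2)^n)" by (rule real_sqrt_le_mono)
   then show ?thesis by (simp add: a_def real_sqrt_mult real_sqrt_power)
  qed
  have "summable (\<lambda>n. sqrt C * (sqrt (1/2))^n)"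
   by (intro summable_mult summable_geometric) (simp add: real_sqrt_lt_1_iff)
  then have "summable (\<lambda>n. f (Suc n) x - f n x)"
   by (rule summable_comparison_test'[where N=0]) (use le in simp)
  then have "convergent (\<lambda>n. \<Sum>i<n. f (Suc i) x - f i x)"
   by (simp add: summable_iff_convergent)
  then have "convergent (\<lambda>n. f n x - f 0 x)" by (simp only: sum_lessThan_telescope[of "\<lambda>n. f n x"])
  then have "convergent (\<lambda>n. (f n x - f 0 x) + f 0 x)"
   by (intro convergent_add convergent_const)
  then show ?case by simp
 qed
 define g where "g x = lim (\<lambda>n. f n x)" for x
 have [measurable]: "g \<in> borel_measurable M" unfolding g_def by measurable
 have "(\<integral>\<^sup>+x. ennreal ((norm (g x - f m x))\<^sup>2) \<partial>M) \<le> ennreal ((1/4)^m)" for m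
 proof -
  have "(\<integral>\<^sup>+x. ennreal ((norm (g x - f m x))\<^sup>2) \<partial>M) =
    (\<integral>\<^sup>+x. liminf (\<lambda>n. ennreal ((norm (f n x - f m x))\<^sup>2)) \<partial>M)"
  proof (rule nn_integral_cong_AE)
   show "AE x in M. ennreal ((norm (g x - f m x))\<^sup>2) = liminf (\<lambda>n. ennreal ((norm (f n x - f m x))\<^sup>2))"
    using conv
   proof eventually_elim
    case (elim x)
    then have "(\<lambda>n. f n x) \<longlonglongrightarrow> g x" by (simp add: g_def convergent_LIMSEQ_iff)
    then have "(\<lambda>n. ennreal ((norm (f n x - f m x))\<^sup>2)) \<longlonglongrightarrow> ennreal ((norm (g x - f m x))\<^sup>2)"
     by (intro tendsto_ennrealI tendsto_power tendsto_norm tendsto_diff tendsto_const)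
    then show ?case using lim_imp_Liminf[OF sequentially_bot, of "\<lambda>n. ennreal ((norm (f n x - f m x))\<^sup>2)"] by metis
   qed
  qed
  also have "\<dots> \<le> liminf (\<lambda>n. \<integral>\<^sup>+x. ennreal ((norm (f n x - f m x))\<^sup>2) \<partial>M)"
   by (intro nn_integral_liminf) measurable
  also have "\<dots> \<le> ennreal ((1/4)^m)"
   by (rule Liminf_le) (auto simp: eventually_sequentially intro!: exI[of _ m] fast)
  finally show ?thesis .
 qed
 then show ?thesis by (intro exI[of _ g]) auto
qed

text \<open>
 A mean value inequality that needs the derivative bound only in the direction of the segment. This is
 what turns a bound for the derivative on \<open>W\<close> into a Lipschitz bound on \<open>K\<close>.
\<close>

lemma norm_diff_le_along_segment:
 fixes F :: "'a::real_normed_vector \<Rightarrow> 'b::real_normed_vector"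
 assumes der: "\<And>\<xi>. \<xi> \<in> K \<Longrightarrow> (F has_derivative D \<xi>) (at \<xi> within A)"
  and KA: "K \<subseteq> A" and K: "convex K" and x: "x \<in> K" and y: "y \<in> K"
  and bound: "\<And>\<xi>. \<xi> \<in> K \<Longrightarrow> norm (D \<xi> (y - x)) \<le> c"
 shows "norm (F y - F x) \<le> c"
proof -
 define p where "p t = x + t *\<^sub>R (y - x)" for t :: real
 have pK: "p t \<in> K" if "t \<in> {0..1}" for t
 proof -
  have "p t = (1 - t) *\<^sub>R x + t *\<^sub>R y" by (simp add: p_def algebra_simps)
  then show ?thesis using K x y that by (simp add: convexD)
 qed
 have "norm ((F \<circ> p) 1 - (F \<circ> p) 0) \<le> c * norm (1 - 0 :: real)"
 proof (rule differentiable_bound[of "{0..1}" _ "\<lambda>t h. D (p t) (h *\<^sub>R (y - x))"])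
  fix t :: real assume t: "t \<in> {0..1}"
  have dp: "(p has_derivative (\<lambda>h. h *\<^sub>R (y - x))) (at t within {0..1})"
   unfolding p_def by (auto intro!: derivative_eq_intros)
  have "(F has_derivative D (p t)) (at (p t) within p ` {0..1})"
   using der[OF pK[OF t]] by (rule has_derivative_subset) (use pK KA in auto)
  from diff_chain_within[OF dp this]
  show "(F \<circ> p has_derivative (\<lambda>h. D (p t) (h *\<^sub>R (y - x)))) (at t within {0..1})"
   by (simp add: o_def)
  interpret bounded_linear "D (p t)" using der[OF pK[OF t]] by (rule has_derivative_bounded_linear)
  show "onorm (\<lambda>h. D (p t) (h *\<^sub>R (y - x))) \<le> c"
   by (rule onorm_le) (use bound[OF pK[OF t]] in \<open>simp add: scale mult.commute[of c] mult_left_mono\<close>)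
 qed auto
 then show ?thesis by (simp add: p_def)
qed

lemma norm_le_of_opnorm_on:
 assumes op: "opnorm_on W T \<le> ennreal c" and c: "c \<ge> 0" and bl: "bounded_linear T"
  and w: "w \<in> W" "\<And>r. r *\<^sub>R w \<in> W"
 shows "norm (T w) \<le> c * norm w"
proof (cases "w = 0")
 case True
 then show ?thesis using bl by (simp add: bounded_linear.linear linear_0)
next
 case False
 let ?v = "(1 / norm w) *\<^sub>R w"
 have "ennreal (norm (T ?v)) \<le> opnorm_on W T"
  unfolding opnorm_on_def using w(2) False by (intro SUP_upper) auto
 then have "norm (T ?v) \<le> c" using op c by (metis ennreal_le_iff order_trans)
 then show ?thesis
  using False by (simp add: bounded_linear.linear[OF bl] linear_scale field_simps)
qed

section \<open>Completeness of the spaces of square-integrable functions\<close>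

lemma l2_norm_abs: "l2_fun f \<Longrightarrow> norm (abs_l2 f) = sqrt (\<integral>p. (norm (f p))\<^sup>2 \<partial>S2S2)"
 by (rule norm_l2.abs_eq) (simp add: l2_rel_def)

lemma nn_integral_sq_le_iff:
 assumes "integrable M (\<lambda>x. (norm (f x))\<^sup>2)" "0 \<le> c"
 shows "(\<integral>\<^sup>+x. ennreal ((norm (f x))\<^sup>2) \<partial>M) \<le> ennreal (c\<^sup>2) \<longleftrightarrow> sqrt (\<integral>x. (norm (f x))\<^sup>2 \<partial>M) \<le> c"
proof -
 have "(\<integral>\<^sup>+x. ennreal ((norm (f x))\<^sup>2) \<partial>M) = ennreal (\<integral>x. (norm (f x))\<^sup>2 \<partial>M)"
  by (rule nn_integral_eq_integral[OF assms(1)]) auto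
 then show ?thesis using assms(2)
  by (simp add: real_sqrt_le_iff' integral_nonneg ennreal_le_iff)
qed

lemma integrable_sq_if_nn_integral_le:
 assumes "f \<in> borel_measurable M" "(\<integral>\<^sup>+x. ennreal ((norm (f x))\<^sup>2) \<partial>M) \<le> ennreal c"
 shows "integrable M (\<lambda>x. (norm (f x))\<^sup>2)"
proof (rule integrableI_bounded)
 show "(\<lambda>x. (norm (f x))\<^sup>2) \<in> borel_measurable M" using assms(1) by measurable
 show "(\<integral>\<^sup>+x. ennreal (norm ((norm (f x))\<^sup>2)) \<partial>M) < \<infinity>" using assms(2) by (simp add: le_less_trans)
qed

lemma half_pow_quarter: "((1/2)^m)\<^sup>2 = ((1/4)^m :: real)"
 by (simp add: power_mult_distrib[symmetric] power2_eq_square)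

lemma half_pow_tendsto: "(\<lambda>m. (1/2)^m :: real) \<longlonglongrightarrow> 0"
 by (rule LIMSEQ_realpow_zero) auto

definition sqint :: "(real^3 \<Rightarrow> complex) \<Rightarrow> bool" where
 "sqint f \<longleftrightarrow> f \<in> borel_measurable lborel \<and> integrable lborel (\<lambda>x. (norm (f x))\<^sup>2)"

definition sqint_rel :: "(real^3 \<Rightarrow> complex) \<Rightarrow> (real^3 \<Rightarrow> complex) \<Rightarrow> bool" where
 "sqint_rel f g \<longleftrightarrow> sqint f \<and> sqint g \<and> (AE x in lborel. f x = g x)"

lemma sqint_zero: "sqint (\<lambda>x. 0)"
 unfolding sqint_def by simp

lemma sqint_relI: "sqint f \<Longrightarrow> (\<And>x. f x = g x) \<Longrightarrow> sqint_rel f g"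
 by (drule ext) (simp add: sqint_rel_def)

lemma borel_measurable_cnj [measurable (raw)]:
 "f \<in> borel_measurable M \<Longrightarrow> (\<lambda>x. cnj (f x)) \<in> borel_measurable M"
 by (rule borel_measurable_continuous_on[where f = cnj]) (auto intro: continuous_intros)

lemma mult_le_half_squares:
 fixes a b :: real
 shows "a * b \<le> (a\<^sup>2 + b\<^sup>2) / 2"
 using sum_squares_bound[of a b] by simp

lemma sqint_integrable_mult:
 assumes "sqint f" "sqint g"
 shows "integrable lborel (\<lambda>x. f x * g x)"
proof (rule integrable_bound)
 have [measurable]: "f \<in> borel_measurable lborel" "g \<in> borel_measurable lborel"
  using assms unfolding sqint_def by auto
 show "integrable lborel (\<lambda>x. ((norm (f x))\<^sup>2 + (norm (g x))\<^sup>2) / 2)"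
  using assms unfolding sqint_def by auto
 show "(\<lambda>x. f x * g x) \<in> borel_measurable lborel" by measurable
 show "AE x in lborel. norm (f x * g x) \<le> norm (((norm (f x))\<^sup>2 + (norm (g x))\<^sup>2) / 2)"
  by (intro AE_I2) (simp only: norm_mult real_norm_def, intro order_trans[OF mult_le_half_squares abs_ge_self])
qed

lemma sqint_cnj: "sqint f \<Longrightarrow> sqint (\<lambda>x. cnj (f x))"
 unfolding sqint_def by auto

lemma sqint_mult_bounded:
 assumes f: "sqint f" and a: "a \<in> borel_measurable lborel" "AE x in lborel. norm (a x) \<le> c"
 shows "sqint (\<lambda>x. a x * f x)"
proof -
 have [measurable]: "f \<in> borel_measurable lborel" "a \<in> borel_measurable lborel"
  using assms unfolding sqint_def by auto
 have "integrable lborel (\<lambda>x. (norm (a x * f x))\<^sup>2)"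
 proof (rule integrable_bound)
  show "integrable lborel (\<lambda>x. c\<^sup>2 * (norm (f x))\<^sup>2)" using f by (simp add: sqint_def)
  show "AE x in lborel. norm ((norm (a x * f x))\<^sup>2) \<le> norm (c\<^sup>2 * (norm (f x))\<^sup>2)"
   using a(2) by eventually_elim (auto simp: norm_mult power_mult_distrib intro!: mult_right_mono power_mono)
 qed measurable
 then show ?thesis by (simp add: sqint_def)
qed

lemma sqint_cmult: "sqint f \<Longrightarrow> sqint (\<lambda>x. a * f x)"
 using sqint_mult_bounded[of f "\<lambda>_. a" "norm a"] by simp

lemma sqint_scaleR: "sqint f \<Longrightarrow> sqint (\<lambda>x. r *\<^sub>R f x)"
 using sqint_cmult[of f "of_real r"] by (simp add: scaleR_conv_of_real)

lemma sqint_uminus: "sqint f \<Longrightarrow> sqint (\<lambda>x. - f x)"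
 using sqint_cmult[of f "-1"] by simp

lemma sqint_add:
 assumes "sqint f" "sqint g"
 shows "sqint (\<lambda>x. f x + g x)"
proof -
 have [measurable]: "f \<in> borel_measurable lborel" "g \<in> borel_measurable lborel"
  using assms unfolding sqint_def by auto
 have "integrable lborel (\<lambda>x. (norm (f x + g x))\<^sup>2)"
 proof (rule integrable_bound)
  show "integrable lborel (\<lambda>x. 2 * (norm (f x))\<^sup>2 + 2 * (norm (g x))\<^sup>2)"
   using assms by (simp add: sqint_def)
  have "(norm (f x + g x))\<^sup>2 \<le> 2 * (norm (f x))\<^sup>2 + 2 * (norm (g x))\<^sup>2" for x
  proof -
   have "(norm (f x + g x))\<^sup>2 \<le> (norm (f x) + norm (g x))\<^sup>2"
    by (intro power_mono norm_triangle_ineq) auto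
   also have "\<dots> \<le> 2 * (norm (f x))\<^sup>2 + 2 * (norm (g x))\<^sup>2"
    using sum_squares_bound[of "norm (f x)" "norm (g x)"] by (simp add: power2_sum)
   finally show ?thesis .
  qed
  then show "AE x in lborel. norm ((norm (f x + g x))\<^sup>2) \<le> norm (2 * (norm (f x))\<^sup>2 + 2 * (norm (g x))\<^sup>2)"
   by (intro AE_I2) simp
 qed measurable
 then show ?thesis by (simp add: sqint_def)
qed

lemma sqint_diff: "sqint f \<Longrightarrow> sqint g \<Longrightarrow> sqint (\<lambda>x. f x - g x)"
 using sqint_add[of f "\<lambda>x. - g x"] sqint_uminus[of g] by simp

quotient_type hl2 = "real^3 \<Rightarrow> complex" / partial: sqint_rel
proof (rule part_equivpI)
 show "\<exists>x. sqint_rel x x"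
  using sqint_zero unfolding sqint_rel_def by auto
 show "symp sqint_rel"
  unfolding sqint_rel_def by (rule sympI) (auto elim: eventually_mono)
 show "transp sqint_rel"
  unfolding sqint_rel_def by (rule transpI) (auto elim: eventually_elim2)
qed

instantiation hl2 :: real_vector
begin

lift_definition zero_hl2 :: hl2 is "\<lambda>x. 0"
 by (simp add: sqint_rel_def sqint_zero)

lift_definition plus_hl2 :: "hl2 \<Rightarrow> hl2 \<Rightarrow> hl2" is "\<lambda>f g x. f x + g x"
 unfolding sqint_rel_def by (auto intro: sqint_add elim: eventually_elim2)

lift_definition uminus_hl2 :: "hl2 \<Rightarrow> hl2" is "\<lambda>f x. - f x"
 unfolding sqint_rel_def by (auto intro: sqint_uminus elim: eventually_mono)

lift_definition minus_hl2 :: "hl2 \<Rightarrow> hl2 \<Rightarrow> hl2" is "\<lambda>f g x. f x - g x"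
 unfolding sqint_rel_def by (auto intro: sqint_diff elim: eventually_elim2)

lift_definition scaleR_hl2 :: "real \<Rightarrow> hl2 \<Rightarrow> hl2" is "\<lambda>r f x. r *\<^sub>R f x"
 unfolding sqint_rel_def by (auto intro: sqint_scaleR elim: eventually_mono)

instance
 by standard
  (transfer, rule sqint_relI,
   (intro sqint_zero sqint_add sqint_uminus sqint_diff sqint_cmult sqint_scaleR;
    simp add: sqint_rel_def),
   simp add: algebra_simps scaleR_conv_of_real)+

end

lift_definition cinner :: "hl2 \<Rightarrow> hl2 \<Rightarrow> complex" is "\<lambda>f g. (LBINT x. f x * cnj (g x))"
proof -
 fix f f' g g'
 assume ff: "sqint_rel f f'" and gg: "sqint_rel g g'"
 show "(LBINT x. f x * cnj (g x)) = (LBINT x. f' x * cnj (g' x))"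
 proof (rule integral_cong_AE)
  show "AE p in lborel. f p * cnj (g p) = f' p * cnj (g' p)"
   using ff gg unfolding sqint_rel_def by (auto elim: eventually_elim2)
 qed (use ff gg in \<open>auto simp: sqint_rel_def sqint_def\<close>)
qed

lemma cinner_commute: "cinner f g = cnj (cinner g f)"
 by transfer (simp flip: integral_cnj add: mult.commute)

lemma cinner_add_left: "cinner (f + g) h = cinner f h + cinner g h"
 by transfer (simp add: sqint_rel_def distrib_right sqint_integrable_mult sqint_cnj)

lemma cinner_scaleR_left: "cinner (r *\<^sub>R f) g = r *\<^sub>R cinner f g"
 by transfer (simp add: sqint_rel_def)

lemma cinner_self_aux:
 "(\<integral>p. f p * cnj (f p) \<partial>M) = of_real (\<integral>p. (norm (f p))\<^sup>2 \<partial>M)"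
proof -
 have "(\<integral>p. f p * cnj (f p) \<partial>M) = (\<integral>p. of_real ((norm (f p))\<^sup>2) \<partial>M)"
  by (intro integral_cong refl) (metis complex_norm_square)
 also have "\<dots> = of_real (\<integral>p. (norm (f p))\<^sup>2 \<partial>M)"
  by (rule integral_complex_of_real)
 finally show ?thesis .
qed

instantiation hl2 :: real_inner
begin

definition inner_hl2 :: "hl2 \<Rightarrow> hl2 \<Rightarrow> real" where
 "inner_hl2 f g = Re (cinner f g)"

definition norm_hl2 :: "hl2 \<Rightarrow> real" where
 "norm_hl2 f = sqrt (inner f f)"

definition dist_hl2 :: "hl2 \<Rightarrow> hl2 \<Rightarrow> real" where
 "dist_hl2 f g = norm (f - g)"

definition sgn_hl2 :: "hl2 \<Rightarrow> hl2" where
 "sgn_hl2 f = f /\<^sub>R norm f"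

definition uniformity_hl2 :: "(hl2 \<times> hl2) filter" where
 "uniformity_hl2 = (INF e\<in>{0 <..}. principal {(f, g). dist f g < e})"

definition open_hl2 :: "hl2 set \<Rightarrow> bool" where
 "open_hl2 U \<longleftrightarrow> (\<forall>f\<in>U. eventually (\<lambda>(f', g). f' = f \<longrightarrow> g \<in> U) uniformity)"

instance
proof
 show "inner f g = inner g f" for f g :: hl2
  using cinner_commute[of f g] by (simp add: inner_hl2_def)
 show "inner (f + g) h = inner f h + inner g h" for f g h :: hl2
  by (simp add: inner_hl2_def cinner_add_left)
 show "inner (r *\<^sub>R f) g = r * inner f g" for r and f g :: hl2
  by (simp add: inner_hl2_def cinner_scaleR_left)
 show "0 \<le> inner f f" for f :: hl2
  unfolding inner_hl2_def
  by transfer (simp add: cinner_self_aux integral_nonneg)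
 show "(inner f f = 0) = (f = 0)" for f :: hl2
  unfolding inner_hl2_def
 proof (transfer, unfold sqint_rel_def)
  fix f
  assume f: "sqint f \<and> sqint f \<and> (AE p in lborel. f p = f p)"
  then have "(LBINT p. (norm (f p))\<^sup>2) = 0 \<longleftrightarrow> (AE p in lborel. (norm (f p))\<^sup>2 = 0)"
   by (intro integral_nonneg_eq_0_iff_AE) (auto simp: sqint_def)
  then show "(Re (LBINT x. f x * cnj (f x)) = 0) =
    (sqint f \<and> sqint (\<lambda>x. 0) \<and> (AE x in lborel. f x = 0))"
   using f by (simp add: sqint_zero cinner_self_aux)
 qed
qed (simp_all add: dist_hl2_def sgn_hl2_def uniformity_hl2_def open_hl2_def norm_hl2_def)

end

lemma hl2_rep: "sqint (rep_hl2 q)"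
 using Quotient3_rep_reflp[OF Quotient3_hl2, of q] by (simp add: sqint_rel_def)

lemma hl2_abs_rep: "abs_hl2 (rep_hl2 q) = q"
 by (rule Quotient3_abs_rep[OF Quotient3_hl2])

lemma hl2_eq_iff: "sqint f \<Longrightarrow> sqint g \<Longrightarrow> abs_hl2 f = abs_hl2 g \<longleftrightarrow> (AE x in lborel. f x = g x)"
 using Quotient3_rel_abs[OF Quotient3_hl2, of f g] Quotient3_rel[OF Quotient3_hl2, of f g]
 by (auto simp: sqint_rel_def)

lemma hl2_rep_abs: "sqint f \<Longrightarrow> AE x in lborel. rep_hl2 (abs_hl2 f) x = f x"
 using hl2_eq_iff[OF hl2_rep, of f "abs_hl2 f"] by (simp add: hl2_abs_rep)

lemma cinner_abs: "sqint f \<Longrightarrow> sqint g \<Longrightarrow> cinner (abs_hl2 f) (abs_hl2 g) = (LBINT x. f x * cnj (g x))"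
 by (rule cinner.abs_eq) (simp_all add: sqint_rel_def)

lemma hl2_norm_abs: "sqint f \<Longrightarrow> norm (abs_hl2 f) = sqrt (LBINT x. (norm (f x))\<^sup>2)"
 by (simp add: norm_eq_sqrt_inner inner_hl2_def cinner_abs cinner_self_aux)

lemma hl2_norm_rep: "norm q = sqrt (LBINT x. (norm (rep_hl2 q x))\<^sup>2)"
 using hl2_norm_abs[OF hl2_rep, of q] by (simp add: hl2_abs_rep)

lemma hl2_add_abs: "sqint f \<Longrightarrow> sqint g \<Longrightarrow> abs_hl2 f + abs_hl2 g = abs_hl2 (\<lambda>p. f p + g p)"
 by (rule plus_hl2.abs_eq) (simp_all add: sqint_rel_def)

lemma hl2_diff_abs: "sqint f \<Longrightarrow> sqint g \<Longrightarrow> abs_hl2 f - abs_hl2 g = abs_hl2 (\<lambda>p. f p - g p)"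
 by (rule minus_hl2.abs_eq) (simp_all add: sqint_rel_def)

lemma hl2_scaleR_abs: "sqint f \<Longrightarrow> r *\<^sub>R abs_hl2 f = abs_hl2 (\<lambda>p. r *\<^sub>R f p)"
 by (rule scaleR_hl2.abs_eq) (simp_all add: sqint_rel_def)

instance hl2 :: banach
proof
 fix X :: "nat \<Rightarrow> hl2"
 assume "Cauchy X"
 show "convergent X"
 proof (rule Cauchy_convergent_fast[OF _ \<open>Cauchy X\<close>])
  fix Y :: "nat \<Rightarrow> hl2"
  assume Y: "\<And>m n. m \<le> n \<Longrightarrow> dist (Y n) (Y m) \<le> (1/2)^m"
  define f where "f n = rep_hl2 (Y n)" for n
  have f: "sqint (f n)" "abs_hl2 (f n) = Y n" for n
   by (simp_all add: f_def hl2_rep hl2_abs_rep)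
  have fm[measurable]: "f n \<in> borel_measurable lborel" for n using f(1)[of n] by (simp add: sqint_def)
  have fast: "(NN x. ennreal ((norm (f n x - f m x))\<^sup>2)) \<le> ennreal ((1/4)^m)" if "m \<le> n" for m n
  proof -
   have "norm (abs_hl2 (f n) - abs_hl2 (f m)) \<le> (1/2)^m"
    using Y[OF that] f by (simp add: dist_norm)
   moreover have d: "sqint (\<lambda>x. f n x - f m x)" by (rule sqint_diff[OF f(1) f(1)])
   ultimately have "sqrt (LBINT p. (norm (f n p - f m p))\<^sup>2) \<le> (1/2)^m"
    by (simp add: hl2_diff_abs f(1) hl2_norm_abs)
   then show ?thesis
    using nn_integral_sq_le_iff[of lborel "\<lambda>x. f n x - f m x" "(1/2)^m"] d
    by (simp add: sqint_def half_pow_quarter)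
  qed
  obtain g where g[measurable]: "g \<in> borel_measurable lborel"
   and gf: "(NN x. ennreal ((norm (g x - f m x))\<^sup>2)) \<le> ennreal ((1/4)^m)" for m
   using riesz_fischer_fast[OF fm fast] by blast
  have d: "sqint (\<lambda>x. g x - f m x)" for m
   unfolding sqint_def using integrable_sq_if_nn_integral_le[OF _ gf] by simp
  have lg: "sqint g" using sqint_add[OF d[of 0] f(1)[of 0]] by simp
  have "norm (Y m - abs_hl2 g) \<le> (1/2)^m" for m
  proof -
   have "norm (abs_hl2 g - Y m) = sqrt (LBINT x. (norm (g x - f m x))\<^sup>2)"
    unfolding f(2)[symmetric] by (simp add: hl2_diff_abs lg f(1) hl2_norm_abs d)
   also have "\<dots> \<le> (1/2)^m"
    using nn_integral_sq_le_iff[of lborel "\<lambda>x. g x - f m x" "(1/2)^m"] d[of m] gf[of m]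
    by (simp add: sqint_def half_pow_quarter)
   finally show ?thesis by (simp add: norm_minus_commute)
  qed
  then have "Y \<longlonglongrightarrow> abs_hl2 g"
   by (intro LIM_zero_cancel[OF Lim_null_comparison[OF _ half_pow_tendsto]]) auto
  then show "convergent Y" by (rule convergentI)
 qed
qed

section \<open>Bounded multipliers\<close>

lemma linf_rep: "linf_fun (rep_linf f)"
 using Quotient3_rep_reflp[OF Quotient3_linf, of f] by (simp add: linf_rel_def)

lemma linf_abs_rep: "abs_linf (rep_linf f) = f"
 by (rule Quotient3_abs_rep[OF Quotient3_linf])

lemma linf_eq_iff: "linf_fun f \<Longrightarrow> linf_fun g \<Longrightarrow> abs_linf f = abs_linf g \<longleftrightarrow> (AE x in lborel. f x = g x)"
 using Quotient3_rel_abs[OF Quotient3_linf, of f g] Quotient3_rel[OF Quotient3_linf, of f g]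
 by (auto simp: linf_rel_def)

lemma linf_rep_abs: "linf_fun f \<Longrightarrow> AE x in lborel. rep_linf (abs_linf f) x = f x"
 using linf_eq_iff[OF linf_rep, of f "abs_linf f"] by (simp add: linf_abs_rep)

lemma linf_norm_rep: "norm f = esssup_norm (rep_linf f)"
 using norm_linf.abs_eq[of "rep_linf f"] by (simp add: linf_abs_rep linf_rel_def linf_rep)

lemma linf_AE_le_norm: "AE x in lborel. norm (rep_linf f x) \<le> norm f"
 unfolding linf_norm_rep by (rule esssup_norm_AE[OF linf_rep])

lemma linf_add_rep: "AE x in lborel. rep_linf (f + g) x = rep_linf f x + rep_linf g x"
proof -
 have "f + g = abs_linf (\<lambda>x. rep_linf f x + rep_linf g x)"
  using plus_linf.abs_eq[of "rep_linf f" "rep_linf g"] by (simp add: linf_abs_rep linf_rel_def linf_rep)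
 then show ?thesis using linf_rep_abs[OF linf_fun_add[OF linf_rep linf_rep]] by metis
qed

lemma linf_scaleR_rep: "AE x in lborel. rep_linf (r *\<^sub>R f) x = r *\<^sub>R rep_linf f x"
proof -
 have "r *\<^sub>R f = abs_linf (\<lambda>x. r *\<^sub>R rep_linf f x)"
  using scaleR_linf.abs_eq[of "rep_linf f"] by (simp add: linf_abs_rep linf_rel_def linf_rep)
 then show ?thesis using linf_rep_abs[OF linf_fun_scaleR[OF linf_rep]] by metis
qed

lemma linf_scaleC_rep: "AE x in lborel. rep_linf (a *\<^sub>C f) x = a * rep_linf f x"
proof -
 have "a *\<^sub>C f = abs_linf (\<lambda>x. a * rep_linf f x)"
  using scaleC_linf.abs_eq[of "rep_linf f"] by (simp add: linf_abs_rep linf_rel_def linf_rep)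
 then show ?thesis using linf_rep_abs[OF linf_fun_mult[OF linf_rep]] by metis
qed

lemma linf_norm_leI: "0 \<le> c \<Longrightarrow> AE x in lborel. norm (rep_linf f x) \<le> c \<Longrightarrow> norm f \<le> c"
 unfolding linf_norm_rep by (rule esssup_norm_leI)

lemma norm_scaleC_le: "norm (a *\<^sub>C f) \<le> norm a * norm (f :: linf)"
proof (rule linf_norm_leI)
 show "AE x in lborel. norm (rep_linf (a *\<^sub>C f) x) \<le> norm a * norm f"
  using linf_scaleC_rep[of a f] linf_AE_le_norm[of f]
  by eventually_elim (simp add: norm_mult mult_left_mono)
qed simp

lemma bounded_bilinear_scaleC: "bounded_bilinear (scaleC :: complex \<Rightarrow> linf \<Rightarrow> linf)"
proof
 show "\<exists>K. \<forall>a b. norm (a *\<^sub>C b :: linf) \<le> norm a * norm b * K"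
  using norm_scaleC_le by (intro exI[of _ 1]) simp
 show "(r *\<^sub>R a) *\<^sub>C b = r *\<^sub>R (a *\<^sub>C b)" for r a and b :: linf
  unfolding scaleC_of_real[symmetric] scaleC_scaleC by (simp add: scaleR_conv_of_real)
 show "a *\<^sub>C (r *\<^sub>R b) = r *\<^sub>R (a *\<^sub>C b)" for r a and b :: linf
  unfolding scaleC_of_real[symmetric] scaleC_scaleC by (simp add: mult.commute)
qed (simp_all add: scaleC_add_right scaleC_add_left)

lemma closed_if_compact_Int_cball:
 fixes V :: "'a::real_normed_vector set"
 assumes "\<And>r. compact (V \<inter> cball 0 r)"
 shows "closed V"
proof (rule closed_sequential_limits[THEN iffD2], intro allI impI, elim conjE)
 fix x l assume x: "\<forall>n. x n \<in> V" "x \<longlonglongrightarrow> l"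
 then obtain r where "\<And>n. norm (x n) \<le> r"
  using convergent_imp_Bseq[of x] unfolding convergent_def Bseq_def by blast
 then have "\<forall>n. x n \<in> V \<inter> cball 0 r" using x by auto
 then have "l \<in> V \<inter> cball 0 r"
  using compact_imp_closed[OF assms, of r] x(2) unfolding closed_sequential_limits by blast
 then show "l \<in> V" by blast
qed

text \<open>
 Induction on the generators: a generator outside the closed span of the others has a positive distance
 to it, which bounds its coefficient.
\<close>

lemma compact_span_Int_cball:
 fixes S :: "linf set"
 assumes "finite S"
 shows "compact (cvec.span S \<inter> cball 0 r)"
 using assms
proof (induction S arbitrary: r)
 case empty
 have "cvec.span {} \<inter> cball (0::linf) r = (if 0 \<le> r then {0} else {})" by (auto simp: cvec.span_empty)
 then show ?case by simp
next
 case (insert v S)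
 let ?V = "cvec.span S"
 note scont = bounded_bilinear.tendsto[OF bounded_bilinear_scaleC]
 have Vc: "closed ?V" by (rule closed_if_compact_Int_cball) (rule insert.IH)
 show ?case
 proof (cases "v \<in> ?V")
  case True
  then show ?thesis using insert.IH[of r] by (simp add: cvec.span_redundant)
 next
  case False
  then have "open (- ?V)" "v \<in> - ?V" using Vc by auto
  then obtain d where d: "d > 0" "ball v d \<subseteq> - ?V" by (meson open_contains_ball)
  have d': "d \<le> dist v x" if "x \<in> ?V" for x
   using d(2) that by (meson ComplD linorder_not_le mem_ball subsetD)
  let ?f = "\<lambda>p. fst p *\<^sub>C v + snd p"
  let ?P = "cball (0::complex) (r / d) \<times> (?V \<inter> cball 0 (r + (r / d) * norm v))"
  have "compact ?P" by (intro compact_Times compact_cball insert.IH)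
  then have c: "compact (?f ` ?P)"
   by (rule compact_continuous_image[rotated])
    (intro continuous_on_add bounded_bilinear.continuous_on[OF bounded_bilinear_scaleC] continuous_intros)
  have eq: "cvec.span (insert v S) \<inter> cball 0 r = ?f ` ?P \<inter> cball 0 r"
  proof (intro subset_antisym subsetI)
   fix x assume x: "x \<in> cvec.span (insert v S) \<inter> cball 0 r"
   then obtain a where a: "x - a *\<^sub>C v \<in> ?V" by (auto simp: cvec.span_insert)
   have nx: "norm x \<le> r" using x by simp
   have na: "norm a \<le> r / d"
   proof (cases "a = 0")
    case True
    then show ?thesis using nx d(1) by (simp add: order_trans[OF norm_ge_zero])
   next
    case False
    let ?w = "- (inverse a *\<^sub>C (x - a *\<^sub>C v))"
    have "?w \<in> ?V" using a by (intro cvec.span_neg cvec.span_scale)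
    then have "d \<le> dist v ?w" by (rule d')
    also have "v - ?w = inverse a *\<^sub>C x"
     using False by (simp add: cvec.scale_right_diff_distrib)
    then have "dist v ?w = norm (inverse a *\<^sub>C x)" by (simp add: dist_norm)
    also have "\<dots> \<le> norm (inverse a) * norm x" by (rule norm_scaleC_le)
    also have "\<dots> \<le> norm (inverse a) * r" by (intro mult_left_mono nx) auto
    finally show ?thesis using False d(1) by (simp add: norm_divide field_simps)
   qed
   have "norm (x - a *\<^sub>C v) \<le> norm x + norm (a *\<^sub>C v)" by (rule norm_triangle_ineq4)
   also have "\<dots> \<le> r + (r / d) * norm v"
    using nx na order_trans[OF norm_scaleC_le mult_right_mono[OF na norm_ge_zero]] by (intro add_mono) auto
   finally have "(a, x - a *\<^sub>C v) \<in> ?P" using a na by simp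
   moreover have "x = ?f (a, x - a *\<^sub>C v)" by simp
   ultimately have "x \<in> ?f ` ?P" by (rule rev_image_eqI)
   then show "x \<in> ?f ` ?P \<inter> cball 0 r" using x by blast
  next
   fix x assume x: "x \<in> ?f ` ?P \<inter> cball 0 r"
   then obtain a y where "x = a *\<^sub>C v + y" "y \<in> ?V" by auto
   then have "x \<in> cvec.span (insert v S)" by (auto simp: cvec.span_insert intro!: exI[of _ a])
   then show "x \<in> cvec.span (insert v S) \<inter> cball 0 r" using x by blast
  qed
  show ?thesis unfolding eq by (intro compact_Int_closed c closed_cball)
 qed
qed

lift_definition mulop :: "linf \<Rightarrow> hl2 \<Rightarrow> hl2" is "\<lambda>a f x. a x * f x"
 unfolding sqint_rel_def linf_rel_def linf_fun_def
 by (auto intro: sqint_mult_bounded elim: eventually_elim2)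

lemma mulop_rep: "mulop a f = abs_hl2 (\<lambda>x. rep_linf a x * rep_hl2 f x)"
 using mulop.abs_eq[of "rep_linf a" "rep_hl2 f"]
 by (simp add: linf_abs_rep hl2_abs_rep linf_rel_def linf_rep sqint_rel_def hl2_rep)

lemma sqint_linf_mult: "sqint f \<Longrightarrow> sqint (\<lambda>x. rep_linf a x * f x)"
 using linf_rep[of a] unfolding linf_fun_def by (auto intro: sqint_mult_bounded)

lemma bounded_bilinear_mulop: "bounded_bilinear mulop"
proof
 show "mulop (a + a') b = mulop a b + mulop a' b" for a a' b
  by (transfer, rule sqint_relI)
   (auto simp: linf_rel_def sqint_rel_def linf_fun_def distrib_right intro!: sqint_add sqint_mult_bounded)
 show "mulop a (b + b') = mulop a b + mulop a b'" for a b b'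
  by (transfer, rule sqint_relI)
   (auto simp: linf_rel_def sqint_rel_def linf_fun_def distrib_left intro!: sqint_add sqint_mult_bounded)
 show "mulop (r *\<^sub>R a) b = r *\<^sub>R mulop a b" for r a b
  by (transfer, rule sqint_relI[THEN Quotient_symp[OF Quotient_hl2, THEN sympD]])
   (auto simp: linf_rel_def sqint_rel_def linf_fun_def intro!: sqint_scaleR sqint_mult_bounded)
 show "mulop a (r *\<^sub>R b) = r *\<^sub>R mulop a b" for r a b
  by (transfer, rule sqint_relI[THEN Quotient_symp[OF Quotient_hl2, THEN sympD]])
   (auto simp: linf_rel_def sqint_rel_def linf_fun_def intro!: sqint_scaleR sqint_mult_bounded)
 have "norm (mulop a b) \<le> norm a * norm b" for a b
 proof -
  have "(LBINT x. (norm (rep_linf a x * rep_hl2 b x))\<^sup>2) \<le> (LBINT x. (norm a)\<^sup>2 * (norm (rep_hl2 b x))\<^sup>2)"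
  proof (rule integral_mono_AE)
   show "AE x in lborel. (norm (rep_linf a x * rep_hl2 b x))\<^sup>2 \<le> (norm a)\<^sup>2 * (norm (rep_hl2 b x))\<^sup>2"
    using linf_AE_le_norm[of a]
    by eventually_elim (auto simp: norm_mult power_mult_distrib intro!: mult_right_mono power_mono)
  qed (use hl2_rep[of b] sqint_linf_mult[OF hl2_rep, of a b] in \<open>auto simp: sqint_def\<close>)
  then have "sqrt (LBINT x. (norm (rep_linf a x * rep_hl2 b x))\<^sup>2) \<le> sqrt ((norm a)\<^sup>2 * (LBINT x. (norm (rep_hl2 b x))\<^sup>2))"
   by simp
  then show ?thesis
   by (simp add: mulop_rep hl2_norm_abs sqint_linf_mult hl2_rep real_sqrt_mult flip: hl2_norm_rep)
 qed
 then show "\<exists>K. \<forall>a b. norm (mulop a b) \<le> norm a * norm b * K"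
  by (intro exI[of _ 1]) simp
qed

section \<open>Polar coordinates\<close>

lemma space_S2_measure: "space S2_measure = sphere 0 1"
 unfolding S2_measure_def by (simp add: space_scale_measure space_restrict_space)

lemma sets_S2_measure [measurable_cong]: "sets S2_measure = sets (restrict_space borel (sphere 0 1))"
 unfolding S2_measure_def by simp

lemma normalize_measurable_sphere:
 "(\<lambda>x::real^3. x /\<^sub>R norm x) \<in> measurable (restrict_space lborel (ball 0 1 - {0})) (restrict_space borel (sphere 0 1))"
 by (rule measurable_restrict_space2) (auto simp: space_restrict_space intro!: measurable_restrict_space1)

lemma emeasure_S2_measure:
 assumes E: "E \<in> sets (restrict_space borel (sphere (0::real^3) 1))"
 shows "emeasure S2_measure E = 3 * emeasure lborel {x. 0 < norm x \<and> norm x < 1 \<and> x /\<^sub>R norm x \<in> E}"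
proof -
 have "emeasure S2_measure E = 3 * emeasure (restrict_space lborel (ball 0 1 - {0}))
   ((\<lambda>x. x /\<^sub>R norm x) -` E \<inter> space (restrict_space lborel (ball 0 1 - {0})))"
  unfolding S2_measure_def
  by (simp add: emeasure_distr[OF normalize_measurable_sphere E])
 also have "emeasure (restrict_space lborel (ball 0 1 - {0}))
   ((\<lambda>x. x /\<^sub>R norm x) -` E \<inter> space (restrict_space lborel (ball 0 1 - {0}))) =
   emeasure lborel ((\<lambda>x. x /\<^sub>R norm x) -` E \<inter> space (restrict_space lborel (ball 0 1 - {0})))"
  by (rule emeasure_restrict_space) (auto simp: space_restrict_space)
 also have "(\<lambda>x. x /\<^sub>R norm x) -` E \<inter> space (restrict_space lborel (ball (0::real^3) 1 - {0})) =
   {x. 0 < norm x \<and> norm x < 1 \<and> x /\<^sub>R norm x \<in> E}"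
  by (auto simp: space_restrict_space)
 finally show ?thesis .
qed

lemma emeasure_S2_total: "emeasure S2_measure (space S2_measure) = ennreal (4 * pi)"
proof -
 have "sphere 0 1 \<in> sets (restrict_space borel (sphere (0::real^3) 1))"
  by (metis sets.top space_restrict_space2 space_borel UNIV_I sets_restrict_space_iff inf_top_right space_restrict_space)
 moreover have dirs: "{x. 0 < norm x \<and> norm x < 1 \<and> x /\<^sub>R norm x \<in> sphere (0::real^3) 1} = ball 0 1 - {0}"
  by auto
 ultimately have "emeasure S2_measure (space S2_measure) = 3 * emeasure lborel (ball (0::real^3) 1 - {0})"
  using emeasure_S2_measure[of "sphere 0 1"]
  by (simp only: space_S2_measure dirs)
 also have "emeasure lborel (ball (0::real^3) 1 - {0}) = emeasure lborel (ball (0::real^3) 1)"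
  by (rule emeasure_Diff_null_set) auto
 also have "\<dots> = ennreal (4 / 3 * pi)"
  by (simp add: emeasure_ball unit_ball_vol_3)
 also have "3 * ennreal (4 / 3 * pi) = ennreal (4 * pi)"
  by (subst ennreal_numeral[symmetric], subst ennreal_mult[symmetric]) auto
 finally show ?thesis .
qed

interpretation S2: finite_measure S2_measure
 by standard (simp add: emeasure_S2_total)

lemma measure_S2_total: "measure S2_measure (space S2_measure) = 4 * pi"
 by (simp add: measure_def emeasure_S2_total)

lemma emeasure_lborel_scale:
 fixes A :: "(real^3) set"
 assumes A: "A \<in> sets borel" and c: "c > 0"
 shows "emeasure lborel {x. x /\<^sub>R c \<in> A} = ennreal (c ^ 3) * emeasure lborel A"
proof -
 have [measurable]: "A \<in> sets borel" by fact
 have "emeasure lborel {x. x /\<^sub>R c \<in> A} =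
   emeasure (density (distr lborel borel (\<lambda>x::real^3. 0 + c *\<^sub>R x)) (\<lambda>_. ennreal (\<bar>c\<bar>^DIM(real^3)))) {x. x /\<^sub>R c \<in> A}"
  using lborel_affine[of c "0::real^3"] c by simp
 also have "\<dots> = ennreal (c^3) * emeasure (distr lborel borel (\<lambda>x::real^3. c *\<^sub>R x)) {x. x /\<^sub>R c \<in> A}"
  using c by (subst emeasure_density_const) auto
 also have "emeasure (distr lborel borel (\<lambda>x::real^3. c *\<^sub>R x)) {x. x /\<^sub>R c \<in> A} = emeasure lborel A"
  using c by (subst emeasure_distr) auto
 finally show ?thesis .
qed

definition radial_measure :: "real measure" where
 "radial_measure = density lborel (\<lambda>r. ennreal (indicator {0<..} r * r\<^sup>2))"

lemma sets_radial_measure [measurable_cong]: "sets radial_measure = sets borel"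
 by (simp add: radial_measure_def)

lemma space_radial_measure: "space radial_measure = UNIV"
 by (simp add: radial_measure_def)

lemma emeasure_radial_atMost:
 "emeasure radial_measure {..a} = ennreal ((max 0 a)^3 / 3)"
proof -
 have "emeasure radial_measure {..a} = (NN r. ennreal (indicator {0<..} r * r\<^sup>2) * indicator {..a} r)"
  unfolding radial_measure_def by (rule emeasure_density) auto
 also have "\<dots> = (NN r. ennreal (r\<^sup>2) * indicator {0..max 0 a} r)"
 proof (rule nn_integral_cong)
  fix r :: real
  show "ennreal (indicator {0<..} r * r\<^sup>2) * indicator {..a} r = ennreal (r\<^sup>2) * indicator {0..max 0 a} r"
   by (cases "r = 0") (auto simp: indicator_def)
 qed
 also have "\<dots> = ennreal ((max 0 a)^3 / 3 - 0^3 / 3)"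
  by (rule nn_integral_FTC_Icc) (auto intro!: derivative_eq_intros simp: power2_eq_square)
 finally show ?thesis by simp
qed

interpretation radial: sigma_finite_measure radial_measure
proof
 show "\<exists>A::real set set. countable A \<and> A \<subseteq> sets radial_measure \<and> \<Union> A = space radial_measure \<and> (\<forall>a\<in>A. emeasure radial_measure a \<noteq> \<infinity>)"
 proof (intro exI conjI)
  show "countable (range (\<lambda>n::nat. {..real n}))" by simp
  show "(\<Union>n::nat. {..real n}) = space radial_measure"
   by (auto simp: space_radial_measure real_arch_simple)
 qed (auto simp: sets_radial_measure emeasure_radial_atMost)
qed

lemma polar_measure:
 "radial_measure \<Otimes>\<^sub>M S2_measure =
  distr (restrict_space lborel (- {0})) (borel \<Otimes>\<^sub>M S2_measure) (\<lambda>x. (norm x, x /\<^sub>R norm x))"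
proof (rule pair_measure_eqI)
 let ?M = "distr (restrict_space lborel (- {0::real^3})) (borel \<Otimes>\<^sub>M S2_measure) (\<lambda>x. (norm x, x /\<^sub>R norm x))"
 show "sets (radial_measure \<Otimes>\<^sub>M S2_measure) = sets ?M"
  by (simp add: sets_radial_measure cong: sets_pair_measure_cong)
 have dir: "(\<lambda>x. x /\<^sub>R norm x) \<in> measurable (restrict_space lborel (- {0::real^3})) S2_measure"
  unfolding measurable_cong_sets[OF refl sets_S2_measure]
  by (rule measurable_restrict_space2) (auto simp: space_restrict_space intro!: measurable_restrict_space1)
 have pm[measurable]: "(\<lambda>x. (norm x, x /\<^sub>R norm x)) \<in> measurable (restrict_space lborel (- {0::real^3})) (borel \<Otimes>\<^sub>M S2_measure)"
  by (intro measurable_Pair dir measurable_restrict_space1) auto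
 fix A B assume A: "A \<in> sets radial_measure" and B: "B \<in> sets S2_measure"
 define E where "E = {x::real^3. x \<noteq> 0 \<and> x /\<^sub>R norm x \<in> B}"
 have Eborel: "E \<in> sets borel"
 proof -
  have "(\<lambda>x. x /\<^sub>R norm x) -` B \<inter> space (restrict_space lborel (- {0::real^3})) \<in> sets (restrict_space lborel (- {0::real^3}))"
   using dir B by (rule measurable_sets)
  also have "(\<lambda>x. x /\<^sub>R norm x) -` B \<inter> space (restrict_space lborel (- {0::real^3})) = E"
   by (auto simp: E_def space_restrict_space)
  finally have "E \<in> sets (restrict_space lborel (- {0::real^3}))" .
  then show ?thesis
   by (subst (asm) sets_restrict_space_iff) auto
 qed
 define \<mu> where "\<mu> = distr (restrict_space lborel E) borel (norm :: real^3 \<Rightarrow> real)"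
 define \<nu> where "\<nu> = scale_measure (emeasure S2_measure B) radial_measure"
 have nm: "norm \<in> borel_measurable (restrict_space lborel E)"
  by (intro measurable_restrict_space1) auto
 have em: "emeasure \<mu> X = emeasure lborel {x\<in>E. norm x \<in> X}" if "X \<in> sets borel" for X
 proof -
  have "emeasure \<mu> X = emeasure (restrict_space lborel E) (norm -` X \<inter> space (restrict_space lborel E))"
   unfolding \<mu>_def by (rule emeasure_distr[OF nm that])
  also have "\<dots> = emeasure lborel (norm -` X \<inter> space (restrict_space lborel E))"
   using Eborel by (intro emeasure_restrict_space) (auto simp: space_restrict_space)
  also have "norm -` X \<inter> space (restrict_space lborel E) = {x\<in>E. norm x \<in> X}"
   by (auto simp: space_restrict_space)
  finally show ?thesis .
 qed
 have Bsub: "B \<subseteq> sphere 0 1" using sets.sets_into_space[OF B] by (simp add: space_S2_measure)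
 have open1: "emeasure lborel {x\<in>E. norm x < 1} * 3 = emeasure S2_measure B"
 proof -
  have "emeasure S2_measure B = 3 * emeasure lborel {x. 0 < norm x \<and> norm x < 1 \<and> x /\<^sub>R norm x \<in> B}"
   using B by (intro emeasure_S2_measure) (simp add: sets_S2_measure)
  also have "{x. 0 < norm x \<and> norm x < 1 \<and> x /\<^sub>R norm x \<in> B} = {x\<in>E. norm x < 1}"
   by (auto simp: E_def)
  finally show ?thesis by (simp add: mult.commute)
 qed
 have sph: "sphere (0::real^3) a \<in> null_sets lborel" for a
  using negligible_sphere[of "0::real^3" a] by (auto simp: negligible_iff_null_sets null_sets_completion_iff)
 have cone: "emeasure \<mu> {..a} = emeasure \<nu> {..a}" for a
 proof (cases "a > 0")
  case False
  have "x \<notin> E" if "norm x \<le> a" for x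
   using False that zero_less_norm_iff[of x] unfolding E_def mem_Collect_eq by linarith
  then have emp: "{x \<in> E. norm x \<in> {..a}} = {}" by auto
  have "emeasure \<mu> {..a} = 0" using em[of "{..a}"] unfolding emp by simp
  then show ?thesis using False by (simp add: \<nu>_def emeasure_radial_atMost)
 next
  case True
  have "emeasure \<mu> {..a} = emeasure lborel {x\<in>E. norm x \<le> a}" by (subst em) auto
  also have "\<dots> = emeasure lborel {x\<in>E. norm x < a}"
  proof (rule emeasure_eq_AE)
   have "AE x in lborel. x \<notin> sphere (0::real^3) a"
    by (rule AE_not_in) (rule sph)
   then show "AE x in lborel. (x \<in> {x\<in>E. norm x \<le> a}) = (x \<in> {x\<in>E. norm x < a})"
    by eventually_elim auto
  qed (use Eborel in measurable)
  also have "{x\<in>E. norm x < a} = {x. x /\<^sub>R a \<in> {x\<in>E. norm x < 1}}"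
   using True by (auto simp: E_def field_simps)
  also have "emeasure lborel \<dots> = ennreal (a^3) * emeasure lborel {x\<in>E. norm x < 1}"
   using Eborel True by (intro emeasure_lborel_scale) (measurable, auto)
  also have "ennreal (a^3) = ennreal (a^3/3) * 3"
   using True by (subst ennreal_numeral[symmetric], subst ennreal_mult[symmetric]) auto
  also have "ennreal (a^3/3) * 3 * emeasure lborel {x\<in>E. norm x < 1} = ennreal (a^3/3) * emeasure S2_measure B"
   unfolding open1[symmetric] by (simp add: ac_simps)
  also have "\<dots> = emeasure \<nu> {..a}"
   using True by (simp add: \<nu>_def emeasure_radial_atMost mult.commute)
  finally show ?thesis .
 qed
 have eq: "\<mu> = \<nu>"
 proof (rule measure_eqI_generator_eq[of "range (\<lambda>a::real. {..a})" UNIV _ _ "\<lambda>n. {..real n}"])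
  show "Int_stable (range (\<lambda>a::real. {..a}))" by (auto simp: Int_stable_def)
  show "sets \<mu> = sigma_sets UNIV (range (\<lambda>a. {..a}))" by (simp add: \<mu>_def borel_eq_atMost)
  show "sets \<nu> = sigma_sets UNIV (range (\<lambda>a. {..a}))" by (simp add: \<nu>_def sets_radial_measure borel_eq_atMost)
  show "(\<Union>n. {..real n}) = UNIV" by (auto simp: real_arch_simple)
  show "emeasure \<mu> {..real i} \<noteq> \<infinity>" for i
   unfolding cone by (simp add: \<nu>_def emeasure_radial_atMost ennreal_mult_eq_top_iff)
 qed (use cone in auto)
 have A': "A \<in> sets borel" using A by (simp add: sets_radial_measure)
 have "emeasure radial_measure A * emeasure S2_measure B = emeasure \<nu> A"
  by (simp add: \<nu>_def mult.commute)
 also have "\<dots> = emeasure lborel {x\<in>E. norm x \<in> A}" using em[OF A'] eq by simp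
 also have "\<dots> = emeasure (restrict_space lborel (- {0::real^3})) {x\<in>E. norm x \<in> A}"
  by (rule emeasure_restrict_space[symmetric]) (auto simp: E_def)
 also have "\<dots> = emeasure ?M (A \<times> B)"
  using A' B by (subst emeasure_distr[OF pm])
   (auto simp: E_def space_restrict_space intro!: arg_cong[where f="emeasure _"])
 finally show "emeasure radial_measure A * emeasure S2_measure B = emeasure ?M (A \<times> B)" .
qed (fact radial.sigma_finite_measure_axioms S2.sigma_finite_measure_axioms)+

lemma polar_dir_measurable [measurable]:
 "(\<lambda>x. (norm x, x /\<^sub>R norm x)) \<in> measurable (restrict_space lborel (- {0::real^3})) (borel \<Otimes>\<^sub>M S2_measure)"
proof -
 have "(\<lambda>x. x /\<^sub>R norm x) \<in> measurable (restrict_space lborel (- {0::real^3})) S2_measure"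
  unfolding measurable_cong_sets[OF refl sets_S2_measure]
  by (rule measurable_restrict_space2) (auto simp: space_restrict_space intro!: measurable_restrict_space1)
 then show ?thesis by (rule measurable_Pair[rotated]) (rule measurable_restrict_space1, simp)
qed

lemma id_S2_measurable [measurable]: "(\<lambda>w. w) \<in> borel_measurable S2_measure"
 unfolding measurable_cong_sets[OF sets_S2_measure refl] by (rule measurable_restrict_space1) simp

lemma snd_S2_measurable [measurable]: "snd \<in> borel_measurable (borel \<Otimes>\<^sub>M S2_measure)"
 using measurable_compose[OF measurable_snd id_S2_measurable] by simp

interpretation polar: pair_sigma_finite radial_measure S2_measure ..

lemma AE_nonzero: "AE x in lborel. x \<noteq> (0::real^3)"
 by (rule AE_lborel_singleton)

lemma nn_integral_polar:
 fixes f :: "real^3 \<Rightarrow> ennreal"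
 assumes [measurable]: "f \<in> borel_measurable borel"
 shows "(NN x. f x) =
  (NN r. ennreal (indicator {0<..} r * r\<^sup>2) * (\<integral>\<^sup>+w. f (r *\<^sub>R w) \<partial>S2_measure))"
proof -
 have [measurable]: "(\<lambda>p. f (fst p *\<^sub>R snd p)) \<in> borel_measurable (borel \<Otimes>\<^sub>M S2_measure)"
  by measurable
 have m2: "(\<lambda>p. f (fst p *\<^sub>R snd p)) \<in> borel_measurable (radial_measure \<Otimes>\<^sub>M S2_measure)"
  using sets_radial_measure by (simp cong: measurable_cong_sets sets_pair_measure_cong)
 have "(NN x. f x) = (NN x. f x * indicator (- {0}) x)"
  by (intro nn_integral_cong_AE) (use AE_nonzero in eventually_elim, simp)
 also have "\<dots> = (\<integral>\<^sup>+x. f x \<partial>restrict_space lborel (- {0}))"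
  by (rule nn_integral_restrict_space[symmetric]) auto
 also have "\<dots> = (\<integral>\<^sup>+x. f (norm x *\<^sub>R (x /\<^sub>R norm x)) \<partial>restrict_space lborel (- {0}))"
  by (intro nn_integral_cong) (auto simp: space_restrict_space)
 also have "\<dots> = (\<integral>\<^sup>+p. f (fst p *\<^sub>R snd p) \<partial>(radial_measure \<Otimes>\<^sub>M S2_measure))"
  unfolding polar_measure by (subst nn_integral_distr) auto
 also have "\<dots> = (\<integral>\<^sup>+r. (\<integral>\<^sup>+w. f (r *\<^sub>R w) \<partial>S2_measure) \<partial>radial_measure)"
  using S2.nn_integral_fst[OF m2] by simp
 also have "\<dots> = (NN r. ennreal (indicator {0<..} r * r\<^sup>2) * (\<integral>\<^sup>+w. f (r *\<^sub>R w) \<partial>S2_measure))"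
  unfolding radial_measure_def
 proof (rule nn_integral_density)
  have "(\<lambda>r. \<integral>\<^sup>+w. f (r *\<^sub>R w) \<partial>S2_measure) \<in> borel_measurable borel"
   by (rule S2.borel_measurable_nn_integral[where N=borel]) (simp add: split_beta')
  then show "(\<lambda>r. \<integral>\<^sup>+w. f (r *\<^sub>R w) \<partial>S2_measure) \<in> borel_measurable lborel" by simp
 qed auto
 finally show ?thesis .
qed

lemma integral_polar:
 fixes f :: "real^3 \<Rightarrow> complex"
 assumes f: "integrable lborel f"
 shows "(LBINT x. f x) = (LBINT r. indicator {0<..} r *\<^sub>R sphere_integral r f)"
  and "integrable lborel (\<lambda>r. indicator {0<..} r *\<^sub>R sphere_integral r f)"
proof -
 have [measurable]: "f \<in> borel_measurable borel" using f by auto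
 let ?R = "restrict_space lborel (- {0::real^3})"
 have fR: "integrable ?R f"
  by (rule integrable_restrict_space[THEN iffD2])
   (auto intro!: integrable_mult_indicator f)
 have mm[measurable]: "(\<lambda>p. f (fst p *\<^sub>R snd p)) \<in> borel_measurable (borel \<Otimes>\<^sub>M S2_measure)"
  by measurable
 have eqR: "integrable ?R (\<lambda>x. f (norm x *\<^sub>R (x /\<^sub>R norm x)))"
  by (rule integrable_cong[THEN iffD1, OF refl _ fR]) (auto simp: space_restrict_space)
 have int: "integrable (radial_measure \<Otimes>\<^sub>M S2_measure) (\<lambda>p. f (fst p *\<^sub>R snd p))"
  unfolding polar_measure by (subst integrable_distr_eq) (use eqR in auto)
 have "(LBINT x. f x) = (LBINT x. indicator (- {0}) x *\<^sub>R f x)"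
  by (intro integral_cong_AE) (use AE_nonzero in \<open>auto elim: eventually_mono\<close>)
 also have "\<dots> = (\<integral>x. f x \<partial>?R)"
  by (rule integral_restrict_space[symmetric]) auto
 also have "\<dots> = (\<integral>x. f (norm x *\<^sub>R (x /\<^sub>R norm x)) \<partial>?R)"
  by (intro integral_cong) (auto simp: space_restrict_space)
 also have "\<dots> = (\<integral>p. f (fst p *\<^sub>R snd p) \<partial>(radial_measure \<Otimes>\<^sub>M S2_measure))"
  unfolding polar_measure by (subst integral_distr) auto
 also have "\<dots> = (\<integral>r. (\<integral>w. f (r *\<^sub>R w) \<partial>S2_measure) \<partial>radial_measure)"
  using polar.integral_fst'[OF int] by simp
 also have "\<dots> = (LBINT r. (indicator {0<..} r * r\<^sup>2) *\<^sub>R (\<integral>w. f (r *\<^sub>R w) \<partial>S2_measure))"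
  unfolding radial_measure_def
 proof (rule integral_density)
  have "(\<lambda>r. \<integral>w. f (r *\<^sub>R w) \<partial>S2_measure) \<in> borel_measurable borel"
   by (rule S2.borel_measurable_lebesgue_integral[where N=borel]) (simp add: split_beta')
  then show "(\<lambda>r. \<integral>w. f (r *\<^sub>R w) \<partial>S2_measure) \<in> borel_measurable lborel" by simp
 qed auto
 finally show "(LBINT x. f x) = (LBINT r. indicator {0<..} r *\<^sub>R sphere_integral r f)"
  by (simp add: sphere_integral_def)
 have "integrable radial_measure (\<lambda>r. \<integral>w. f (r *\<^sub>R w) \<partial>S2_measure)"
  using polar.integrable_fst'[OF int] by simp
 then have "integrable lborel (\<lambda>r. (indicator {0<..} r * r\<^sup>2) *\<^sub>R (\<integral>w. f (r *\<^sub>R w) \<partial>S2_measure))"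
  unfolding radial_measure_def
  by (rule integrable_density[THEN iffD1, rotated 3])
   (auto intro!: S2.borel_measurable_lebesgue_integral[where N=borel] simp: split_beta')
 then show "integrable lborel (\<lambda>r. indicator {0<..} r *\<^sub>R sphere_integral r f)"
  by (simp add: sphere_integral_def)
qed

lemma inverse_square_ball_measurable [measurable]:
 "(\<lambda>x::real^3. indicator (ball 0 D) x / (norm x)\<^sup>2 :: real) \<in> borel_measurable borel"
 by (intro borel_measurable_divide borel_measurable_indicator borel_measurable_power borel_measurable_norm) auto

lemma nn_integral_inverse_square_ball:
 assumes "0 \<le> D"
 shows "(NN x. ennreal (indicator (ball (0::real^3) D) x / (norm x)\<^sup>2)) = ennreal (4 * pi * D)"
proof -
 have "(NN x. ennreal (indicator (ball (0::real^3) D) x / (norm x)\<^sup>2)) =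
   (NN r. ennreal (indicator {0<..} r * r\<^sup>2) * (\<integral>\<^sup>+w. ennreal (indicator (ball (0::real^3) D) (r *\<^sub>R w) / (norm (r *\<^sub>R w))\<^sup>2) \<partial>S2_measure))"
  by (rule nn_integral_polar) measurable
 also have "\<dots> = (NN r. ennreal (4 * pi) * indicator {0<..<D} r)"
 proof (rule nn_integral_cong)
  fix r :: real
  show "ennreal (indicator {0<..} r * r\<^sup>2) * (\<integral>\<^sup>+w. ennreal (indicator (ball (0::real^3) D) (r *\<^sub>R w) / (norm (r *\<^sub>R w))\<^sup>2) \<partial>S2_measure) =
    ennreal (4 * pi) * indicator {0<..<D} r"
  proof (cases "r > 0")
   case True
   have "(\<integral>\<^sup>+w. ennreal (indicator (ball (0::real^3) D) (r *\<^sub>R w) / (norm (r *\<^sub>R w))\<^sup>2) \<partial>S2_measure) =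
     (\<integral>\<^sup>+w. ennreal (indicator {0<..<D} r / r\<^sup>2) \<partial>S2_measure)"
    using True by (intro nn_integral_cong) (auto simp: space_S2_measure indicator_def)
   also have "\<dots> = ennreal (indicator {0<..<D} r / r\<^sup>2) * ennreal (4 * pi)"
    by (simp add: emeasure_S2_total)
   finally show ?thesis using True
    by (auto simp: indicator_def ennreal_mult[symmetric])
  qed auto
 qed
 also have "\<dots> = ennreal (4 * pi * D)"
  using assms by (simp add: nn_integral_cmult ennreal_mult[symmetric])
 finally show ?thesis .
qed

lemma integrable_inverse_square_ball:
 "integrable lborel (\<lambda>x::real^3. indicator (ball 0 D) x / (norm x)\<^sup>2)"
proof (cases "0 \<le> D")
 case True
 show ?thesis
  by (rule integrableI_bounded) (use nn_integral_inverse_square_ball[OF True] in auto)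
next
 case False
 then have "(\<lambda>x::real^3. indicator (ball 0 D) x / (norm x)\<^sup>2 :: real) = (\<lambda>_. 0)"
  by (auto simp: indicator_def fun_eq_iff not_less intro: order_trans[OF _ norm_ge_zero])
 then show ?thesis by simp
qed

section \<open>Radial cutoffs\<close>

definition pos2 :: "real \<Rightarrow> real" where "pos2 t = (max 0 t)\<^sup>2"

lemma pos2_deriv: "(pos2 has_real_derivative 2 * max 0 t) (at t)"
proof -
 consider "t > 0" | "t < 0" | "t = 0" by linarith
 then show ?thesis
 proof cases
  case 1
  have "((\<lambda>t. t\<^sup>2) has_real_derivative 2 * max 0 t) (at t)"
   using 1 by (auto intro!: derivative_eq_intros)
  then show ?thesis
   by (rule DERIV_cong_ev[THEN iffD1, OF refl _ refl, rotated])
    (use 1 in \<open>auto simp: pos2_def eventually_nhds intro!: exI[of _ "{0<..}"]\<close>)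
 next
  case 2
  have "((\<lambda>t. 0) has_real_derivative 2 * max 0 t) (at t)"
   using 2 by (auto intro!: derivative_eq_intros)
  then show ?thesis
   by (rule DERIV_cong_ev[THEN iffD1, OF refl _ refl, rotated])
    (use 2 in \<open>auto simp: pos2_def eventually_nhds intro!: exI[of _ "{..<0}"]\<close>)
 next
  case 3
  have "(\<lambda>h. (pos2 (0 + h) - pos2 0) / h) \<midarrow>0\<rightarrow> 0"
  proof (rule Lim_null_comparison[of _ "\<lambda>h. \<bar>h\<bar>"])
   show "\<forall>\<^sub>F h in at 0. norm ((pos2 (0 + h) - pos2 0) / h) \<le> \<bar>h\<bar>"
    by (rule always_eventually) (auto simp: pos2_def max_def power2_eq_square)
   show "((\<lambda>h. \<bar>h\<bar>) \<longlongrightarrow> 0) (at (0::real))" by (auto intro!: tendsto_eq_intros)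
  qed
  then show ?thesis using 3 by (simp only: DERIV_def) simp
 qed
qed

definition tent :: "real \<Rightarrow> real" where "tent s = max 0 (1 - \<bar>s\<bar>)"

text \<open>
 A \<open>C\<^sup>1\<close> step from 1 to 0 whose slope is minus a tent function of mass 1; the second difference of
 \<open>pos2\<close> is the antiderivative of that tent.
\<close>

definition step_down :: "real \<Rightarrow> real" where
 "step_down s = 1 - (pos2 (s + 1) - 2 * pos2 s + pos2 (s - 1)) / 2"

lemma step_down_deriv: "(step_down has_real_derivative - tent s) (at s)"
proof -
 have "(step_down has_real_derivative - ((2 * max 0 (s+1) - 2 * (2 * max 0 s) + 2 * max 0 (s-1)) / 2)) (at s)"
  unfolding step_down_def
  by (auto intro!: derivative_eq_intros DERIV_chain2[OF pos2_deriv])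
 also have "- ((2 * max 0 (s+1) - 2 * (2 * max 0 s) + 2 * max 0 (s-1)) / 2) = - tent s"
  by (auto simp: tent_def max_def abs_if)
 finally show ?thesis .
qed

lemma step_down_eq_1: "s \<le> -1 \<Longrightarrow> step_down s = 1"
 and step_down_eq_0: "1 \<le> s \<Longrightarrow> step_down s = 0"
 by (auto simp: step_down_def pos2_def max_def power2_eq_square algebra_simps)

lemma tent_nonneg: "0 \<le> tent s" and tent_le_1: "tent s \<le> 1"
 by (auto simp: tent_def)

lemma tent_eq_0: "1 \<le> \<bar>s\<bar> \<Longrightarrow> tent s = 0"
 by (auto simp: tent_def)

lemma continuous_tent [continuous_intros]:
 "continuous_on S f \<Longrightarrow> continuous_on S (\<lambda>x. tent (f x))"
 unfolding tent_def by (intro continuous_intros)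

lemma tent_measurable [measurable]: "tent \<in> borel_measurable borel"
 unfolding tent_def by measurable

lemma integral_tent: "(LBINT s. tent s) = 1" and integrable_tent: "integrable lborel tent"
proof -
 have "has_bochner_integral lborel (\<lambda>x. tent x * indicator {-1..1} x) (- step_down 1 - - step_down (-1))"
  by (rule has_bochner_integral_FTC_Icc_nonneg)
   (auto intro!: derivative_eq_intros step_down_deriv continuous_intros tent_nonneg continuous_at_imp_continuous_on isCont_o2
    simp: tent_def)
 moreover have "tent x * indicator {-1..1} x = tent x" for x
  by (auto simp: indicator_def tent_def)
 ultimately have "has_bochner_integral lborel tent 1"
  by (simp add: step_down_eq_1 step_down_eq_0)
 then show "(LBINT s. tent s) = 1" "integrable lborel tent"
  by (auto simp: has_bochner_integral_iff)
qed

lemma sphere_integral_cong: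
 assumes "r > 0" "\<And>x. norm x = r \<Longrightarrow> f x = g x"
 shows "sphere_integral r f = sphere_integral r g"
 unfolding sphere_integral_def using assms
 by (intro arg_cong[where f="scaleR _"] integral_cong) (auto simp: space_S2_measure)

lemma sphere_integral_scaleR_radial:
 assumes "r > 0"
 shows "sphere_integral r (\<lambda>x. c (norm x) *\<^sub>R G x) = c r *\<^sub>R sphere_integral r G"
proof -
 have "sphere_integral r (\<lambda>x. c (norm x) *\<^sub>R G x) = sphere_integral r (\<lambda>x. c r *\<^sub>R G x)"
  using assms by (intro sphere_integral_cong) auto
 then show ?thesis by (simp add: sphere_integral_def)
qed

definition shell :: "real \<Rightarrow> real \<Rightarrow> real \<Rightarrow> real" where
 "shell R \<delta> r = (1 / \<delta>) * tent ((r - R) / \<delta>)"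

lemma shell_measurable [measurable]: "shell R \<delta> \<in> borel_measurable borel"
 unfolding shell_def by measurable

lemma continuous_shell [continuous_intros]:
 "continuous_on S f \<Longrightarrow> continuous_on S (\<lambda>x. shell R \<delta> (f x))"
 unfolding shell_def by (cases "\<delta> = 0") (auto intro!: continuous_intros)

lemma shell_eq_0: "\<delta> > 0 \<Longrightarrow> \<delta> \<le> \<bar>r - R\<bar> \<Longrightarrow> shell R \<delta> r = 0"
 by (simp add: shell_def tent_eq_0)

lemma shell_polar:
 fixes G :: "real^3 \<Rightarrow> complex"
 assumes "0 < \<delta>" "\<delta> < R" and int: "integrable lborel (\<lambda>x. shell R \<delta> (norm x) *\<^sub>R G x)"
 shows "(LBINT x. shell R \<delta> (norm x) *\<^sub>R G x) = (LBINT s. tent s *\<^sub>R sphere_integral (R + \<delta> * s) G)"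
  and "integrable lborel (\<lambda>s. tent s *\<^sub>R sphere_integral (R + \<delta> * s) G)"
proof -
 have eq: "indicator {0<..} r *\<^sub>R sphere_integral r (\<lambda>x. shell R \<delta> (norm x) *\<^sub>R G x) = shell R \<delta> r *\<^sub>R sphere_integral r G" for r
  using assms by (cases "r > 0") (auto simp: sphere_integral_scaleR_radial shell_eq_0)
 have eq2: "shell R \<delta> (R + \<delta> * s) *\<^sub>R sphere_integral (R + \<delta> * s) G = (1 / \<delta>) *\<^sub>R (tent s *\<^sub>R sphere_integral (R + \<delta> * s) G)" for s
  using assms by (simp add: shell_def)
 have "(LBINT x. shell R \<delta> (norm x) *\<^sub>R G x) = (LBINT r. shell R \<delta> r *\<^sub>R sphere_integral r G)"
  using integral_polar(1)[OF int] unfolding eq .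
 also have "\<dots> = \<bar>\<delta>\<bar> *\<^sub>R (LBINT s. shell R \<delta> (R + \<delta> * s) *\<^sub>R sphere_integral (R + \<delta> * s) G)"
  using assms by (intro lborel_integral_real_affine) auto
 also have "\<dots> = (LBINT s. tent s *\<^sub>R sphere_integral (R + \<delta> * s) G)"
  using assms by (simp only: eq2 integral_scaleR_right) simp
 finally show "(LBINT x. shell R \<delta> (norm x) *\<^sub>R G x) = (LBINT s. tent s *\<^sub>R sphere_integral (R + \<delta> * s) G)" .
 have "integrable lborel (\<lambda>r. shell R \<delta> r *\<^sub>R sphere_integral r G)"
  using integral_polar(2)[OF int] unfolding eq .
 then have "integrable lborel (\<lambda>s. shell R \<delta> (R + \<delta> * s) *\<^sub>R sphere_integral (R + \<delta> * s) G)"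
  using assms by (intro lborel_integrable_real_affine) auto
 then have "integrable lborel (\<lambda>s. \<delta> *\<^sub>R (shell R \<delta> (R + \<delta> * s) *\<^sub>R sphere_integral (R + \<delta> * s) G))"
  by (rule integrable_scaleR_right)
 then show "integrable lborel (\<lambda>s. tent s *\<^sub>R sphere_integral (R + \<delta> * s) G)"
  unfolding eq2 using assms by simp
qed

lemma continuous_sphere_measurable:
 fixes f :: "real^3 \<Rightarrow> 'b::topological_space"
 assumes "continuous_on (sphere 0 1) f"
 shows "f \<in> borel_measurable S2_measure"
 unfolding measurable_cong_sets[OF sets_S2_measure refl]
 using assms by (rule borel_measurable_continuous_on_restrict)

lemma continuous_on_sphere_integral:
 fixes G :: "real^3 \<Rightarrow> 'b::{banach, second_countable_topology}"
 assumes G: "continuous_on {x. a < norm x \<and> norm x < b} G" and a: "0 \<le> a"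
 shows "continuous_on {a<..<b} (\<lambda>r. sphere_integral r G)"
proof -
 have "continuous_on {a<..<b} (\<lambda>r. \<integral>w. G (r *\<^sub>R w) \<partial>S2_measure)"
 proof (rule continuous_at_imp_continuous_on, rule ballI)
  fix r assume r: "r \<in> {a<..<b}"
  obtain l u where lu: "a < l" "l < r" "r < u" "u < b"
   using r dense[of a r] dense[of r b] by auto
  have sub: "{x::real^3. l \<le> norm x \<and> norm x \<le> u} \<subseteq> {x. a < norm x \<and> norm x < b}" using lu by auto
  have cpt: "compact {x::real^3. l \<le> norm x \<and> norm x \<le> u}"
  proof (rule compact_eq_bounded_closed[THEN iffD2], rule conjI)
   show "bounded {x::real^3. l \<le> norm x \<and> norm x \<le> u}" by (rule boundedI[of _ u]) auto
   show "closed {x::real^3. l \<le> norm x \<and> norm x \<le> u}"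
    by (intro closed_Collect_conj closed_Collect_le continuous_intros)
  qed
  obtain M where M: "\<And>x. l \<le> norm x \<Longrightarrow> norm x \<le> u \<Longrightarrow> norm (G x) \<le> M"
   using compact_imp_bounded[OF compact_continuous_image[OF continuous_on_subset[OF G sub] cpt]]
   unfolding bounded_iff by auto
  show "isCont (\<lambda>r. \<integral>w. G (r *\<^sub>R w) \<partial>S2_measure) r"
  proof (rule continuous_at_sequentiallyI)
   fix s :: "nat \<Rightarrow> real" assume s: "s \<longlonglongrightarrow> r"
   have "\<forall>\<^sub>F n in sequentially. s n \<in> {l<..<u}"
    using s lu by (intro topological_tendstoD) auto
   then obtain N where N: "\<And>n. n \<ge> N \<Longrightarrow> s n \<in> {l<..<u}" by (auto simp: eventually_sequentially)
   have cont: "continuous_on (sphere 0 1) (\<lambda>w. G (t *\<^sub>R w))" if "t \<in> {l<..<u}" for t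
    using that lu a by (intro continuous_on_compose2[OF G] continuous_intros) auto
   have "(\<lambda>n. \<integral>w. G (s (n + N) *\<^sub>R w) \<partial>S2_measure) \<longlonglongrightarrow> (\<integral>w. G (r *\<^sub>R w) \<partial>S2_measure)"
   proof (rule integral_dominated_convergence[where w="\<lambda>_. M"])
    show "(\<lambda>w. G (r *\<^sub>R w)) \<in> borel_measurable S2_measure"
     using lu by (intro continuous_sphere_measurable cont) auto
    show "(\<lambda>w. G (s (n + N) *\<^sub>R w)) \<in> borel_measurable S2_measure" for n
     using N by (intro continuous_sphere_measurable cont) auto
    show "AE w in S2_measure. norm (G (s (n + N) *\<^sub>R w)) \<le> M" for n
     using N[of "n + N"] lu a by (intro AE_I2 M) (auto simp: space_S2_measure)
    show "AE w in S2_measure. (\<lambda>n. G (s (n + N) *\<^sub>R w)) \<longlonglongrightarrow> G (r *\<^sub>R w)"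
    proof (rule AE_I2)
     fix w assume w: "w \<in> space S2_measure"
     have op: "open {x::real^3. a < norm x \<and> norm x < b}"
      by (intro open_Collect_conj open_Collect_less continuous_intros)
     have "isCont G (r *\<^sub>R w)"
      by (rule continuous_on_interior[OF G]) (use w lu a op in \<open>auto simp: interior_open space_S2_measure\<close>)
     then show "(\<lambda>n. G (s (n + N) *\<^sub>R w)) \<longlonglongrightarrow> G (r *\<^sub>R w)"
      by (rule isCont_tendsto_compose) (intro tendsto_intros LIMSEQ_ignore_initial_segment s)
    qed
   qed simp
   then show "(\<lambda>n. \<integral>w. G (s n *\<^sub>R w) \<partial>S2_measure) \<longlonglongrightarrow> (\<integral>w. G (r *\<^sub>R w) \<partial>S2_measure)"
    by (rule LIMSEQ_offset)
  qed
 qed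
 then show ?thesis unfolding sphere_integral_def by (intro continuous_intros)
qed

lemma shell_integrable:
 fixes G :: "real^3 \<Rightarrow> complex"
 assumes G: "continuous_on {x. a < norm x \<and> norm x < b} G" and "0 \<le> a" "a < R - \<delta>" "R + \<delta> < b" "0 < \<delta>"
 shows "integrable lborel (\<lambda>x. shell R \<delta> (norm x) *\<^sub>R G x)"
proof -
 let ?K = "{x::real^3. R - \<delta> \<le> norm x \<and> norm x \<le> R + \<delta>}"
 have cpt: "compact ?K"
 proof (rule compact_eq_bounded_closed[THEN iffD2], rule conjI)
  show "bounded ?K" by (rule boundedI[of _ "R + \<delta>"]) auto
  show "closed ?K" by (intro closed_Collect_conj closed_Collect_le continuous_intros)
 qed
 have "integrable lborel (\<lambda>x. indicator ?K x *\<^sub>R (shell R \<delta> (norm x) *\<^sub>R G x))"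
  by (intro borel_integrable_compact cpt continuous_intros continuous_on_subset[OF G])
   (use assms in auto)
 moreover have "indicator ?K x *\<^sub>R (shell R \<delta> (norm x) *\<^sub>R G x) = shell R \<delta> (norm x) *\<^sub>R G x" for x
 proof (cases "\<delta> \<le> \<bar>norm x - R\<bar>")
  case False
  then have "x \<in> ?K" unfolding mem_Collect_eq by linarith
  then show ?thesis by simp
 qed (use assms in \<open>simp add: shell_eq_0\<close>)
 ultimately show ?thesis by (simp only:)
qed

text \<open>
 Shells of shrinking thickness average the sphere integrals near \<open>R\<close>, which depend continuously on
 the radius.
\<close>

lemma sphere_integral_eq_if_shell_const:
 fixes G :: "real^3 \<Rightarrow> complex"
 assumes G: "continuous_on {x. a < norm x \<and> norm x < b} G" and a: "0 \<le> a" "a < R" "R < b" and d: "0 < d"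
  and const: "\<And>\<delta>. 0 < \<delta> \<Longrightarrow> \<delta> < d \<Longrightarrow> (LBINT x. shell R \<delta> (norm x) *\<^sub>R G x) = c"
 shows "sphere_integral R G = c"
proof -
 define e where "e = min d (min (R - a) (b - R)) / 2"
 have e: "0 < e" "e < d" "a < R - e" "R + e < b"
 proof -
  have "e \<le> d / 2" "e \<le> (R - a) / 2" "e \<le> (b - R) / 2" by (auto simp: e_def)
  then have *: "2 * e \<le> d" "2 * e \<le> R - a" "2 * e \<le> b - R" by simp_all
  show "0 < e" using a d by (simp add: e_def)
  then show "e < d" using * d by linarith
  show "a < R - e" using * a by linarith
  show "R + e < b" using * a by linarith
 qed
 define \<delta> where "\<delta> n = e / (real n + 1)" for n
 have \<delta>: "0 < \<delta> n" "\<delta> n \<le> e" for n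
  using e by (auto simp: \<delta>_def field_simps)
 have \<delta>0: "\<delta> \<longlonglongrightarrow> 0"
  unfolding \<delta>_def using tendsto_mult[OF tendsto_const[of e] LIMSEQ_inverse_real_of_nat]
  by (simp add: divide_inverse add.commute)
 note contS = continuous_on_sphere_integral[OF G a(1)]
 obtain M where M: "\<And>r. r \<in> {R - e..R + e} \<Longrightarrow> norm (sphere_integral r G) \<le> M"
 proof -
  have "{R - e..R + e} \<subseteq> {a<..<b}" using e by auto
  from compact_imp_bounded[OF compact_continuous_image[OF continuous_on_subset[OF contS this] compact_Icc]]
  show ?thesis unfolding bounded_iff by (auto intro: that)
 qed
 have int: "integrable lborel (\<lambda>x. shell R (\<delta> n) (norm x) *\<^sub>R G x)" for n
  using e \<delta>[of n] a by (intro shell_integrable[OF G]) auto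
 have \<delta>R: "\<delta> n < R" for n using \<delta>[of n] e a by linarith
 have eqc: "(LBINT s. tent s *\<^sub>R sphere_integral (R + \<delta> n * s) G) = c" for n
  using shell_polar(1)[OF \<delta>(1) \<delta>R int] const[of "\<delta> n"] \<delta>[of n] e by simp
 have "(\<lambda>n. (LBINT s. tent s *\<^sub>R sphere_integral (R + \<delta> n * s) G)) \<longlonglongrightarrow> (LBINT s. tent s *\<^sub>R sphere_integral R G)"
 proof (rule integral_dominated_convergence[where w="\<lambda>s. tent s * M"])
  show "integrable lborel (\<lambda>s. tent s * M)" using integrable_tent by simp
  show "(\<lambda>s. tent s *\<^sub>R sphere_integral (R + \<delta> n * s) G) \<in> borel_measurable lborel" for n
   using shell_polar(2)[OF \<delta>(1) \<delta>R int] by auto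
  show "AE s in lborel. norm (tent s *\<^sub>R sphere_integral (R + \<delta> n * s) G) \<le> tent s * M" for n
  proof (rule AE_I2)
   fix s
   show "norm (tent s *\<^sub>R sphere_integral (R + \<delta> n * s) G) \<le> tent s * M"
   proof (cases "\<bar>s\<bar> < 1")
    case True
    have "\<bar>\<delta> n * s\<bar> \<le> e * 1" unfolding abs_mult using \<delta>[of n] True by (intro mult_mono) auto
    then have "R + \<delta> n * s \<in> {R - e..R + e}" by auto
    then show ?thesis using M tent_nonneg by (auto intro!: mult_left_mono)
   qed (simp add: tent_eq_0)
  qed
  show "AE s in lborel. (\<lambda>n. tent s *\<^sub>R sphere_integral (R + \<delta> n * s) G) \<longlonglongrightarrow> tent s *\<^sub>R sphere_integral R G"
  proof (rule AE_I2)
   fix s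
   have "isCont (\<lambda>r. sphere_integral r G) R"
    by (rule continuous_on_interior[OF contS]) (use a in simp)
   moreover have "(\<lambda>n. R + \<delta> n * s) \<longlonglongrightarrow> R"
    using \<delta>0 by (auto intro!: tendsto_eq_intros)
   ultimately have "(\<lambda>n. sphere_integral (R + \<delta> n * s) G) \<longlonglongrightarrow> sphere_integral R G"
    by (rule isCont_tendsto_compose)
   then show "(\<lambda>n. tent s *\<^sub>R sphere_integral (R + \<delta> n * s) G) \<longlonglongrightarrow> tent s *\<^sub>R sphere_integral R G"
    by (intro tendsto_intros)
  qed
 qed (use integrable_tent in simp)
 moreover have "(LBINT s. tent s *\<^sub>R sphere_integral R G) = sphere_integral R G"
  using integrable_tent by (simp add: integral_tent)
 ultimately show ?thesis unfolding eqc using LIMSEQ_unique[OF tendsto_const] by metis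
qed

declare polar_dir_measurable [measurable del] id_S2_measurable [measurable del] snd_S2_measurable [measurable del]
declare sets_S2_measure [measurable_cong del] sets_radial_measure [measurable_cong del]

section \<open>Calculus for complex-valued functions on three-space\<close>

lemma pderiv_at_eq: "(f has_derivative f') (at x) \<Longrightarrow> pderiv_at i f x = f' (axis i 1)"
 by (simp add: pderiv_at_def frechet_derivative_at[symmetric])

lemma rderiv_eq: "(f has_derivative f') (at x) \<Longrightarrow> rderiv f x = f' (x /\<^sub>R norm x)"
 by (simp add: rderiv_def frechet_derivative_at[symmetric])

lemma linear_axis_expansion:
 fixes f' :: "real^3 \<Rightarrow> complex"
 assumes "linear f'"
 shows "f' h = (\<Sum>i\<in>UNIV. h $ i *\<^sub>R f' (axis i 1))"
proof -
 have "f' h = f' (\<Sum>i\<in>UNIV. h $ i *\<^sub>R axis i 1)"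
  using basis_expansion[of h] by (simp add: scalar_mult_eq_scaleR)
 then show ?thesis using assms by (simp add: linear_sum linear_scale)
qed

text \<open>
 The derivative with prescribed partial derivatives, as a linear form.
\<close>

definition grad_form :: "(3 \<Rightarrow> complex) \<Rightarrow> real^3 \<Rightarrow> complex" where
 "grad_form p h = (\<Sum>i\<in>UNIV. h $ i *\<^sub>R p i)"

lemma grad_form_axis [simp]: "grad_form p (axis i 1) = p i"
proof -
 have "axis i 1 $ j *\<^sub>R p j = (if j = i then p j else 0)" for j by (simp add: axis_def)
 then show ?thesis unfolding grad_form_def by simp
qed

lemma bounded_linear_grad_form: "bounded_linear (grad_form p)"
 unfolding grad_form_def
 by (intro bounded_linear_sum bounded_linear_scaleR_left[THEN bounded_linear_compose] bounded_linear_vec_nth)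

lemma grad_form_scaleR_axis: "grad_form p (s *\<^sub>R axis i 1) = s *\<^sub>R p i"
 using linear_scale[OF bounded_linear.linear[OF bounded_linear_grad_form]] by simp

lemma norm_grad_form_le: "norm (grad_form p h) \<le> norm h * (\<Sum>i\<in>UNIV. norm (p i))"
 unfolding grad_form_def sum_distrib_left
 by (rule sum_norm_le) (simp add: mult_right_mono component_le_norm_cart)

lemma has_derivative_grad_form:
 assumes "f differentiable (at x)"
 shows "(f has_derivative grad_form (\<lambda>i. pderiv_at i f x)) (at x)"
proof -
 have d: "(f has_derivative frechet_derivative f (at x)) (at x)"
  using assms by (simp add: frechet_derivative_works)
 have "frechet_derivative f (at x) = grad_form (\<lambda>i. pderiv_at i f x)"
  unfolding grad_form_def pderiv_at_def
  by (rule ext) (rule linear_axis_expansion[OF has_derivative_linear[OF d]])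
 then show ?thesis using d by simp
qed

lemma rderiv_grad_form: "f differentiable (at x) \<Longrightarrow> rderiv f x = grad_form (\<lambda>i. pderiv_at i f x) (x /\<^sub>R norm x)"
 using rderiv_eq[OF has_derivative_grad_form] .

lemma C1_onI:
 assumes "\<And>x. x \<in> S \<Longrightarrow> (f has_derivative grad_form (\<lambda>i. p i x)) (at x)"
  and "\<And>i. continuous_on S (p i)"
 shows "C1_on S f"
 unfolding C1_on_def
proof (intro conjI ballI allI)
 show "f differentiable (at x)" if "x \<in> S" for x using assms(1)[OF that] by (rule differentiableI)
 show "continuous_on S (pderiv_at i f)" for i
  using assms(2)[of i] by (rule continuous_on_eq) (use pderiv_at_eq[OF assms(1)] in simp)
qed

lemma C1_on_has_derivative: "C1_on S f \<Longrightarrow> x \<in> S \<Longrightarrow> (f has_derivative grad_form (\<lambda>i. pderiv_at i f x)) (at x)"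
 unfolding C1_on_def by (blast intro: has_derivative_grad_form)

lemma C1_on_pderiv_continuous: "C1_on S f \<Longrightarrow> continuous_on S (pderiv_at i f)"
 unfolding C1_on_def by blast

lemma C1_on_subset: "C1_on S f \<Longrightarrow> T \<subseteq> S \<Longrightarrow> C1_on T f"
 unfolding C1_on_def by (meson continuous_on_subset subsetD)

lemma C1_on_continuous: "C1_on S f \<Longrightarrow> continuous_on S f"
 unfolding C1_on_def by (blast intro: differentiable_imp_continuous_on differentiable_at_withinI differentiable_on_def[THEN iffD2])

lemma grad_form_add: "grad_form p h + grad_form q h = grad_form (\<lambda>i. p i + q i) h"
 by (simp add: grad_form_def sum.distrib scaleR_add_right)

lemma grad_form_cmult: "c * grad_form p h = grad_form (\<lambda>i. c * p i) h"
 by (simp add: grad_form_def sum_distrib_left)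

lemma grad_form_cmult_right: "grad_form p h * c = grad_form (\<lambda>i. p i * c) h"
 by (simp add: grad_form_def sum_distrib_right)

lemma grad_form_cnj: "cnj (grad_form p h) = grad_form (\<lambda>i. cnj (p i)) h"
 by (simp add: grad_form_def cnj_sum)

lemma has_derivative_mult_grad:
 assumes "(f has_derivative grad_form p) (at x)" "(g has_derivative grad_form q) (at x)"
 shows "((\<lambda>x. f x * g x) has_derivative grad_form (\<lambda>i. f x * q i + p i * g x)) (at x)"
proof -
 have "((\<lambda>x. f x * g x) has_derivative (\<lambda>h. f x * grad_form q h + grad_form p h * g x)) (at x)"
  by (rule has_derivative_mult[OF assms])
 then show ?thesis by (simp add: grad_form_cmult grad_form_cmult_right grad_form_add)
qed

lemma has_derivative_add_grad:
 assumes "(f has_derivative grad_form p) (at x)" "(g has_derivative grad_form q) (at x)"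
 shows "((\<lambda>x. f x + g x) has_derivative grad_form (\<lambda>i. p i + q i)) (at x)"
 using has_derivative_add[OF assms] by (simp add: grad_form_add)

lemma has_derivative_cnj_grad:
 assumes "(f has_derivative grad_form p) (at x)"
 shows "((\<lambda>x. cnj (f x)) has_derivative grad_form (\<lambda>i. cnj (p i))) (at x)"
 using bounded_linear.has_derivative[OF bounded_linear_cnj assms] by (simp add: grad_form_cnj)

lemma pderiv_at_mult:
 assumes "f differentiable (at x)" "g differentiable (at x)"
 shows "pderiv_at i (\<lambda>x. f x * g x) x = f x * pderiv_at i g x + pderiv_at i f x * g x"
 using pderiv_at_eq[OF has_derivative_mult_grad[OF assms[THEN has_derivative_grad_form]]] by simp

lemma pderiv_at_add:
 assumes "f differentiable (at x)" "g differentiable (at x)"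
 shows "pderiv_at i (\<lambda>x. f x + g x) x = pderiv_at i f x + pderiv_at i g x"
 using pderiv_at_eq[OF has_derivative_add_grad[OF assms[THEN has_derivative_grad_form]]] by simp

lemma pderiv_at_cnj:
 assumes "f differentiable (at x)"
 shows "pderiv_at i (\<lambda>x. cnj (f x)) x = cnj (pderiv_at i f x)"
 using pderiv_at_eq[OF has_derivative_cnj_grad[OF assms[THEN has_derivative_grad_form]]] by simp

lemma C1_on_differentiable: "C1_on S f \<Longrightarrow> x \<in> S \<Longrightarrow> f differentiable (at x)"
 unfolding C1_on_def by blast

lemma C1_on_mult:
 assumes f: "C1_on S f" and g: "C1_on S g"
 shows "C1_on S (\<lambda>x. f x * g x)"
proof (rule C1_onI[OF has_derivative_mult_grad[OF C1_on_has_derivative[OF f] C1_on_has_derivative[OF g]]])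
 show "continuous_on S (\<lambda>x. f x * pderiv_at i g x + pderiv_at i f x * g x)" for i
  by (intro continuous_on_add continuous_on_mult C1_on_continuous[OF f] C1_on_continuous[OF g]
   C1_on_pderiv_continuous f g)
qed

lemma C1_on_add:
 assumes f: "C1_on S f" and g: "C1_on S g"
 shows "C1_on S (\<lambda>x. f x + g x)"
proof (rule C1_onI[OF has_derivative_add_grad[OF C1_on_has_derivative[OF f] C1_on_has_derivative[OF g]]])
 show "continuous_on S (\<lambda>x. pderiv_at i f x + pderiv_at i g x)" for i
  by (intro continuous_on_add C1_on_pderiv_continuous f g)
qed

lemma C1_on_cnj: "C1_on S f \<Longrightarrow> C1_on S (\<lambda>x. cnj (f x))"
 by (rule C1_onI, rule has_derivative_cnj_grad)
  (auto intro!: C1_on_has_derivative continuous_on_cnj C1_on_pderiv_continuous)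

lemma C1_on_const: "C1_on S (\<lambda>x. c)"
proof (rule C1_onI[where p="\<lambda>i x. 0"])
 show "((\<lambda>x. c) has_derivative grad_form (\<lambda>i. 0)) (at x)" for x
  by (auto intro!: derivative_eq_intros simp: grad_form_def)
qed auto

lemma C1_on_cong_open:
 assumes f: "C1_on S f" and S: "open S" and eq: "\<And>x. x \<in> S \<Longrightarrow> g x = f x"
 shows "C1_on S g" and "\<And>x i. x \<in> S \<Longrightarrow> pderiv_at i g x = pderiv_at i f x"
proof -
 have *: "(g has_derivative grad_form (\<lambda>i. pderiv_at i f x)) (at x)" if "x \<in> S" for x
  by (rule has_derivative_transform_within_open[OF C1_on_has_derivative[OF f that] S that]) (simp add: eq)
 show "C1_on S g"
  by (rule C1_onI[OF *]) (auto intro: C1_on_pderiv_continuous f)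
 show "pderiv_at i g x = pderiv_at i f x" if "x \<in> S" for x i
  using pderiv_at_eq[OF *[OF that]] by simp
qed

lemma C1_on_Un:
 assumes "open S" "open T" "C1_on S f" "C1_on T f"
 shows "C1_on (S \<union> T) f"
 using assms continuous_on_open_Un[of S T] unfolding C1_on_def by blast

lemma test_funD:
 fixes x :: "real^3"
 assumes "test_fun \<phi>"
 shows "C1_on UNIV \<phi>" "continuous_on UNIV \<phi>" "\<exists>D. \<forall>x. D < norm x \<longrightarrow> \<phi> x = 0"
  "x \<notin> closure {x. \<phi> x \<noteq> 0} \<Longrightarrow> \<phi> x = 0" "x \<notin> closure {x. \<phi> x \<noteq> 0} \<Longrightarrow> pderiv_at i \<phi> x = 0"
proof -
 show C: "C1_on UNIV \<phi>" using assms by (simp add: test_fun_def)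
 then show "continuous_on UNIV \<phi>" by (rule C1_on_continuous)
 have "bounded (closure {x. \<phi> x \<noteq> 0})" using assms by (auto simp: test_fun_def compact_imp_bounded)
 then have "bounded {x. \<phi> x \<noteq> 0}" by (rule bounded_subset) (rule closure_subset)
 then obtain D where D: "\<And>x. \<phi> x \<noteq> 0 \<Longrightarrow> norm x \<le> D" by (auto simp: bounded_iff)
 have "\<forall>x. D < norm x \<longrightarrow> \<phi> x = 0"
 proof (intro allI impI)
  fix x :: "real^3" assume "D < norm x"
  then show "\<phi> x = 0" using D[of x] by (metis linorder_not_le)
 qed
 then show "\<exists>D. \<forall>x. D < norm x \<longrightarrow> \<phi> x = 0" by blast
 show "\<phi> x = 0" if "x \<notin> closure {x. \<phi> x \<noteq> 0}"
  using that closure_subset[of "{x. \<phi> x \<noteq> 0}"] by blast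
 show "pderiv_at i \<phi> x = 0" if "x \<notin> closure {x. \<phi> x \<noteq> 0}"
 proof -
  have "(\<phi> has_derivative (\<lambda>h. 0)) (at x)"
   by (rule has_derivative_transform_within_open[OF has_derivative_const[of 0], of "- closure {x. \<phi> x \<noteq> 0}"])
    (use that closure_subset[of "{x. \<phi> x \<noteq> 0}"] in auto)
  then show ?thesis by (simp add: pderiv_at_eq)
 qed
qed

lemma test_funI:
 assumes "C1_on UNIV \<phi>" "\<And>x. D < norm x \<Longrightarrow> \<phi> x = 0"
 shows "test_fun \<phi>"
proof -
 have "{x. \<phi> x \<noteq> 0} \<subseteq> cball 0 D" using assms(2) by (auto simp: not_less[symmetric])
 then have "bounded {x. \<phi> x \<noteq> 0}" by (rule bounded_subset[OF bounded_cball])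
 then show ?thesis using assms(1) by (simp add: test_fun_def compact_closure)
qed

lemma bounded_on_compact:
 fixes f :: "'a::topological_space \<Rightarrow> 'b::real_normed_vector"
 assumes "compact S" "continuous_on S f"
 shows "\<exists>M. \<forall>x\<in>S. norm (f x) \<le> M"
 using compact_imp_bounded[OF compact_continuous_image[OF assms(2,1)]] by (auto simp: bounded_iff)

lemma test_fun_bounded:
 assumes "test_fun \<phi>"
 shows "\<exists>D M. D > 0 \<and> M > 0 \<and> (\<forall>x. norm (\<phi> x) \<le> M) \<and> (\<forall>i x. norm (pderiv_at i \<phi> x) \<le> M) \<and>
  (\<forall>x. D < norm x \<longrightarrow> \<phi> x = 0) \<and> (\<forall>i x. D < norm x \<longrightarrow> pderiv_at i \<phi> x = 0)"
proof -
 let ?S = "closure {x. \<phi> x \<noteq> 0}"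
 have cpt: "compact ?S" using assms by (simp add: test_fun_def)
 obtain D where D: "\<And>x. x \<in> ?S \<Longrightarrow> norm x \<le> D" using compact_imp_bounded[OF cpt] by (auto simp: bounded_iff)
 obtain m0 where m0: "\<forall>x\<in>?S. norm (\<phi> x) \<le> m0"
  using bounded_on_compact[OF cpt continuous_on_subset[OF test_funD(2)[OF assms]]] by blast
 have "\<forall>i. \<exists>m. \<forall>x\<in>?S. norm (pderiv_at i \<phi> x) \<le> m"
  using bounded_on_compact[OF cpt continuous_on_subset[OF C1_on_pderiv_continuous[OF test_funD(1)[OF assms]]]] by blast
 then obtain m where m: "\<forall>i. \<forall>x\<in>?S. norm (pderiv_at i \<phi> x) \<le> m i" by (rule choice[THEN exE])
 define M where "M = \<bar>m0\<bar> + (\<Sum>i\<in>UNIV. \<bar>m i\<bar>) + 1"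
 have sm: "\<bar>m i\<bar> \<le> (\<Sum>i\<in>UNIV. \<bar>m i\<bar>)" for i
  by (rule member_le_sum) auto
 have M1: "\<bar>m0\<bar> \<le> M" "\<bar>m i\<bar> \<le> M" "M > 0" for i
  using sm[of i] abs_ge_zero[of "m i"] abs_ge_zero[of m0] unfolding M_def by linarith+
 show ?thesis
 proof (rule exI[of _ "\<bar>D\<bar> + 1"], rule exI[of _ M], intro conjI allI impI)
  show "norm (\<phi> x) \<le> M" for x
  proof (cases "x \<in> ?S")
   case True
   then have "norm (\<phi> x) \<le> m0" using m0 by blast
   then show ?thesis using M1 by linarith
  next
   case False
   then have "\<phi> x = 0" by (rule test_funD(4)[OF assms])
   then show ?thesis using M1 by simp
  qed
  show "norm (pderiv_at i \<phi> x) \<le> M" for i x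
  proof (cases "x \<in> ?S")
   case True
   then have "norm (pderiv_at i \<phi> x) \<le> m i" using m by blast
   then show ?thesis using M1(2)[of i] by linarith
  next
   case False
   then have "pderiv_at i \<phi> x = 0" by (rule test_funD(5)[OF assms])
   then show ?thesis using M1 by simp
  qed
  show "\<phi> x = 0" "pderiv_at i \<phi> x = 0" if "\<bar>D\<bar> + 1 < norm x" for x i
  proof -
   have "x \<notin> ?S" using D[of x] that by linarith
   then show "\<phi> x = 0" "pderiv_at i \<phi> x = 0" by (rule test_funD(4)[OF assms], rule test_funD(5)[OF assms])
  qed
 qed (use M1 in auto)
qed

lemma ball_pred_measurable [measurable]:
 "Measurable.pred borel (\<lambda>x. x \<in> ball a r)" "Measurable.pred borel (\<lambda>x. x \<in> cball a r)"
 for a :: "real^3"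
 by (simp_all only: mem_ball mem_cball) measurable

definition L1loc :: "(real^3 \<Rightarrow> complex) \<Rightarrow> bool" where
 "L1loc f \<longleftrightarrow> f \<in> borel_measurable lborel \<and> (\<forall>D. integrable lborel (\<lambda>x. indicator (cball 0 D) x *\<^sub>R f x))"

lemma L1loc_mult_integrable:
 assumes f: "L1loc f" and g: "g \<in> borel_measurable borel" "\<And>x. norm (g x) \<le> M" "\<And>x. D < norm x \<Longrightarrow> g x = 0"
 shows "integrable lborel (\<lambda>x. f x * g x)"
proof (rule integrable_bound)
 show "integrable lborel (\<lambda>x. M *\<^sub>R norm (indicator (cball 0 D) x *\<^sub>R f x))"
  using f by (intro integrable_scaleR_right integrable_norm) (auto simp: L1loc_def)
 show "(\<lambda>x. f x * g x) \<in> borel_measurable lborel"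
  using f g by (auto simp: L1loc_def)
 have "M \<ge> 0" using g(2)[of 0] norm_ge_zero order_trans by blast
 show "AE x in lborel. norm (f x * g x) \<le> norm (M *\<^sub>R norm (indicator (cball 0 D) x *\<^sub>R f x))"
 proof (rule AE_I2)
  fix x
  show "norm (f x * g x) \<le> norm (M *\<^sub>R norm (indicator (cball 0 D) x *\<^sub>R f x))"
   using g(2)[of x] g(3)[of x] \<open>M \<ge> 0\<close>
   by (cases "D < norm x") (auto simp: norm_mult mult.commute[of M] intro!: mult_left_mono)
 qed
qed

lemma L1loc_mult_continuous:
 assumes f: "L1loc f" and g: "continuous_on UNIV g" "\<And>x. D < norm x \<Longrightarrow> g x = 0"
 shows "integrable lborel (\<lambda>x. f x * g x)"
proof -
 obtain M where M: "\<forall>x\<in>cball 0 D. norm (g x) \<le> M"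
  using bounded_on_compact[OF compact_cball continuous_on_subset[OF g(1)]] by blast
 show ?thesis
 proof (rule L1loc_mult_integrable[OF f, where g=g and M="\<bar>M\<bar>" and D=D])
  show "g \<in> borel_measurable borel" using g(1) by (rule borel_measurable_continuous_onI)
  show "norm (g x) \<le> \<bar>M\<bar>" for x
   using M g(2)[of x] by (cases "D < norm x") (auto intro: order_trans[OF _ abs_ge_self])
 qed (rule g(2))
qed

lemma L1loc_test_fun:
 assumes "L1loc f" "test_fun \<phi>"
 shows "integrable lborel (\<lambda>x. f x * \<phi> x)" "integrable lborel (\<lambda>x. f x * pderiv_at i \<phi> x)"
proof -
 obtain D where D0: "\<forall>x. D < norm x \<longrightarrow> \<phi> x = 0" "\<forall>i x. D < norm x \<longrightarrow> pderiv_at i \<phi> x = 0"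
  using test_fun_bounded[OF assms(2)] by blast
 note D = D0[rule_format]
 show "integrable lborel (\<lambda>x. f x * \<phi> x)"
  by (rule L1loc_mult_continuous[OF assms(1) test_funD(2)[OF assms(2)], where D=D]) (rule D(1))
 show "integrable lborel (\<lambda>x. f x * pderiv_at i \<phi> x)"
  by (rule L1loc_mult_continuous[OF assms(1) C1_on_pderiv_continuous[OF test_funD(1)[OF assms(2)]], where D=D]) (rule D(2))
qed

lemma L1loc_continuous:
 assumes "continuous_on UNIV f"
 shows "L1loc f"
 unfolding L1loc_def
 using borel_integrable_compact[OF compact_cball continuous_on_subset[OF assms]] borel_measurable_continuous_onI[OF assms]
 by auto

lemma L2loc_imp_L1loc:
 assumes "L2loc f"
 shows "L1loc f"
 unfolding L1loc_def
proof (intro conjI allI)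
 have [measurable]: "f \<in> borel_measurable borel" using assms by (simp add: L2loc_def)
 then show "f \<in> borel_measurable lborel" by simp
 fix D
 have i2: "integrable lborel (\<lambda>x. indicator (cball 0 D) x *\<^sub>R (norm (f x))\<^sup>2)"
  using assms by (simp add: L2loc_def set_integrable_def)
 have i1: "integrable lborel (\<lambda>x. indicator (cball (0::real^3) D) x *\<^sub>R (1::real))"
  by (rule borel_integrable_compact) auto
 show "integrable lborel (\<lambda>x. indicator (cball 0 D) x *\<^sub>R f x)"
 proof (rule integrable_bound[OF integrable_add[OF i1 i2]])
  show "AE x in lborel. norm (indicator (cball 0 D) x *\<^sub>R f x)
   \<le> norm (indicator (cball 0 D) x *\<^sub>R 1 + indicator (cball 0 D) x *\<^sub>R (norm (f x))\<^sup>2)"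
  proof (rule AE_I2)
   fix x
   have "norm (f x) \<le> 1 + (norm (f x))\<^sup>2"
   proof -
    have "2 * norm (f x) \<le> (norm (f x))\<^sup>2 + 1" using sum_squares_bound[of "norm (f x)" 1] by simp
    moreover have "0 \<le> norm (f x)" by simp
    ultimately show ?thesis by linarith
   qed
   then show "norm (indicator (cball 0 D) x *\<^sub>R f x)
    \<le> norm (indicator (cball 0 D) x *\<^sub>R 1 + indicator (cball 0 D) x *\<^sub>R (norm (f x))\<^sup>2)"
    by (auto simp: indicator_def)
  qed
  show "(\<lambda>x. indicator (cball 0 D) x *\<^sub>R f x) \<in> borel_measurable lborel"
   using assms by (intro borel_measurable_scaleR borel_measurable_indicator) (auto simp: L2loc_def)
 qed
qed

lemma lborel_integral_shift:
 fixes f :: "real^3 \<Rightarrow> complex"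
 assumes "f \<in> borel_measurable borel"
 shows "(LBINT x. f (x + t)) = (LBINT x. f x)"
proof -
 have "(LBINT x. f x) = (\<integral>x. f x \<partial>distr lborel borel ((+) t))"
  by (simp add: lborel_distr_plus)
 also have "\<dots> = (LBINT x. f (t + x))"
  using assms by (intro integral_distr) auto
 finally show ?thesis by (simp only: add.commute)
qed

text \<open>
 Differentiation under the integral sign. The mean value inequality dominates the difference quotients.
\<close>

lemma has_derivative_integral:
 fixes F :: "'a::euclidean_space \<Rightarrow> 'm \<Rightarrow> 'b::{banach,second_countable_topology}"
 assumes d: "0 < \<delta>"
  and der: "\<And>x y. x \<in> ball x0 \<delta> \<Longrightarrow> ((\<lambda>x. F x y) has_derivative F' x y) (at x)"
  and bound: "\<And>x y h. x \<in> ball x0 \<delta> \<Longrightarrow> norm (F' x y h) \<le> w y * norm h"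
  and w: "integrable M w" and int: "\<And>x. x \<in> ball x0 \<delta> \<Longrightarrow> integrable M (F x)"
  and int': "\<And>h. integrable M (\<lambda>y. F' x0 y h)"
 shows "((\<lambda>x. \<integral>y. F x y \<partial>M) has_derivative (\<lambda>h. \<integral>y. F' x0 y h \<partial>M)) (at x0)"
proof -
 let ?L = "\<lambda>h. \<integral>y. F' x0 y h \<partial>M"
 have x0: "x0 \<in> ball x0 \<delta>" using d by simp
 have lin: "linear (F' x0 y)" for y by (rule has_derivative_linear[OF der[OF x0]])
 have L: "bounded_linear ?L"
 proof (rule bounded_linear_intro)
  show "?L (g + h) = ?L g + ?L h" for g h using int'[of g] int'[of h] by (simp add: linear_add[OF lin])
  show "?L (r *\<^sub>R h) = r *\<^sub>R ?L h" for r h unfolding linear_scale[OF lin] by (rule integral_scaleR_right)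
  show "norm (?L h) \<le> norm h * (\<integral>y. w y \<partial>M)" for h
  proof -
   have "norm (?L h) \<le> (\<integral>y. w y * norm h \<partial>M)"
    by (rule order_trans[OF integral_norm_bound integral_mono[OF integrable_norm[OF int'] _ bound[OF x0]]]) (simp add: w)
   then show ?thesis by (simp add: mult.commute)
  qed
 qed
 show ?thesis unfolding has_derivative_at tendsto_at_iff_sequentially
 proof (intro conjI L allI impI)
  fix X assume X: "\<forall>i. X i \<in> UNIV - {0::'a}" "X \<longlonglongrightarrow> 0"
  have "\<forall>\<^sub>F n in sequentially. norm (X n) < \<delta>" using tendsto_norm[OF X(2)] d by (auto intro: order_tendstoD)
  then obtain N where N: "\<And>n. n \<ge> N \<Longrightarrow> norm (X n) < \<delta>" by (auto simp: eventually_sequentially)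
  define Y where "Y n = X (n + N)" for n
  have Y: "norm (Y n) < \<delta>" "Y n \<noteq> 0" for n using X N by (auto simp: Y_def)
  have Y0: "Y \<longlonglongrightarrow> 0" unfolding Y_def[abs_def] by (rule LIMSEQ_ignore_initial_segment[OF X(2)])
  have Yb: "x0 + Y n \<in> ball x0 \<delta>" for n using Y(1)[of n] by (simp add: dist_norm)
  let ?q = "\<lambda>n y. (F (x0 + Y n) y - F x0 y - F' x0 y (Y n)) /\<^sub>R norm (Y n)"
  have iq: "integrable M (?q n)" for n by (intro integrable_scaleR_right integrable_diff int int' Yb x0)
  have "(\<lambda>n. \<integral>y. ?q n y \<partial>M) \<longlonglongrightarrow> (\<integral>y. 0 \<partial>M)"
  proof (rule integral_dominated_convergence[where w="\<lambda>y. 2 * w y"])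
   show "AE y in M. norm (?q n y) \<le> 2 * w y" for n
   proof (rule AE_I2)
    fix y
    have "norm (F (x0 + Y n) y - F x0 y) \<le> w y * norm (Y n)"
     by (rule norm_diff_le_along_segment[where K="ball x0 \<delta>" and A=UNIV and D="\<lambda>x. F' x y" and F="\<lambda>x. F x y"])
      (use der bound x0 Yb in auto)
    then have "norm (F (x0 + Y n) y - F x0 y - F' x0 y (Y n)) \<le> 2 * w y * norm (Y n)"
     using norm_triangle_ineq4[of "F (x0 + Y n) y - F x0 y" "F' x0 y (Y n)"] bound[OF x0, of y "Y n"] by simp
    moreover have "norm (?q n y) = norm (F (x0 + Y n) y - F x0 y - F' x0 y (Y n)) / norm (Y n)"
     by (simp add: divide_inverse mult.commute)
    ultimately show "norm (?q n y) \<le> 2 * w y" using Y(2)[of n] by (simp add: pos_divide_le_eq)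
   qed
   show "AE y in M. (\<lambda>n. ?q n y) \<longlonglongrightarrow> 0"
   proof (rule AE_I2)
    fix y
    have "(\<lambda>h. norm (F (x0 + h) y - F x0 y - F' x0 y h) / norm h) \<midarrow>0\<rightarrow> 0"
     using der[OF x0, of y] unfolding has_derivative_at by blast
    moreover have "filterlim Y (at 0) sequentially" using Y0 Y(2) by (intro filterlim_atI) auto
    ultimately have "(\<lambda>n. norm (F (x0 + Y n) y - F x0 y - F' x0 y (Y n)) / norm (Y n)) \<longlonglongrightarrow> 0" by (rule filterlim_compose)
    then have "(\<lambda>n. norm (?q n y)) \<longlonglongrightarrow> 0" by (simp add: divide_inverse mult.commute)
    then show "(\<lambda>n. ?q n y) \<longlonglongrightarrow> 0" by (rule tendsto_norm_zero_cancel)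
   qed
  qed (use w iq in auto)
  from tendsto_norm[OF this] have "(\<lambda>n. norm (\<integral>y. ?q n y \<partial>M)) \<longlonglongrightarrow> 0" by simp
  moreover have "norm (\<integral>y. ?q n y \<partial>M) = norm ((\<integral>y. F (x0 + Y n) y \<partial>M) - (\<integral>y. F x0 y \<partial>M) - ?L (Y n)) / norm (Y n)" for n
   unfolding integral_scaleR_right
   by (simp add: integral_diff[OF integrable_diff[OF int[OF Yb] int[OF x0]] int'] integral_diff[OF int[OF Yb] int[OF x0]] divide_inverse mult.commute)
  ultimately have "(\<lambda>n. norm ((\<integral>y. F (x0 + X (n + N)) y \<partial>M) - (\<integral>y. F x0 y \<partial>M) - ?L (X (n + N))) / norm (X (n + N))) \<longlonglongrightarrow> 0"
   by (simp only: Y_def)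
  then show "((\<lambda>h. norm ((\<integral>y. F (x0 + h) y \<partial>M) - (\<integral>y. F x0 y \<partial>M) - ?L h) / norm h) \<circ> X) \<longlonglongrightarrow> 0"
   unfolding o_def by (rule LIMSEQ_offset)
 qed
qed

text \<open>
 The integral of a translate does not depend on the translation.
\<close>

lemma test_fun_integral_pderiv:
 assumes \<phi>: "test_fun \<phi>"
 shows "(LBINT x. pderiv_at i \<phi> x) = 0"
proof -
 obtain D M where b0: "D > 0" "M > 0" "\<forall>x. norm (\<phi> x) \<le> M" "\<forall>i x. norm (pderiv_at i \<phi> x) \<le> M"
  "\<forall>x. D < norm x \<longrightarrow> \<phi> x = 0" "\<forall>i x. D < norm x \<longrightarrow> pderiv_at i \<phi> x = 0"
  using test_fun_bounded[OF \<phi>] by blast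
 define e where "e = axis i (1::real)"
 have cont: "continuous_on UNIV \<phi>" "continuous_on UNIV (pderiv_at i \<phi>)"
  by (rule test_funD(2)[OF \<phi>], rule C1_on_pderiv_continuous[OF test_funD(1)[OF \<phi>]])
 have L1: "L1loc (\<lambda>x. 1)" by (intro L1loc_continuous continuous_intros)
 have far: "D < norm (x + t *\<^sub>R e)" if "t \<in> ball 0 1" "D + 1 < norm x" for t and x :: "real^3"
  using norm_triangle_ineq4[of "x + t *\<^sub>R e" "t *\<^sub>R e"] that by (simp add: e_def)
 have "((\<lambda>t. LBINT x. \<phi> (x + t *\<^sub>R e)) has_derivative (\<lambda>s. LBINT x. s *\<^sub>R pderiv_at i \<phi> (x + 0 *\<^sub>R e))) (at (0::real))"
 proof (rule has_derivative_integral[where \<delta>=1 and w="\<lambda>x. indicator (cball 0 (D + 1)) x *\<^sub>R M" and F'="\<lambda>t x s. s *\<^sub>R pderiv_at i \<phi> (x + t *\<^sub>R e)"])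
  show "integrable lborel (\<lambda>x::real^3. indicator (cball 0 (D + 1)) x *\<^sub>R M)"
   by (rule borel_integrable_compact) auto
  show "integrable lborel (\<lambda>x. s *\<^sub>R pderiv_at i \<phi> (x + 0 *\<^sub>R e))" for s
   using L1loc_test_fun(2)[OF L1 \<phi>, of i] by simp
  fix t :: real assume t: "t \<in> ball 0 1"
  have "integrable lborel (\<lambda>x. 1 * \<phi> (x + t *\<^sub>R e))"
   by (rule L1loc_mult_continuous[OF L1, where D="D + 1"])
    (use b0(5) far[OF t] in \<open>auto intro!: continuous_on_compose2[OF cont(1)] continuous_intros\<close>)
  then show "integrable lborel (\<lambda>x. \<phi> (x + t *\<^sub>R e))" by simp
  fix x :: "real^3"
  have "(\<phi> has_derivative grad_form (\<lambda>i. pderiv_at i \<phi> (x + t *\<^sub>R e))) (at (x + t *\<^sub>R e))"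
   by (rule C1_on_has_derivative[OF test_funD(1)[OF \<phi>]]) simp
  moreover have "((\<lambda>s. x + s *\<^sub>R e) has_derivative (\<lambda>s. s *\<^sub>R e)) (at t)"
   by (auto intro!: derivative_eq_intros)
  ultimately have "((\<lambda>s. \<phi> (x + s *\<^sub>R e)) has_derivative (\<lambda>s. grad_form (\<lambda>i. pderiv_at i \<phi> (x + t *\<^sub>R e)) (s *\<^sub>R e))) (at t)"
   by (rule has_derivative_compose[rotated])
  then show "((\<lambda>t. \<phi> (x + t *\<^sub>R e)) has_derivative (\<lambda>s. s *\<^sub>R pderiv_at i \<phi> (x + t *\<^sub>R e))) (at t)"
   unfolding e_def grad_form_scaleR_axis .
  show "norm (s *\<^sub>R pderiv_at i \<phi> (x + t *\<^sub>R e)) \<le> indicator (cball 0 (D + 1)) x *\<^sub>R M * norm s" for s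
   using b0(4,6) far[OF t, of x] by (cases "D + 1 < norm x") (auto simp: mult.commute[of M] intro!: mult_left_mono)
 qed simp
 moreover have "(LBINT x. \<phi> (x + t *\<^sub>R e)) = (LBINT x. \<phi> x)" for t
  by (rule lborel_integral_shift[OF borel_measurable_continuous_onI[OF cont(1)]])
 ultimately have "((\<lambda>t::real. LBINT x. \<phi> x) has_derivative (\<lambda>s. LBINT x. s *\<^sub>R pderiv_at i \<phi> x)) (at 0)" by simp
 from has_derivative_unique[OF this has_derivative_const]
 have "(LBINT x. 1 *\<^sub>R pderiv_at i \<phi> x) = 0" by (rule fun_cong)
 then show ?thesis by simp
qed

lemma test_fun_mult_C1_on:
 assumes \<phi>: "test_fun \<phi>" and u: "C1_on U u" and U: "open U" "closure {x. \<phi> x \<noteq> 0} \<subseteq> U"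
 shows "test_fun (\<lambda>x. u x * \<phi> x)"
  and "pderiv_at i (\<lambda>x. u x * \<phi> x) x = u x * pderiv_at i \<phi> x + pderiv_at i u x * \<phi> x"
proof -
 let ?V = "- closure {x. \<phi> x \<noteq> 0}"
 have c1: "C1_on U (\<lambda>x. u x * \<phi> x)" by (rule C1_on_mult[OF u C1_on_subset[OF test_funD(1)[OF \<phi>] subset_UNIV]])
 have V: "open ?V" by (rule open_Compl[OF closed_closure])
 have eq: "u x * \<phi> x = 0" if "x \<in> ?V" for x by (simp only: test_funD(4)[OF \<phi> that[THEN ComplD]] mult_zero_right)
 have c2: "C1_on ?V (\<lambda>x. u x * \<phi> x)" by (rule C1_on_cong_open(1)[OF C1_on_const V eq])
 have c3: "C1_on UNIV (\<lambda>x. u x * \<phi> x)"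
  by (rule C1_on_subset[OF C1_on_Un[OF U(1) V c1 c2]]) (use U(2) in blast)
 obtain D where D: "\<forall>x. D < norm x \<longrightarrow> \<phi> x = 0" using test_funD(3)[OF \<phi>] by blast
 show "test_fun (\<lambda>x. u x * \<phi> x)" by (rule test_funI[OF c3, where D=D]) (simp add: D)
 show "pderiv_at i (\<lambda>x. u x * \<phi> x) x = u x * pderiv_at i \<phi> x + pderiv_at i u x * \<phi> x"
 proof (cases "x \<in> U")
  case True
  then show ?thesis
   by (intro pderiv_at_mult C1_on_differentiable[OF u] C1_on_differentiable[OF test_funD(1)[OF \<phi>]]) auto
 next
  case False
  then have x: "x \<in> ?V" using U by blast
  have "pderiv_at i (\<lambda>x. u x * \<phi> x) x = pderiv_at i (\<lambda>x. 0) x" by (rule C1_on_cong_open(2)[OF C1_on_const V eq x])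
  also have "\<dots> = 0" using pderiv_at_eq[OF has_derivative_const[of 0 "at x"]] by simp
  finally show ?thesis by (simp only: test_funD(4,5)[OF \<phi> x[THEN ComplD]])  simp
 qed
qed

lemma integration_by_parts:
 assumes \<phi>: "test_fun \<phi>" and u: "C1_on U u" and U: "open U" "closure {x. \<phi> x \<noteq> 0} \<subseteq> U"
 shows "(LBINT x. u x * pderiv_at i \<phi> x) = - (LBINT x. pderiv_at i u x * \<phi> x)"
  and "integrable lborel (\<lambda>x. u x * pderiv_at i \<phi> x)" "integrable lborel (\<lambda>x. pderiv_at i u x * \<phi> x)"
  and "integrable lborel (\<lambda>x. u x * \<phi> x)"
proof -
 let ?K = "closure {x. \<phi> x \<noteq> 0}"
 have K: "compact ?K" using \<phi> by (simp add: test_fun_def)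
 have int: "integrable lborel (\<lambda>x. a x * b x)"
  if "continuous_on U a" "continuous_on UNIV b" "\<And>x. x \<notin> ?K \<Longrightarrow> b x = 0" for a b :: "real^3 \<Rightarrow> complex"
 proof -
  have "integrable lborel (\<lambda>x. indicator ?K x *\<^sub>R (a x * b x))"
   using U(2) that by (intro borel_integrable_compact K continuous_intros) (auto intro: continuous_on_subset)
  moreover have "indicator ?K x *\<^sub>R (a x * b x) = a x * b x" for x
   using that(3)[of x] by (auto simp: indicator_def)
  ultimately show ?thesis by simp
 qed
 note c = C1_on_continuous[OF u] C1_on_pderiv_continuous[OF u] test_funD(2)[OF \<phi>] C1_on_pderiv_continuous[OF test_funD(1)[OF \<phi>]]
 show i1: "integrable lborel (\<lambda>x. u x * pderiv_at i \<phi> x)" by (intro int c test_funD(5)[OF \<phi>])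
 show i2: "integrable lborel (\<lambda>x. pderiv_at i u x * \<phi> x)" by (intro int c test_funD(4)[OF \<phi>])
 show "integrable lborel (\<lambda>x. u x * \<phi> x)" by (intro int c test_funD(4)[OF \<phi>])
 have "0 = (LBINT x. pderiv_at i (\<lambda>x. u x * \<phi> x) x)"
  using test_fun_integral_pderiv[OF test_fun_mult_C1_on(1)[OF assms]] by simp
 also have "\<dots> = (LBINT x. u x * pderiv_at i \<phi> x) + (LBINT x. pderiv_at i u x * \<phi> x)"
  unfolding test_fun_mult_C1_on(2)[OF assms] using i1 i2 by (rule integral_add)
 finally show "(LBINT x. u x * pderiv_at i \<phi> x) = - (LBINT x. pderiv_at i u x * \<phi> x)"
  by (rule eq_neg_iff_add_eq_0[THEN iffD2, OF sym])
qed

section \<open>The outgoing fundamental solution of the Helmholtz equation\<close>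

lemma integral_affine3:
 fixes f :: "real^3 \<Rightarrow> complex"
 assumes f: "f \<in> borel_measurable borel" and c: "c > 0"
 shows "(LBINT x. f x) = (LBINT z. c ^ 3 *\<^sub>R f (y + c *\<^sub>R z))"
proof -
 have [measurable]: "f \<in> borel_measurable borel" by fact
 have "(LBINT x. f x) = (\<integral>x. f x \<partial>density (distr lborel borel (\<lambda>z. y + c *\<^sub>R z)) (\<lambda>_. ennreal (\<bar>c\<bar>^DIM(real^3))))"
  using lborel_affine[of c y] c by simp
 also have "\<dots> = (\<integral>x. (c ^ 3) *\<^sub>R f x \<partial>distr lborel borel (\<lambda>z. y + c *\<^sub>R z))"
  using c by (subst integral_density) auto
 also have "\<dots> = (LBINT z. c ^ 3 *\<^sub>R f (y + c *\<^sub>R z))"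
  by (rule integral_distr) measurable
 finally show ?thesis .
qed

definition rho :: "real \<Rightarrow> real^3 \<Rightarrow> real" where
 "rho \<epsilon> z = sqrt ((norm z)\<^sup>2 + \<epsilon>\<^sup>2)"

lemma rho_0 [simp]: "rho 0 z = norm z"
 by (simp add: rho_def)

lemma rho_nonneg: "0 \<le> rho \<epsilon> z"
 by (simp add: rho_def)

lemma norm_le_rho: "norm z \<le> rho \<epsilon> z"
 unfolding rho_def by (rule real_le_rsqrt) simp

lemma rho_pos: "\<epsilon> \<noteq> 0 \<or> z \<noteq> 0 \<Longrightarrow> 0 < rho \<epsilon> z"
 unfolding rho_def by (auto simp: add_pos_nonneg add_nonneg_pos)

lemma rho_le: "rho \<epsilon> z \<le> norm z + \<bar>\<epsilon>\<bar>"
 unfolding rho_def by (rule real_le_lsqrt) (auto simp: power2_sum)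

lemma rho_power2: "(rho \<epsilon> z)\<^sup>2 = (norm z)\<^sup>2 + \<epsilon>\<^sup>2"
 by (simp add: rho_def)

lemma continuous_rho [continuous_intros]: "continuous_on S f \<Longrightarrow> continuous_on S (\<lambda>x. rho \<epsilon> (f x))"
 unfolding rho_def by (intro continuous_intros)

text \<open>The radial profile of the fundamental solution, and what \<open>(1/r) d/dr\<close> makes of it.\<close>

definition hC :: "real \<Rightarrow> complex \<Rightarrow> complex" where
 "hC k z = exp (\<i> * of_real k * z) / (of_real (4 * pi) * z)"

definition qC :: "real \<Rightarrow> complex \<Rightarrow> complex" where
 "qC k z = exp (\<i> * of_real k * z) * (\<i> * of_real k * z - 1) / (of_real (4 * pi) * z ^ 3)"

definition sC :: "real \<Rightarrow> complex \<Rightarrow> complex" where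
 "sC k z = exp (\<i> * of_real k * z) * (3 - 3 * \<i> * of_real k * z - (of_real k)\<^sup>2 * z\<^sup>2) / (of_real (4 * pi) * z ^ 5)"

lemma hC_deriv: "z \<noteq> 0 \<Longrightarrow> (hC k has_field_derivative z * qC k z) (at z)"
 unfolding hC_def qC_def
 by (auto intro!: derivative_eq_intros simp: field_simps power2_eq_square power3_eq_cube)

lemma qC_deriv: "z \<noteq> 0 \<Longrightarrow> (qC k has_field_derivative z * sC k z) (at z)"
 unfolding qC_def sC_def
 apply (rule derivative_eq_intros refl | simp)+
 apply (simp add: field_simps eval_nat_numeral)
 done

lemma helmholtz_profile: "z \<noteq> 0 \<Longrightarrow> z\<^sup>2 * sC k z + 3 * qC k z + (of_real k)\<^sup>2 * hC k z = 0"
 unfolding hC_def qC_def sC_def by (simp add: field_simps eval_nat_numeral)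

lemma has_derivative_radial:
 assumes F: "(F has_field_derivative of_real (rho \<epsilon> z) * G) (at (of_real (rho \<epsilon> z)))" and z: "\<epsilon> \<noteq> 0 \<or> z \<noteq> 0"
 shows "((\<lambda>z. F (of_real (rho \<epsilon> z))) has_derivative grad_form (\<lambda>i. of_real (z $ i) * G)) (at z)"
proof -
 let ?r = "rho \<epsilon> z"
 have r: "?r > 0" by (rule rho_pos[OF z])
 have pos: "z \<bullet> z + \<epsilon>\<^sup>2 > 0" using r unfolding rho_def power2_norm_eq_inner by simp
 have "((\<lambda>z. z \<bullet> z + \<epsilon>\<^sup>2) has_derivative (\<lambda>h. 2 * (z \<bullet> h))) (at z)"
  by (auto intro!: derivative_eq_intros simp: inner_commute)
 then have d0: "((\<lambda>z. sqrt (z \<bullet> z + \<epsilon>\<^sup>2)) has_derivative (\<lambda>h. (2 * (z \<bullet> h)) * (inverse (sqrt (z \<bullet> z + \<epsilon>\<^sup>2)) / 2))) (at z)"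
  by (rule DERIV_compose_FDERIV[where g="\<lambda>z. z \<bullet> z + \<epsilon>\<^sup>2", OF DERIV_real_sqrt[OF pos]])
 have eqf: "(\<lambda>z. sqrt (z \<bullet> z + \<epsilon>\<^sup>2)) = rho \<epsilon>"
  by (rule ext) (simp only: rho_def power2_norm_eq_inner)
 have eqd: "(\<lambda>h. (2 * (z \<bullet> h)) * (inverse (sqrt (z \<bullet> z + \<epsilon>\<^sup>2)) / 2)) = (\<lambda>h. (z \<bullet> h) / ?r)"
  by (rule ext) (simp add: rho_def power2_norm_eq_inner field_simps)
 have d1: "(rho \<epsilon> has_derivative (\<lambda>h. (z \<bullet> h) / ?r)) (at z)"
  using d0 unfolding eqf eqd .
 have "((\<lambda>s. F (of_real s)) has_derivative (\<lambda>s. s *\<^sub>R (of_real ?r * G))) (at ?r)"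
  using has_vector_derivative_real_field[OF F, of UNIV] unfolding has_vector_derivative_def .
 from has_derivative_compose[OF d1 this]
 have d: "((\<lambda>z. F (of_real (rho \<epsilon> z))) has_derivative (\<lambda>h. ((z \<bullet> h) / ?r) *\<^sub>R (of_real ?r * G))) (at z)" .
 have "(\<lambda>h. ((z \<bullet> h) / ?r) *\<^sub>R (of_real ?r * G)) = grad_form (\<lambda>i. of_real (z $ i) * G)"
 proof
  fix h
  have "((z \<bullet> h) / ?r) *\<^sub>R (of_real ?r * G) = of_real (z \<bullet> h) * G"
   using r by (simp add: scaleR_conv_of_real)
  also have "\<dots> = grad_form (\<lambda>i. of_real (z $ i) * G) h"
   unfolding grad_form_def inner_vec_def of_real_sum sum_distrib_right
   by (intro sum.cong refl) (simp add: scaleR_conv_of_real)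
  finally show "((z \<bullet> h) / ?r) *\<^sub>R (of_real ?r * G) = grad_form (\<lambda>i. of_real (z $ i) * G) h" .
 qed
 with d show ?thesis by (simp only:)
qed

definition helm :: "real \<Rightarrow> real \<Rightarrow> real^3 \<Rightarrow> complex" where
 "helm k \<epsilon> z = hC k (of_real (rho \<epsilon> z))"

definition dhelm :: "real \<Rightarrow> real \<Rightarrow> 3 \<Rightarrow> real^3 \<Rightarrow> complex" where
 "dhelm k \<epsilon> i z = of_real (z $ i) * qC k (of_real (rho \<epsilon> z))"

text \<open>
 Minus the Helmholtz operator applied to \<open>helm k \<epsilon>\<close>. It concentrates at scale \<open>\<epsilon>\<close> and tends to a
 point mass as \<open>\<epsilon>\<close> tends to 0.
\<close>

definition defect :: "real \<Rightarrow> real \<Rightarrow> real^3 \<Rightarrow> complex" where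
 "defect k \<epsilon> z = of_real (\<epsilon>\<^sup>2) * sC k (of_real (rho \<epsilon> z))"

lemma helm_has_derivative:
 assumes z: "\<epsilon> \<noteq> 0 \<or> z \<noteq> 0"
 shows "(helm k \<epsilon> has_derivative grad_form (\<lambda>i. dhelm k \<epsilon> i z)) (at z)"
 unfolding helm_def[abs_def] dhelm_def
 using rho_pos[OF z] by (intro has_derivative_radial[OF hC_deriv z]) auto

lemma has_derivative_component: "((\<lambda>z::real^3. complex_of_real (z $ i)) has_derivative grad_form (\<lambda>j. if j = i then 1 else 0)) (at z)"
proof -
 have d: "((\<lambda>z::real^3. complex_of_real (z $ i)) has_derivative (\<lambda>h. complex_of_real (h $ i))) (at z)"
  by (rule bounded_linear.has_derivative[OF bounded_linear_of_real]) (rule bounded_linear_imp_has_derivative[OF bounded_linear_vec_nth])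
 have "(\<lambda>h. complex_of_real (h $ i)) = grad_form (\<lambda>j. if j = i then 1 else 0)"
 proof
  fix h :: "real^3"
  have "(\<Sum>j\<in>UNIV. h $ j *\<^sub>R (if j = i then 1 else (0::complex))) = (\<Sum>j\<in>UNIV. if j = i then of_real (h $ j) else 0)"
   by (intro sum.cong) (auto simp: scaleR_conv_of_real)
  then show "complex_of_real (h $ i) = grad_form (\<lambda>j. if j = i then 1 else 0) h"
   by (simp add: grad_form_def)
 qed
 from back_subst[of "\<lambda>D. ((\<lambda>z. complex_of_real (z $ i)) has_derivative D) (at z)", OF d this] show ?thesis .
qed

definition ddhelm :: "real \<Rightarrow> real \<Rightarrow> 3 \<Rightarrow> 3 \<Rightarrow> real^3 \<Rightarrow> complex" where
 "ddhelm k \<epsilon> i j z = of_real (z $ i) * (of_real (z $ j) * sC k (of_real (rho \<epsilon> z))) + (if j = i then 1 else 0) * qC k (of_real (rho \<epsilon> z))"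

lemma dhelm_has_derivative:
 assumes z: "\<epsilon> \<noteq> 0 \<or> z \<noteq> 0"
 shows "(dhelm k \<epsilon> i has_derivative grad_form (\<lambda>j. ddhelm k \<epsilon> i j z)) (at z)"
 unfolding dhelm_def[abs_def] ddhelm_def
 using rho_pos[OF z] by (intro has_derivative_mult_grad has_derivative_component has_derivative_radial[OF qC_deriv z]) auto

lemma continuous_profile:
 assumes "\<And>z. z \<in> S \<Longrightarrow> \<epsilon> \<noteq> 0 \<or> z \<noteq> (0::real^3)"
 shows "continuous_on S (\<lambda>z. hC k (of_real (rho \<epsilon> z)))" "continuous_on S (\<lambda>z. qC k (of_real (rho \<epsilon> z)))"
  "continuous_on S (\<lambda>z. sC k (of_real (rho \<epsilon> z)))"
proof -
 have "rho \<epsilon> z \<noteq> 0" if "z \<in> S" for z using rho_pos[OF assms[OF that]] by simp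
 then show "continuous_on S (\<lambda>z. hC k (of_real (rho \<epsilon> z)))" "continuous_on S (\<lambda>z. qC k (of_real (rho \<epsilon> z)))"
  "continuous_on S (\<lambda>z. sC k (of_real (rho \<epsilon> z)))"
  unfolding hC_def qC_def sC_def by (auto intro!: continuous_intros)
qed

lemma C1_on_helm: "(\<And>z. z \<in> S \<Longrightarrow> \<epsilon> \<noteq> 0 \<or> z \<noteq> 0) \<Longrightarrow> C1_on S (helm k \<epsilon>)"
 by (rule C1_onI[OF helm_has_derivative]) (auto simp: dhelm_def[abs_def] intro!: continuous_intros continuous_profile)

lemma C1_on_dhelm: "(\<And>z. z \<in> S \<Longrightarrow> \<epsilon> \<noteq> 0 \<or> z \<noteq> 0) \<Longrightarrow> C1_on S (dhelm k \<epsilon> i)"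
 by (rule C1_onI[OF dhelm_has_derivative]) (auto simp: ddhelm_def[abs_def] intro!: continuous_intros continuous_profile)

lemma pderiv_helm: "\<epsilon> \<noteq> 0 \<or> z \<noteq> 0 \<Longrightarrow> pderiv_at i (helm k \<epsilon>) z = dhelm k \<epsilon> i z"
 using pderiv_at_eq[OF helm_has_derivative] by simp

lemma pderiv_dhelm: "\<epsilon> \<noteq> 0 \<or> z \<noteq> 0 \<Longrightarrow> pderiv_at j (dhelm k \<epsilon> i) z = ddhelm k \<epsilon> i j z"
 using pderiv_at_eq[OF dhelm_has_derivative] by simp

lemma helm_laplace:
 assumes z: "\<epsilon> \<noteq> 0 \<or> z \<noteq> 0"
 shows "(\<Sum>i\<in>UNIV. ddhelm k \<epsilon> i i z) = - of_real (k\<^sup>2) * helm k \<epsilon> z - defect k \<epsilon> z"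
proof -
 let ?r = "complex_of_real (rho \<epsilon> z)"
 have nz: "(\<Sum>i\<in>UNIV. (z $ i)\<^sup>2) = (norm z)\<^sup>2"
  unfolding power2_norm_eq_inner inner_vec_def by (simp add: power2_eq_square)
 have r0: "?r \<noteq> 0" using rho_pos[OF z] by simp
 have "(\<Sum>i\<in>UNIV. ddhelm k \<epsilon> i i z) = (\<Sum>i\<in>UNIV. of_real ((z $ i)\<^sup>2)) * sC k ?r + 3 * qC k ?r"
  by (simp add: ddhelm_def sum.distrib sum_distrib_right power2_eq_square mult.assoc)
 also have "(\<Sum>i\<in>UNIV. complex_of_real ((z $ i)\<^sup>2)) = ?r\<^sup>2 - of_real (\<epsilon>\<^sup>2)"
  unfolding of_real_sum[symmetric] nz using rho_power2[of \<epsilon> z] by (simp flip: of_real_power)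
 also have "(?r\<^sup>2 - of_real (\<epsilon>\<^sup>2)) * sC k ?r + 3 * qC k ?r =
   (?r\<^sup>2 * sC k ?r + 3 * qC k ?r + (of_real k)\<^sup>2 * hC k ?r) - (of_real k)\<^sup>2 * hC k ?r - of_real (\<epsilon>\<^sup>2) * sC k ?r"
  by (simp add: algebra_simps)
 finally show ?thesis
  unfolding helmholtz_profile[OF r0] by (simp add: helm_def defect_def)
qed

lemma exp_ik_norm: "norm (exp (\<i> * of_real k * of_real r)) = 1"
 using norm_exp_i_times[of "k * r"] by (simp add: mult.assoc)

lemma norm_hC: "0 < r \<Longrightarrow> norm (hC k (of_real r)) = 1 / (4 * pi * r)"
 unfolding hC_def by (simp add: norm_divide norm_mult exp_ik_norm)

lemma norm_qC: "0 < r \<Longrightarrow> 0 \<le> k \<Longrightarrow> norm (qC k (of_real r)) \<le> (1 + k * r) / (4 * pi * r ^ 3)"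
proof -
 assume r: "0 < r" "0 \<le> k"
 have "norm (\<i> * of_real k * complex_of_real r - 1) \<le> 1 + k * r"
  using norm_triangle_ineq4[of "\<i> * of_real k * complex_of_real r" 1] r by (simp add: norm_mult)
 then show ?thesis
  unfolding qC_def using r by (simp add: norm_divide norm_mult exp_ik_norm norm_power divide_right_mono)
qed

lemma norm_sC: "0 < r \<Longrightarrow> 0 \<le> k \<Longrightarrow> norm (sC k (of_real r)) \<le> (3 + 3 * k * r + k\<^sup>2 * r\<^sup>2) / (4 * pi * r ^ 5)"
proof -
 assume r: "0 < r" "0 \<le> k"
 have "norm (3 - 3 * \<i> * of_real k * complex_of_real r - (of_real k)\<^sup>2 * (complex_of_real r)\<^sup>2) \<le> norm (3::complex) + norm (3 * \<i> * of_real k * complex_of_real r) + norm ((of_real k)\<^sup>2 * (complex_of_real r)\<^sup>2)"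
  by (meson norm_triangle_ineq4 norm_triangle_le_diff order_refl order_trans add_right_mono)
 also have "\<dots> = 3 + 3 * k * r + k\<^sup>2 * r\<^sup>2"
  using r by (simp add: norm_mult norm_power)
 finally show ?thesis
  unfolding sC_def using r by (simp add: norm_divide norm_mult exp_ik_norm norm_power divide_right_mono)
qed

lemma helm_measurable [measurable]: "helm k \<epsilon> \<in> borel_measurable borel"
 unfolding helm_def[abs_def] hC_def rho_def by measurable

lemma dhelm_measurable [measurable]: "dhelm k \<epsilon> i \<in> borel_measurable borel"
 unfolding dhelm_def[abs_def] qC_def rho_def by measurable

lemma defect_measurable [measurable]: "defect k \<epsilon> \<in> borel_measurable borel"
 unfolding defect_def[abs_def] sC_def rho_def by measurable

lemma norm_helm_le: "z \<noteq> 0 \<Longrightarrow> norm (helm k \<epsilon> z) \<le> 1 / (4 * pi * norm z)"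
 using norm_le_rho[of z \<epsilon>] rho_pos[of \<epsilon> z] by (simp add: helm_def norm_hC frac_le)

lemma norm_dhelm_le:
 assumes "z \<noteq> 0" "0 \<le> k"
 shows "norm (dhelm k \<epsilon> i z) \<le> 1 / (4 * pi * (norm z)\<^sup>2) + k / (4 * pi * norm z)"
proof -
 let ?r = "rho \<epsilon> z"
 have r: "0 < ?r" "norm z \<le> ?r" "0 < norm z" using rho_pos[of \<epsilon> z] norm_le_rho assms by auto
 have "norm (dhelm k \<epsilon> i z) \<le> norm z * ((1 + k * ?r) / (4 * pi * ?r ^ 3))"
  unfolding dhelm_def norm_mult
  by (rule mult_mono[OF _ norm_qC[OF r(1) assms(2)] norm_ge_zero norm_ge_zero]) (simp add: component_le_norm_cart)
 also have "\<dots> \<le> ?r * ((1 + k * ?r) / (4 * pi * ?r ^ 3))"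
 proof (rule mult_right_mono[OF r(2)])
  show "0 \<le> (1 + k * ?r) / (4 * pi * ?r ^ 3)"
   using r assms by (intro divide_nonneg_nonneg add_nonneg_nonneg mult_nonneg_nonneg zero_le_power) (auto simp: rho_nonneg)
 qed
 also have "\<dots> = 1 / (4 * pi * ?r\<^sup>2) + k / (4 * pi * ?r)"
  using r(1) by (simp add: field_simps eval_nat_numeral)
 also have "\<dots> \<le> 1 / (4 * pi * (norm z)\<^sup>2) + k / (4 * pi * norm z)"
 proof -
  have "1 / (4 * pi * b\<^sup>2) + k / (4 * pi * b) \<le> 1 / (4 * pi * a\<^sup>2) + k / (4 * pi * a)" if "0 < a" "a \<le> b" for a b :: real
   using that assms(2) by (intro add_mono divide_left_mono mult_left_mono power_mono mult_pos_pos) auto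
  then show ?thesis using r(3,2) .
 qed
 finally show ?thesis .
qed

definition sing :: "real \<Rightarrow> real^3 \<Rightarrow> real" where
 "sing D z = indicator (ball 0 D) z / (norm z)\<^sup>2"

lemma integrable_sing: "integrable lborel (sing D)"
 unfolding sing_def[abs_def] by (rule integrable_inverse_square_ball)

lemma sing_measurable [measurable]: "sing D \<in> borel_measurable borel"
 unfolding sing_def[abs_def] by (rule inverse_square_ball_measurable)

lemma sing_nonneg: "0 \<le> sing D z"
 by (simp add: sing_def indicator_def)

lemma integrable_sing_shift: "integrable lborel (\<lambda>x. sing D (x - y))"
proof -
 have "integrable (distr lborel borel ((+) (- y))) (sing D)"
  using integrable_sing[of D] by (simp add: lborel_distr_plus)
 then have "integrable lborel (\<lambda>x. sing D (- y + x))"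
  by (subst (asm) integrable_distr_eq) auto
 then show ?thesis by (simp add: algebra_simps)
qed

definition sing_const :: "real \<Rightarrow> real \<Rightarrow> real" where
 "sing_const k D = (1 + k * D + D) / (4 * pi)"

lemma norm_helm_sing:
 assumes "norm z < D" "0 \<le> k" "z \<noteq> 0"
 shows "norm (helm k \<epsilon> z) \<le> sing_const k D * sing D z" "norm (dhelm k \<epsilon> i z) \<le> sing_const k D * sing D z"
proof -
 have z: "0 < norm z" using assms by auto
 then have D: "0 < D" using assms(1) by linarith
 have "1 / (4 * pi * norm z) = norm z * (1 / (4 * pi * (norm z)\<^sup>2))"
  using z by (simp add: power2_eq_square)
 also have "\<dots> \<le> D * (1 / (4 * pi * (norm z)\<^sup>2))"
  using assms by (intro mult_right_mono) auto
 finally have 1: "1 / (4 * pi * norm z) \<le> D * (1 / (4 * pi * (norm z)\<^sup>2))" .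
 have e: "sing_const k D * sing D z = (1 + k * D + D) * (1 / (4 * pi * (norm z)\<^sup>2))"
  using assms by (simp add: sing_def sing_const_def)
 have "norm (helm k \<epsilon> z) \<le> D * (1 / (4 * pi * (norm z)\<^sup>2))"
  using norm_helm_le[OF assms(3)] 1 by (rule order_trans)
 also have "\<dots> \<le> (1 + k * D + D) * (1 / (4 * pi * (norm z)\<^sup>2))"
  using assms D by (intro mult_right_mono) auto
 finally show "norm (helm k \<epsilon> z) \<le> sing_const k D * sing D z" unfolding e .
 have "norm (dhelm k \<epsilon> i z) \<le> 1 / (4 * pi * (norm z)\<^sup>2) + k * (1 / (4 * pi * norm z))"
  using norm_dhelm_le[OF assms(3,2)] by simp
 also have "\<dots> \<le> 1 / (4 * pi * (norm z)\<^sup>2) + k * (D * (1 / (4 * pi * (norm z)\<^sup>2)))"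
  using 1 assms by (intro add_left_mono mult_left_mono) auto
 also have "\<dots> \<le> (1 + k * D + D) * (1 / (4 * pi * (norm z)\<^sup>2))"
 proof -
  have "(1 + k * D + D) * X = X + k * (D * X) + D * X" for X by (simp add: algebra_simps)
  note this[of "1 / (4 * pi * (norm z)\<^sup>2)"]
  moreover have "0 \<le> D * (1 / (4 * pi * (norm z)\<^sup>2))" using D by simp
  ultimately show ?thesis by linarith
 qed
 finally show "norm (dhelm k \<epsilon> i z) \<le> sing_const k D * sing D z" unfolding e .
qed

lemma helm_eps_tendsto:
 assumes "e \<longlonglongrightarrow> 0" "z \<noteq> 0"
 shows "(\<lambda>n. helm k (e n) z) \<longlonglongrightarrow> helm k 0 z" "(\<lambda>n. dhelm k (e n) i z) \<longlonglongrightarrow> dhelm k 0 i z"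
proof -
 have r: "(\<lambda>n. complex_of_real (rho (e n) z)) \<longlonglongrightarrow> of_real (norm z)"
  unfolding rho_def by (auto intro!: tendsto_eq_intros assms(1))
 have "isCont (hC k) (of_real (norm z))" "isCont (qC k) (of_real (norm z))"
  using hC_deriv[of "of_real (norm z)"] qC_deriv[of "of_real (norm z)"] assms(2) by (auto intro: DERIV_isCont)
 from this[THEN isCont_tendsto_compose[OF _ r]]
 show "(\<lambda>n. helm k (e n) z) \<longlonglongrightarrow> helm k 0 z" "(\<lambda>n. dhelm k (e n) i z) \<longlonglongrightarrow> dhelm k 0 i z"
  unfolding helm_def dhelm_def by (auto intro!: tendsto_intros)
qed

section \<open>The regularization defect is an approximate identity\<close>

text \<open>
 In polar coordinates \<open>r^3 / (3 * sqrt (1 + r\<^sup>2)^3)\<close> is an antiderivative.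
\<close>

lemma nn_integral_profile:
 "(NN z. ennreal (1 / (rho 1 (z::real^3)) ^ 5)) = ennreal (4 * pi / 3)"
proof -
 have [measurable]: "(\<lambda>z::real^3. 1 / (rho 1 z) ^ 5) \<in> borel_measurable borel" unfolding rho_def by measurable
 have "(NN z. ennreal (1 / (rho 1 (z::real^3)) ^ 5)) =
  (NN r. ennreal (indicator {0<..} r * r\<^sup>2) * (\<integral>\<^sup>+w. ennreal (1 / (rho 1 (r *\<^sub>R (w::real^3))) ^ 5) \<partial>S2_measure))"
  by (rule nn_integral_polar) measurable
 also have "\<dots> = (NN r. ennreal (4 * pi * (r\<^sup>2 / (sqrt (1 + r\<^sup>2)) ^ 5)) * indicator {0..} r)"
 proof (rule nn_integral_cong)
  fix r :: real
  have "(\<integral>\<^sup>+w. ennreal (1 / (rho 1 (r *\<^sub>R (w::real^3))) ^ 5) \<partial>S2_measure) = (\<integral>\<^sup>+w. ennreal (1 / (sqrt (1 + r\<^sup>2)) ^ 5) \<partial>(S2_measure :: (real^3) measure))"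
   by (intro nn_integral_cong) (auto simp: space_S2_measure rho_def add.commute)
  also have "\<dots> = ennreal (1 / (sqrt (1 + r\<^sup>2)) ^ 5) * ennreal (4 * pi)"
   by (simp add: emeasure_S2_total)
  finally have *: "(\<integral>\<^sup>+w. ennreal (1 / (rho 1 (r *\<^sub>R (w::real^3))) ^ 5) \<partial>S2_measure) = ennreal (1 / (sqrt (1 + r\<^sup>2)) ^ 5) * ennreal (4 * pi)" .
  show "ennreal (indicator {0<..} r * r\<^sup>2) * (\<integral>\<^sup>+w. ennreal (1 / (rho 1 (r *\<^sub>R (w::real^3))) ^ 5) \<partial>S2_measure) =
   ennreal (4 * pi * (r\<^sup>2 / (sqrt (1 + r\<^sup>2)) ^ 5)) * indicator {0..} r"
   unfolding * by (cases "r = 0") (auto simp: indicator_def ennreal_mult[symmetric] mult_ac)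
 qed
 also have "\<dots> = ennreal (4 * pi / 3 - 4 * pi * (0^3 / (3 * (sqrt (1 + 0\<^sup>2)) ^ 3)))"
 proof (rule nn_integral_FTC_atLeast[where F="\<lambda>r. 4 * pi * (r^3 / (3 * (sqrt (1 + r\<^sup>2)) ^ 3))"])
  show "(\<lambda>r. 4 * pi * (r\<^sup>2 / (sqrt (1 + r\<^sup>2)) ^ 5)) \<in> borel_measurable borel" by measurable
  fix r :: real
  let ?s = "sqrt (1 + r\<^sup>2)"
  have s: "?s > 0" "?s\<^sup>2 = 1 + r\<^sup>2" by (auto simp: add_pos_nonneg)
  have "((\<lambda>r. sqrt (1 + r\<^sup>2)) has_real_derivative r / ?s) (at r)"
  proof -
   have pos: "0 < 1 + r\<^sup>2" by (simp add: add_pos_nonneg)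
   have "((\<lambda>r. 1 + r\<^sup>2) has_real_derivative 2 * r) (at r)" by (auto intro!: derivative_eq_intros)
   from DERIV_chain2[OF DERIV_real_sqrt[OF pos] this]
   have "((\<lambda>r. sqrt (1 + r\<^sup>2)) has_real_derivative inverse ?s / 2 * (2 * r)) (at r)" .
   moreover have "inverse ?s / 2 * (2 * r) = r / ?s" by (simp add: field_simps)
   ultimately show ?thesis by (simp only:)
  qed
  note DS = this
  have den: "((\<lambda>r. 3 * (sqrt (1 + r\<^sup>2)) ^ 3) has_real_derivative 3 * (3 * ?s\<^sup>2 * (r / ?s))) (at r)"
   using DERIV_cmult[OF DERIV_power[OF DS, of 3], of 3] by (simp add: mult_ac)
  have d3: "((\<lambda>r. r ^ 3) has_real_derivative 3 * r\<^sup>2) (at r)"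
   using DERIV_pow[of 3 r] by simp
  have nz: "3 * ?s ^ 3 \<noteq> 0" using s(1) by simp
  have "((\<lambda>r. 4 * pi * (r^3 / (3 * (sqrt (1 + r\<^sup>2)) ^ 3))) has_real_derivative
    4 * pi * ((3 * r\<^sup>2 * (3 * ?s ^ 3) - r ^ 3 * (3 * (3 * ?s\<^sup>2 * (r / ?s)))) / ((3 * ?s ^ 3) * (3 * ?s ^ 3)))) (at r)"
   by (rule DERIV_cmult[OF DERIV_divide[OF d3 den nz]])
  also have "4 * pi * ((3 * r\<^sup>2 * (3 * ?s ^ 3) - r ^ 3 * (3 * (3 * ?s\<^sup>2 * (r / ?s)))) / ((3 * ?s ^ 3) * (3 * ?s ^ 3))) = 4 * pi * (r\<^sup>2 / ?s ^ 5)"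
  proof -
   define s where "s = ?s"
   have s: "s > 0" "s * s = 1 + r * r" using s by (auto simp: s_def power2_eq_square)
   have "3 * r\<^sup>2 * (3 * s ^ 3) - r ^ 3 * (3 * (3 * s\<^sup>2 * (r / s))) = 9 * r\<^sup>2 * s * (s * s - r * r)"
    using s(1) by (simp add: field_simps eval_nat_numeral)
   also have "\<dots> = 9 * r\<^sup>2 * s" using s(2) by simp
   finally show ?thesis unfolding s_def[symmetric] using s(1) by (simp add: field_simps eval_nat_numeral)
  qed
  finally show "((\<lambda>r. 4 * pi * (r^3 / (3 * (sqrt (1 + r\<^sup>2)) ^ 3))) has_real_derivative 4 * pi * (r\<^sup>2 / ?s ^ 5)) (at r)" .
  show "0 \<le> 4 * pi * (r\<^sup>2 / ?s ^ 5)" by simp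
 next
  show "((\<lambda>r. 4 * pi * (r^3 / (3 * (sqrt (1 + r\<^sup>2)) ^ 3))) \<longlongrightarrow> 4 * pi / 3) at_top"
   by real_asymp
 qed
 finally show ?thesis by simp
qed

lemma integrable_profile: "integrable lborel (\<lambda>z::real^3. 1 / (rho 1 z) ^ 5)"
 and integral_profile: "(LBINT z. 1 / (rho 1 (z::real^3)) ^ 5) = 4 * pi / 3"
proof -
 have [measurable]: "(\<lambda>z::real^3. 1 / (rho 1 z) ^ 5) \<in> borel_measurable borel" unfolding rho_def by measurable
 have nn: "0 \<le> 1 / (rho 1 z) ^ 5" for z :: "real^3" using rho_nonneg[of 1 z] by simp
 show i: "integrable lborel (\<lambda>z::real^3. 1 / (rho 1 z) ^ 5)"
  by (rule integrableI_bounded) (use nn_integral_profile nn in auto)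
 have "ennreal (LBINT z. 1 / (rho 1 (z::real^3)) ^ 5) = ennreal (4 * pi / 3)"
  using nn_integral_eq_integral[OF i] nn nn_integral_profile by simp
 then show "(LBINT z. 1 / (rho 1 (z::real^3)) ^ 5) = 4 * pi / 3"
  using nn by (subst (asm) ennreal_inj) (auto intro: integral_nonneg)
qed

lemma defect_scaled:
 assumes "e > 0"
 shows "e ^ 3 *\<^sub>R defect k e (e *\<^sub>R z) =
  exp (\<i> * of_real k * of_real (e * rho 1 z)) * (3 - 3 * \<i> * of_real k * of_real (e * rho 1 z) - (of_real k)\<^sup>2 * (of_real (e * rho 1 z))\<^sup>2) / of_real (4 * pi) * of_real (1 / (rho 1 z) ^ 5)"
proof -
 have "rho e (e *\<^sub>R z) = sqrt (e\<^sup>2 * ((norm z)\<^sup>2 + 1))"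
  using assms by (simp add: rho_def algebra_simps power_mult_distrib)
 also have "\<dots> = e * rho 1 z" using assms by (simp add: rho_def real_sqrt_mult)
 finally have r: "rho e (e *\<^sub>R z) = e * rho 1 z" .
 have r1: "rho 1 z \<noteq> 0" using rho_pos[of 1 z] by simp
 show ?thesis
  unfolding defect_def sC_def r using assms r1
  by (simp add: scaleR_conv_of_real field_simps)
qed

definition defect_const :: "real \<Rightarrow> real \<Rightarrow> real" where
 "defect_const k P = (3 + 3 * k * P + k\<^sup>2 * P\<^sup>2) / (4 * pi)"

lemma norm_defect_scaled:
 assumes "e > 0" "0 \<le> k" "e * rho 1 z \<le> P"
 shows "norm (e ^ 3 *\<^sub>R defect k e (e *\<^sub>R z)) \<le> defect_const k P * (1 / (rho 1 z) ^ 5)"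
proof -
 let ?t = "e * rho 1 z"
 have t: "0 \<le> ?t" using assms rho_nonneg[of 1 z] by simp
 have "norm (3 - 3 * \<i> * of_real k * complex_of_real ?t - (of_real k)\<^sup>2 * (complex_of_real ?t)\<^sup>2) \<le> norm (3 - 3 * \<i> * of_real k * complex_of_real ?t) + norm ((of_real k)\<^sup>2 * (complex_of_real ?t)\<^sup>2)"
  by (rule norm_triangle_ineq4)
 also have "norm (3 - 3 * \<i> * of_real k * complex_of_real ?t) \<le> norm (3::complex) + norm (3 * \<i> * of_real k * complex_of_real ?t)"
  by (rule norm_triangle_ineq4)
 also have "norm (3::complex) + norm (3 * \<i> * of_real k * complex_of_real ?t) + norm ((of_real k)\<^sup>2 * (complex_of_real ?t)\<^sup>2) = 3 + 3 * k * ?t + k\<^sup>2 * ?t\<^sup>2"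
  using assms t by (simp only: norm_mult norm_power norm_of_real norm_ii) simp
 also have "\<dots> \<le> 3 + 3 * k * P + k\<^sup>2 * P\<^sup>2"
  using assms t by (intro add_mono mult_left_mono power_mono) auto
 finally have *: "norm (3 - 3 * \<i> * of_real k * complex_of_real ?t - (of_real k)\<^sup>2 * (complex_of_real ?t)\<^sup>2) \<le> 3 + 3 * k * P + k\<^sup>2 * P\<^sup>2" by simp
 have a1: "\<bar>4 * pi\<bar> = 4 * pi" and a2: "\<bar>1 / rho 1 z ^ 5\<bar> = 1 / rho 1 z ^ 5"
  using rho_nonneg[of 1 z] by simp_all
 show ?thesis
  unfolding defect_scaled[OF assms(1)] norm_mult[of _ "of_real (1 / rho 1 z ^ 5)"] norm_divide[of _ "of_real (4 * pi)"]
   norm_mult[of "exp _"] exp_ik_norm defect_const_def norm_of_real a1 a2 mult_1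
  by (intro mult_right_mono divide_right_mono *) (use rho_nonneg[of 1 z] in auto)
qed

lemma defect_approximate_identity:
 fixes \<theta> :: "real^3 \<Rightarrow> complex"
 assumes [measurable]: "\<theta> \<in> borel_measurable borel" and M: "\<And>x. norm (\<theta> x) \<le> M"
  and D: "\<And>x. D < norm x \<Longrightarrow> \<theta> x = 0" and k: "0 \<le> k" and e: "e \<longlonglongrightarrow> 0" "\<And>n. 0 < e n" "\<And>n. e n \<le> 1"
 shows "isCont \<theta> y \<Longrightarrow> (\<lambda>n. (LBINT x. defect k (e n) (x - y) * \<theta> x)) \<longlonglongrightarrow> \<theta> y"
  and "norm (LBINT x. defect k (e n) (x - y) * \<theta> x) \<le> defect_const k (\<bar>D\<bar> + norm y + 1) * M * (4 * pi / 3)"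
proof -
 let ?P = "\<bar>D\<bar> + norm y + 1"
 let ?C = "defect_const k ?P"
 let ?g = "\<lambda>n z. (e n ^ 3 *\<^sub>R defect k (e n) (e n *\<^sub>R z)) * \<theta> (y + e n *\<^sub>R z)"
 have M0: "0 \<le> M" using M[of 0] norm_ge_zero order_trans by blast
 have C0: "0 \<le> ?C" using k by (simp add: defect_const_def)
 have eq: "(LBINT x. defect k (e n) (x - y) * \<theta> x) = (LBINT z. ?g n z)" for n
 proof -
  have "(\<lambda>x. defect k (e n) (x - y) * \<theta> x) \<in> borel_measurable borel"
   by (intro borel_measurable_times measurable_compose[OF _ defect_measurable] assms(1)) simp
  from integral_affine3[OF this e(2)[of n], of y] show ?thesis by simp
 qed
 have bnd: "norm (?g n z) \<le> ?C * M * (1 / (rho 1 z) ^ 5)" for n z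
 proof (cases "norm (y + e n *\<^sub>R z) \<le> D")
  case True
  have "e n * norm z = norm (y + e n *\<^sub>R z - y)" using e(2)[of n] by simp
  also have "\<dots> \<le> D + norm y" using norm_triangle_ineq4[of "y + e n *\<^sub>R z" y] True by linarith
  finally have "e n * norm z \<le> D + norm y" .
  moreover have "e n * rho 1 z \<le> e n * (norm z + 1)" using rho_le[of 1 z] e(2)[of n] by (intro mult_left_mono) auto
  ultimately have "e n * rho 1 z \<le> ?P" using e(3)[of n] by (simp add: algebra_simps)
  from norm_defect_scaled[OF e(2) k this]
  have "norm (?g n z) \<le> (?C * (1 / (rho 1 z) ^ 5)) * M"
   unfolding norm_mult by (intro mult_mono M) (use C0 rho_nonneg[of 1 z] in auto)
  then show ?thesis by (simp add: mult_ac)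
 next
  case False
  then have "\<theta> (y + e n *\<^sub>R z) = 0" by (intro D) simp
  then show ?thesis using C0 M0 rho_nonneg[of 1 z] by simp
 qed
 have ib: "integrable lborel (\<lambda>z. ?C * M * (1 / (rho 1 z) ^ 5))"
  using integrable_profile by (rule integrable_mult_right)
 have "norm (LBINT z. ?g n z) \<le> (LBINT z. ?C * M * (1 / (rho 1 z) ^ 5))"
  by (rule integral_norm_bound_integral[OF _ ib bnd])
   (rule integrable_bound[OF ib], measurable, intro AE_I2 order_trans[OF bnd], simp only: real_norm_def abs_ge_self)
 then show "norm (LBINT x. defect k (e n) (x - y) * \<theta> x) \<le> ?C * M * (4 * pi / 3)"
  unfolding eq integral_mult_right_zero integral_profile .
 show "(\<lambda>n. (LBINT x. defect k (e n) (x - y) * \<theta> x)) \<longlonglongrightarrow> \<theta> y" if cont: "isCont \<theta> y"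
 proof -
  have "(\<lambda>n. (LBINT z. ?g n z)) \<longlonglongrightarrow> (LBINT z. (3 / of_real (4 * pi) * \<theta> y) * of_real (1 / (rho 1 (z::real^3)) ^ 5))"
  proof (rule integral_dominated_convergence[OF _ _ ib])
   show "?g n \<in> borel_measurable lborel" for n by measurable
   show "(\<lambda>z. (3 / of_real (4 * pi) * \<theta> y) * of_real (1 / (rho 1 (z::real^3)) ^ 5)) \<in> borel_measurable lborel"
    unfolding rho_def by measurable
   show "AE z in lborel. norm (?g n z) \<le> ?C * M * (1 / (rho 1 z) ^ 5)" for n
    by (intro AE_I2 bnd)
   show "AE z in lborel. (\<lambda>n. ?g n z) \<longlonglongrightarrow> (3 / of_real (4 * pi) * \<theta> y) * of_real (1 / (rho 1 z) ^ 5)"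
   proof (rule AE_I2)
    fix z :: "real^3"
    have "(\<lambda>n. y + e n *\<^sub>R z) \<longlonglongrightarrow> y" by (auto intro!: tendsto_eq_intros e)
    then have 1: "(\<lambda>n. \<theta> (y + e n *\<^sub>R z)) \<longlonglongrightarrow> \<theta> y" by (rule isCont_tendsto_compose[OF cont])
    have "(\<lambda>n. complex_of_real (e n * rho 1 z)) \<longlonglongrightarrow> of_real (0 * rho 1 z)" by (intro tendsto_intros e)
    then have 0: "(\<lambda>n. complex_of_real (e n * rho 1 z)) \<longlonglongrightarrow> 0" by simp
    have "(\<lambda>n. exp (\<i> * of_real k * of_real (e n * rho 1 z)) * (3 - 3 * \<i> * of_real k * of_real (e n * rho 1 z) - (of_real k)\<^sup>2 * (of_real (e n * rho 1 z))\<^sup>2) / of_real (4 * pi) * of_real (1 / (rho 1 z) ^ 5) * \<theta> (y + e n *\<^sub>R z))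
     \<longlonglongrightarrow> exp (\<i> * of_real k * 0) * (3 - 3 * \<i> * of_real k * 0 - (of_real k)\<^sup>2 * 0\<^sup>2) / of_real (4 * pi) * of_real (1 / (rho 1 z) ^ 5) * \<theta> y"
     by (intro tendsto_intros 0 1) simp
    then show "(\<lambda>n. ?g n z) \<longlonglongrightarrow> (3 / of_real (4 * pi) * \<theta> y) * of_real (1 / (rho 1 z) ^ 5)"
     unfolding defect_scaled[OF e(2)] by (simp add: mult_ac)
   qed
  qed
  also have "(LBINT z. (3 / of_real (4 * pi) * \<theta> y) * of_real (1 / (rho 1 (z::real^3)) ^ 5)) = (3 / of_real (4 * pi) * \<theta> y) * of_real (4 * pi / 3)"
   unfolding integral_mult_right_zero integral_complex_of_real integral_profile ..
  also have "\<dots> = \<theta> y" by simp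
  finally show ?thesis unfolding eq .
 qed
qed

section \<open>Weak identities for the fundamental solution\<close>

definition eps_seq :: "nat \<Rightarrow> real" where "eps_seq n = 1 / (real n + 1)"

lemma eps_seq: "eps_seq \<longlonglongrightarrow> 0" "0 < eps_seq n" "eps_seq n \<le> 1"
proof -
 show "eps_seq \<longlonglongrightarrow> 0"
  unfolding eps_seq_def[abs_def] using LIMSEQ_inverse_real_of_nat by (simp add: divide_inverse add.commute)
qed (auto simp: eps_seq_def)

lemma C1_on_shift:
 assumes f: "C1_on S f"
 shows "C1_on {x. x - y \<in> S} (\<lambda>x. f (x - y))" and "x - y \<in> S \<Longrightarrow> pderiv_at i (\<lambda>x. f (x - y)) x = pderiv_at i f (x - y)"
proof -
 have *: "((\<lambda>x. f (x - y)) has_derivative grad_form (\<lambda>i. pderiv_at i f (x - y))) (at x)" if "x - y \<in> S" for x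
 proof -
  have "((\<lambda>x. x - y) has_derivative (\<lambda>h. h)) (at x)" by (auto intro!: derivative_eq_intros)
  from has_derivative_compose[OF this C1_on_has_derivative[OF f that]] show ?thesis .
 qed
 show "C1_on {x. x - y \<in> S} (\<lambda>x. f (x - y))"
 proof (rule C1_onI[OF *])
  show "continuous_on {x. x - y \<in> S} (\<lambda>x. pderiv_at i f (x - y))" for i
   by (rule continuous_on_compose2[OF C1_on_pderiv_continuous[OF f]]) (auto intro!: continuous_intros)
 qed simp
 show "x - y \<in> S \<Longrightarrow> pderiv_at i (\<lambda>x. f (x - y)) x = pderiv_at i f (x - y)"
  using pderiv_at_eq[OF *] by simp
qed

lemma C1_on_helm_shift: "\<epsilon> \<noteq> 0 \<Longrightarrow> C1_on UNIV (\<lambda>x. helm k \<epsilon> (x - y))"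
 and C1_on_dhelm_shift: "\<epsilon> \<noteq> 0 \<Longrightarrow> C1_on UNIV (\<lambda>x. dhelm k \<epsilon> i (x - y))"
 and pderiv_helm_shift: "\<epsilon> \<noteq> 0 \<Longrightarrow> pderiv_at i (\<lambda>x. helm k \<epsilon> (x - y)) x = dhelm k \<epsilon> i (x - y)"
 and pderiv_dhelm_shift: "\<epsilon> \<noteq> 0 \<Longrightarrow> pderiv_at j (\<lambda>x. dhelm k \<epsilon> i (x - y)) x = ddhelm k \<epsilon> i j (x - y)"
 using C1_on_shift[OF C1_on_helm[of UNIV \<epsilon> k]] C1_on_shift[OF C1_on_dhelm[of UNIV \<epsilon> k i]]
 by (simp_all add: pderiv_helm pderiv_dhelm)

lemma kernel_test_integrable:
 fixes y :: "real^3"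
 assumes k: "0 \<le> k" and [measurable]: "\<theta> \<in> borel_measurable borel" and M: "\<And>x. norm (\<theta> x) \<le> M" and D: "\<And>x. D < norm x \<Longrightarrow> \<theta> x = 0"
 defines "P \<equiv> \<bar>D\<bar> + norm y + 1"
 shows "integrable lborel (\<lambda>x. sing_const k P * sing P (x - y) * M)"
  and "AE x in lborel. norm (helm k \<epsilon> (x - y) * \<theta> x) \<le> sing_const k P * sing P (x - y) * M"
  and "AE x in lborel. norm (dhelm k \<epsilon> i (x - y) * \<theta> x) \<le> sing_const k P * sing P (x - y) * M"
  and "integrable lborel (\<lambda>x. helm k \<epsilon> (x - y) * \<theta> x)"
  and "integrable lborel (\<lambda>x. dhelm k \<epsilon> i (x - y) * \<theta> x)"
proof -
 have M0: "0 \<le> M" using M[of 0] norm_ge_zero order_trans by blast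
 have c0: "0 \<le> sing_const k P" using k by (simp add: sing_const_def P_def)
 show i: "integrable lborel (\<lambda>x. sing_const k P * sing P (x - y) * M)"
  by (intro integrable_mult_left integrable_mult_right integrable_sing_shift)
 have nz: "AE x in lborel. x \<noteq> y" by (rule AE_lborel_singleton)
 have b: "norm (helm k \<epsilon> (x - y) * \<theta> x) \<le> sing_const k P * sing P (x - y) * M \<and> norm (dhelm k \<epsilon> i (x - y) * \<theta> x) \<le> sing_const k P * sing P (x - y) * M" if "x \<noteq> y" for x
 proof (cases "norm x \<le> D")
  case True
  have "norm (x - y) \<le> norm x + norm y" by (rule norm_triangle_ineq4)
  then have lt: "norm (x - y) < P" using True by (simp add: P_def)
  show ?thesis
   unfolding norm_mult using norm_helm_sing[OF lt k, of \<epsilon>] that M[of x] c0 sing_nonneg[of P "x - y"]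
   by (auto intro!: mult_mono)
 next
  case False
  then have "\<theta> x = 0" by (intro D) simp
  then show ?thesis using c0 M0 sing_nonneg[of P "x - y"] by simp
 qed
 show h: "AE x in lborel. norm (helm k \<epsilon> (x - y) * \<theta> x) \<le> sing_const k P * sing P (x - y) * M"
  and d: "AE x in lborel. norm (dhelm k \<epsilon> i (x - y) * \<theta> x) \<le> sing_const k P * sing P (x - y) * M"
  using nz by (eventually_elim, use b in blast)+
 show "integrable lborel (\<lambda>x. helm k \<epsilon> (x - y) * \<theta> x)"
  by (rule integrable_bound[OF i]) (measurable, use h in eventually_elim, simp)
 show "integrable lborel (\<lambda>x. dhelm k \<epsilon> i (x - y) * \<theta> x)"
  by (rule integrable_bound[OF i]) (measurable, use d in eventually_elim, simp)
qed

lemma kernel_test_tendsto: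
 fixes y :: "real^3"
 assumes k: "0 \<le> k" and [measurable]: "\<theta> \<in> borel_measurable borel" and M: "\<And>x. norm (\<theta> x) \<le> M" and D: "\<And>x. D < norm x \<Longrightarrow> \<theta> x = 0"
 shows "(\<lambda>n. (LBINT x. helm k (eps_seq n) (x - y) * \<theta> x)) \<longlonglongrightarrow> (LBINT x. helm k 0 (x - y) * \<theta> x)"
  and "(\<lambda>n. (LBINT x. dhelm k (eps_seq n) i (x - y) * \<theta> x)) \<longlonglongrightarrow> (LBINT x. dhelm k 0 i (x - y) * \<theta> x)"
proof -
 have nz: "AE x in lborel. x \<noteq> y" by (rule AE_lborel_singleton)
 show "(\<lambda>n. (LBINT x. helm k (eps_seq n) (x - y) * \<theta> x)) \<longlonglongrightarrow> (LBINT x. helm k 0 (x - y) * \<theta> x)"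
 proof (rule integral_dominated_convergence[OF _ _ kernel_test_integrable(1)[OF assms, where y=y]])
  show "AE x in lborel. (\<lambda>n. helm k (eps_seq n) (x - y) * \<theta> x) \<longlonglongrightarrow> helm k 0 (x - y) * \<theta> x"
   using nz by eventually_elim (intro tendsto_mult helm_eps_tendsto eps_seq tendsto_const, simp)
 qed (measurable, rule kernel_test_integrable(2)[OF assms])
 show "(\<lambda>n. (LBINT x. dhelm k (eps_seq n) i (x - y) * \<theta> x)) \<longlonglongrightarrow> (LBINT x. dhelm k 0 i (x - y) * \<theta> x)"
 proof (rule integral_dominated_convergence[OF _ _ kernel_test_integrable(1)[OF assms, where y=y]])
  show "AE x in lborel. (\<lambda>n. dhelm k (eps_seq n) i (x - y) * \<theta> x) \<longlonglongrightarrow> dhelm k 0 i (x - y) * \<theta> x"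
   using nz by eventually_elim (intro tendsto_mult helm_eps_tendsto eps_seq tendsto_const, simp)
 qed (measurable, rule kernel_test_integrable(3)[OF assms])
qed

lemma fundamental_solution_weak:
 assumes k: "0 \<le> k" and \<theta>: "test_fun \<theta>"
 shows "(LBINT x. helm k 0 (x - y) * pderiv_at i \<theta> x) = - (LBINT x. dhelm k 0 i (x - y) * \<theta> x)"
  and "(\<Sum>i\<in>UNIV. (LBINT x. dhelm k 0 i (x - y) * pderiv_at i \<theta> x)) = of_real (k\<^sup>2) * (LBINT x. helm k 0 (x - y) * \<theta> x) + \<theta> y"
proof -
 obtain D M where b0: "D > 0" "M > 0" "\<forall>x. norm (\<theta> x) \<le> M" "\<forall>i x. norm (pderiv_at i \<theta> x) \<le> M"
  "\<forall>x. D < norm x \<longrightarrow> \<theta> x = 0" "\<forall>i x. D < norm x \<longrightarrow> pderiv_at i \<theta> x = 0"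
  using test_fun_bounded[OF \<theta>] by blast
 note b = b0[rule_format]
 have m0: "\<theta> \<in> borel_measurable borel" by (rule borel_measurable_continuous_onI[OF test_funD(2)[OF \<theta>]])
 have m1: "pderiv_at i \<theta> \<in> borel_measurable borel" for i
  by (rule borel_measurable_continuous_onI[OF C1_on_pderiv_continuous[OF test_funD(1)[OF \<theta>]]])
 have t0a: "(\<lambda>n. (LBINT x. helm k (eps_seq n) (x - y) * \<theta> x)) \<longlonglongrightarrow> (LBINT x. helm k 0 (x - y) * \<theta> x)"
  and t0b: "(\<lambda>n. (LBINT x. dhelm k (eps_seq n) i (x - y) * \<theta> x)) \<longlonglongrightarrow> (LBINT x. dhelm k 0 i (x - y) * \<theta> x)" for i
  using kernel_test_tendsto[OF k m0 b(3,5)] by blast+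
 have t1a: "(\<lambda>n. (LBINT x. helm k (eps_seq n) (x - y) * pderiv_at i \<theta> x)) \<longlonglongrightarrow> (LBINT x. helm k 0 (x - y) * pderiv_at i \<theta> x)"
  and t1b: "(\<lambda>n. (LBINT x. dhelm k (eps_seq n) i (x - y) * pderiv_at i \<theta> x)) \<longlonglongrightarrow> (LBINT x. dhelm k 0 i (x - y) * pderiv_at i \<theta> x)" for i
  using kernel_test_tendsto[OF k m1 b(4,6)] by blast+
 have e0: "eps_seq n \<noteq> 0" for n using eps_seq(2)[of n] by simp
 have U: "open UNIV" "closure {x. \<theta> x \<noteq> 0} \<subseteq> UNIV" by auto
 have by1: "(LBINT x. helm k (eps_seq n) (x - y) * pderiv_at i \<theta> x) = - (LBINT x. dhelm k (eps_seq n) i (x - y) * \<theta> x)" for n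
  using integration_by_parts(1)[OF \<theta> C1_on_helm_shift[OF e0[of n], where k=k and y=y] U, where i=i] by (simp add: pderiv_helm_shift e0)
 show "(LBINT x. helm k 0 (x - y) * pderiv_at i \<theta> x) = - (LBINT x. dhelm k 0 i (x - y) * \<theta> x)"
 proof (rule LIMSEQ_unique[OF t1a])
  show "(\<lambda>n. (LBINT x. helm k (eps_seq n) (x - y) * pderiv_at i \<theta> x)) \<longlonglongrightarrow> - (LBINT x. dhelm k 0 i (x - y) * \<theta> x)"
   unfolding by1 by (rule tendsto_minus[OF t0b])
 qed
 have by2: "(\<Sum>i\<in>UNIV. (LBINT x. dhelm k (eps_seq n) i (x - y) * pderiv_at i \<theta> x)) =
   of_real (k\<^sup>2) * (LBINT x. helm k (eps_seq n) (x - y) * \<theta> x) + (LBINT x. defect k (eps_seq n) (x - y) * \<theta> x)" for n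
 proof -
  note p = integration_by_parts[OF \<theta> C1_on_dhelm_shift[OF e0[of n], where k=k and y=y] U]
  have ih: "integrable lborel (\<lambda>x. helm k (eps_seq n) (x - y) * \<theta> x)"
   by (rule kernel_test_integrable(4)[OF k m0 b(3,5)])
  have id: "integrable lborel (\<lambda>x. ddhelm k (eps_seq n) i i (x - y) * \<theta> x)" for i
   using p(3)[of i i] by (simp add: pderiv_dhelm_shift e0)
  have "(\<Sum>i\<in>UNIV. (LBINT x. dhelm k (eps_seq n) i (x - y) * pderiv_at i \<theta> x)) = (\<Sum>i\<in>UNIV. - (LBINT x. ddhelm k (eps_seq n) i i (x - y) * \<theta> x))"
   using p(1) by (simp add: pderiv_dhelm_shift e0)
  also have "\<dots> = - (LBINT x. (\<Sum>i\<in>UNIV. ddhelm k (eps_seq n) i i (x - y) * \<theta> x))"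
   by (simp only: sum_negf integral_sum[OF id])
  also have "\<dots> = - (LBINT x. - of_real (k\<^sup>2) * (helm k (eps_seq n) (x - y) * \<theta> x) - defect k (eps_seq n) (x - y) * \<theta> x)"
   by (simp only: sum_distrib_right[symmetric] helm_laplace[OF disjI1[OF e0]] left_diff_distrib mult.assoc)
  also have "\<dots> = of_real (k\<^sup>2) * (LBINT x. helm k (eps_seq n) (x - y) * \<theta> x) + (LBINT x. defect k (eps_seq n) (x - y) * \<theta> x)"
  proof -
   have "integrable lborel (\<lambda>x. (\<Sum>i\<in>UNIV. ddhelm k (eps_seq n) i i (x - y) * \<theta> x))"
    by (intro integrable_sum id)
   then have "integrable lborel (\<lambda>x. - of_real (k\<^sup>2) * (helm k (eps_seq n) (x - y) * \<theta> x) - defect k (eps_seq n) (x - y) * \<theta> x)"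
    by (simp only: sum_distrib_right[symmetric] helm_laplace[OF disjI1[OF e0]] left_diff_distrib mult.assoc)
   from integrable_diff[OF integrable_mult_right[OF ih, of "- of_real (k\<^sup>2)"] this]
   have idf: "integrable lborel (\<lambda>x. defect k (eps_seq n) (x - y) * \<theta> x)" by simp
   show ?thesis
    by (subst integral_diff[OF integrable_mult_right[OF ih] idf]) simp
  qed
  finally show ?thesis .
 qed
 have cont: "isCont \<theta> y" using test_funD(2)[OF \<theta>] by (simp add: continuous_on_eq_continuous_at)
 have "(\<lambda>n. \<Sum>i\<in>UNIV. (LBINT x. dhelm k (eps_seq n) i (x - y) * pderiv_at i \<theta> x))
  \<longlonglongrightarrow> (\<Sum>i\<in>UNIV. (LBINT x. dhelm k 0 i (x - y) * pderiv_at i \<theta> x))"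
  by (intro tendsto_sum t1b)
 moreover have "(\<lambda>n. \<Sum>i\<in>UNIV. (LBINT x. dhelm k (eps_seq n) i (x - y) * pderiv_at i \<theta> x))
  \<longlonglongrightarrow> of_real (k\<^sup>2) * (LBINT x. helm k 0 (x - y) * \<theta> x) + \<theta> y"
  unfolding by2 by (intro tendsto_intros t0a defect_approximate_identity(1)[OF m0 b(3,5) k eps_seq] cont)
 ultimately show "(\<Sum>i\<in>UNIV. (LBINT x. dhelm k 0 i (x - y) * pderiv_at i \<theta> x)) = of_real (k\<^sup>2) * (LBINT x. helm k 0 (x - y) * \<theta> x) + \<theta> y"
  by (rule LIMSEQ_unique)
qed

section \<open>Functions determined by their integrals over boxes\<close>

text \<open>
 Boxes form an intersection-stable generator of the Borel sets, so all set integrals vanish.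
\<close>

lemma AE_zero_if_box_integrals_zero:
 fixes f :: "real^3 \<Rightarrow> complex"
 assumes f: "integrable lborel f" and box0: "\<And>a b. (LBINT x. indicator (box a b) x *\<^sub>R f x) = 0"
 shows "AE x in lborel. f x = 0"
proof (rule sigma_finite_measure.density_zero[OF lborel.sigma_finite_measure_axioms f])
 fix A :: "(real^3) set" assume "A \<in> sets lborel"
 have intA: "integrable lborel (\<lambda>x. indicator A x *\<^sub>R f x)" if "A \<in> sets borel" for A
  using that by (intro integrable_mult_indicator f) simp
 have fUN: "(LBINT x. f x) = 0"
 proof -
  have "(\<lambda>n. (LBINT x. indicator (box (- real n *\<^sub>R One) (real n *\<^sub>R One)) x *\<^sub>R f x)) \<longlonglongrightarrow> (LBINT x. f x)"
  proof (rule integral_dominated_convergence[where w="\<lambda>x. norm (f x)"])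
   show "f \<in> borel_measurable lborel" using f by auto
   show "(\<lambda>x. indicator (box (- real n *\<^sub>R One) (real n *\<^sub>R One)) x *\<^sub>R f x) \<in> borel_measurable lborel" for n
    by (rule borel_measurable_integrable[OF intA]) simp
   show "integrable lborel (\<lambda>x. norm (f x))" using f by simp
   show "AE x in lborel. norm (indicator (box (- real n *\<^sub>R One) (real n *\<^sub>R One)) x *\<^sub>R f x) \<le> norm (f x)" for n
    by (intro AE_I2) (auto simp: indicator_def)
   show "AE x in lborel. (\<lambda>n. indicator (box (- real n *\<^sub>R One) (real n *\<^sub>R One)) x *\<^sub>R f x) \<longlonglongrightarrow> f x"
   proof (rule AE_I2)
    fix x :: "real^3"
    obtain N :: nat where N: "norm x < real N" using reals_Archimedean2 by blast
    have "indicator (box (- real n *\<^sub>R One) (real n *\<^sub>R One)) x = (1::real)" if "n \<ge> N" for n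
    proof -
     have "\<bar>x \<bullet> i\<bar> < real n" if "i \<in> Basis" for i
      using Basis_le_norm[OF that, of x] N \<open>n \<ge> N\<close> by linarith
     then have "x \<in> box (- real n *\<^sub>R One) (real n *\<^sub>R One)" by (auto simp: mem_box abs_less_iff minus_less_iff)
     then show ?thesis by simp
    qed
    then have "\<forall>\<^sub>F n in sequentially. f x = indicator (box (- real n *\<^sub>R One) (real n *\<^sub>R One)) x *\<^sub>R f x"
     by (auto simp: eventually_sequentially intro!: exI[of _ N])
    then show "(\<lambda>n. indicator (box (- real n *\<^sub>R One) (real n *\<^sub>R One)) x *\<^sub>R f x) \<longlonglongrightarrow> f x"
     by (rule Lim_transform_eventually[OF tendsto_const])
   qed
  qed
  then show ?thesis unfolding box0 by (rule LIMSEQ_unique[OF _ tendsto_const])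
 qed
 have ist: "Int_stable (range (\<lambda>(a, b). box a b :: (real^3) set))"
  by (auto simp: Int_stable_def box_Int_box)
 have sub: "range (\<lambda>(a, b). box a b :: (real^3) set) \<subseteq> Pow UNIV" by simp
 have "A \<in> sigma_sets UNIV (range (\<lambda>(a, b). box a b :: (real^3) set))"
  using \<open>A \<in> sets lborel\<close> by (simp add: borel_eq_box)
 with ist sub have "(LBINT x. indicator A x *\<^sub>R f x) = 0"
 proof (induction rule: sigma_sets_induct_disjoint)
  case (basic A)
  then show ?case using box0 by auto
 next
  case empty
  then show ?case by simp
 next
  case (compl A)
  have A: "A \<in> sets borel" using compl by (simp add: borel_eq_box)
  have "(LBINT x. indicator (UNIV - A) x *\<^sub>R f x) = (LBINT x. f x - indicator A x *\<^sub>R f x)"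
   by (intro integral_cong) (auto simp: indicator_def)
  also have "\<dots> = 0" using compl fUN by (subst integral_diff[OF f intA[OF A]]) simp
  finally show ?case .
 next
  case (union A)
  have A: "A i \<in> sets borel" for i using union by (auto simp: borel_eq_box)
  have "(\<Sum>i. (LBINT x. indicator (A i) x *\<^sub>R f x)) = (LBINT x. indicator (\<Union>i. A i) x *\<^sub>R f x)"
  proof -
   have "set_lebesgue_integral lborel (\<Union>i. A i) f = (\<Sum>i. set_lebesgue_integral lborel (A i) f)"
    by (rule lebesgue_integral_countable_add)
     (use A union in \<open>auto simp: disjoint_family_on_def set_integrable_def intro!: intA sets.countable_UN\<close>)
   then show ?thesis by (simp add: set_lebesgue_integral_def)
  qed
  then show ?case using union by simp
 qed
 then show "set_lebesgue_integral lborel A f = 0" by (simp add: set_lebesgue_integral_def)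
qed

lemma AE_zero_on_open_if_box_integrals_zero:
 fixes f :: "real^3 \<Rightarrow> complex"
 assumes U: "open U" and f: "f \<in> borel_measurable borel"
  and int: "\<And>a b. cbox a b \<subseteq> U \<Longrightarrow> integrable lborel (\<lambda>x. indicator (cbox a b) x *\<^sub>R f x)"
  and box0: "\<And>a b. cbox a b \<subseteq> U \<Longrightarrow> (LBINT x. indicator (box a b) x *\<^sub>R f x) = 0"
 shows "AE x in lborel. x \<in> U \<longrightarrow> f x = 0"
proof -
 obtain \<D> where \<D>: "countable \<D>" "\<D> \<subseteq> Pow U" "\<And>X. X \<in> \<D> \<Longrightarrow> \<exists>a b. X = cbox a b" "\<Union>\<D> = U"
  using open_countable_Union_open_cbox[OF U] by metis
 have "AE x in lborel. x \<in> X \<longrightarrow> f x = 0" if "X \<in> \<D>" for X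
 proof -
  obtain a b where X1: "X = cbox a b" using \<D>(3)[OF \<open>X \<in> \<D>\<close>] by blast
  have X: "X = cbox a b" "cbox a b \<subseteq> U" using \<D>(2) \<open>X \<in> \<D>\<close> X1 by auto
  let ?f = "\<lambda>x. indicator (cbox a b) x *\<^sub>R f x"
  have bdry: "AE x in lborel. x \<in> cbox a b \<longrightarrow> x \<in> box a b"
  proof -
   have "cbox a b - box a b \<in> null_sets lborel"
    using negligible_frontier_interval[of a b] by (auto simp: negligible_iff_null_sets null_sets_completion_iff)
   then have "AE x in lborel. x \<notin> cbox a b - box a b" by (rule AE_not_in)
   then show ?thesis by eventually_elim auto
  qed
  have "AE x in lborel. ?f x = 0"
  proof (rule AE_zero_if_box_integrals_zero[OF int[OF X(2)]])
   fix p q :: "real^3"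
   obtain p' q' where pq: "box p q \<inter> box a b = box p' q'" by (simp add: box_Int_box)
   have "(LBINT x. indicator (box p q) x *\<^sub>R ?f x) = (LBINT x. indicator (box p q \<inter> box a b) x *\<^sub>R f x)"
   proof (rule integral_cong_AE)
    show "AE x in lborel. indicator (box p q) x *\<^sub>R ?f x = indicator (box p q \<inter> box a b) x *\<^sub>R f x"
     using bdry by eventually_elim (use box_subset_cbox[of a b] in \<open>auto simp: indicator_def\<close>)
   qed (use f in \<open>auto intro!: borel_measurable_scaleR borel_measurable_indicator\<close>)
   also have "\<dots> = 0"
   proof (cases "box p q \<inter> box a b = {}")
    case False
    then have ne: "box p' q' \<noteq> {}" using pq by simp
    have "closure (box p' q') \<subseteq> closure (box a b)" using pq by (intro closure_mono) blast
    moreover have "box a b \<noteq> {}" using False by blast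
    ultimately have "cbox p' q' \<subseteq> U" using ne X(2) by (simp add: closure_box)
    then show ?thesis unfolding pq by (rule box0)
   qed simp
   finally show "(LBINT x. indicator (box p q) x *\<^sub>R ?f x) = 0" .
  qed
  then show ?thesis unfolding X by eventually_elim auto
 qed
 then have "AE x in lborel. \<forall>X\<in>\<D>. x \<in> X \<longrightarrow> f x = 0"
  by (subst AE_ball_countable[OF \<D>(1)]) blast
 then show ?thesis by eventually_elim (use \<D>(4) in blast)
qed

section \<open>Weak derivatives of continuously differentiable functions\<close>

definition ramp :: "real \<Rightarrow> real" where "ramp s = 1 - step_down (2 * s - 3)"

lemma ramp_deriv: "(ramp has_real_derivative 2 * tent (2 * s - 3)) (at s)"
 unfolding ramp_def by (auto intro!: derivative_eq_intros DERIV_chain2[OF step_down_deriv])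

lemma ramp_eq: "s \<le> 1 \<Longrightarrow> ramp s = 0" "2 \<le> s \<Longrightarrow> ramp s = 1"
 by (auto simp: ramp_def step_down_eq_1 step_down_eq_0)

lemma step_down_bounds: "0 \<le> step_down s" "step_down s \<le> 1"
proof -
 have mono: "step_down b \<le> step_down a" if "a \<le> b" for a b
  by (rule DERIV_nonpos_imp_nonincreasing[OF that]) (use step_down_deriv tent_nonneg in \<open>force intro!: exI\<close>)
 show "0 \<le> step_down s" using mono[of s "max s 1"] step_down_eq_0[of "max s 1"] by simp
 show "step_down s \<le> 1" using mono[of "min s (-1)" s] step_down_eq_1[of "min s (-1)"] by simp
qed

lemma ramp_bounds: "0 \<le> ramp s" "ramp s \<le> 1"
 using step_down_bounds[of "2 * s - 3"] by (auto simp: ramp_def)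

lemma C1_on_coordinate:
 assumes f: "\<And>t. (f has_real_derivative f' t) (at t)" and f': "continuous_on UNIV f'"
 shows "C1_on UNIV (\<lambda>x::real^3. complex_of_real (f (x $ j)))"
proof (rule C1_onI)
 fix x :: "real^3"
 have "((\<lambda>x::real^3. f (x $ j)) has_derivative (\<lambda>h. h $ j * f' (x $ j))) (at x)"
  by (rule DERIV_compose_FDERIV[where g="\<lambda>x. x $ j", OF f]) (rule bounded_linear_imp_has_derivative[OF bounded_linear_vec_nth])
 then have d: "((\<lambda>x::real^3. complex_of_real (f (x $ j))) has_derivative (\<lambda>h. of_real (h $ j * f' (x $ j)))) (at x)"
  by (rule bounded_linear.has_derivative[OF bounded_linear_of_real])
 have "(\<lambda>h. complex_of_real (h $ j * f' (x $ j))) = grad_form (\<lambda>i. if i = j then of_real (f' (x $ j)) else 0)"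
 proof
  fix h :: "real^3"
  have "(\<Sum>i\<in>UNIV. h $ i *\<^sub>R (if i = j then complex_of_real (f' (x $ j)) else 0)) = (\<Sum>i\<in>UNIV. if i = j then of_real (h $ j * f' (x $ j)) else 0)"
   by (intro sum.cong) (auto simp: scaleR_conv_of_real)
  then show "complex_of_real (h $ j * f' (x $ j)) = grad_form (\<lambda>i. if i = j then of_real (f' (x $ j)) else 0) h"
   by (simp add: grad_form_def)
 qed
 with d show "((\<lambda>x::real^3. complex_of_real (f (x $ j))) has_derivative grad_form (\<lambda>i. if i = j then of_real (f' (x $ j)) else 0)) (at x)"
  by (simp only:)
next
 have "continuous_on UNIV (\<lambda>x::real^3. complex_of_real (f' (x $ j)))"
  by (intro continuous_on_of_real continuous_on_compose2[OF f'] continuous_intros) auto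
 then show "continuous_on UNIV (\<lambda>x::real^3. if i = j then complex_of_real (f' (x $ j)) else 0)" for i
  by (cases "i = j") auto
qed

definition box_bump :: "nat \<Rightarrow> real^3 \<Rightarrow> real^3 \<Rightarrow> real^3 \<Rightarrow> real" where
 "box_bump n a b x = (\<Prod>j\<in>UNIV. ramp (real n * (x $ j - a $ j)) * ramp (real n * (b $ j - x $ j)))"

lemma box_bump_bounds: "0 \<le> box_bump n a b x" "box_bump n a b x \<le> 1"
 unfolding box_bump_def by (auto intro!: prod_nonneg prod_le_1 mult_nonneg_nonneg mult_le_one ramp_bounds)

lemma C1_on_box_bump: "C1_on UNIV (\<lambda>x. complex_of_real (box_bump n a b x))"
proof -
 have c: "C1_on UNIV (\<lambda>x::real^3. complex_of_real (ramp (real n * (x $ j - a $ j)) * ramp (real n * (b $ j - x $ j))))" for j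
 proof -
  let ?f = "\<lambda>t. ramp (real n * (t - a $ j)) * ramp (real n * (b $ j - t))"
  let ?f' = "\<lambda>t. (2 * tent (2 * (real n * (t - a $ j)) - 3) * real n) * ramp (real n * (b $ j - t))
    + (2 * tent (2 * (real n * (b $ j - t)) - 3) * (- real n)) * ramp (real n * (t - a $ j))"
  have d: "(?f has_real_derivative ?f' t) (at t)" for t
   by (rule DERIV_mult; rule DERIV_chain2[OF ramp_deriv]) (auto intro!: derivative_eq_intros)
  have cr: "continuous_on UNIV ramp" by (rule DERIV_continuous_on[OF ramp_deriv[THEN has_field_derivative_at_within]])
  have "continuous_on UNIV ?f'"
   by (intro continuous_intros continuous_on_compose2[OF cr]) auto
  from C1_on_coordinate[of ?f ?f', OF d this] show ?thesis .
 qed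
 have "C1_on UNIV (\<lambda>x::real^3. complex_of_real (\<Prod>j\<in>J. ramp (real n * (x $ j - a $ j)) * ramp (real n * (b $ j - x $ j))))" if "finite J" for J :: "3 set"
  using that
 proof (induction J)
  case empty
  show ?case by (simp add: C1_on_const)
 next
  case (insert j J)
  then show ?case using C1_on_mult[OF c[of j] insert.IH] by simp
 qed
 then show ?thesis unfolding box_bump_def by simp
qed

lemma box_bump_support: "closure {x. complex_of_real (box_bump n a b x) \<noteq> 0} \<subseteq> box a b"
proof (cases "n = 0")
 case True
 then show ?thesis by (simp add: box_bump_def ramp_eq)
next
 case False
 let ?K = "cbox (a + (1 / real n) *\<^sub>R 1) (b - (1 / real n) *\<^sub>R 1)"
 have "{x. complex_of_real (box_bump n a b x) \<noteq> 0} \<subseteq> ?K"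
 proof
  fix x assume "x \<in> {x. complex_of_real (box_bump n a b x) \<noteq> 0}"
  then have "ramp (real n * (x $ j - a $ j)) \<noteq> 0" "ramp (real n * (b $ j - x $ j)) \<noteq> 0" for j
   by (auto simp: box_bump_def)
  then have "1 < real n * (x $ j - a $ j)" "1 < real n * (b $ j - x $ j)" for j
   using ramp_eq(1) by (meson linorder_not_le)+
  then show "x \<in> ?K" using False by (simp add: mem_box_cart field_simps less_imp_le)
 qed
 then have "closure {x. complex_of_real (box_bump n a b x) \<noteq> 0} \<subseteq> ?K" by (rule closure_minimal) (rule closed_cbox)
 also have "?K \<subseteq> box a b"
 proof
  fix x assume "x \<in> ?K"
  then have j: "a $ j + 1 / real n \<le> x $ j" "x $ j \<le> b $ j - 1 / real n" for j by (auto simp: mem_box_cart)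
  have n: "1 / real n > 0" using False by simp
  have "a $ j < x $ j" "x $ j < b $ j" for j using j[of j] n by linarith+
  then show "x \<in> box a b" by (simp add: mem_box_cart)
 qed
 finally show ?thesis .
qed

lemma box_bump_tendsto: "(\<lambda>n. box_bump n a b x) \<longlonglongrightarrow> indicator (box a b) x"
proof -
 have r1: "(\<lambda>n. ramp (real n * c)) \<longlonglongrightarrow> (if 0 < c then 1 else 0)" for c
 proof (cases "0 < c")
  case True
  obtain N :: nat where N: "2 / c < real N" using reals_Archimedean2 by blast
  have "ramp (real n * c) = 1" if "n \<ge> N" for n
  proof (rule ramp_eq(2))
   have "2 / c \<le> real n" using N that by linarith
   then show "2 \<le> real n * c" using True by (simp add: pos_divide_le_eq)
  qed
  then have "\<forall>\<^sub>F n in sequentially. 1 = ramp (real n * c)"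
   by (auto simp: eventually_sequentially intro!: exI[of _ N])
  then show ?thesis using True Lim_transform_eventually[OF tendsto_const[of 1]] by auto
 next
  case False
  then have "ramp (real n * c) = 0" for n
   by (intro ramp_eq(1)) (smt (verit) mult_nonneg_nonpos of_nat_0_le_iff)
  then show ?thesis using False by simp
 qed
 have "(\<lambda>n. box_bump n a b x) \<longlonglongrightarrow> (\<Prod>j\<in>UNIV. (if 0 < x $ j - a $ j then 1 else 0) * (if 0 < b $ j - x $ j then 1 else 0))"
  unfolding box_bump_def by (intro tendsto_prod tendsto_mult r1)
 also have "(\<Prod>j\<in>UNIV. (if 0 < x $ j - a $ j then 1 else 0) * (if 0 < b $ j - x $ j then 1 else (0::real))) = indicator (box a b) x"
 proof (cases "x \<in> box a b")
  case True
  then show ?thesis by (auto simp: mem_box_cart intro!: prod.neutral)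
 next
  case False
  then obtain j where "\<not> (a $ j < x $ j \<and> x $ j < b $ j)" by (auto simp: mem_box_cart)
  then show ?thesis using False by (auto intro!: prod_zero bexI[of _ j])
 qed
 finally show ?thesis .
qed

text \<open>
 Both functions have the same integrals against bumps that converge boundedly to the indicator of a box.
\<close>

lemma weak_derivative_eq_pderiv:
 assumes U: "open U" and u: "C1_on U u" and g: "L1loc g"
  and weak: "\<And>\<phi>. test_fun \<phi> \<Longrightarrow> (LBINT x. u x * pderiv_at i \<phi> x) = - (LBINT x. g x * \<phi> x)"
 shows "AE x in lborel. x \<in> U \<longrightarrow> g x = pderiv_at i u x"
proof -
 let ?p = "\<lambda>x. if x \<in> U then pderiv_at i u x else 0"
 have gm: "g \<in> borel_measurable borel" using g by (simp add: L1loc_def)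
 have pm: "?p \<in> borel_measurable borel"
  by (rule borel_measurable_continuous_on_if) (use U C1_on_pderiv_continuous[OF u] in auto)
 let ?f = "\<lambda>x. g x - ?p x"
 have fm: "?f \<in> borel_measurable borel" using gm pm by measurable
 have int: "integrable lborel (\<lambda>x. indicator (cbox a b) x *\<^sub>R ?f x)" if ab: "cbox a b \<subseteq> U" for a b
 proof -
  have "integrable lborel (\<lambda>x. indicator (cbox a b) x *\<^sub>R pderiv_at i u x)"
   by (rule borel_integrable_compact[OF compact_cbox continuous_on_subset[OF C1_on_pderiv_continuous[OF u] ab]])
  also have "(\<lambda>x. indicator (cbox a b) x *\<^sub>R pderiv_at i u x) = (\<lambda>x. indicator (cbox a b) x *\<^sub>R ?p x)"
   using ab by (auto simp: indicator_def fun_eq_iff)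
  finally have 1: "integrable lborel (\<lambda>x. indicator (cbox a b) x *\<^sub>R ?p x)" .
  obtain D where D: "\<And>x. x \<in> cbox a b \<Longrightarrow> norm x \<le> D" using bounded_cbox[of a b] by (auto simp: bounded_iff)
  have "integrable lborel (\<lambda>x. g x * complex_of_real (indicator (cbox a b) x))"
   by (rule L1loc_mult_integrable[OF g, where M=1 and D=D]) (use D in \<open>auto simp: indicator_def not_le[symmetric]\<close>)
  then have 2: "integrable lborel (\<lambda>x. indicator (cbox a b) x *\<^sub>R g x)" by (simp add: scaleR_conv_of_real mult.commute)
  show ?thesis using integrable_diff[OF 2 1] by (simp add: scaleR_diff_right)
 qed
 have "AE x in lborel. x \<in> U \<longrightarrow> ?f x = 0"
 proof (rule AE_zero_on_open_if_box_integrals_zero[OF U fm int])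
  fix a b assume ab: "cbox a b \<subseteq> U"
  let ?\<phi> = "\<lambda>n x. complex_of_real (box_bump n a b x)"
  obtain D where D: "\<And>x. x \<in> cbox a b \<Longrightarrow> norm x \<le> D" using bounded_cbox[of a b] by (auto simp: bounded_iff)
  have sup: "closure {x. ?\<phi> n x \<noteq> 0} \<subseteq> box a b" for n by (rule box_bump_support)
  have out: "?\<phi> n x = 0" if "x \<notin> box a b" for n x
   using sup[of n] closure_subset[of "{x. ?\<phi> n x \<noteq> 0}"] that by blast
  have t: "test_fun (?\<phi> n)" for n
  proof (rule test_funI[OF C1_on_box_bump, where D=D])
   fix x :: "real^3" assume "D < norm x"
   then have "x \<notin> cbox a b" using D[of x] by auto
   then show "?\<phi> n x = 0" using out box_subset_cbox by blast
  qed
  have supU: "closure {x. ?\<phi> n x \<noteq> 0} \<subseteq> U" for n using sup[of n] ab box_subset_cbox by blast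
  have eq: "(LBINT x. ?\<phi> n x * (indicator (cbox a b) x *\<^sub>R ?f x)) = 0" for n
  proof -
   note p = integration_by_parts[OF t[of n] u U supU[of n]]
   have "(LBINT x. ?\<phi> n x * (indicator (cbox a b) x *\<^sub>R ?f x)) = (LBINT x. g x * ?\<phi> n x - pderiv_at i u x * ?\<phi> n x)"
   proof (intro integral_cong refl)
    fix x
    show "?\<phi> n x * (indicator (cbox a b) x *\<^sub>R ?f x) = g x * ?\<phi> n x - pderiv_at i u x * ?\<phi> n x"
    proof (cases "x \<in> box a b")
     case True
     then have "x \<in> cbox a b" "x \<in> U" using ab box_subset_cbox by blast+
     then show ?thesis by (simp add: algebra_simps)
    qed (simp add: out)
   qed
   also have "\<dots> = (LBINT x. g x * ?\<phi> n x) - (LBINT x. pderiv_at i u x * ?\<phi> n x)"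
    by (rule integral_diff[OF L1loc_test_fun(1)[OF g t] p(3)])
   also have "\<dots> = 0" using weak[OF t[of n]] p(1)[of i] by simp
   finally show ?thesis .
  qed
  have "(\<lambda>n. (LBINT x. ?\<phi> n x * (indicator (cbox a b) x *\<^sub>R ?f x))) \<longlonglongrightarrow> (LBINT x. of_real (indicator (box a b) x) * (indicator (cbox a b) x *\<^sub>R ?f x))"
  proof (rule integral_dominated_convergence[OF _ _ integrable_norm[OF int[OF ab]]])
   have m1: "(\<lambda>x. indicator (cbox a b) x *\<^sub>R ?f x) \<in> borel_measurable lborel"
    by (rule borel_measurable_integrable[OF int[OF ab]])
   have m2: "?\<phi> n \<in> borel_measurable lborel" for n
    using borel_measurable_continuous_onI[OF C1_on_continuous[OF C1_on_box_bump]] by simp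
   show "(\<lambda>x. ?\<phi> n x * (indicator (cbox a b) x *\<^sub>R ?f x)) \<in> borel_measurable lborel" for n
    by (rule borel_measurable_times[OF m2 m1])
   show "(\<lambda>x. of_real (indicator (box a b) x) * (indicator (cbox a b) x *\<^sub>R ?f x)) \<in> borel_measurable lborel"
    by (rule borel_measurable_times[OF _ m1]) simp
   show "AE x in lborel. norm (?\<phi> n x * (indicator (cbox a b) x *\<^sub>R ?f x)) \<le> norm (indicator (cbox a b) x *\<^sub>R ?f x)" for n
   proof (rule AE_I2)
    fix x
    have "norm (complex_of_real r * F) \<le> norm F" if "0 \<le> r" "r \<le> 1" for r and F :: complex
     using that by (simp add: norm_mult mult_left_le_one_le)
    then show "norm (?\<phi> n x * (indicator (cbox a b) x *\<^sub>R ?f x)) \<le> norm (indicator (cbox a b) x *\<^sub>R ?f x)"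
     using box_bump_bounds by blast
   qed
   show "AE x in lborel. (\<lambda>n. ?\<phi> n x * (indicator (cbox a b) x *\<^sub>R ?f x)) \<longlonglongrightarrow> of_real (indicator (box a b) x) * (indicator (cbox a b) x *\<^sub>R ?f x)"
    by (intro AE_I2 tendsto_mult tendsto_of_real box_bump_tendsto tendsto_const)
  qed
  then have "(LBINT x. of_real (indicator (box a b) x) * (indicator (cbox a b) x *\<^sub>R ?f x)) = 0"
   unfolding eq by (rule LIMSEQ_unique[OF _ tendsto_const])
  moreover have "of_real (indicator (box a b) x) * (indicator (cbox a b) x *\<^sub>R ?f x) = indicator (box a b) x *\<^sub>R ?f x" for x
   using box_subset_cbox[of a b] by (auto simp: indicator_def)
  ultimately show "(LBINT x. indicator (box a b) x *\<^sub>R ?f x) = 0" by (simp only:)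
 qed
 then show ?thesis by eventually_elim auto
qed

section \<open>Green's identity with radial cutoffs\<close>

definition cutoff :: "real \<Rightarrow> real \<Rightarrow> real^3 \<Rightarrow> complex" where
 "cutoff R \<delta> x = of_real (step_down ((norm x - R) / \<delta>))"

lemma cutoff_eq_1: "0 < \<delta> \<Longrightarrow> norm x \<le> R - \<delta> \<Longrightarrow> cutoff R \<delta> x = 1"
 by (simp add: cutoff_def step_down_eq_1 pos_divide_le_eq)

lemma cutoff_eq_0: "0 < \<delta> \<Longrightarrow> R + \<delta> \<le> norm x \<Longrightarrow> cutoff R \<delta> x = 0"
 by (simp add: cutoff_def step_down_eq_0 pos_le_divide_eq)

lemma cutoff_C1:
 assumes \<delta>: "0 < \<delta>" "\<delta> < R"
 shows "C1_on UNIV (cutoff R \<delta>)"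
  and "pderiv_at i (cutoff R \<delta>) x = - (shell R \<delta> (norm x) *\<^sub>R complex_of_real (x $ i / norm x))"
proof -
 let ?p = "\<lambda>i x. - (shell R \<delta> (norm x) *\<^sub>R complex_of_real (x $ i / norm x))"
 have d1: "(cutoff R \<delta> has_derivative grad_form (\<lambda>i. ?p i x)) (at x)" if x: "x \<noteq> 0" for x
 proof -
  have n: "(norm has_derivative (\<lambda>h. (x \<bullet> h) / norm x)) (at x)"
  proof -
   have "(norm has_derivative (\<lambda>h. h \<bullet> sgn x)) (at x)" by (rule has_derivative_norm[OF x])
   moreover have "(\<lambda>h. h \<bullet> sgn x) = (\<lambda>h. (x \<bullet> h) / norm x)"
    by (rule ext) (simp add: sgn_div_norm inner_commute divide_inverse mult.commute)
   ultimately show ?thesis by (simp only:)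
  qed
  have "((\<lambda>t. (t - R) / \<delta>) has_real_derivative 1 / \<delta>) (at (norm x))"
   using \<delta> by (auto intro!: derivative_eq_intros)
  from DERIV_chain2[OF step_down_deriv this]
  have "((\<lambda>t. step_down ((t - R) / \<delta>)) has_real_derivative - shell R \<delta> (norm x)) (at (norm x))"
   by (simp add: shell_def)
  from DERIV_compose_FDERIV[where g=norm, OF this n]
  have "((\<lambda>x. step_down ((norm x - R) / \<delta>)) has_derivative (\<lambda>h. (x \<bullet> h) / norm x * - shell R \<delta> (norm x))) (at x)" .
  from bounded_linear.has_derivative[OF bounded_linear_of_real this]
  have d: "(cutoff R \<delta> has_derivative (\<lambda>h. complex_of_real ((x \<bullet> h) / norm x * - shell R \<delta> (norm x)))) (at x)"
   by (simp only: cutoff_def[abs_def])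
  have "(\<lambda>h. complex_of_real ((x \<bullet> h) / norm x * - shell R \<delta> (norm x))) = grad_form (\<lambda>i. ?p i x)"
  proof
   fix h
   have "(x \<bullet> h) / norm x * - shell R \<delta> (norm x) = (\<Sum>i\<in>UNIV. h $ i * - (shell R \<delta> (norm x) * (x $ i / norm x)))"
    unfolding inner_vec_def sum_divide_distrib sum_distrib_right by (intro sum.cong refl) simp
   then show "complex_of_real ((x \<bullet> h) / norm x * - shell R \<delta> (norm x)) = grad_form (\<lambda>i. ?p i x) h"
    by (simp add: grad_form_def scaleR_conv_of_real)
  qed
  with d show ?thesis by (simp only:)
 qed
 have d2: "(cutoff R \<delta> has_derivative grad_form (\<lambda>i. ?p i x)) (at x)" if x: "x \<in> ball 0 (R - \<delta>)" for x
 proof -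
  have "grad_form (\<lambda>i. ?p i x) = (\<lambda>h. 0)"
   using x \<delta> by (auto simp: grad_form_def fun_eq_iff shell_eq_0)
  moreover have "(cutoff R \<delta> has_derivative (\<lambda>h. 0)) (at x)"
   by (rule has_derivative_transform_within_open[OF has_derivative_const[of 1] open_ball x])
    (use \<delta> in \<open>auto simp: cutoff_eq_1\<close>)
  ultimately show ?thesis by (simp only:)
 qed
 have d: "(cutoff R \<delta> has_derivative grad_form (\<lambda>i. ?p i x)) (at x)" for x
  using d1[of x] d2[of x] \<delta> by (cases "x = 0") auto
 show "pderiv_at i (cutoff R \<delta>) x = ?p i x"
  using pderiv_at_eq[OF d] by simp
 have c1: "C1_on (- {0}) (cutoff R \<delta>)"
  by (rule C1_onI[OF d1]) (auto intro!: continuous_intros)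
 have c2: "C1_on (ball 0 (R - \<delta>)) (cutoff R \<delta>)"
 proof (rule C1_onI[OF d2])
  show "continuous_on (ball 0 (R - \<delta>)) (?p i)" for i
   by (rule continuous_on_eq[OF continuous_on_const[of _ 0]]) (use \<delta> in \<open>auto simp: shell_eq_0\<close>)
 qed
 have U: "- {0} \<union> ball 0 (R - \<delta>) = (UNIV :: (real^3) set)" using \<delta> by auto
 have "C1_on (- {0} \<union> ball 0 (R - \<delta>)) (cutoff R \<delta>)"
  by (rule C1_on_Un[OF _ open_ball c1 c2]) (rule open_Compl, simp)
 then show "C1_on UNIV (cutoff R \<delta>)" unfolding U .
qed

lemma pderiv_cutoff_eq_0:
 assumes "0 < \<delta>" "\<delta> < R" "norm x \<le> R - \<delta> \<or> R + \<delta> \<le> norm x"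
 shows "pderiv_at i (cutoff R \<delta>) x = 0"
 using assms by (auto simp: cutoff_C1(2) shell_eq_0)

lemma test_fun_cutoff_mult:
 assumes "0 < \<delta>" "\<delta> < R" "C1_on UNIV v"
 shows "test_fun (\<lambda>x. v x * cutoff R \<delta> x)"
  and "pderiv_at i (\<lambda>x. v x * cutoff R \<delta> x) x = v x * pderiv_at i (cutoff R \<delta>) x + pderiv_at i v x * cutoff R \<delta> x"
proof -
 show "test_fun (\<lambda>x. v x * cutoff R \<delta> x)"
  by (rule test_funI[OF C1_on_mult[OF assms(3) cutoff_C1(1)[OF assms(1,2)]], where D="R + \<delta>"]) (use assms in \<open>simp add: cutoff_eq_0\<close>)
 show "pderiv_at i (\<lambda>x. v x * cutoff R \<delta> x) x = v x * pderiv_at i (cutoff R \<delta>) x + pderiv_at i v x * cutoff R \<delta> x"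
  by (rule pderiv_at_mult[OF C1_on_differentiable[OF assms(3) UNIV_I] C1_on_differentiable[OF cutoff_C1(1)[OF assms(1,2)] UNIV_I]])
qed

definition weak_helmholtz ::
 "complex \<Rightarrow> (real^3 \<Rightarrow> complex) \<Rightarrow> (3 \<Rightarrow> real^3 \<Rightarrow> complex) \<Rightarrow> ((real^3 \<Rightarrow> complex) \<Rightarrow> complex) \<Rightarrow> bool" where
 "weak_helmholtz \<kappa> u g l \<longleftrightarrow> L1loc u \<and> (\<forall>i. L1loc (g i)) \<and>
  (\<forall>\<phi> i. test_fun \<phi> \<longrightarrow> (LBINT x. u x * pderiv_at i \<phi> x) = - (LBINT x. g i x * \<phi> x)) \<and>
  (\<forall>\<phi>. test_fun \<phi> \<longrightarrow> (\<Sum>i\<in>UNIV. (LBINT x. g i x * pderiv_at i \<phi> x)) = \<kappa> * (LBINT x. u x * \<phi> x) + l \<phi>)"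

lemma weak_helmholtzD:
 assumes "weak_helmholtz \<kappa> u g l"
 shows "L1loc u" "L1loc (g i)"
  "test_fun \<phi> \<Longrightarrow> (LBINT x. u x * pderiv_at i \<phi> x) = - (LBINT x. g i x * \<phi> x)"
  "test_fun \<phi> \<Longrightarrow> (\<Sum>i\<in>UNIV. (LBINT x. g i x * pderiv_at i \<phi> x)) = \<kappa> * (LBINT x. u x * \<phi> x) + l \<phi>"
 using assms by (auto simp: weak_helmholtz_def)

lemma rderiv_sum: "f differentiable (at x) \<Longrightarrow> rderiv f x = (\<Sum>i\<in>UNIV. complex_of_real (x $ i / norm x) * pderiv_at i f x)"
 unfolding rderiv_grad_form grad_form_def vector_scaleR_component
 by (intro sum.cong refl) (simp add: scaleR_conv_of_real divide_inverse mult.commute)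

lemma open_exterior: "open {x::real^3. a < norm x}"
 by (intro open_Collect_less continuous_intros)

lemma continuous_rderiv:
 assumes u: "C1_on S u" and S: "0 \<notin> S"
 shows "continuous_on S (rderiv u)"
proof -
 have "continuous_on S (\<lambda>x. \<Sum>i\<in>UNIV. complex_of_real (x $ i / norm x) * pderiv_at i u x)"
  using S by (intro continuous_intros C1_on_pderiv_continuous[OF u]) auto
 then show ?thesis
  by (rule continuous_on_eq) (simp add: rderiv_sum C1_on_differentiable[OF u])
qed

text \<open>
 The weak equation is tested with \<open>v\<close> times a radial cutoff. The gradient of the cutoff lives on a thin
 shell, where the solution is \<open>C\<^sup>1\<close>, and produces the boundary form there.
\<close>

lemma green_weak:
 assumes w: "weak_helmholtz \<kappa> u g l"
  and ext: "C1_on {x. a < norm x} u" and a: "0 \<le> a" "0 < \<delta>" "a < R - \<delta>"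
  and v: "C1_on UNIV v" "\<And>i. C1_on UNIV (pderiv_at i v)"
 shows "(LBINT x. u x * (cutoff R \<delta> x * ((\<Sum>i\<in>UNIV. pderiv_at i (pderiv_at i v) x) + \<kappa> * v x))) + l (\<lambda>x. v x * cutoff R \<delta> x)
  = - (LBINT x. shell R \<delta> (norm x) *\<^sub>R (rderiv u x * v x - u x * rderiv v x))"
proof -
 let ?\<chi> = "cutoff R \<delta>"
 let ?dd = "\<lambda>i. pderiv_at i (pderiv_at i v)"
 have \<delta>R: "0 < \<delta>" "\<delta> < R" using a by auto
 note tf = test_fun_cutoff_mult[OF \<delta>R]
 have c\<chi>: "continuous_on UNIV ?\<chi>" "continuous_on UNIV (pderiv_at i ?\<chi>)" for i
  by (rule C1_on_continuous[OF cutoff_C1(1)[OF \<delta>R]], rule C1_on_pderiv_continuous[OF cutoff_C1(1)[OF \<delta>R]])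
 have cv: "continuous_on UNIV v" "continuous_on UNIV (pderiv_at i v)" "continuous_on UNIV (?dd i)" for i
  by (rule C1_on_continuous[OF v(1)], rule C1_on_continuous[OF v(2)], rule C1_on_pderiv_continuous[OF v(2)])
 have out: "?\<chi> x = 0" "pderiv_at i ?\<chi> x = 0" if "R + \<delta> < norm x" for i x
  using that \<delta>R by (simp_all add: cutoff_eq_0 pderiv_cutoff_eq_0)
 have int: "integrable lborel (\<lambda>x. f x * h x)"
  if "L1loc f" "continuous_on UNIV h" "\<And>x. R + \<delta> < norm x \<Longrightarrow> h x = 0" for f h
  by (rule L1loc_mult_continuous[OF that(1,2), where D="R + \<delta>"]) (rule that(3))
 note Lu = weak_helmholtzD(1)[OF w] and Lg = weak_helmholtzD(2)[OF w]
 have iA: "integrable lborel (\<lambda>x. g i x * (v x * pderiv_at i ?\<chi> x))" for i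
  by (rule int[OF Lg]) (auto intro!: continuous_intros cv c\<chi> simp: out)
 have iB: "integrable lborel (\<lambda>x. g i x * (pderiv_at i v x * ?\<chi> x))" for i
  by (rule int[OF Lg]) (auto intro!: continuous_intros cv c\<chi> simp: out)
 have iC: "integrable lborel (\<lambda>x. u x * (pderiv_at i v x * pderiv_at i ?\<chi> x))" for i
  by (rule int[OF Lu]) (auto intro!: continuous_intros cv c\<chi> simp: out)
 have iE: "integrable lborel (\<lambda>x. u x * (?dd i x * ?\<chi> x))" for i
  by (rule int[OF Lu]) (auto intro!: continuous_intros cv c\<chi> simp: out)
 have iU: "integrable lborel (\<lambda>x. u x * (v x * ?\<chi> x))"
  by (rule int[OF Lu]) (auto intro!: continuous_intros cv c\<chi> simp: out)
 define A where "A i = (LBINT x. g i x * (v x * pderiv_at i ?\<chi> x))" for i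
 define B where "B i = (LBINT x. g i x * (pderiv_at i v x * ?\<chi> x))" for i
 define C where "C i = (LBINT x. u x * (pderiv_at i v x * pderiv_at i ?\<chi> x))" for i
 define E where "E i = (LBINT x. u x * (?dd i x * ?\<chi> x))" for i
 define U where "U = (LBINT x. u x * (v x * ?\<chi> x))"
 have W2: "(\<Sum>i\<in>UNIV. A i + B i) = \<kappa> * U + l (\<lambda>x. v x * ?\<chi> x)"
 proof -
  have "(LBINT x. g i x * pderiv_at i (\<lambda>x. v x * ?\<chi> x) x) = A i + B i" for i
   unfolding A_def B_def tf(2)[OF v(1)] distrib_left
   by (rule integral_add[OF iA iB])
  then show ?thesis using weak_helmholtzD(4)[OF w tf(1)[OF v(1)]] by (simp add: U_def)
 qed
 have W1: "C i + E i = - B i" for i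
 proof -
  have "(LBINT x. u x * pderiv_at i (\<lambda>x. pderiv_at i v x * ?\<chi> x) x) = C i + E i"
   unfolding C_def E_def tf(2)[OF v(2)] distrib_left
   by (rule integral_add[OF iC iE])
  then show ?thesis using weak_helmholtzD(3)[OF w tf(1)[OF v(2)], of i i] by (simp add: B_def)
 qed
 have "(LBINT x. u x * (?\<chi> x * ((\<Sum>i\<in>UNIV. ?dd i x) + \<kappa> * v x))) =
   (LBINT x. (\<Sum>i\<in>UNIV. u x * (?dd i x * ?\<chi> x)) + \<kappa> * (u x * (v x * ?\<chi> x)))"
  by (intro integral_cong refl) (simp add: sum_distrib_left sum_distrib_right algebra_simps)
 also have "\<dots> = (\<Sum>i\<in>UNIV. E i) + \<kappa> * U"
  unfolding E_def U_def
  by (simp only: integral_add[OF integrable_sum[OF iE] integrable_mult_right[OF iU]]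
   integral_sum[OF iE] integral_mult_right_zero)
 finally have "(LBINT x. u x * (?\<chi> x * ((\<Sum>i\<in>UNIV. ?dd i x) + \<kappa> * v x))) + l (\<lambda>x. v x * ?\<chi> x) =
   (\<Sum>i\<in>UNIV. E i) + (\<Sum>i\<in>UNIV. A i + B i)" unfolding W2 by simp
 also have "\<dots> = (\<Sum>i\<in>UNIV. A i - C i)"
 proof -
  have "E i + (A i + B i) = A i - C i" for i
  proof -
   have "B i = - (C i + E i)" using W1[of i] by simp
   then show ?thesis by simp
  qed
  then show ?thesis by (simp only: sum.distrib[symmetric])
 qed
 also have "\<dots> = (LBINT x. (\<Sum>i\<in>UNIV. g i x * (v x * pderiv_at i ?\<chi> x) - u x * (pderiv_at i v x * pderiv_at i ?\<chi> x)))"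
  unfolding A_def C_def
  by (simp only: integral_sum[OF integrable_diff[OF iA iC]] integral_diff[OF iA iC])
 also have "\<dots> = (LBINT x. - (shell R \<delta> (norm x) *\<^sub>R (rderiv u x * v x - u x * rderiv v x)))"
 proof (rule integral_cong_AE)
  have "AE x in lborel. a < norm x \<longrightarrow> g i x = pderiv_at i u x" for i
   using weak_derivative_eq_pderiv[OF open_exterior ext Lg weak_helmholtzD(3)[OF w]] by simp
  then have "AE x in lborel. \<forall>i\<in>UNIV. a < norm x \<longrightarrow> g i x = pderiv_at i u x"
   by (intro AE_ball_countable[THEN iffD2] ballI) auto
  then show "AE x in lborel. (\<Sum>i\<in>UNIV. g i x * (v x * pderiv_at i ?\<chi> x) - u x * (pderiv_at i v x * pderiv_at i ?\<chi> x)) =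
   - (shell R \<delta> (norm x) *\<^sub>R (rderiv u x * v x - u x * rderiv v x))"
  proof eventually_elim
   case (elim x)
   show ?case
   proof (cases "norm x \<le> R - \<delta>")
    case True
    then show ?thesis using \<delta>R by (simp add: pderiv_cutoff_eq_0 shell_eq_0)
   next
    case False
    then have ax: "a < norm x" using a by simp
    then have du: "u differentiable (at x)" using C1_on_differentiable[OF ext] by simp
    have dv: "v differentiable (at x)" using C1_on_differentiable[OF v(1)] by simp
    have "(\<Sum>i\<in>UNIV. g i x * (v x * pderiv_at i ?\<chi> x) - u x * (pderiv_at i v x * pderiv_at i ?\<chi> x)) =
     (\<Sum>i\<in>UNIV. - (of_real (shell R \<delta> (norm x)) * ((of_real (x $ i / norm x) * pderiv_at i u x) * v x - u x * (of_real (x $ i / norm x) * pderiv_at i v x))))"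
     using elim ax by (intro sum.cong refl) (simp add: cutoff_C1(2)[OF \<delta>R] scaleR_conv_of_real algebra_simps)
    also have "\<dots> = - (shell R \<delta> (norm x) *\<^sub>R (rderiv u x * v x - u x * rderiv v x))"
     unfolding rderiv_sum[OF du] rderiv_sum[OF dv] scaleR_conv_of_real
     by (simp only: sum_negf sum_distrib_left sum_distrib_right sum_subtractf right_diff_distrib)
    finally show ?thesis .
   qed
  qed
  show "(\<lambda>x. \<Sum>i\<in>UNIV. g i x * (v x * pderiv_at i ?\<chi> x) - u x * (pderiv_at i v x * pderiv_at i ?\<chi> x)) \<in> borel_measurable lborel"
   by (intro borel_measurable_integrable integrable_sum integrable_diff iA iC)
  have "integrable lborel (\<lambda>x. shell R \<delta> (norm x) *\<^sub>R (rderiv u x * v x - u x * rderiv v x))"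
  proof (rule shell_integrable[where a=a and b="R + \<delta> + 1"])
   have sub: "{x. a < norm x \<and> norm x < R + \<delta> + 1} \<subseteq> {x. a < norm x}" by auto
   show "continuous_on {x. a < norm x \<and> norm x < R + \<delta> + 1} (\<lambda>x. rderiv u x * v x - u x * rderiv v x)"
    using a by (intro continuous_on_diff continuous_on_mult
     continuous_rderiv[OF C1_on_subset[OF ext sub]] continuous_rderiv[OF C1_on_subset[OF v(1) subset_UNIV]]
     C1_on_continuous[OF C1_on_subset[OF ext sub]] C1_on_continuous[OF C1_on_subset[OF v(1) subset_UNIV]]) auto
  qed (use a in auto)
  then show "(\<lambda>x. - (shell R \<delta> (norm x) *\<^sub>R (rderiv u x * v x - u x * rderiv v x))) \<in> borel_measurable lborel"
   by (intro borel_measurable_uminus borel_measurable_integrable)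
 qed
 finally show ?thesis by simp
qed

lemma green_sphere:
 assumes w: "weak_helmholtz \<kappa> u g l"
  and ext: "C1_on {x. a < norm x} u" and a: "0 \<le> a" "a < R"
  and v: "C1_on UNIV v" "\<And>i. C1_on UNIV (pderiv_at i v)" "\<And>x. (\<Sum>i\<in>UNIV. pderiv_at i (pderiv_at i v) x) = - \<kappa> * v x"
  and l: "\<And>R \<delta>. 0 < \<delta> \<Longrightarrow> a < R - \<delta> \<Longrightarrow> l (\<lambda>x. v x * cutoff R \<delta> x) = c"
 shows "sphere_integral R (\<lambda>x. rderiv u x * v x - u x * rderiv v x) = - c"
proof (rule sphere_integral_eq_if_shell_const[where a=a and b="R + 1" and d="R - a"])
 have sub: "{x. a < norm x \<and> norm x < R + 1} \<subseteq> {x. a < norm x}" by auto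
 show "continuous_on {x. a < norm x \<and> norm x < R + 1} (\<lambda>x. rderiv u x * v x - u x * rderiv v x)"
  using a by (intro continuous_on_diff continuous_on_mult
   continuous_rderiv[OF C1_on_subset[OF ext sub]] continuous_rderiv[OF C1_on_subset[OF v(1) subset_UNIV]]
   C1_on_continuous[OF C1_on_subset[OF ext sub]] C1_on_continuous[OF C1_on_subset[OF v(1) subset_UNIV]]) auto
 fix \<delta> assume \<delta>: "0 < \<delta>" "\<delta> < R - a"
 then have \<delta>': "a < R - \<delta>" by simp
 show "(LBINT x. shell R \<delta> (norm x) *\<^sub>R (rderiv u x * v x - u x * rderiv v x)) = - c"
  using green_weak[OF w ext a(1) \<delta>(1) \<delta>' v(1,2)] l[OF \<delta>(1) \<delta>'] v(3) by (simp add: equation_minus_iff)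
qed (use a in auto)

section \<open>Plane waves\<close>

lemma plane_wave_has_derivative:
 "(plane_wave k d has_derivative grad_form (\<lambda>i. \<i> * of_real (k * d $ i) * plane_wave k d x)) (at x)"
proof -
 have "((\<lambda>x. \<i> * complex_of_real (k * (x \<bullet> d))) has_derivative (\<lambda>h. \<i> * of_real (k * (h \<bullet> d)))) (at x)"
  by (auto intro!: derivative_eq_intros)
 from has_derivative_compose[OF this, of exp "\<lambda>h. exp (\<i> * of_real (k * (x \<bullet> d))) * h"]
 have d: "(plane_wave k d has_derivative (\<lambda>h. plane_wave k d x * (\<i> * of_real (k * (h \<bullet> d))))) (at x)"
  using DERIV_exp[of "\<i> * complex_of_real (k * (x \<bullet> d))"]
  by (simp add: has_field_derivative_def plane_wave_def[abs_def])
 have "(\<lambda>h. plane_wave k d x * (\<i> * of_real (k * (h \<bullet> d)))) = grad_form (\<lambda>i. \<i> * of_real (k * d $ i) * plane_wave k d x)"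
 proof
  fix h
  have "complex_of_real (k * (h \<bullet> d)) = (\<Sum>i\<in>UNIV. of_real (h $ i) * of_real (k * d $ i))"
   unfolding inner_vec_def sum_distrib_left of_real_sum by (intro sum.cong refl) simp
  then show "plane_wave k d x * (\<i> * of_real (k * (h \<bullet> d))) = grad_form (\<lambda>i. \<i> * of_real (k * d $ i) * plane_wave k d x) h"
   unfolding grad_form_def by (simp only: sum_distrib_left scaleR_conv_of_real) (intro sum.cong refl, simp add: mult_ac)
 qed
 with d show ?thesis by (simp only:)
qed

lemma continuous_plane_wave: "continuous_on S (plane_wave k d)"
 unfolding plane_wave_def[abs_def] by (intro continuous_intros)

lemma pderiv_plane_wave: "pderiv_at i (plane_wave k d) = (\<lambda>x. \<i> * of_real (k * d $ i) * plane_wave k d x)"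
 using pderiv_at_eq[OF plane_wave_has_derivative] by (auto simp: fun_eq_iff)

lemma C1_on_plane_wave: "C1_on S (plane_wave k d)"
 by (rule C1_onI[OF plane_wave_has_derivative]) (intro continuous_intros continuous_plane_wave)

lemma C1_on_pderiv_plane_wave: "C1_on S (pderiv_at i (plane_wave k d))"
 unfolding pderiv_plane_wave by (intro C1_on_mult C1_on_const C1_on_plane_wave)

lemma plane_wave_laplace:
 assumes "norm d = 1"
 shows "(\<Sum>i\<in>UNIV. pderiv_at i (pderiv_at i (plane_wave k d)) x) = - of_real (k\<^sup>2) * plane_wave k d x"
proof -
 have p: "pderiv_at i (pderiv_at i (plane_wave k d)) x = - (of_real (k\<^sup>2) * plane_wave k d x) * of_real ((d $ i)\<^sup>2)" for i
 proof -
  have "pderiv_at i (\<lambda>x. \<i> * of_real (k * d $ i) * plane_wave k d x) x =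
    \<i> * of_real (k * d $ i) * pderiv_at i (plane_wave k d) x + pderiv_at i (\<lambda>x. \<i> * of_real (k * d $ i)) x * plane_wave k d x"
   by (rule pderiv_at_mult[OF differentiable_const C1_on_differentiable[OF C1_on_plane_wave UNIV_I]])
  also have "pderiv_at i (\<lambda>x. \<i> * of_real (k * d $ i)) x = 0"
   using pderiv_at_eq[OF has_derivative_const] by simp
  finally show ?thesis by (simp add: pderiv_plane_wave power2_eq_square mult_ac)
 qed
 have "(\<Sum>i\<in>UNIV. (d $ i)\<^sup>2) = (norm d)\<^sup>2"
  unfolding power2_norm_eq_inner inner_vec_def by (simp add: power2_eq_square)
 then have "(\<Sum>i\<in>UNIV. complex_of_real ((d $ i)\<^sup>2)) = 1"
  unfolding of_real_sum[symmetric] using assms by simp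
 then show ?thesis unfolding p sum_distrib_left[symmetric] by simp
qed

lemma norm_plane_wave [simp]: "norm (plane_wave k d x) = 1"
 unfolding plane_wave_def by (rule norm_exp_i_times)

lemma cnj_plane_wave: "cnj (plane_wave k d x) = plane_wave k (- d) x"
 unfolding plane_wave_def by (simp add: exp_cnj)

lemma rderiv_plane_wave: "rderiv (plane_wave k d) x = \<i> * of_real (k * ((x /\<^sub>R norm x) \<bullet> d)) * plane_wave k d x"
 unfolding rderiv_eq[OF plane_wave_has_derivative] grad_form_def inner_vec_def sum_distrib_left of_real_sum sum_distrib_right
 by (intro sum.cong refl) (simp add: scaleR_conv_of_real mult_ac)

lemma L1loc_kernel: "0 \<le> k \<Longrightarrow> L1loc (helm k 0)" "0 \<le> k \<Longrightarrow> L1loc (dhelm k 0 i)"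
proof -
 assume k: "0 \<le> k"
 have *: "complex_of_real (indicator (cball 0 D) x) * z = indicator (cball 0 D) x *\<^sub>R z" for D and x :: "real^3" and z
  by (simp add: scaleR_conv_of_real)
 have m: "(\<lambda>x::real^3. complex_of_real (indicator (cball 0 D) x)) \<in> borel_measurable borel" for D by simp
 have b: "norm (complex_of_real (indicator (cball 0 D) x)) \<le> 1" for x :: "real^3" and D by (simp add: indicator_def)
 have o: "complex_of_real (indicator (cball 0 D) x) = 0" if "D < norm x" for x :: "real^3" and D using that by (simp add: indicator_def)
 have "integrable lborel (\<lambda>x. helm k 0 (x - 0) * complex_of_real (indicator (cball 0 D) x))"
  "integrable lborel (\<lambda>x. dhelm k 0 i (x - 0) * complex_of_real (indicator (cball 0 D) x))" for D
  by (rule kernel_test_integrable[OF k m b o], assumption)+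
 then have "integrable lborel (\<lambda>x. indicator (cball 0 D) x *\<^sub>R helm k 0 x)"
   "integrable lborel (\<lambda>x. indicator (cball 0 D) x *\<^sub>R dhelm k 0 i x)" for D
  by (simp_all add: mult.commute[of "helm k 0 _"] mult.commute[of "dhelm k 0 i _"] *)
 then show "L1loc (helm k 0)" "L1loc (dhelm k 0 i)" by (simp_all add: L1loc_def)
qed

lemma weak_helmholtz_fundamental:
 assumes "0 \<le> k"
 shows "weak_helmholtz (of_real (k\<^sup>2)) (helm k 0) (dhelm k 0) (\<lambda>\<phi>. \<phi> 0)"
 unfolding weak_helmholtz_def
 using fundamental_solution_weak[OF assms, where y=0] L1loc_kernel[OF assms] by simp

lemma rderiv_helm:
 assumes "x \<noteq> 0"
 shows "rderiv (helm k 0) x = of_real (norm x) * qC k (of_real (norm x))"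
proof -
 have "rderiv (helm k 0) x = (\<Sum>i\<in>UNIV. of_real (x $ i * x $ i / norm x) * qC k (of_real (norm x)))"
  unfolding rderiv_eq[OF helm_has_derivative[OF disjI2[OF assms]]] grad_form_def dhelm_def vector_scaleR_component rho_0
  by (intro sum.cong refl) (simp add: scaleR_conv_of_real divide_inverse mult_ac)
 also have "\<dots> = of_real ((\<Sum>i\<in>UNIV. x $ i * x $ i) / norm x) * qC k (of_real (norm x))"
  by (simp add: sum_distrib_right sum_divide_distrib)
 also have "(\<Sum>i\<in>UNIV. x $ i * x $ i) / norm x = norm x"
 proof -
  have "(\<Sum>i\<in>UNIV. x $ i * x $ i) = (norm x)\<^sup>2" unfolding power2_norm_eq_inner inner_vec_def by simp
  then show ?thesis using assms by (simp add: power2_eq_square)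
 qed
 finally show ?thesis .
qed

lemma continuous_S2_integrable:
 fixes f :: "real^3 \<Rightarrow> 'b::{banach, second_countable_topology}"
 assumes "continuous_on (sphere 0 1) f"
 shows "integrable S2_measure f"
proof -
 obtain M where M: "\<forall>x\<in>sphere 0 1. norm (f x) \<le> M"
  using bounded_on_compact[OF compact_sphere assms] by blast
 show ?thesis
  by (rule S2.integrable_const_bound[where B=M])
   (use M continuous_sphere_measurable[OF assms] in \<open>auto intro!: AE_I2 simp: space_S2_measure\<close>)
qed

text \<open>
 Two instances of Green's identity, for the outgoing fundamental solution and for its complex
 conjugate, form a linear system for the mean of a plane wave and of its radial derivative.
\<close>

text \<open>
 The imaginary part of the outgoing kernel is a superposition of plane waves with positive weight. The
 identity is Green's formula for the kernel and a plane wave on the sphere through \<open>z\<close>, where the kernel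
 and its radial derivative are constant.
\<close>

lemma im_fundamental_eq_plane_wave_mean:
 assumes k: "0 < k" and z: "z \<noteq> 0"
 shows "helm k 0 z - cnj (helm k 0 z) = 2 * \<i> * of_real (k / (16 * pi\<^sup>2)) * (\<integral>w. plane_wave k w z \<partial>S2_measure)"
proof -
 define R where "R = norm z"
 define d where "d = z /\<^sub>R norm z"
 have R: "0 < R" using z by (simp add: R_def)
 have nd: "norm d = 1" using z by (simp add: d_def)
 have zRd: "z = R *\<^sub>R d" using z by (simp add: R_def d_def)
 define h where "h = hC k (of_real R)"
 define h1 where "h1 = of_real R * qC k (of_real R)"
 have ext: "C1_on {x. 0 < norm x} (helm k 0)" by (rule C1_on_helm) auto
 have key: "of_real (R\<^sup>2) * (h1 * (\<integral>w. plane_wave k e (R *\<^sub>R w) \<partial>S2_measure) - h * (\<integral>w. rderiv (plane_wave k e) (R *\<^sub>R w) \<partial>S2_measure)) = -1"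
  if e: "norm e = 1" for e
 proof -
  have "sphere_integral R (\<lambda>x. rderiv (helm k 0) x * plane_wave k e x - helm k 0 x * rderiv (plane_wave k e) x) = -1"
  proof (rule green_sphere[OF weak_helmholtz_fundamental ext])
   show "plane_wave k e 0 * cutoff R' \<delta> 0 = 1" if "0 < \<delta>" "0 < R' - \<delta>" for R' \<delta>
    using that by (simp add: plane_wave_def cutoff_eq_1)
   show "(\<Sum>i\<in>UNIV. pderiv_at i (pderiv_at i (plane_wave k e)) x) = - of_real (k\<^sup>2) * plane_wave k e x" for x
    by (rule plane_wave_laplace[OF e])
  qed (use k R in \<open>auto intro: C1_on_plane_wave C1_on_pderiv_plane_wave\<close>)
  also have "sphere_integral R (\<lambda>x. rderiv (helm k 0) x * plane_wave k e x - helm k 0 x * rderiv (plane_wave k e) x) =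
   sphere_integral R (\<lambda>x. h1 * plane_wave k e x - h * rderiv (plane_wave k e) x)"
   using R by (intro sphere_integral_cong) (auto simp: rderiv_helm helm_def h_def h1_def)
  also have "\<dots> = of_real (R\<^sup>2) * (h1 * (\<integral>w. plane_wave k e (R *\<^sub>R w) \<partial>S2_measure) - h * (\<integral>w. rderiv (plane_wave k e) (R *\<^sub>R w) \<partial>S2_measure))"
  proof -
   have 1: "integrable S2_measure (\<lambda>w. plane_wave k e (R *\<^sub>R w))"
    by (intro continuous_S2_integrable continuous_on_compose2[OF continuous_plane_wave[of UNIV]] continuous_intros) auto
   have 2: "integrable S2_measure (\<lambda>w. rderiv (plane_wave k e) (R *\<^sub>R w))"
    using R by (intro continuous_S2_integrable continuous_on_compose2[OF continuous_rderiv[OF C1_on_plane_wave[of "-{0}"]]] continuous_intros) auto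
   show ?thesis unfolding sphere_integral_def using 1 2 by (simp add: scaleR_conv_of_real)
  qed
  finally show ?thesis .
 qed
 define m where "m = (\<integral>w. plane_wave k d (R *\<^sub>R w) \<partial>S2_measure)"
 define m1 where "m1 = (\<integral>w. rderiv (plane_wave k d) (R *\<^sub>R w) \<partial>S2_measure)"
 have eq1: "of_real (R\<^sup>2) * (h1 * m - h * m1) = -1" using key[OF nd] by (simp add: m_def m1_def)
 have "of_real (R\<^sup>2) * (h1 * cnj m - h * cnj m1) = -1"
 proof -
  have "cnj (rderiv (plane_wave k d) x) = rderiv (plane_wave k (- d)) x" for x
   by (simp add: rderiv_plane_wave cnj_plane_wave)
  then show ?thesis using key[of "- d"] nd
   by (simp add: m_def m1_def cnj_plane_wave flip: integral_cnj)
 qed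
 then have "cnj (of_real (R\<^sup>2) * (h1 * cnj m - h * cnj m1)) = cnj (-1)" by (simp only:)
 then have eq2: "of_real (R\<^sup>2) * (cnj h1 * m - cnj h * m1) = -1" by simp
 have h1h: "h1 = h * (\<i> * of_real k - 1 / of_real R)"
  unfolding h1_def h_def qC_def hC_def using R by (simp add: field_simps eval_nat_numeral)
 have hh: "h * cnj h = of_real (1 / (16 * pi\<^sup>2 * R\<^sup>2))"
 proof -
  have "h * cnj h = of_real ((norm h)\<^sup>2)" by (metis complex_norm_square)
  also have "norm h = 1 / (4 * pi * R)" unfolding h_def by (rule norm_hC[OF R])
  also have "(1 / (4 * pi * R))\<^sup>2 = 1 / (16 * pi\<^sup>2 * R\<^sup>2)" by (simp add: power2_eq_square)
  finally show ?thesis .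
 qed
 have "h - cnj h = cnj h * (of_real (R\<^sup>2) * (h1 * m - h * m1)) - h * (of_real (R\<^sup>2) * (cnj h1 * m - cnj h * m1))"
  unfolding eq1 eq2 by simp
 also have "\<dots> = of_real (R\<^sup>2) * m * (cnj h * h1 - h * cnj h1)" by (simp add: algebra_simps)
 also have "cnj h * h1 - h * cnj h1 = (h * cnj h) * (2 * \<i> * of_real k)"
  unfolding h1h by (simp add: algebra_simps)
 also have "of_real (R\<^sup>2) * m * ((h * cnj h) * (2 * \<i> * of_real k)) = 2 * \<i> * of_real (k / (16 * pi\<^sup>2)) * m"
  unfolding hh using R by (simp add: field_simps)
 finally have "h - cnj h = 2 * \<i> * of_real (k / (16 * pi\<^sup>2)) * m" .
 moreover have "helm k 0 z = h" by (simp add: helm_def h_def R_def)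
 moreover have "plane_wave k d (R *\<^sub>R w) = plane_wave k w z" for w
  unfolding zRd plane_wave_def by (simp add: inner_commute)
 ultimately show ?thesis by (simp add: m_def)
qed

section \<open>Volume potentials\<close>

definition pot :: "real \<Rightarrow> (real^3 \<Rightarrow> complex) \<Rightarrow> real^3 \<Rightarrow> complex" where
 "pot k f x = (LBINT y. helm k 0 (x - y) * f y)"

definition dpot :: "real \<Rightarrow> 3 \<Rightarrow> (real^3 \<Rightarrow> complex) \<Rightarrow> real^3 \<Rightarrow> complex" where
 "dpot k i f x = (LBINT y. dhelm k 0 i (x - y) * f y)"

lemma nn_integral_lborel_reflect:
 fixes f :: "real^3 \<Rightarrow> ennreal"
 assumes [measurable]: "f \<in> borel_measurable borel"
 shows "(NN y. f (x - y)) = (NN y. f y)"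
proof -
 have "(NN y. f y) = (\<integral>\<^sup>+y. f y \<partial>density (distr lborel borel (\<lambda>y. x + (- 1) *\<^sub>R y)) (\<lambda>_. ennreal (\<bar>- 1\<bar> ^ DIM(real^3))))"
  using lborel_affine[of "- 1" x] by simp
 also have "\<dots> = (\<integral>\<^sup>+y. f y \<partial>distr lborel borel (\<lambda>y. x + (- 1) *\<^sub>R y))"
  by (subst nn_integral_density) auto
 also have "\<dots> = (NN y. f (x + (- 1) *\<^sub>R y))"
  by (rule nn_integral_distr) measurable
 finally show ?thesis by simp
qed

lemma nn_integral_lborel_shift:
 fixes f :: "real^3 \<Rightarrow> ennreal"
 assumes [measurable]: "f \<in> borel_measurable borel"
 shows "(NN x. f (x - y)) = (NN x. f x)"
proof -
 have "(NN x. f x) = (\<integral>\<^sup>+x. f x \<partial>distr lborel borel ((+) (- y)))"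
  by (simp add: lborel_distr_plus)
 also have "\<dots> = (NN x. f (- y + x))"
  by (rule nn_integral_distr) auto
 finally show ?thesis by simp
qed

text \<open>
 The weighted Cauchy--Schwarz inequality with weight \<open>S\<close>, followed by Tonelli.
\<close>

lemma kernel_young:
 fixes K f :: "real^3 \<Rightarrow> complex" and S :: "real^3 \<Rightarrow> real"
 assumes K[measurable]: "K \<in> borel_measurable borel" and S: "integrable lborel S" "\<And>z. 0 \<le> S z"
  and bound: "\<And>z. z \<noteq> 0 \<Longrightarrow> norm z < P \<Longrightarrow> norm (K z) \<le> S z"
  and f: "sqint f" "\<And>y. b < norm y \<Longrightarrow> f y = 0" and P: "D + b < P"
 defines "\<kappa> \<equiv> (LBINT z. S z)"
 shows "(NN x. indicator (cball 0 D) x * (NN y. ennreal (norm (K (x - y) * f y)))\<^sup>2)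
   \<le> ennreal (\<kappa>\<^sup>2 * (LBINT y. (norm (f y))\<^sup>2))"
  and "integrable lborel (\<lambda>x. indicator (cball 0 D) x * (norm (LBINT y. K (x - y) * f y))\<^sup>2)"
  and "(LBINT x. indicator (cball 0 D) x * (norm (LBINT y. K (x - y) * f y))\<^sup>2) \<le> \<kappa>\<^sup>2 * (LBINT y. (norm (f y))\<^sup>2)"
proof -
 let ?N = "\<lambda>x. (NN y. ennreal (norm (K (x - y) * f y)))" and ?M = "\<lambda>x. (NN y. ennreal (S (x - y) * (norm (f y))\<^sup>2))" and ?F = "LBINT y. (norm (f y))\<^sup>2"
 have fm[measurable]: "f \<in> borel_measurable borel" using f(1) by (simp add: sqint_def)
 have Sm[measurable]: "S \<in> borel_measurable borel" using S(1) by auto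
 have \<kappa>0: "0 \<le> \<kappa>" using S(2) by (simp add: \<kappa>_def integral_nonneg)
 have nnS: "(NN z. ennreal (S z)) = ennreal \<kappa>"
  unfolding \<kappa>_def by (rule nn_integral_eq_integral[OF S(1)]) (use S(2) in auto)
 have nnf: "(NN y. ennreal ((norm (f y))\<^sup>2)) = ennreal ?F"
  using f(1) by (intro nn_integral_eq_integral) (auto simp: sqint_def)
 have pt: "indicator (cball 0 D) x * (?N x)\<^sup>2
   \<le> ennreal \<kappa> * ?M x" for x
 proof (cases "x \<in> cball 0 D")
  case True
  have nz: "AE y in lborel. y \<noteq> x" by (rule AE_lborel_singleton)
  have "?N x \<le> (NN y. ennreal (sqrt (S (x - y))) * ennreal (sqrt (S (x - y)) * norm (f y)))"
  proof (rule nn_integral_mono_AE)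
   show "AE y in lborel. ennreal (norm (K (x - y) * f y)) \<le> ennreal (sqrt (S (x - y))) * ennreal (sqrt (S (x - y)) * norm (f y))"
    using nz
   proof eventually_elim
    case (elim y)
    have "norm (K (x - y) * f y) \<le> S (x - y) * norm (f y)"
    proof (cases "b < norm y")
     case False
     have "norm (x - y) \<le> norm x + norm y" by (rule norm_triangle_ineq4)
     then have "norm (x - y) < P" using True False P by simp
     then show ?thesis using bound[of "x - y"] elim by (simp add: norm_mult mult_right_mono)
    qed (simp add: f(2))
    also have "\<dots> = sqrt (S (x - y)) * (sqrt (S (x - y)) * norm (f y))"
     using S(2) by (simp add: mult.assoc[symmetric])
    finally show ?case using S(2) by (subst ennreal_mult[symmetric]) (auto intro: ennreal_leI)
   qed
  qed
  then have "(?N x)\<^sup>2 \<le> (NN y. ennreal (sqrt (S (x - y))) * ennreal (sqrt (S (x - y)) * norm (f y)))\<^sup>2"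
   by (rule power_mono) simp
  also have "\<dots> \<le> (NN y. (ennreal (sqrt (S (x - y))))\<^sup>2) * (NN y. (ennreal (sqrt (S (x - y)) * norm (f y)))\<^sup>2)"
   by (rule Cauchy_Schwarz_nn_integral) measurable
  also have "(NN y. (ennreal (sqrt (S (x - y))))\<^sup>2) = (NN y. ennreal (S (x - y)))"
   using S(2) by (intro nn_integral_cong) (simp add: ennreal_power)
  also have "\<dots> = ennreal \<kappa>"
   using nn_integral_lborel_reflect[of "\<lambda>z. ennreal (S z)" x] nnS by simp
  also have "(NN y. (ennreal (sqrt (S (x - y)) * norm (f y)))\<^sup>2) = ?M x"
   using S(2) by (intro nn_integral_cong) (simp add: ennreal_power power_mult_distrib)
  finally show ?thesis using True by simp
 qed simp
 have "(NN x. indicator (cball 0 D) x * (?N x)\<^sup>2)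
   \<le> (NN x. ennreal \<kappa> * ?M x)"
  by (intro nn_integral_mono pt)
 also have "\<dots> = ennreal \<kappa> * (NN x. ?M x)"
  by (rule nn_integral_cmult) measurable
 also have "(NN x. ?M x) = (NN y. (NN x. ennreal (S (x - y) * (norm (f y))\<^sup>2)))"
  by (rule lborel_pair.Fubini') measurable
 also have "\<dots> = (NN y. ennreal \<kappa> * ennreal ((norm (f y))\<^sup>2))"
 proof (rule nn_integral_cong)
  fix y
  have "(NN x. ennreal (S (x - y) * (norm (f y))\<^sup>2)) = (NN x. ennreal (S (x - y)) * ennreal ((norm (f y))\<^sup>2))"
   using S(2) by (simp add: ennreal_mult)
  also have "\<dots> = (NN x. ennreal (S (x - y))) * ennreal ((norm (f y))\<^sup>2)"
   by (rule nn_integral_multc) measurable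
  also have "(NN x. ennreal (S (x - y))) = ennreal \<kappa>"
   using nn_integral_lborel_shift[of "\<lambda>z. ennreal (S z)" y] nnS by simp
  finally show "(NN x. ennreal (S (x - y) * (norm (f y))\<^sup>2)) = ennreal \<kappa> * ennreal ((norm (f y))\<^sup>2)" .
 qed
 also have "\<dots> = ennreal \<kappa> * ennreal ?F"
  by (subst nn_integral_cmult) (simp_all add: nnf)
 also have "ennreal \<kappa> * (ennreal \<kappa> * ennreal ?F) = ennreal (\<kappa>\<^sup>2 * ?F)"
  using \<kappa>0 by (simp add: ennreal_mult[symmetric] integral_nonneg power2_eq_square mult.assoc)
 finally show nn: "(NN x. indicator (cball 0 D) x * (?N x)\<^sup>2)
   \<le> ennreal (\<kappa>\<^sup>2 * ?F)" .
 let ?g = "\<lambda>x. indicator (cball 0 D) x * (norm (LBINT y. K (x - y) * f y))\<^sup>2"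
 have gm[measurable]: "(\<lambda>x. (LBINT y. K (x - y) * f y)) \<in> borel_measurable borel"
  by (rule lborel.borel_measurable_lebesgue_integral[where N=borel]) measurable
 have "(NN x. ennreal (?g x)) \<le> (NN x. indicator (cball 0 D) x * (?N x)\<^sup>2)"
 proof (rule nn_integral_mono)
  fix x
  have "ennreal (norm (LBINT y. K (x - y) * f y)) \<le> ?N x"
  proof (cases "integrable lborel (\<lambda>y. K (x - y) * f y)")
   case True
   then show ?thesis by (rule integral_norm_bound_ennreal)
  qed (simp add: not_integrable_integral_eq)
  then have "(ennreal (norm (LBINT y. K (x - y) * f y)))\<^sup>2 \<le> (?N x)\<^sup>2"
   by (rule power_mono) simp
  then show "ennreal (?g x) \<le> indicator (cball 0 D) x * (?N x)\<^sup>2"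
   by (simp add: indicator_def ennreal_power)
 qed
 then have le: "(NN x. ennreal (?g x)) \<le> ennreal (\<kappa>\<^sup>2 * ?F)"
  using nn by (rule order_trans)
 have g0: "0 \<le> ?g x" for x by simp
 have m: "?g \<in> borel_measurable lborel"
  by (intro borel_measurable_times borel_measurable_indicator borel_measurable_power borel_measurable_norm) (use gm in auto)
 show i: "integrable lborel ?g"
  by (rule integrableI_bounded[OF m]) (use le g0 in \<open>auto intro: le_less_trans\<close>)
 have "ennreal (LBINT x. ?g x) \<le> ennreal (\<kappa>\<^sup>2 * ?F)"
  using le nn_integral_eq_integral[OF i] g0 by simp
 then show "(LBINT x. ?g x) \<le> \<kappa>\<^sup>2 * ?F"
  by (subst (asm) ennreal_le_iff) (auto intro!: integral_nonneg mult_nonneg_nonneg)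
qed

lemma kernel_fubini:
 fixes K f \<theta> :: "real^3 \<Rightarrow> complex"
 assumes K[measurable]: "K \<in> borel_measurable borel" and f: "integrable lborel f" and \<theta>[measurable]: "\<theta> \<in> borel_measurable borel"
  and c: "\<And>y. f y \<noteq> 0 \<Longrightarrow> (NN x. ennreal (norm (K (x - y) * \<theta> x))) \<le> ennreal c"
 shows "(LBINT x. (LBINT y. K (x - y) * f y) * \<theta> x) = (LBINT y. f y * (LBINT x. K (x - y) * \<theta> x))"
  and "integrable lborel (\<lambda>y. f y * (LBINT x. K (x - y) * \<theta> x))"
proof -
 have fm[measurable]: "f \<in> borel_measurable borel" using f by auto
 let ?h = "\<lambda>x y. K (x - y) * f y * \<theta> x"
 have hm: "case_prod ?h \<in> borel_measurable (lborel \<Otimes>\<^sub>M lborel)" by measurable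
 have "(\<integral>\<^sup>+p. ennreal (norm (case_prod ?h p)) \<partial>(lborel \<Otimes>\<^sub>M lborel)) = (NN y. (NN x. ennreal (norm (?h x y))))"
  by (subst lborel_pair.nn_integral_snd[symmetric]) (use hm in auto)
 also have "\<dots> \<le> (NN y. ennreal (norm (f y)) * ennreal c)"
 proof (rule nn_integral_mono)
  fix y
  have "(NN x. ennreal (norm (?h x y))) = (NN x. ennreal (norm (f y)) * ennreal (norm (K (x - y) * \<theta> x)))"
   by (intro nn_integral_cong) (simp add: ennreal_mult[symmetric] norm_mult mult_ac)
  also have "\<dots> = ennreal (norm (f y)) * (NN x. ennreal (norm (K (x - y) * \<theta> x)))"
   by (rule nn_integral_cmult) measurable
  also have "\<dots> \<le> ennreal (norm (f y)) * ennreal c"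
   using c[of y] by (cases "f y = 0") (auto intro: mult_left_mono)
  finally show "(NN x. ennreal (norm (?h x y))) \<le> ennreal (norm (f y)) * ennreal c" .
 qed
 also have "\<dots> = (NN y. ennreal (norm (f y))) * ennreal c"
  by (rule nn_integral_multc) measurable
 also have "\<dots> < \<infinity>"
  using f by (simp add: integrable_iff_bounded ennreal_mult_less_top)
 finally have int: "integrable (lborel \<Otimes>\<^sub>M lborel) (case_prod ?h)"
  using hm by (intro integrableI_bounded)
 have 1: "(LBINT y. ?h x y) = (LBINT y. K (x - y) * f y) * \<theta> x" for x
  by (rule integral_mult_left_zero)
 have 2: "(LBINT x. ?h x y) = f y * (LBINT x. K (x - y) * \<theta> x)" for y
  unfolding integral_mult_right_zero[symmetric] by (intro integral_cong refl) (simp add: mult_ac)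
 show "(LBINT x. (LBINT y. K (x - y) * f y) * \<theta> x) = (LBINT y. f y * (LBINT x. K (x - y) * \<theta> x))"
  using lborel_pair.Fubini_integral[OF int] unfolding 1 2 by simp
 have "integrable lborel (\<lambda>y. (LBINT x. ?h x y))"
  by (rule lborel_pair.integrable_snd[OF int])
 then show "integrable lborel (\<lambda>y. f y * (LBINT x. K (x - y) * \<theta> x))" unfolding 2 .
qed

lemma nn_kernel_test_bound:
 assumes k: "0 \<le> k" and [measurable]: "\<theta> \<in> borel_measurable borel" and M: "\<And>x. norm (\<theta> x) \<le> M" and D: "\<And>x. D < norm x \<Longrightarrow> \<theta> x = 0"
  and y: "norm y \<le> b"
 defines "P \<equiv> \<bar>D\<bar> + b + 1"
 shows "(NN x. ennreal (norm (helm k \<epsilon> (x - y) * \<theta> x))) \<le> ennreal (sing_const k P * (LBINT z. sing P z) * M)"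
  and "(NN x. ennreal (norm (dhelm k \<epsilon> i (x - y) * \<theta> x))) \<le> ennreal (sing_const k P * (LBINT z. sing P z) * M)"
proof -
 have M0: "0 \<le> M" using M[of 0] norm_ge_zero order_trans by blast
 have b0: "0 \<le> b" using y norm_ge_zero order_trans by blast
 have c0: "0 \<le> sing_const k P" using k b0 by (simp add: sing_const_def P_def)
 have nz: "AE x in lborel. x \<noteq> y" by (rule AE_lborel_singleton)
 have b: "norm (helm k \<epsilon> (x - y) * \<theta> x) \<le> (sing_const k P * M) * sing P (x - y) \<and> norm (dhelm k \<epsilon> i (x - y) * \<theta> x) \<le> (sing_const k P * M) * sing P (x - y)" if "x \<noteq> y" for x
 proof (cases "norm x \<le> D")
  case True
  have "norm (x - y) \<le> norm x + norm y" by (rule norm_triangle_ineq4)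
  then have lt: "norm (x - y) < P" using True y by (simp add: P_def)
  have "norm (helm k \<epsilon> (x - y)) * norm (\<theta> x) \<le> (sing_const k P * sing P (x - y)) * M"
   "norm (dhelm k \<epsilon> i (x - y)) * norm (\<theta> x) \<le> (sing_const k P * sing P (x - y)) * M"
   using norm_helm_sing[OF lt k, of \<epsilon>] that M[of x] c0 sing_nonneg[of P "x - y"]
   by (auto intro!: mult_mono)
  then show ?thesis by (simp add: norm_mult mult_ac)
 next
  case False
  then have "\<theta> x = 0" by (intro D) simp
  then show ?thesis using c0 M0 sing_nonneg[of P "x - y"] by simp
 qed
 have e: "(NN x. ennreal ((sing_const k P * M) * sing P (x - y))) = ennreal (sing_const k P * (LBINT z. sing P z) * M)"
 proof -
  have "(NN x. ennreal ((sing_const k P * M) * sing P (x - y))) = (NN x. ennreal ((sing_const k P * M) * sing P x))"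
   by (rule nn_integral_lborel_shift) measurable
  also have "\<dots> = ennreal (LBINT x. (sing_const k P * M) * sing P x)"
   using c0 M0 sing_nonneg by (intro nn_integral_eq_integral integrable_mult_right integrable_sing) auto
  finally show ?thesis by (simp add: mult_ac)
 qed
 show "(NN x. ennreal (norm (helm k \<epsilon> (x - y) * \<theta> x))) \<le> ennreal (sing_const k P * (LBINT z. sing P z) * M)"
  unfolding e[symmetric] by (rule nn_integral_mono_AE) (use nz in eventually_elim, use b in \<open>blast intro: ennreal_leI\<close>)
 show "(NN x. ennreal (norm (dhelm k \<epsilon> i (x - y) * \<theta> x))) \<le> ennreal (sing_const k P * (LBINT z. sing P z) * M)"
  unfolding e[symmetric] by (rule nn_integral_mono_AE) (use nz in eventually_elim, use b in \<open>blast intro: ennreal_leI\<close>)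
qed

lemma sqint_supp_integrable:
 assumes f: "sqint f" "\<And>y. b < norm y \<Longrightarrow> f y = 0"
 shows "integrable lborel f"
proof -
 have fm[measurable]: "f \<in> borel_measurable borel" using f(1) by (simp add: sqint_def)
 have i1: "integrable lborel (\<lambda>x. indicator (cball (0::real^3) b) x *\<^sub>R (1::real))"
  by (rule borel_integrable_compact) auto
 have i2: "integrable lborel (\<lambda>x. (norm (f x))\<^sup>2)" using f by (simp add: sqint_def)
 show ?thesis
 proof (rule integrable_bound[OF integrable_add[OF i1 i2]])
  show "AE x in lborel. norm (f x) \<le> norm (indicator (cball 0 b) x *\<^sub>R 1 + (norm (f x))\<^sup>2)"
  proof (rule AE_I2)
   fix x
   have "2 * norm (f x) \<le> (norm (f x))\<^sup>2 + 1" using sum_squares_bound[of "norm (f x)" 1] by simp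
   moreover have "0 \<le> norm (f x)" by simp
   ultimately have "norm (f x) \<le> 1 + (norm (f x))\<^sup>2" by linarith
   then show "norm (f x) \<le> norm (indicator (cball 0 b) x *\<^sub>R 1 + (norm (f x))\<^sup>2)"
    using f(2)[of x] by (cases "b < norm x") (auto simp: indicator_def)
  qed
 qed (use fm in simp)
qed

lemma pot_measurable:
 assumes "f \<in> borel_measurable borel"
 shows "pot k f \<in> borel_measurable borel" "dpot k i f \<in> borel_measurable borel"
proof -
 have [measurable]: "f \<in> borel_measurable borel" by fact
 show "pot k f \<in> borel_measurable borel" unfolding pot_def[abs_def]
  by (rule lborel.borel_measurable_lebesgue_integral[where N=borel]) measurable
 show "dpot k i f \<in> borel_measurable borel" unfolding dpot_def[abs_def]
  by (rule lborel.borel_measurable_lebesgue_integral[where N=borel]) measurable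
qed

definition young_const :: "real \<Rightarrow> real \<Rightarrow> real" where
 "young_const k P = (LBINT z. sing_const k P * sing P z)"

lemma pot_young:
 assumes k: "0 \<le> k" and f: "sqint f" "\<And>y. b < norm y \<Longrightarrow> f y = 0" and P: "D + b < P" "0 \<le> P"
 shows "(NN x. indicator (cball 0 D) x * (NN y. ennreal (norm (helm k 0 (x - y) * f y)))\<^sup>2)
   \<le> ennreal ((young_const k P)\<^sup>2 * (LBINT y. (norm (f y))\<^sup>2))"
  and "integrable lborel (\<lambda>x. indicator (cball 0 D) x * (norm (pot k f x))\<^sup>2)"
  and "integrable lborel (\<lambda>x. indicator (cball 0 D) x * (norm (dpot k i f x))\<^sup>2)"
  and "(LBINT x. indicator (cball 0 D) x * (norm (pot k f x))\<^sup>2) \<le> (young_const k P)\<^sup>2 * (LBINT y. (norm (f y))\<^sup>2)"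
proof -
 have c0: "0 \<le> sing_const k P" using k P by (simp add: sing_const_def)
 have S: "integrable lborel (\<lambda>z. sing_const k P * sing P z)" "\<And>z. 0 \<le> sing_const k P * sing P z"
  using c0 sing_nonneg by (auto intro: integrable_sing)
 have b: "norm (helm k 0 z) \<le> sing_const k P * sing P z" "norm (dhelm k 0 i z) \<le> sing_const k P * sing P z" if "z \<noteq> 0" "norm z < P" for z i
  using norm_helm_sing[OF that(2) k that(1)] by auto
 note y1 = kernel_young[OF helm_measurable S b(1) f P(1), folded pot_def young_const_def]
 note y2 = kernel_young[OF dhelm_measurable S b(2) f P(1), folded dpot_def young_const_def]
 show "(NN x. indicator (cball 0 D) x * (NN y. ennreal (norm (helm k 0 (x - y) * f y)))\<^sup>2)
   \<le> ennreal ((young_const k P)\<^sup>2 * (LBINT y. (norm (f y))\<^sup>2))" by (rule y1(1))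
 show "integrable lborel (\<lambda>x. indicator (cball 0 D) x * (norm (pot k f x))\<^sup>2)" by (rule y1(2))
 show "integrable lborel (\<lambda>x. indicator (cball 0 D) x * (norm (dpot k i f x))\<^sup>2)" by (rule y2(2))
 show "(LBINT x. indicator (cball 0 D) x * (norm (pot k f x))\<^sup>2) \<le> (young_const k P)\<^sup>2 * (LBINT y. (norm (f y))\<^sup>2)"
  by (rule y1(3))
qed

lemma L2locI:
 assumes "f \<in> borel_measurable borel" "\<And>D. integrable lborel (\<lambda>x. indicator (cball 0 D) x * (norm (f x))\<^sup>2)"
 shows "L2loc f"
 unfolding L2loc_def
proof (intro conjI allI impI)
 show "f \<in> borel_measurable lborel" using assms(1) by simp
 fix S :: "(real^3) set" assume S: "compact S"
 obtain D where D: "\<forall>x\<in>S. norm x \<le> D" using compact_imp_bounded[OF S] by (auto simp: bounded_iff)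
 have [measurable]: "f \<in> borel_measurable borel" by fact
 have Sm: "S \<in> sets borel" using S by (simp add: compact_imp_closed)
 show "set_integrable lborel S (\<lambda>x. (norm (f x))\<^sup>2)"
  unfolding set_integrable_def
 proof (rule integrable_bound[OF assms(2)[of D]])
  show "(\<lambda>x. indicator S x *\<^sub>R (norm (f x))\<^sup>2) \<in> borel_measurable lborel" using Sm by measurable
  show "AE x in lborel. norm (indicator S x *\<^sub>R (norm (f x))\<^sup>2) \<le> norm (indicator (cball 0 D) x * (norm (f x))\<^sup>2)"
   using D by (intro AE_I2) (auto simp: indicator_def)
 qed
qed

lemma pot_L2loc:
 assumes k: "0 \<le> k" and f: "sqint f" "\<And>y. b < norm y \<Longrightarrow> f y = 0"
 shows "L2loc (pot k f)" "L2loc (dpot k i f)"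
proof -
 have fm: "f \<in> borel_measurable borel" using f(1) by (simp add: sqint_def)
 have i: "integrable lborel (\<lambda>x. indicator (cball 0 D) x * (norm (pot k f x))\<^sup>2)"
  "integrable lborel (\<lambda>x. indicator (cball 0 D) x * (norm (dpot k i f x))\<^sup>2)" for D
  using pot_young(2,3)[OF k f, where P="\<bar>D\<bar> + \<bar>b\<bar> + 1" and D=D] by auto
 show "L2loc (pot k f)" by (rule L2locI[OF pot_measurable(1)[OF fm] i(1)])
 show "L2loc (dpot k i f)" by (rule L2locI[OF pot_measurable(2)[OF fm] i(2)])
qed

lemma pot_weak_helmholtz:
 assumes k: "0 \<le> k" and f: "sqint f" "\<And>y. b < norm y \<Longrightarrow> f y = 0"
 shows "weak_helmholtz (of_real (k\<^sup>2)) (pot k f) (\<lambda>i. dpot k i f) (\<lambda>\<phi>. (LBINT y. f y * \<phi> y))"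
 unfolding weak_helmholtz_def
proof (intro conjI allI impI)
 show "L1loc (pot k f)" "L1loc (dpot k i f)" for i
  using pot_L2loc[OF k f] by (auto intro: L2loc_imp_L1loc)
 have fi: "integrable lborel f" by (rule sqint_supp_integrable[OF f])
 have b: "norm y \<le> b" if "f y \<noteq> 0" for y using f(2)[of y] that by (auto simp: not_less[symmetric])
 have swap: "(LBINT x. pot k f x * \<theta> x) = (LBINT y. f y * (LBINT x. helm k 0 (x - y) * \<theta> x))"
   "(LBINT x. dpot k i f x * \<theta> x) = (LBINT y. f y * (LBINT x. dhelm k 0 i (x - y) * \<theta> x))"
   "integrable lborel (\<lambda>y. f y * (LBINT x. helm k 0 (x - y) * \<theta> x))"
   "integrable lborel (\<lambda>y. f y * (LBINT x. dhelm k 0 i (x - y) * \<theta> x))"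
  if t: "continuous_on UNIV \<theta>" "\<forall>x. norm (\<theta> x) \<le> M" "\<forall>x. D < norm x \<longrightarrow> \<theta> x = 0" for \<theta> M D i
 proof -
  note m = borel_measurable_continuous_onI[OF t(1)]
  note B = nn_kernel_test_bound[OF k m t(2)[rule_format] t(3)[rule_format] b]
  show "(LBINT x. pot k f x * \<theta> x) = (LBINT y. f y * (LBINT x. helm k 0 (x - y) * \<theta> x))"
   unfolding pot_def by (rule kernel_fubini(1)[OF helm_measurable fi m B(1)])
  show "integrable lborel (\<lambda>y. f y * (LBINT x. helm k 0 (x - y) * \<theta> x))"
   by (rule kernel_fubini(2)[OF helm_measurable fi m B(1)])
  show "(LBINT x. dpot k i f x * \<theta> x) = (LBINT y. f y * (LBINT x. dhelm k 0 i (x - y) * \<theta> x))"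
   unfolding dpot_def by (rule kernel_fubini(1)[OF dhelm_measurable fi m B(2)])
  show "integrable lborel (\<lambda>y. f y * (LBINT x. dhelm k 0 i (x - y) * \<theta> x))"
   by (rule kernel_fubini(2)[OF dhelm_measurable fi m B(2)])
 qed
 fix \<phi> :: "real^3 \<Rightarrow> complex" assume \<phi>: "test_fun \<phi>"
 obtain D M where B: "\<forall>x. norm (\<phi> x) \<le> M" "\<forall>i x. norm (pderiv_at i \<phi> x) \<le> M"
  "\<forall>x. D < norm x \<longrightarrow> \<phi> x = 0" "\<forall>i x. D < norm x \<longrightarrow> pderiv_at i \<phi> x = 0"
  using test_fun_bounded[OF \<phi>] by blast
 note s0 = swap[OF test_funD(2)[OF \<phi>] B(1,3)]
 note s1 = swap[OF C1_on_pderiv_continuous[OF test_funD(1)[OF \<phi>]] B(2)[THEN spec] B(4)[THEN spec]]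
 note w = fundamental_solution_weak[OF k \<phi>]
 show "(LBINT x. pot k f x * pderiv_at i \<phi> x) = - (LBINT x. dpot k i f x * \<phi> x)" for i
  unfolding s0 s1 w by simp
 have f\<phi>: "integrable lborel (\<lambda>y. f y * \<phi> y)"
  by (rule integrable_bound[OF integrable_mult_right[OF integrable_norm[OF fi], of M]])
   (use B(1) fi borel_measurable_continuous_onI[OF test_funD(2)[OF \<phi>]] in
    \<open>auto simp: norm_mult mult.commute intro!: borel_measurable_times mult_right_mono order_trans[OF _ abs_ge_self]\<close>)
 have "(\<Sum>i\<in>UNIV. (LBINT x. dpot k i f x * pderiv_at i \<phi> x)) = (\<Sum>i\<in>UNIV. (LBINT y. f y * (LBINT x. dhelm k 0 i (x - y) * pderiv_at i \<phi> x)))"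
  unfolding s1 ..
 also have "\<dots> = (LBINT y. (\<Sum>i\<in>UNIV. f y * (LBINT x. dhelm k 0 i (x - y) * pderiv_at i \<phi> x)))"
  by (rule integral_sum[symmetric]) (rule s1(4))
 also have "\<dots> = (LBINT y. of_real (k\<^sup>2) * (f y * (LBINT x. helm k 0 (x - y) * \<phi> x)) + f y * \<phi> y)"
  unfolding sum_distrib_left[symmetric] w(2) by (simp add: algebra_simps)
 also have "\<dots> = of_real (k\<^sup>2) * (LBINT x. pot k f x * \<phi> x) + (LBINT y. f y * \<phi> y)"
  unfolding s0 by (simp only: integral_add[OF integrable_mult_right[OF s0(3)] f\<phi>] integral_mult_right_zero)
 finally show "(\<Sum>i\<in>UNIV. (LBINT x. dpot k i f x * pderiv_at i \<phi> x)) = of_real (k\<^sup>2) * (LBINT x. pot k f x * \<phi> x) + (LBINT y. f y * \<phi> y)" .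
qed

lemma kernel_supp_integrable:
 fixes K :: "real^3 \<Rightarrow> complex"
 assumes f: "integrable lborel f" and m: "K \<in> borel_measurable borel" and L: "\<And>y. f y \<noteq> 0 \<Longrightarrow> norm (K (x - y)) \<le> L"
 shows "integrable lborel (\<lambda>y. K (x - y) * f y)"
proof (rule integrable_bound[OF integrable_mult_right[OF integrable_norm[OF f], of "\<bar>L\<bar>"]])
 have [measurable]: "f \<in> borel_measurable borel" using f by auto
 have [measurable]: "K \<in> borel_measurable borel" by fact
 show "(\<lambda>y. K (x - y) * f y) \<in> borel_measurable lborel" by measurable
 show "AE y in lborel. norm (K (x - y) * f y) \<le> norm (\<bar>L\<bar> * norm (f y))"
 proof (rule AE_I2)
  fix y
  show "norm (K (x - y) * f y) \<le> norm (\<bar>L\<bar> * norm (f y))"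
   using L[of y] by (cases "f y = 0") (auto simp: norm_mult intro!: mult_right_mono)
 qed
qed

definition lip :: "real \<Rightarrow> real \<Rightarrow> real" where
 "lip k \<delta> = 1 / (4 * pi * \<delta>\<^sup>2) + k / (4 * pi * \<delta>) + 1 / (4 * pi * \<delta>)"

lemma norm_kernel_away:
 assumes "0 \<le> k" "0 < \<delta>" "\<delta> \<le> norm z"
 shows "norm (helm k \<epsilon> z) \<le> lip k \<delta>" "norm (dhelm k \<epsilon> i z) \<le> lip k \<delta>"
proof -
 have z: "z \<noteq> 0" using assms by auto
 have m: "1 / (4 * pi * norm z) \<le> 1 / (4 * pi * \<delta>)" "k / (4 * pi * norm z) \<le> k / (4 * pi * \<delta>)" "1 / (4 * pi * (norm z)\<^sup>2) \<le> 1 / (4 * pi * \<delta>\<^sup>2)"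
  using assms by (auto intro!: divide_left_mono mult_left_mono power_mono mult_pos_pos)
 have p: "0 \<le> 1 / (4 * pi * \<delta>\<^sup>2)" "0 \<le> k / (4 * pi * \<delta>)" "0 \<le> 1 / (4 * pi * \<delta>)" using assms by auto
 show "norm (helm k \<epsilon> z) \<le> lip k \<delta>" using norm_helm_le[OF z, of k \<epsilon>] m p unfolding lip_def by linarith
 show "norm (dhelm k \<epsilon> i z) \<le> lip k \<delta>" using norm_dhelm_le[OF z assms(1), of \<epsilon> i] m p unfolding lip_def by linarith
qed

text \<open>
 Near a point of the open set the kernel stays away from its singularity on the support of \<open>f\<close>.
\<close>

lemma pot_C1:
 assumes k: "0 \<le> k" and f: "integrable lborel f" and Opn: "open S" and f0: "\<And>y. y \<in> S \<Longrightarrow> f y = 0"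
 shows "C1_on S (pot k f)" and "x \<in> S \<Longrightarrow> pderiv_at i (pot k f) x = dpot k i f x"
proof -
 have fm[measurable]: "f \<in> borel_measurable borel" using f by auto
 have away: "\<exists>\<delta>>0. \<forall>x\<in>ball x0 \<delta>. \<forall>y. f y \<noteq> 0 \<longrightarrow> \<delta> \<le> norm (x - y)" if "x0 \<in> S" for x0
 proof -
  obtain r where r: "r > 0" "ball x0 r \<subseteq> S" using Opn \<open>x0 \<in> S\<close> unfolding open_contains_ball by blast
  show ?thesis
  proof (intro exI[of _ "r / 2"] conjI ballI allI impI)
   fix x y assume x: "x \<in> ball x0 (r / 2)" and y: "f y \<noteq> 0"
   have "y \<notin> ball x0 r" using f0 r(2) y by blast
   then have "r \<le> dist x0 y" by simp
   also have "\<dots> \<le> dist x0 x + dist x y" by (rule dist_triangle)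
   finally show "r / 2 \<le> norm (x - y)" using x by (simp add: dist_norm)
  qed (use r in simp)
 qed
 have der: "(pot k f has_derivative grad_form (\<lambda>i. dpot k i f x0)) (at x0)" if x0: "x0 \<in> S" for x0
 proof -
  obtain \<delta> where \<delta>: "\<delta> > 0" "\<And>x y. x \<in> ball x0 \<delta> \<Longrightarrow> f y \<noteq> 0 \<Longrightarrow> \<delta> \<le> norm (x - y)"
   using away[OF x0] by blast
  have x0b: "x0 \<in> ball x0 \<delta>" using \<delta>(1) by simp
  have id: "integrable lborel (\<lambda>y. dhelm k 0 i (x0 - y) * f y)" for i
   by (rule kernel_supp_integrable[OF f dhelm_measurable]) (rule norm_kernel_away(2)[OF k \<delta>(1) \<delta>(2)[OF x0b]])
  have e: "grad_form (\<lambda>i. dhelm k 0 i (x0 - y)) h * f y = (\<Sum>i\<in>UNIV. h $ i *\<^sub>R (dhelm k 0 i (x0 - y) * f y))" for y h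
   by (simp add: grad_form_def sum_distrib_right)
  have "((\<lambda>x. LBINT y. helm k 0 (x - y) * f y) has_derivative (\<lambda>h. LBINT y. grad_form (\<lambda>i. dhelm k 0 i (x0 - y)) h * f y)) (at x0)"
  proof (rule has_derivative_integral[OF \<delta>(1), where w="\<lambda>y. 3 * lip k \<delta> * norm (f y)" and F'="\<lambda>x y h. grad_form (\<lambda>i. dhelm k 0 i (x - y)) h * f y"])
   show "integrable lborel (\<lambda>y. 3 * lip k \<delta> * norm (f y))" using f by simp
   show "integrable lborel (\<lambda>y. grad_form (\<lambda>i. dhelm k 0 i (x0 - y)) h * f y)" for h
    unfolding e by (intro integrable_sum integrable_scaleR_right id)
   fix x assume x: "x \<in> ball x0 \<delta>"
   show "integrable lborel (\<lambda>y. helm k 0 (x - y) * f y)"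
    by (rule kernel_supp_integrable[OF f helm_measurable]) (rule norm_kernel_away(1)[OF k \<delta>(1) \<delta>(2)[OF x]])
   fix y
   show "((\<lambda>x. helm k 0 (x - y) * f y) has_derivative (\<lambda>h. grad_form (\<lambda>i. dhelm k 0 i (x - y)) h * f y)) (at x)"
   proof (cases "f y = 0")
    case False
    then have "x - y \<noteq> 0" using \<delta>(2)[OF x False] \<delta>(1) by auto
    then have "(helm k 0 has_derivative grad_form (\<lambda>i. dhelm k 0 i (x - y))) (at (x - y))" by (intro helm_has_derivative) simp
    moreover have "((\<lambda>x. x - y) has_derivative (\<lambda>h. h)) (at x)" by (auto intro!: derivative_eq_intros)
    ultimately have "((\<lambda>x. helm k 0 (x - y)) has_derivative grad_form (\<lambda>i. dhelm k 0 i (x - y))) (at x)"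
     by (rule has_derivative_compose[rotated])
    then show ?thesis by (rule has_derivative_mult_left)
   qed simp
   show "norm (grad_form (\<lambda>i. dhelm k 0 i (x - y)) h * f y) \<le> 3 * lip k \<delta> * norm (f y) * norm h" for h
   proof (cases "f y = 0")
    case False
    have "norm (grad_form (\<lambda>i. dhelm k 0 i (x - y)) h) \<le> norm h * (\<Sum>i\<in>UNIV. norm (dhelm k 0 i (x - y)))" by (rule norm_grad_form_le)
    also have "\<dots> \<le> norm h * (\<Sum>i\<in>(UNIV::3 set). lip k \<delta>)"
     by (intro mult_left_mono sum_mono norm_kernel_away(2)[OF k \<delta>(1) \<delta>(2)[OF x False]]) auto
    finally have "norm (grad_form (\<lambda>i. dhelm k 0 i (x - y)) h) * norm (f y) \<le> (3 * lip k \<delta> * norm h) * norm (f y)"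
     by (intro mult_right_mono) (simp_all add: mult_ac)
    then show ?thesis by (simp add: norm_mult mult_ac)
   qed simp
  qed
  moreover have "(LBINT y. grad_form (\<lambda>i. dhelm k 0 i (x0 - y)) h * f y) = grad_form (\<lambda>i. dpot k i f x0) h" for h
   unfolding e by (subst integral_sum) (auto intro!: id simp: grad_form_def dpot_def)
  ultimately show ?thesis unfolding pot_def[abs_def] by (simp only:)
 qed
 show "x \<in> S \<Longrightarrow> pderiv_at i (pot k f) x = dpot k i f x" using pderiv_at_eq[OF der] by simp
 have "isCont (dpot k i f) x0" if x0: "x0 \<in> S" for i x0
 proof (rule continuous_at_sequentiallyI)
  fix X :: "nat \<Rightarrow> real^3" assume X: "X \<longlonglongrightarrow> x0"
  obtain \<delta> where \<delta>: "\<delta> > 0" "\<And>x y. x \<in> ball x0 \<delta> \<Longrightarrow> f y \<noteq> 0 \<Longrightarrow> \<delta> \<le> norm (x - y)"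
   using away[OF x0] by blast
  have "\<forall>\<^sub>F n in sequentially. X n \<in> ball x0 \<delta>"
   using X \<delta>(1) by (intro topological_tendstoD) auto
  then obtain N where N: "\<And>n. n \<ge> N \<Longrightarrow> X n \<in> ball x0 \<delta>" by (auto simp: eventually_sequentially)
  have "(\<lambda>n. dpot k i f (X (n + N))) \<longlonglongrightarrow> dpot k i f x0"
   unfolding dpot_def
  proof (rule integral_dominated_convergence[where w="\<lambda>y. lip k \<delta> * norm (f y)"])
   show "integrable lborel (\<lambda>y. lip k \<delta> * norm (f y))" using f by simp
   show "AE y in lborel. norm (dhelm k 0 i (X (n + N) - y) * f y) \<le> lip k \<delta> * norm (f y)" for n
   proof (rule AE_I2)
    fix y
    show "norm (dhelm k 0 i (X (n + N) - y) * f y) \<le> lip k \<delta> * norm (f y)"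
     using norm_kernel_away(2)[OF k \<delta>(1) \<delta>(2)[OF N]] by (cases "f y = 0") (auto simp: norm_mult intro!: mult_right_mono)
   qed
   show "AE y in lborel. (\<lambda>n. dhelm k 0 i (X (n + N) - y) * f y) \<longlonglongrightarrow> dhelm k 0 i (x0 - y) * f y"
   proof (rule AE_I2)
    fix y
    show "(\<lambda>n. dhelm k 0 i (X (n + N) - y) * f y) \<longlonglongrightarrow> dhelm k 0 i (x0 - y) * f y"
    proof (cases "f y = 0")
     case False
     then have "x0 - y \<noteq> 0" using \<delta>(2)[of x0 y] \<delta>(1) by auto
     then have "isCont (dhelm k 0 i) (x0 - y)"
      using dhelm_has_derivative[of 0 "x0 - y"] by (auto intro: has_derivative_continuous)
     moreover have "(\<lambda>n. X (n + N) - y) \<longlonglongrightarrow> x0 - y" by (intro tendsto_intros LIMSEQ_ignore_initial_segment X)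
     ultimately have "(\<lambda>n. dhelm k 0 i (X (n + N) - y)) \<longlonglongrightarrow> dhelm k 0 i (x0 - y)" by (rule isCont_tendsto_compose)
     then show ?thesis by (intro tendsto_intros)
    qed simp
   qed
  qed measurable
  then show "(\<lambda>n. dpot k i f (X n)) \<longlonglongrightarrow> dpot k i f x0" by (rule LIMSEQ_offset)
 qed
 then show "C1_on S (pot k f)"
  by (intro C1_onI[OF der] continuous_at_imp_continuous_on) auto
qed

section \<open>The radiation condition\<close>

text \<open>
 A constant for the radiation estimate that does not depend on the regularization parameter.
\<close>

definition rad :: "real \<Rightarrow> real \<Rightarrow> real" where
 "rad k b = (k * (2 * b + 1) + 1) / pi"

text \<open>
 Applying \<open>d/dr - \<i> k\<close> cancels the leading term: the phase gradient and the radial direction differ by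
 a term of order \<open>1 / norm x\<close>.
\<close>

lemma radiation_kernel:
 fixes x y :: "real^3"
 assumes k: "0 \<le> k" and y: "norm y \<le> b" and e: "0 \<le> \<epsilon>" "\<epsilon> \<le> 1" and x: "2 * (b + 1) \<le> norm x"
 shows "norm ((\<Sum>i\<in>UNIV. complex_of_real (x $ i / norm x) * dhelm k \<epsilon> i (x - y)) - \<i> * of_real k * helm k \<epsilon> (x - y)) \<le> rad k b / (norm x)\<^sup>2"
  and "norm (helm k \<epsilon> (x - y)) \<le> 1 / norm x"
proof -
 let ?d = "\<Sum>i\<in>UNIV. complex_of_real (x $ i / norm x) * dhelm k \<epsilon> i (x - y)"
 define r where "r = norm x"
 define t where "t = rho \<epsilon> (x - y)"
 define s where "s = (\<Sum>i\<in>UNIV. x $ i / norm x * (x - y) $ i)"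
 have b0: "0 \<le> b" using y norm_ge_zero order_trans by blast
 have r0: "0 < r" and rb: "2 * (b + 1) \<le> r" using x b0 by (auto simp: r_def)
 have "norm x \<le> norm (x - y) + norm y" using norm_triangle_ineq[of "x - y" y] by simp
 then have dl: "r - b \<le> norm (x - y)" using y by (simp add: r_def)
 have du: "norm (x - y) \<le> r + b" using norm_triangle_ineq4[of x y] y by (simp add: r_def)
 have tl: "norm (x - y) \<le> t" unfolding t_def by (rule norm_le_rho)
 have tu: "t \<le> norm (x - y) + 1" using rho_le[of \<epsilon> "x - y"] e by (simp add: t_def)
 have t2: "r / 2 \<le> t" and t0: "0 < t" using tl dl rb r0 b0 by auto
 have s1: "s = (x \<bullet> (x - y)) / norm x"
  unfolding s_def inner_vec_def sum_divide_distrib by (intro sum.cong refl) simp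
 have "\<bar>x \<bullet> (x - y)\<bar> \<le> norm x * norm (x - y)" by (rule Cauchy_Schwarz_ineq2)
 then have sa: "\<bar>s\<bar> \<le> norm (x - y)" unfolding s1 using r0 by (simp add: r_def abs_divide pos_divide_le_eq mult.commute)
 have s2: "s = r - (x \<bullet> y) / r"
 proof -
  have "x \<bullet> x = r * r" unfolding r_def power2_norm_eq_inner[symmetric] by (simp add: power2_eq_square)
  then show ?thesis unfolding s1 inner_diff_right r_def[symmetric] using r0 by (simp add: diff_divide_distrib)
 qed
 have "\<bar>x \<bullet> y\<bar> \<le> r * b"
  unfolding r_def by (rule order_trans[OF Cauchy_Schwarz_ineq2 mult_left_mono[OF y norm_ge_zero]])
 then have "\<bar>(x \<bullet> y) / r\<bar> \<le> b" using r0 by (simp add: abs_divide pos_divide_le_eq mult.commute)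
 then have st: "\<bar>s - t\<bar> \<le> 2 * b + 1" unfolding s2 using tl tu dl du by linarith
 have st': "\<bar>s\<bar> \<le> t" using sa tl by linarith
 define h where "h = hC k (of_real t)"
 have nh: "norm h = 1 / (4 * pi * t)" unfolding h_def by (rule norm_hC[OF t0])
 have q: "qC k (of_real t) = h * (\<i> * of_real k / of_real t - 1 / (of_real t)\<^sup>2)"
  unfolding h_def qC_def hC_def using t0 by (simp add: field_simps eval_nat_numeral)
 have sq: "?d = of_real s * qC k (of_real t)"
  unfolding dhelm_def s_def t_def[symmetric] of_real_sum sum_distrib_right by (intro sum.cong refl) simp
 have pure: "of_real s * (h * (\<i> * of_real k / of_real t - 1 / (of_real t)\<^sup>2)) - \<i> * of_real k * h
   = h * (\<i> * of_real (k * ((s - t) / t)) - of_real (s / t\<^sup>2))"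
  using t0 by (simp add: field_simps power2_eq_square)
 have "?d - \<i> * of_real k * helm k \<epsilon> (x - y)
   = h * (\<i> * of_real (k * ((s - t) / t)) - of_real (s / t\<^sup>2))"
  unfolding sq q helm_def t_def[symmetric] h_def[symmetric] by (rule pure)
 also have "norm \<dots> \<le> 1 / (4 * pi * t) * (k * ((2 * b + 1) / t) + 1 / t)"
  unfolding norm_mult nh
 proof (rule mult_left_mono)
  have "norm (\<i> * complex_of_real (k * ((s - t) / t)) - of_real (s / t\<^sup>2)) \<le> norm (\<i> * complex_of_real (k * ((s - t) / t))) + norm (complex_of_real (s / t\<^sup>2))"
   by (rule norm_triangle_ineq4)
  also have "\<dots> = k * (\<bar>s - t\<bar> / t) + \<bar>s\<bar> / t\<^sup>2"
   using k t0 by (simp only: norm_mult norm_ii norm_of_real) (simp add: abs_mult abs_divide)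
  also have "\<dots> \<le> k * ((2 * b + 1) / t) + t / t\<^sup>2"
   using k t0 st st' by (intro add_mono mult_left_mono divide_right_mono) auto
  finally show "norm (\<i> * complex_of_real (k * ((s - t) / t)) - of_real (s / t\<^sup>2)) \<le> k * ((2 * b + 1) / t) + 1 / t"
   using t0 by (simp add: power2_eq_square)
 qed (use t0 in simp)
 also have "\<dots> = (k * (2 * b + 1) + 1) / (4 * pi * t\<^sup>2)"
  using t0 by (simp add: field_simps power2_eq_square)
 also have "\<dots> \<le> (k * (2 * b + 1) + 1) / (pi * r\<^sup>2)"
 proof (rule divide_left_mono)
  have "(r / 2)\<^sup>2 \<le> t\<^sup>2" using t2 r0 by (intro power_mono) auto
  then have "r\<^sup>2 \<le> 4 * t\<^sup>2" by (simp add: power_divide)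
  then have "pi * r\<^sup>2 \<le> pi * (4 * t\<^sup>2)" by (intro mult_left_mono) auto
  then show "pi * r\<^sup>2 \<le> 4 * pi * t\<^sup>2" by simp
 qed (use k b0 r0 t0 in auto)
 also have "\<dots> = rad k b / (norm x)\<^sup>2" by (simp add: rad_def r_def)
 finally show "norm (?d - \<i> * of_real k * helm k \<epsilon> (x - y)) \<le> rad k b / (norm x)\<^sup>2" .
 have "norm (helm k \<epsilon> (x - y)) = 1 / (4 * pi * t)" unfolding helm_def t_def[symmetric] using nh by (simp add: h_def)
 also have "\<dots> \<le> 1 / (1 * r)"
 proof (rule divide_left_mono)
  have "2 \<le> 4 * pi" using pi_gt3 by simp
  then have "2 * t \<le> 4 * pi * t" using t0 by (intro mult_right_mono) auto
  then show "1 * r \<le> 4 * pi * t" using t2 by linarith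
 qed (use r0 t0 in auto)
 finally show "norm (helm k \<epsilon> (x - y)) \<le> 1 / norm x" by (simp add: r_def)
qed

lemma pot_radiation:
 assumes k: "0 \<le> k" and f: "integrable lborel f" and b: "\<And>y. b < norm y \<Longrightarrow> f y = 0" "0 \<le> b" and x: "2 * (b + 1) \<le> norm x"
 shows "norm (rderiv (pot k f) x - \<i> * of_real k * pot k f x) \<le> rad k b / (norm x)\<^sup>2 * (LBINT y. norm (f y))"
proof -
 let ?S = "{x::real^3. b < norm x}"
 have xS: "x \<in> ?S" using x b(2) by simp
 have C1: "C1_on ?S (pot k f)" and pd: "pderiv_at i (pot k f) x = dpot k i f x" for i
  using pot_C1[OF k f open_exterior b(1)] xS by auto
 have away: "1 \<le> norm (x - y)" if "f y \<noteq> 0" for y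
 proof -
  have "norm y \<le> b" using b(1)[of y] that by (auto simp: not_less[symmetric])
  moreover have "norm x \<le> norm (x - y) + norm y" using norm_triangle_ineq[of "x - y" y] by simp
  moreover have "2 * b + 2 \<le> norm x" using x by simp
  ultimately show ?thesis using b(2) by linarith
 qed
 have ih: "integrable lborel (\<lambda>y. helm k 0 (x - y) * f y)"
  by (rule kernel_supp_integrable[OF f helm_measurable]) (rule norm_kernel_away(1)[OF k zero_less_one away])
 have id: "integrable lborel (\<lambda>y. dhelm k 0 i (x - y) * f y)" for i
  by (rule kernel_supp_integrable[OF f dhelm_measurable]) (rule norm_kernel_away(2)[OF k zero_less_one away])
 let ?\<kappa> = "\<lambda>y. (\<Sum>i\<in>UNIV. complex_of_real (x $ i / norm x) * dhelm k 0 i (x - y)) - \<i> * of_real k * helm k 0 (x - y)"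
 have e: "?\<kappa> y * f y = (\<Sum>i\<in>UNIV. complex_of_real (x $ i / norm x) * (dhelm k 0 i (x - y) * f y)) - \<i> * of_real k * (helm k 0 (x - y) * f y)" for y
  unfolding left_diff_distrib sum_distrib_right by (simp only: mult.assoc)
 have i1: "integrable lborel (\<lambda>y. \<Sum>i\<in>UNIV. complex_of_real (x $ i / norm x) * (dhelm k 0 i (x - y) * f y))"
  by (intro integrable_sum integrable_mult_right id)
 have ie: "integrable lborel (\<lambda>y. ?\<kappa> y * f y)"
  unfolding e by (intro integrable_diff i1 integrable_mult_right ih)
 have "rderiv (pot k f) x - \<i> * of_real k * pot k f x = (LBINT y. ?\<kappa> y * f y)"
  unfolding e integral_diff[OF i1 integrable_mult_right[OF ih]] integral_sum[OF integrable_mult_right[OF id]] integral_mult_right_zero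
  by (simp add: rderiv_sum[OF C1_on_differentiable[OF C1 xS]] pd dpot_def pot_def)
 also have "norm \<dots> \<le> (LBINT y. rad k b / (norm x)\<^sup>2 * norm (f y))"
 proof (rule integral_norm_bound_integral[OF ie])
  show "integrable lborel (\<lambda>y. rad k b / (norm x)\<^sup>2 * norm (f y))" using f by simp
  show "norm (?\<kappa> y * f y) \<le> rad k b / (norm x)\<^sup>2 * norm (f y)" for y
  proof (cases "f y = 0")
   case False
   then have "norm y \<le> b" using b(1)[of y] by (auto simp: not_less[symmetric])
   from radiation_kernel(1)[OF k this _ _ x, of 0] show ?thesis by (simp only: norm_mult) (rule mult_right_mono, auto)
  qed simp
 qed
 finally show ?thesis by simp
qed

lemma S2_integral_bound:
 fixes F :: "real^3 \<Rightarrow> real"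
 assumes "\<And>w. norm w = 1 \<Longrightarrow> 0 \<le> F w" "\<And>w. norm w = 1 \<Longrightarrow> F w \<le> c"
 shows "0 \<le> (\<integral>w. F w \<partial>S2_measure)" "(\<integral>w. F w \<partial>S2_measure) \<le> c * (4 * pi)"
proof -
 have "norm (axis 1 1 :: real^3) = 1" by simp
 then have c0: "0 \<le> c" using assms[of "axis 1 1"] by linarith
 show "0 \<le> (\<integral>w. F w \<partial>S2_measure)"
  using assms by (intro integral_nonneg_AE AE_I2) (simp add: space_S2_measure)
 show "(\<integral>w. F w \<partial>S2_measure) \<le> c * (4 * pi)"
 proof (cases "integrable S2_measure F")
  case True
  have "(\<integral>w. F w \<partial>S2_measure) \<le> (\<integral>w. c \<partial>S2_measure)"
   using True assms by (intro integral_mono_AE AE_I2) (auto simp: space_S2_measure)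
  then show ?thesis by (simp add: measure_S2_total mult.commute)
 next
  case False
  then show ?thesis using c0 by (simp add: not_integrable_integral_eq)
 qed
qed

lemma pot_sommerfeld:
 assumes k: "0 \<le> k" and f: "integrable lborel f" and b: "\<And>y. b < norm y \<Longrightarrow> f y = 0" "0 \<le> b"
 shows "sommerfeld k (pot k f)"
 unfolding sommerfeld_def
proof (rule tendsto_sandwich[OF _ _ tendsto_const])
 define C where "C = rad k b * (LBINT y. norm (f y))"
 let ?F = "\<lambda>y. (norm (rderiv (pot k f) y - \<i> * of_real k * pot k f y))\<^sup>2"
 have pos: "0 \<le> (\<integral>w. ?F (R *\<^sub>R w) \<partial>S2_measure)" for R
  by (intro integral_nonneg) simp
 have bnd: "(\<integral>w. ?F (R *\<^sub>R w) \<partial>S2_measure) \<le> (C / R\<^sup>2)\<^sup>2 * (4 * pi)" if R: "2 * (b + 1) \<le> R" for R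
 proof (rule S2_integral_bound(2))
  fix w :: "real^3" assume w: "norm w = 1"
  have nR: "norm (R *\<^sub>R w) = R" using w R b(2) by simp
  show "?F (R *\<^sub>R w) \<le> (C / R\<^sup>2)\<^sup>2"
   using pot_radiation[OF k f b, of "R *\<^sub>R w"] R unfolding nR by (intro power_mono) (auto simp: C_def)
 qed simp
 show "\<forall>\<^sub>F R in at_top. 0 \<le> sphere_integral R ?F"
  unfolding sphere_integral_def by (intro always_eventually allI) (use pos in simp)
 show "\<forall>\<^sub>F R in at_top. sphere_integral R ?F \<le> R\<^sup>2 * ((C / R\<^sup>2)\<^sup>2 * (4 * pi))"
  using eventually_ge_at_top[of "2 * (b + 1)"]
  by eventually_elim (unfold sphere_integral_def real_scaleR_def, rule mult_left_mono[OF bnd], auto)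
 have "((\<lambda>R::real. (C\<^sup>2 * (4 * pi)) * (R\<^sup>2 * (1 / R\<^sup>2)\<^sup>2)) \<longlongrightarrow> (C\<^sup>2 * (4 * pi)) * 0) at_top"
  by (intro tendsto_mult tendsto_const) real_asymp
 moreover have "(C\<^sup>2 * (4 * pi)) * (R\<^sup>2 * (1 / R\<^sup>2)\<^sup>2) = R\<^sup>2 * ((C / R\<^sup>2)\<^sup>2 * (4 * pi))" for R :: real
  by (simp only: power_divide power_one) simp
 ultimately show "((\<lambda>R. R\<^sup>2 * ((C / R\<^sup>2)\<^sup>2 * (4 * pi))) \<longlongrightarrow> 0) at_top"
  by (simp only: mult_zero_right)
qed

section \<open>Positivity of the imaginary part of the potential operator\<close>

interpretation R3_S2: pair_sigma_finite "lborel :: (real^3) measure" S2_measure ..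

lemma plane_wave_pair_measurable: "(\<lambda>p. plane_wave k (snd p) (fst p)) \<in> borel_measurable ((lborel :: (real^3) measure) \<Otimes>\<^sub>M S2_measure)"
proof -
 have 1: "snd \<in> borel_measurable ((lborel :: (real^3) measure) \<Otimes>\<^sub>M S2_measure)"
  using measurable_compose[OF measurable_snd[of "lborel :: (real^3) measure" S2_measure] id_S2_measurable] by simp
 have 2: "fst \<in> borel_measurable ((lborel :: (real^3) measure) \<Otimes>\<^sub>M S2_measure)"
  using measurable_fst[of "lborel :: (real^3) measure" S2_measure] by simp
 have "(\<lambda>p. fst p \<bullet> snd p) \<in> borel_measurable ((lborel :: (real^3) measure) \<Otimes>\<^sub>M S2_measure)"
  by (rule borel_measurable_inner[OF 2 1])
 then show ?thesis unfolding plane_wave_def by measurable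
qed

lemma plane_wave_fubini:
 assumes a: "integrable lborel a" and c: "c \<in> borel_measurable S2_measure" "\<And>w. w \<in> space S2_measure \<Longrightarrow> norm (c w) \<le> M"
 shows "(LBINT x. a x * (\<integral>w. plane_wave k w x * c w \<partial>S2_measure)) = (\<integral>w. c w * (LBINT x. a x * plane_wave k w x) \<partial>S2_measure)"
proof -
 let ?h = "\<lambda>x w. a x * (plane_wave k w x * c w)"
 have am: "a \<in> borel_measurable lborel" using a by auto
 have hm: "case_prod ?h \<in> borel_measurable ((lborel :: (real^3) measure) \<Otimes>\<^sub>M S2_measure)"
  unfolding case_prod_beta
  by (intro borel_measurable_times measurable_compose[OF measurable_fst am] measurable_compose[OF measurable_snd c(1)] plane_wave_pair_measurable)
 have b: "norm (?h x w) \<le> \<bar>M\<bar> * norm (a x)" if "w \<in> space S2_measure" for x w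
  using mult_right_mono[OF order_trans[OF c(2)[OF that] abs_ge_self] norm_ge_zero[of "a x"]] by (simp add: norm_mult mult.commute)
 have "(\<integral>\<^sup>+p. ennreal (norm (case_prod ?h p)) \<partial>((lborel :: (real^3) measure) \<Otimes>\<^sub>M S2_measure)) = (NN x. \<integral>\<^sup>+w. ennreal (norm (?h x w)) \<partial>S2_measure)"
  by (subst S2.nn_integral_fst[symmetric]) (use hm in auto)
 also have "\<dots> \<le> (NN x. ennreal (\<bar>M\<bar> * norm (a x)) * ennreal (4 * pi))"
 proof (rule nn_integral_mono)
  fix x
  have "(\<integral>\<^sup>+w. ennreal (norm (?h x w)) \<partial>S2_measure) \<le> (\<integral>\<^sup>+w. ennreal (\<bar>M\<bar> * norm (a x)) \<partial>(S2_measure :: (real^3) measure))"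
   using b by (intro nn_integral_mono ennreal_leI) auto
  then show "(\<integral>\<^sup>+w. ennreal (norm (?h x w)) \<partial>S2_measure) \<le> ennreal (\<bar>M\<bar> * norm (a x)) * ennreal (4 * pi)"
   by (simp add: emeasure_S2_total)
 qed
 also have "\<dots> = (NN x. ennreal (norm (\<bar>M\<bar> * norm (a x)))) * ennreal (4 * pi)"
  using am by (subst nn_integral_multc) auto
 also have "\<dots> < \<infinity>"
 proof -
  have "(NN x. ennreal (norm (\<bar>M\<bar> * norm (a x)))) < \<infinity>"
   using integrable_mult_right[OF integrable_norm[OF a], of "\<bar>M\<bar>"] unfolding integrable_iff_bounded by blast
  moreover have "ennreal (4 * pi) < \<infinity>" by simp
  ultimately show ?thesis unfolding infinity_ennreal_def ennreal_mult_less_top by blast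
 qed
 finally have int: "integrable ((lborel :: (real^3) measure) \<Otimes>\<^sub>M S2_measure) (case_prod ?h)"
  using hm by (intro integrableI_bounded)
 have 1: "(\<integral>w. ?h x w \<partial>S2_measure) = a x * (\<integral>w. plane_wave k w x * c w \<partial>S2_measure)" for x
  by (rule integral_mult_right_zero)
 have 2: "(LBINT x. ?h x w) = c w * (LBINT x. a x * plane_wave k w x)" for w
  unfolding integral_mult_right_zero[symmetric] by (intro integral_cong refl) (simp add: mult_ac)
 show ?thesis using R3_S2.Fubini_integral[OF int] unfolding 1 2 by simp
qed

text \<open>
 By the plane wave expansion of the imaginary part of the kernel, the quadratic form is an integral of
 \<open>norm (\<integral> f * cnj (plane_wave k w))\<^sup>2\<close> over the directions \<open>w\<close>.
\<close>

lemma pot_positive: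
 assumes k: "0 < k" and f: "sqint f" "\<And>y. b < norm y \<Longrightarrow> f y = 0" and b0: "0 \<le> b"
 shows "0 \<le> Im (LBINT x. pot k f x * cnj (f x))"
proof -
 have k0: "0 \<le> k" using k by simp
 let ?F = "\<lambda>w. LBINT y. f y * cnj (plane_wave k w y)" and ?c = "2 * \<i> * of_real (k / (16 * pi\<^sup>2))"
 let ?H = "\<lambda>x. \<integral>w. plane_wave k w x * ?F w \<partial>S2_measure" and ?p = "\<lambda>z. \<integral>w. plane_wave k w z \<partial>S2_measure"
 have fm[measurable]: "f \<in> borel_measurable borel" using f(1) by (simp add: sqint_def)
 have fi: "integrable lborel f" by (rule sqint_supp_integrable[OF f])
 have Fm: "(\<lambda>w. ?F w) \<in> borel_measurable S2_measure"
 proof (rule lborel.borel_measurable_lebesgue_integral)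
  have "(\<lambda>p. plane_wave k (fst p) (snd p)) \<in> borel_measurable (S2_measure \<Otimes>\<^sub>M (lborel :: (real^3) measure))"
   using measurable_compose[OF measurable_pair_swap'[of S2_measure "lborel :: (real^3) measure"] plane_wave_pair_measurable[of k]]
   by (simp add: case_prod_beta)
  then show "(\<lambda>(w, y). f y * cnj (plane_wave k w y)) \<in> borel_measurable (S2_measure \<Otimes>\<^sub>M (lborel :: (real^3) measure))"
   unfolding case_prod_beta
   by (intro borel_measurable_times borel_measurable_cnj measurable_compose[OF measurable_snd]) auto
 qed
 let ?P = "\<lambda>x y. helm k 0 (x - y) * f y * cnj (f x)"
 have Pm: "case_prod ?P \<in> borel_measurable (lborel \<Otimes>\<^sub>M lborel)" by measurable
 let ?n = "\<lambda>x. (NN y. ennreal (norm (helm k 0 (x - y) * f y)))"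
 have "(\<integral>\<^sup>+p. ennreal (norm (case_prod ?P p)) \<partial>(lborel \<Otimes>\<^sub>M lborel)) = (NN x. (NN y. ennreal (norm (?P x y))))"
  by (subst lborel.nn_integral_fst[symmetric]) (use Pm in auto)
 also have "\<dots> \<le> (NN x. ennreal ((norm (f x))\<^sup>2) + indicator (cball 0 b) x * (?n x)\<^sup>2)"
 proof (rule nn_integral_mono)
  fix x
  have "(NN y. ennreal (norm (?P x y))) = (NN y. ennreal (norm (helm k 0 (x - y) * f y)) * ennreal (norm (f x)))"
   by (intro nn_integral_cong) (simp add: ennreal_mult[symmetric] norm_mult)
  also have "\<dots> = ?n x * ennreal (norm (f x))" by (rule nn_integral_multc) measurable
  finally have e: "(NN y. ennreal (norm (?P x y))) = ?n x * ennreal (norm (f x))" .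
  show "(NN y. ennreal (norm (?P x y))) \<le> ennreal ((norm (f x))\<^sup>2) + indicator (cball 0 b) x * (?n x)\<^sup>2"
  proof (cases "b < norm x")
   case False
   have ab: "p * q \<le> q\<^sup>2 + p\<^sup>2" for p q :: ennreal
   proof (cases "p \<le> q")
    case True
    then have "p * q \<le> q * q" by (rule mult_right_mono) simp
    then show ?thesis by (simp add: power2_eq_square add_increasing2)
   next
    case False
    then have "p * q \<le> p * p" by (intro mult_left_mono) auto
    then show ?thesis by (simp add: power2_eq_square add_increasing)
   qed
   show ?thesis unfolding e using ab[of "?n x" "ennreal (norm (f x))"] False by (simp add: ennreal_power)
  qed (simp add: e f(2))
 qed
 also have "\<dots> = (NN x. ennreal ((norm (f x))\<^sup>2)) + (NN x. indicator (cball 0 b) x * (?n x)\<^sup>2)"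
  by (rule nn_integral_add) measurable
 also have "\<dots> < \<infinity>"
 proof -
  have "(NN x. ennreal ((norm (f x))\<^sup>2)) < \<infinity>"
   using f(1) by (simp add: sqint_def integrable_iff_bounded)
  moreover have "(NN x. indicator (cball 0 b) x * (?n x)\<^sup>2) < \<infinity>"
   by (rule le_less_trans[OF pot_young(1)[OF k0 f(1), where b=b and D=b and P="2 * b + 1"]]) (use f(2) b0 in \<open>auto simp: ennreal_less_top\<close>)
  ultimately show ?thesis by simp
 qed
 finally have int: "integrable (lborel \<Otimes>\<^sub>M lborel) (case_prod ?P)"
  using Pm by (intro integrableI_bounded)
 define I where "I = (LBINT x. pot k f x * cnj (f x))"
 have I1: "I = (LBINT x. (LBINT y. ?P x y))"
  unfolding I_def pot_def by (simp only: integral_mult_left_zero)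
 have I2: "I = (LBINT x. (LBINT y. ?P y x))"
  using lborel_pair.Fubini_integral[OF int] I1 by simp
 have even: "helm k 0 (y - x) = helm k 0 (x - y)" for x y by (simp add: helm_def norm_minus_commute)
 have "I - cnj I = (LBINT x. (LBINT y. ?P x y)) - (LBINT x. (LBINT y. cnj (?P y x)))"
  using I1 I2 by (simp only: integral_cnj)
 also have "\<dots> = (LBINT x. (LBINT y. ?P x y) - (LBINT y. cnj (?P y x)))"
 proof (rule integral_diff[symmetric])
  show "integrable lborel (\<lambda>x. (LBINT y. ?P x y))" using lborel_pair.integrable_fst[OF int] by simp
  have "integrable lborel (\<lambda>x. (LBINT y. ?P y x))" using lborel_pair.integrable_snd[OF int] by simp
  then show "integrable lborel (\<lambda>x. (LBINT y. cnj (?P y x)))" by (simp only: integral_cnj integrable_cnj)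
 qed
 also have "\<dots> = (LBINT x. ?c * (cnj (f x) * ?H x))"
 proof (rule integral_cong_AE)
  have A1: "AE x in lborel. integrable lborel (\<lambda>y. ?P x y)"
   using lborel_pair.AE_integrable_fst[OF int] by simp
  have A2: "AE x in lborel. integrable lborel (\<lambda>y. ?P y x)"
   using lborel_pair.AE_integrable_snd[OF int] by simp
  show "AE x in lborel. (LBINT y. ?P x y) - (LBINT y. cnj (?P y x)) =
    ?c * (cnj (f x) * ?H x)"
   using A1 A2
  proof eventually_elim
   case (elim x)
   have "(LBINT y. ?P x y) - (LBINT y. cnj (?P y x)) = (LBINT y. ?P x y - cnj (?P y x))"
    by (rule integral_diff[symmetric, OF elim(1) integrable_cnj[OF elim(2)]])
   also have "\<dots> = (LBINT y. (?c * cnj (f x)) * (f y * ?p (x - y)))"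
   proof (rule integral_cong_AE)
    have "AE y in lborel. y \<noteq> x" by (rule AE_lborel_singleton)
    then show "AE y in lborel. ?P x y - cnj (?P y x) = (?c * cnj (f x)) * (f y * ?p (x - y))"
    proof eventually_elim
     case (elim y)
     then have nz: "x - y \<noteq> 0" by simp
     have "?P x y - cnj (?P y x) = (helm k 0 (x - y) - cnj (helm k 0 (x - y))) * (f y * cnj (f x))"
      unfolding even[of y x] by (simp add: algebra_simps)
     then show ?case unfolding im_fundamental_eq_plane_wave_mean[OF k nz] by (simp add: mult_ac)
    qed
    show "(\<lambda>y. ?P x y - cnj (?P y x)) \<in> borel_measurable lborel" by measurable
    have "(\<lambda>y. \<integral>w. plane_wave k w (x - y) \<partial>S2_measure) \<in> borel_measurable borel"
    proof (rule S2.borel_measurable_lebesgue_integral[where N=borel])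
     have "(\<lambda>p. plane_wave k (snd p) (fst p)) \<in> borel_measurable (borel \<Otimes>\<^sub>M S2_measure)"
      using plane_wave_pair_measurable[of k] by (simp cong: measurable_cong_sets sets_pair_measure_cong)
     from measurable_compose[OF measurable_Pair[OF measurable_compose[OF measurable_fst[of borel S2_measure], of "\<lambda>y. x - y" borel] measurable_snd] this]
     show "(\<lambda>(y, w). plane_wave k w (x - y)) \<in> borel_measurable (borel \<Otimes>\<^sub>M S2_measure)"
      by (simp add: case_prod_beta)
    qed
    then show "(\<lambda>y. (?c * cnj (f x)) * (f y * ?p (x - y))) \<in> borel_measurable lborel"
     by (intro borel_measurable_times) auto
   qed
   also have "\<dots> = (?c * cnj (f x)) * (LBINT y. f y * ?p (x - y))"
    by (rule integral_mult_right_zero)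
   also have "(LBINT y. f y * ?p (x - y)) =
     ?H x"
   proof -
    have pw: "plane_wave k w (x - y) = plane_wave (- k) w y * plane_wave k w x" "cnj (plane_wave k w y) = plane_wave (- k) w y" for w y
     unfolding plane_wave_def by (simp_all add: inner_diff_left exp_add[symmetric] algebra_simps exp_cnj)
    show ?thesis unfolding pw
     by (rule plane_wave_fubini[OF fi, where M=1]) (auto intro!: continuous_sphere_measurable continuous_intros simp: plane_wave_def)
   qed
   finally show ?case by (simp add: mult.assoc)
  qed
  have m1: "(\<lambda>x. (LBINT y. ?P x y)) \<in> borel_measurable borel"
   by (rule lborel.borel_measurable_lebesgue_integral[where N=borel]) measurable
  have m2: "(\<lambda>x. (LBINT y. cnj (?P y x))) \<in> borel_measurable borel"
   by (rule lborel.borel_measurable_lebesgue_integral[where N=borel]) measurable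
  show "(\<lambda>x. (LBINT y. ?P x y) - (LBINT y. cnj (?P y x))) \<in> borel_measurable lborel"
   using borel_measurable_diff[OF m1 m2] by simp
  have "(\<lambda>x. \<integral>w. plane_wave k w x * ?F w \<partial>S2_measure) \<in> borel_measurable (lborel :: (real^3) measure)"
   by (rule S2.borel_measurable_lebesgue_integral)
    (unfold case_prod_beta, intro borel_measurable_times plane_wave_pair_measurable measurable_compose[OF measurable_snd Fm])
  then show "(\<lambda>x. ?c * (cnj (f x) * ?H x)) \<in> borel_measurable lborel"
   by (intro borel_measurable_times borel_measurable_cnj) auto
 qed
 also have "\<dots> = ?c * (LBINT x. cnj (f x) * ?H x)"
  by (rule integral_mult_right_zero)
 also have "(LBINT x. cnj (f x) * ?H x) =
  of_real (\<integral>w. (norm (?F w))\<^sup>2 \<partial>S2_measure)"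
 proof -
  have Fb: "norm (?F w) \<le> (LBINT y. norm (f y))" for w
   using integral_norm_bound[of lborel "\<lambda>y. f y * cnj (plane_wave k w y)"] by (simp add: norm_mult)
  have "(LBINT x. cnj (f x) * ?H x) = (\<integral>w. ?F w * (LBINT x. cnj (f x) * plane_wave k w x) \<partial>S2_measure)"
   by (rule plane_wave_fubini[OF _ Fm Fb]) (use fi in simp)
  also have "\<dots> = (\<integral>w. ?F w * cnj (?F w) \<partial>S2_measure)"
   by (simp flip: integral_cnj)
  finally show ?thesis by (simp only: cinner_self_aux)
 qed
 finally have "I - cnj I = 2 * \<i> * of_real (k / (16 * pi\<^sup>2) * (\<integral>w. (norm (?F w))\<^sup>2 \<partial>S2_measure))"
  by simp
 then have "Im (I - cnj I) = Im (2 * \<i> * of_real (k / (16 * pi\<^sup>2) * (\<integral>w. (norm (?F w))\<^sup>2 \<partial>S2_measure)))"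
  by (simp only:)
 then have "Im I = k / (16 * pi\<^sup>2) * (\<integral>w. (norm (?F w))\<^sup>2 \<partial>S2_measure)" by simp
 also have "\<dots> \<ge> 0" using k by (intro mult_nonneg_nonneg integral_nonneg) auto
 finally show ?thesis unfolding I_def .
qed

section \<open>Radiating solutions in the whole space vanish\<close>

lemma test_fun_annulus_mult:
 assumes v: "C1_on {x. a < norm x} v" and h: "C1_on UNIV h" "\<And>x. norm x \<le> m \<Longrightarrow> h x = 0" "\<And>x. D < norm x \<Longrightarrow> h x = 0" and am: "a < m"
 shows "test_fun (\<lambda>x. v x * h x)" "pderiv_at i (\<lambda>x. v x * h x) x = v x * pderiv_at i h x + pderiv_at i v x * h x"
proof -
 have th: "test_fun h" by (rule test_funI[OF h(1,3)])
 have "{x. h x \<noteq> 0} \<subseteq> {x. m \<le> norm x}" using h(2) by (force simp: not_le[symmetric])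
 then have "closure {x. h x \<noteq> 0} \<subseteq> {x. m \<le> norm x}"
  by (intro closure_minimal closed_Collect_le continuous_intros)
 then have cl: "closure {x. h x \<noteq> 0} \<subseteq> {x. a < norm x}" using am by auto
 show "test_fun (\<lambda>x. v x * h x)" "pderiv_at i (\<lambda>x. v x * h x) x = v x * pderiv_at i h x + pderiv_at i v x * h x"
  by (rule test_fun_mult_C1_on[OF th v open_exterior cl])+
qed

lemma continuous_flux:
 assumes "C1_on {x. a < norm x} u" "0 \<le> a"
 shows "continuous_on {x. a < norm x} (\<lambda>x. rderiv u x * cnj (u x))"
 using assms(2) by (intro continuous_intros continuous_rderiv[OF assms(1)] C1_on_continuous[OF assms(1)]) auto

text \<open>
 The solution itself, conjugated, is used as a test function on the annulus between the two shells; all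
 volume terms are real, so the imaginary part of the flux is conserved.
\<close>

lemma flux_shells:
 fixes u :: "real^3 \<Rightarrow> complex"
 assumes w: "weak_helmholtz (of_real \<kappa>) u g (\<lambda>\<phi>. 0)" and ext: "C1_on {x. a < norm x} u" and a: "0 \<le> a"
  and 1: "0 < \<delta>" "a < R - \<delta>" and 2: "0 < \<delta>'" "a < R' - \<delta>'"
 shows "(LBINT x. shell R \<delta> (norm x) *\<^sub>R complex_of_real (Im (rderiv u x * cnj (u x))))
    = (LBINT x. shell R' \<delta>' (norm x) *\<^sub>R complex_of_real (Im (rderiv u x * cnj (u x))))"
proof -
 let ?h = "\<lambda>x. cutoff R \<delta> x + (- 1) * cutoff R' \<delta>' x"
 let ?\<theta> = "\<lambda>x. cnj (u x) * ?h x"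
 define m where "m = min (R - \<delta>) (R' - \<delta>')"
 define D where "D = max (R + \<delta>) (R' + \<delta>')"
 have \<delta>: "0 < \<delta>" "\<delta> < R" "0 < \<delta>'" "\<delta>' < R'" using 1 2 a by auto
 note c = cutoff_C1[OF \<delta>(1,2)] cutoff_C1[OF \<delta>(3,4)]
 have c2: "C1_on UNIV (\<lambda>x. (- 1) * cutoff R' \<delta>' x)" by (rule C1_on_mult[OF C1_on_const c(3)])
 have hC: "C1_on UNIV ?h" by (rule C1_on_add[OF c(1) c2])
 have h0: "?h x = 0" if "norm x \<le> m" for x using that \<delta> by (simp add: m_def cutoff_eq_1)
 have hD: "?h x = 0" if "D < norm x" for x using that \<delta> by (simp add: D_def cutoff_eq_0)
 have am: "a < m" using 1 2 by (simp add: m_def)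
 have pz: "pderiv_at i (\<lambda>x. (- 1 :: complex)) x = 0" for i x by (rule trans[OF pderiv_at_eq[OF has_derivative_const]]) simp
 have ph: "pderiv_at i ?h x = of_real (shell R' \<delta>' (norm x) - shell R \<delta> (norm x)) * of_real (x $ i / norm x)" for i x
 proof -
  have "pderiv_at i ?h x = pderiv_at i (cutoff R \<delta>) x + pderiv_at i (\<lambda>x. (- 1) * cutoff R' \<delta>' x) x"
   by (rule pderiv_at_add[OF C1_on_differentiable[OF c(1) UNIV_I] C1_on_differentiable[OF c2 UNIV_I]])
  also have "pderiv_at i (\<lambda>x. (- 1) * cutoff R' \<delta>' x) x = (- 1) * pderiv_at i (cutoff R' \<delta>') x + pderiv_at i (\<lambda>x. - 1) x * cutoff R' \<delta>' x"
   by (rule pderiv_at_mult[OF C1_on_differentiable[OF C1_on_const UNIV_I] C1_on_differentiable[OF c(3) UNIV_I]])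
  finally show ?thesis unfolding pz c(2) c(4) by (simp add: scaleR_conv_of_real algebra_simps)
 qed
 note \<theta> = test_fun_annulus_mult[OF C1_on_cnj[OF ext] hC h0 hD am]
 note Lu = weak_helmholtzD(1)[OF w] and Lg = weak_helmholtzD(2)[OF w]
 note ig = L1loc_test_fun(2)[OF Lg \<theta>(1)] and iu = L1loc_test_fun(1)[OF Lu \<theta>(1)]
 let ?X = "\<lambda>x. (\<Sum>i\<in>UNIV. g i x * pderiv_at i ?\<theta> x) - of_real \<kappa> * (u x * ?\<theta> x)"
 have iX: "integrable lborel ?X"
  by (intro integrable_diff integrable_sum ig integrable_mult_right iu)
 have "(LBINT x. ?X x) = (\<Sum>i\<in>UNIV. (LBINT x. g i x * pderiv_at i ?\<theta> x)) - of_real \<kappa> * (LBINT x. u x * ?\<theta> x)"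
  by (simp only: integral_diff[OF integrable_sum[OF ig] integrable_mult_right[OF iu]] integral_sum[OF ig] integral_mult_right_zero)
 also have "\<dots> = 0" using weak_helmholtzD(4)[OF w \<theta>(1)] by (simp only: add_0_right diff_self)
 finally have X0: "(LBINT x. ?X x) = 0" .
 let ?G = "\<lambda>x. complex_of_real (Im (rderiv u x * cnj (u x)))"
 have iS: "integrable lborel (\<lambda>x. shell S \<eta> (norm x) *\<^sub>R ?G x)" if "0 < \<eta>" "a < S - \<eta>" for S \<eta>
 proof (rule shell_integrable[where a=a and b="S + \<eta> + 1"])
  show "continuous_on {x. a < norm x \<and> norm x < S + \<eta> + 1} ?G"
   by (rule continuous_on_subset[where s="{x. a < norm x}"]) (intro continuous_intros continuous_flux[OF ext a], auto)
 qed (use that a in auto)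
 have "(LBINT x. of_real (Im (?X x))) = (LBINT x. shell R' \<delta>' (norm x) *\<^sub>R ?G x - shell R \<delta> (norm x) *\<^sub>R ?G x)"
 proof (rule integral_cong_AE)
  have "AE x in lborel. a < norm x \<longrightarrow> g i x = pderiv_at i u x" for i
   using weak_derivative_eq_pderiv[OF open_exterior ext Lg weak_helmholtzD(3)[OF w]] by simp
  then have "AE x in lborel. \<forall>i\<in>UNIV. a < norm x \<longrightarrow> g i x = pderiv_at i u x"
   by (intro AE_ball_countable[THEN iffD2] ballI) auto
  then show "AE x in lborel. complex_of_real (Im (?X x)) = shell R' \<delta>' (norm x) *\<^sub>R ?G x - shell R \<delta> (norm x) *\<^sub>R ?G x"
  proof eventually_elim
   case (elim x)
   show ?case
   proof (cases "norm x \<le> m")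
    case True
    then have "shell R \<delta> (norm x) = 0" "shell R' \<delta>' (norm x) = 0" using \<delta> by (auto intro!: shell_eq_0 simp: m_def)
    have "pderiv_at i ?\<theta> x = cnj (u x) * pderiv_at i ?h x + pderiv_at i (\<lambda>x. cnj (u x)) x * ?h x" for i by (rule \<theta>(2))
    then have "pderiv_at i ?\<theta> x = 0" for i
     using \<open>shell R \<delta> (norm x) = 0\<close> \<open>shell R' \<delta>' (norm x) = 0\<close>
     by (simp only: ph h0[OF True] diff_self of_real_0 mult_zero_left mult_zero_right add_0_right)
    with \<open>shell R \<delta> (norm x) = 0\<close> \<open>shell R' \<delta>' (norm x) = 0\<close> show ?thesis using h0[OF True]
     by (simp only: mult_zero_right sum.neutral_const diff_self zero_complex.sel of_real_0 scaleR_zero_left)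
   next
    case False
    then have ax: "a < norm x" using am by simp
    then have du: "u differentiable (at x)" using C1_on_differentiable[OF ext] by simp
    have hr: "?h x = complex_of_real (step_down ((norm x - R) / \<delta>) - step_down ((norm x - R') / \<delta>'))"
     by (simp add: cutoff_def)
    define s where "s = step_down ((norm x - R) / \<delta>) - step_down ((norm x - R') / \<delta>')"
    define q where "q = shell R' \<delta>' (norm x) - shell R \<delta> (norm x)"
    have "?X x = (\<Sum>i\<in>UNIV. of_real q * ((of_real (x $ i / norm x) * pderiv_at i u x) * cnj (u x)) + of_real (s * (norm (pderiv_at i u x))\<^sup>2)) - of_real (\<kappa> * (s * (norm (u x))\<^sup>2))"
    proof -
     have "g i x * pderiv_at i ?\<theta> x = of_real q * ((of_real (x $ i / norm x) * pderiv_at i u x) * cnj (u x)) + of_real (s * (norm (pderiv_at i u x))\<^sup>2)" for i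
     proof -
      have "pderiv_at i u x * cnj (pderiv_at i u x) = of_real ((norm (pderiv_at i u x))\<^sup>2)" by (simp only: complex_norm_square)
      moreover have "g i x = pderiv_at i u x" using elim ax by simp
      moreover have "pderiv_at i ?\<theta> x = cnj (u x) * (of_real q * of_real (x $ i / norm x)) + cnj (pderiv_at i u x) * of_real s"
      proof -
       have "pderiv_at i ?\<theta> x = cnj (u x) * pderiv_at i ?h x + pderiv_at i (\<lambda>x. cnj (u x)) x * ?h x" by (rule \<theta>(2))
       also have "\<dots> = cnj (u x) * (of_real q * of_real (x $ i / norm x)) + cnj (pderiv_at i u x) * of_real s"
        unfolding ph hr pderiv_at_cnj[OF du] s_def q_def by (rule refl)
       finally show ?thesis .
      qed
      ultimately show ?thesis by (simp add: distrib_left mult_ac)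
     qed
     moreover have "of_real \<kappa> * (u x * ?\<theta> x) = of_real (\<kappa> * (s * (norm (u x))\<^sup>2))"
     proof -
      have "u x * cnj (u x) = of_real ((norm (u x))\<^sup>2)" by (simp only: complex_norm_square)
      then show ?thesis unfolding hr s_def[symmetric] by (simp add: mult_ac)
     qed
     ultimately show ?thesis by (simp only:)
    qed
    also have "\<dots> = of_real q * (rderiv u x * cnj (u x)) + of_real ((\<Sum>i\<in>UNIV. s * (norm (pderiv_at i u x))\<^sup>2) - \<kappa> * (s * (norm (u x))\<^sup>2))"
     unfolding rderiv_sum[OF du] sum_distrib_right sum_distrib_left sum.distrib of_real_diff of_real_sum by simp
    finally have "Im (?X x) = q * Im (rderiv u x * cnj (u x))"
     by (simp only: plus_complex.simps Im_complex_of_real add_0_right) (simp only: times_complex.simps Re_complex_of_real Im_complex_of_real mult_zero_left add_0_right)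
    then have "complex_of_real (Im (?X x)) = of_real (q * Im (rderiv u x * cnj (u x)))" by (simp only:)
    also have "\<dots> = shell R' \<delta>' (norm x) *\<^sub>R ?G x - shell R \<delta> (norm x) *\<^sub>R ?G x"
     unfolding q_def scaleR_conv_of_real of_real_mult of_real_diff by (rule left_diff_distrib)
    finally show ?thesis .
   qed
  qed
  show "(\<lambda>x. complex_of_real (Im (?X x))) \<in> borel_measurable lborel"
   by (rule borel_measurable_integrable[OF integrable_of_real[OF integrable_Im[OF iX]]])
  show "(\<lambda>x. shell R' \<delta>' (norm x) *\<^sub>R ?G x - shell R \<delta> (norm x) *\<^sub>R ?G x) \<in> borel_measurable lborel"
   by (intro borel_measurable_integrable integrable_diff iS 1 2)
 qed
 also have "(LBINT x. of_real (Im (?X x))) = complex_of_real (Im (LBINT x. ?X x))"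
  using integral_Im[OF iX] by (simp only: integral_complex_of_real)
 finally show ?thesis
  unfolding X0 using integral_diff[OF iS[OF 2] iS[OF 1]] by simp
qed

lemma flux_constant:
 fixes u :: "real^3 \<Rightarrow> complex"
 assumes w: "weak_helmholtz (of_real \<kappa>) u g (\<lambda>\<phi>. 0)" and ext: "C1_on {x. a < norm x} u" and a: "0 \<le> a"
 shows "\<exists>c. \<forall>R>a. sphere_integral R (\<lambda>x. complex_of_real (Im (rderiv u x * cnj (u x)))) = c"
proof (intro exI allI impI)
 fix R assume R: "a < R"
 let ?G = "\<lambda>x. complex_of_real (Im (rderiv u x * cnj (u x)))"
 show "sphere_integral R ?G = (LBINT x. shell (a + 2) 1 (norm x) *\<^sub>R ?G x)"
 proof (rule sphere_integral_eq_if_shell_const[where a=a and b="R + 1" and d="R - a"])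
  show "continuous_on {x. a < norm x \<and> norm x < R + 1} ?G"
   by (rule continuous_on_subset[where s="{x. a < norm x}"]) (intro continuous_intros continuous_flux[OF ext a], auto)
  show "(LBINT x. shell R \<delta> (norm x) *\<^sub>R ?G x) = (LBINT x. shell (a + 2) 1 (norm x) *\<^sub>R ?G x)" if "0 < \<delta>" "\<delta> < R - a" for \<delta>
   by (rule flux_shells[OF w ext a]) (use that in auto)
 qed (use a R in auto)
qed

lemma sphere_continuous:
 fixes F :: "real^3 \<Rightarrow> 'b::topological_space"
 assumes F: "continuous_on {x. a < norm x} F" and R: "a < R" "0 \<le> a"
 shows "continuous_on (sphere 0 1) (\<lambda>w. F (R *\<^sub>R w))"
 by (rule continuous_on_compose2[OF F]) (use R in \<open>auto intro!: continuous_intros\<close>)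

text \<open>
 Expanding the square in the radiation condition leaves the conserved flux, so the mean square of the
 solution on large spheres stays bounded.
\<close>

lemma radiating_bounded:
 fixes u :: "real^3 \<Rightarrow> complex"
 assumes k: "0 < k" and w: "weak_helmholtz (of_real \<kappa>) u g (\<lambda>\<phi>. 0)" and ext: "C1_on {x. a < norm x} u" and a: "0 \<le> a"
  and som: "sommerfeld k u"
 shows "\<exists>M. \<forall>\<^sub>F R in at_top. sphere_integral R (\<lambda>x. (norm (u x))\<^sup>2) \<le> M"
proof -
 obtain c where c: "\<And>R. a < R \<Longrightarrow> sphere_integral R (\<lambda>x. complex_of_real (Im (rderiv u x * cnj (u x)))) = c"
  using flux_constant[OF w ext a] by blast
 let ?A = "\<lambda>x. (norm (rderiv u x - \<i> * of_real k * u x))\<^sup>2"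
 let ?I = "\<lambda>x. Im (rderiv u x * cnj (u x))"
 have cu: "continuous_on {x. a < norm x} u" by (rule C1_on_continuous[OF ext])
 have cd: "continuous_on {x. a < norm x} (rderiv u)" by (rule continuous_rderiv[OF ext]) (use a in simp)
 have pt: "k\<^sup>2 * (norm (u x))\<^sup>2 \<le> ?A x + 2 * k * ?I x" for x
 proof -
  have "?A x = (norm (rderiv u x))\<^sup>2 + k\<^sup>2 * (norm (u x))\<^sup>2 - 2 * k * ?I x"
   unfolding cmod_power2 by (simp add: power2_eq_square algebra_simps)
  then show ?thesis by simp
 qed
 have "\<forall>\<^sub>F R in at_top. sphere_integral R ?A < 1"
  using order_tendstoD(2)[OF som[unfolded sommerfeld_def], of 1] by simp
 then have "\<forall>\<^sub>F R in at_top. sphere_integral R (\<lambda>x. (norm (u x))\<^sup>2) \<le> (1 + 2 * k * norm c) / k\<^sup>2"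
  using eventually_gt_at_top[of a]
 proof eventually_elim
  case (elim R)
  have i1: "integrable S2_measure (\<lambda>w. ?A (R *\<^sub>R w))"
   by (rule continuous_S2_integrable[OF sphere_continuous[OF _ elim(2) a]]) (intro continuous_intros cu cd)
  have i2: "integrable S2_measure (\<lambda>w. ?I (R *\<^sub>R w))"
   by (rule continuous_S2_integrable[OF sphere_continuous[OF _ elim(2) a]]) (intro continuous_intros cu cd)
  have i3: "integrable S2_measure (\<lambda>w. (norm (u (R *\<^sub>R w)))\<^sup>2)"
   by (rule continuous_S2_integrable[OF sphere_continuous[OF _ elim(2) a]]) (intro continuous_intros cu cd)
  have "k\<^sup>2 * (\<integral>w. (norm (u (R *\<^sub>R w)))\<^sup>2 \<partial>S2_measure) \<le> (\<integral>w. ?A (R *\<^sub>R w) + 2 * k * ?I (R *\<^sub>R w) \<partial>S2_measure)"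
   unfolding integral_mult_right_zero[symmetric]
   by (intro integral_mono integrable_mult_right integrable_add i1 i2 i3 pt)
  also have "\<dots> = (\<integral>w. ?A (R *\<^sub>R w) \<partial>S2_measure) + 2 * k * (\<integral>w. ?I (R *\<^sub>R w) \<partial>S2_measure)"
   by (simp only: integral_add[OF i1 integrable_mult_right[OF i2]] integral_mult_right_zero)
  finally have "R\<^sup>2 * (k\<^sup>2 * (\<integral>w. (norm (u (R *\<^sub>R w)))\<^sup>2 \<partial>S2_measure)) \<le> R\<^sup>2 * ((\<integral>w. ?A (R *\<^sub>R w) \<partial>S2_measure) + 2 * k * (\<integral>w. ?I (R *\<^sub>R w) \<partial>S2_measure))"
   by (rule mult_left_mono) simp
  then have 1: "k\<^sup>2 * sphere_integral R (\<lambda>x. (norm (u x))\<^sup>2) \<le> sphere_integral R ?A + 2 * k * (R\<^sup>2 * (\<integral>w. ?I (R *\<^sub>R w) \<partial>S2_measure))"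
   by (simp add: sphere_integral_def algebra_simps)
  have "c = complex_of_real (R\<^sup>2 * (\<integral>w. ?I (R *\<^sub>R w) \<partial>S2_measure))"
   using c[OF elim(2)] unfolding sphere_integral_def integral_complex_of_real by (simp add: scaleR_conv_of_real)
  then have "R\<^sup>2 * (\<integral>w. ?I (R *\<^sub>R w) \<partial>S2_measure) \<le> norm c" by (metis abs_ge_self norm_of_real)
  then have "2 * k * (R\<^sup>2 * (\<integral>w. ?I (R *\<^sub>R w) \<partial>S2_measure)) \<le> 2 * k * norm c" using k by (intro mult_left_mono) auto
  then have "k\<^sup>2 * sphere_integral R (\<lambda>x. (norm (u x))\<^sup>2) \<le> 1 + 2 * k * norm c" using 1 elim(1) by linarith
  then show ?case using k by (simp add: pos_le_divide_eq mult.commute)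
 qed
 then show ?thesis by blast
qed

lemma young_pairing:
 fixes x y :: real
 assumes "0 < \<alpha>"
 shows "x * y \<le> \<alpha> * x\<^sup>2 + y\<^sup>2 / \<alpha>"
proof -
 have "0 \<le> (\<alpha> * x - y)\<^sup>2 + (\<alpha> * x)\<^sup>2 + y\<^sup>2" by simp
 then have "\<alpha> * (x * y) \<le> \<alpha> * (\<alpha> * x\<^sup>2) + y\<^sup>2" by (simp add: power2_eq_square algebra_simps)
 then have "\<alpha> * (x * y) \<le> \<alpha> * (\<alpha> * x\<^sup>2 + y\<^sup>2 / \<alpha>)" using assms by (simp add: distrib_left)
 then show ?thesis using assms by simp
qed

text \<open>
 The boundary form is unchanged if \<open>\<i> k\<close> times the function is subtracted from both normal
 derivatives; each product then has one factor that is small and one that is bounded in mean square.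
\<close>

lemma radiating_boundary_form_small:
 fixes u :: "real^3 \<Rightarrow> complex"
 assumes ext: "C1_on {x. a < norm x} u" and a: "0 \<le> a" and som: "sommerfeld k u"
  and bdd: "\<forall>\<^sub>F R in at_top. sphere_integral R (\<lambda>x. (norm (u x))\<^sup>2) \<le> M" and e: "0 < e"
 shows "\<forall>\<^sub>F R in at_top. \<forall>v. C1_on {x. a < norm x} v \<longrightarrow> (\<forall>x. norm x = R \<longrightarrow> norm (v x) \<le> 1 / R \<and> norm (rderiv v x - \<i> * of_real k * v x) \<le> r / R\<^sup>2) \<longrightarrow>
   norm (sphere_integral R (\<lambda>x. rderiv u x * v x - u x * rderiv v x)) \<le> e"
proof -
 let ?A = "\<lambda>x. (norm (rderiv u x - \<i> * of_real k * u x))\<^sup>2"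
 let ?N = "\<lambda>x. (norm (u x))\<^sup>2"
 have cu: "continuous_on {x. a < norm x} u" by (rule C1_on_continuous[OF ext])
 have cd: "continuous_on {x. a < norm x} (rderiv u)" by (rule continuous_rderiv[OF ext]) (use a in simp)
 define \<alpha> where "\<alpha> = 16 * pi / e"
 define \<beta> where "\<beta> = e / (4 * (\<bar>M\<bar> + 1))"
 have pos: "0 < \<alpha>" "0 < \<beta>" using e by (auto simp: \<alpha>_def \<beta>_def intro!: divide_pos_pos)
 have "\<forall>\<^sub>F R in at_top. sphere_integral R ?A < e / (4 * \<alpha>)"
  using order_tendstoD(2)[OF som[unfolded sommerfeld_def], of "e / (4 * \<alpha>)"] e pos by simp
 moreover have "\<forall>\<^sub>F R in at_top. (4 * pi * r\<^sup>2 / \<beta>) * (1 / R\<^sup>2) < e / 4"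
 proof -
  have "((\<lambda>R::real. (4 * pi * r\<^sup>2 / \<beta>) * (1 / R\<^sup>2)) \<longlongrightarrow> (4 * pi * r\<^sup>2 / \<beta>) * 0) at_top"
   by (intro tendsto_mult tendsto_const) real_asymp
  from order_tendstoD(2)[OF this, of "e / 4"] show ?thesis using e by simp
 qed
 ultimately show ?thesis using bdd eventually_gt_at_top[of a]
 proof eventually_elim
  case (elim R)
  have R0: "0 < R" using elim(4) a by simp
  show ?case
  proof (intro allI impI)
   fix v assume v: "C1_on {x. a < norm x} v" and b: "\<forall>x. norm x = R \<longrightarrow> norm (v x) \<le> 1 / R \<and> norm (rderiv v x - \<i> * of_real k * v x) \<le> r / R\<^sup>2"
   let ?B = "\<lambda>x. rderiv u x * v x - u x * rderiv v x"
   let ?C = "1 / (\<alpha> * R\<^sup>2) + r\<^sup>2 / (\<beta> * R ^ 4)"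
   have i1: "integrable S2_measure (\<lambda>w. ?A (R *\<^sub>R w))"
    by (rule continuous_S2_integrable[OF sphere_continuous[OF _ elim(4) a]]) (intro continuous_intros cu cd)
   have i3: "integrable S2_measure (\<lambda>w. ?N (R *\<^sub>R w))"
    by (rule continuous_S2_integrable[OF sphere_continuous[OF _ elim(4) a]]) (intro continuous_intros cu cd)
   have i4: "integrable S2_measure (\<lambda>w. ?B (R *\<^sub>R w))"
    by (rule continuous_S2_integrable[OF sphere_continuous[OF _ elim(4) a]])
     (intro continuous_intros cu cd C1_on_continuous[OF v] continuous_rderiv[OF v], use a in simp)
   have ic: "integrable S2_measure (\<lambda>w::real^3. ?C)" by (rule continuous_S2_integrable) (intro continuous_intros)
   have pt: "norm (?B x) \<le> \<alpha> * ?A x + \<beta> * ?N x + ?C" if x: "norm x = R" for x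
   proof -
    have "?B x = (rderiv u x - \<i> * of_real k * u x) * v x - u x * (rderiv v x - \<i> * of_real k * v x)"
     by (simp add: algebra_simps)
    then have "norm (?B x) \<le> norm (rderiv u x - \<i> * of_real k * u x) * norm (v x) + norm (u x) * norm (rderiv v x - \<i> * of_real k * v x)"
     by (simp only: norm_mult[symmetric] norm_triangle_ineq4)
    also have "\<dots> \<le> norm (rderiv u x - \<i> * of_real k * u x) * (1 / R) + norm (u x) * (r / R\<^sup>2)"
     using b x by (intro add_mono mult_left_mono) auto
    also have "\<dots> \<le> (\<alpha> * ?A x + (1 / R)\<^sup>2 / \<alpha>) + (\<beta> * ?N x + (r / R\<^sup>2)\<^sup>2 / \<beta>)"
     by (intro add_mono young_pairing pos)
    also have "\<dots> = \<alpha> * ?A x + \<beta> * ?N x + ?C" by (simp add: power_divide mult.commute)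
    finally show ?thesis .
   qed
   have "norm (sphere_integral R ?B) = R\<^sup>2 * norm (\<integral>w. ?B (R *\<^sub>R w) \<partial>S2_measure)"
    by (simp add: sphere_integral_def)
   also have "\<dots> \<le> R\<^sup>2 * (\<integral>w. \<alpha> * ?A (R *\<^sub>R w) + \<beta> * ?N (R *\<^sub>R w) + ?C \<partial>S2_measure)"
   proof (rule mult_left_mono)
    have "norm (\<integral>w. ?B (R *\<^sub>R w) \<partial>S2_measure) \<le> (\<integral>w. norm (?B (R *\<^sub>R w)) \<partial>S2_measure)" by (rule integral_norm_bound)
    also have "\<dots> \<le> (\<integral>w. \<alpha> * ?A (R *\<^sub>R w) + \<beta> * ?N (R *\<^sub>R w) + ?C \<partial>S2_measure)"
     by (intro integral_mono_AE AE_I2 integrable_norm integrable_add integrable_mult_right i1 i3 i4 ic pt)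
      (use R0 in \<open>auto simp: space_S2_measure\<close>)
    finally show "norm (\<integral>w. ?B (R *\<^sub>R w) \<partial>S2_measure) \<le> (\<integral>w. \<alpha> * ?A (R *\<^sub>R w) + \<beta> * ?N (R *\<^sub>R w) + ?C \<partial>S2_measure)" .
   qed simp
   also have "\<dots> = R\<^sup>2 * (\<alpha> * (\<integral>w. ?A (R *\<^sub>R w) \<partial>S2_measure) + \<beta> * (\<integral>w. ?N (R *\<^sub>R w) \<partial>S2_measure) + ?C * (4 * pi))"
    by (simp only: integral_add[OF integrable_add[OF integrable_mult_right[OF i1] integrable_mult_right[OF i3]] ic]
      integral_add[OF integrable_mult_right[OF i1] integrable_mult_right[OF i3]] integral_mult_right_zero)
     (simp add: measure_S2_total mult.commute)
   also have "\<dots> = \<alpha> * sphere_integral R ?A + \<beta> * sphere_integral R ?N + (4 * pi / \<alpha> + (4 * pi * r\<^sup>2 / \<beta>) * (1 / R\<^sup>2))"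
    unfolding sphere_integral_def real_scaleR_def using R0 pos by (simp add: field_simps eval_nat_numeral)
   also have "\<dots> \<le> e / 4 + e / 4 + (e / 4 + e / 4)"
   proof (intro add_mono)
    have "\<alpha> * sphere_integral R ?A \<le> \<alpha> * (e / (4 * \<alpha>))" using elim(1) pos by (intro mult_left_mono) auto
    then show "\<alpha> * sphere_integral R ?A \<le> e / 4" using pos by simp
    have "\<beta> * sphere_integral R ?N \<le> \<beta> * (\<bar>M\<bar> + 1)" using elim(3) pos by (intro mult_left_mono) auto
    also have "\<beta> * (\<bar>M\<bar> + 1) = e / 4" by (simp add: \<beta>_def field_simps)
    finally show "\<beta> * sphere_integral R ?N \<le> e / 4" .
    show "4 * pi / \<alpha> \<le> e / 4" by (simp add: \<alpha>_def)
    show "(4 * pi * r\<^sup>2 / \<beta>) * (1 / R\<^sup>2) \<le> e / 4" using elim(2) by simp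
   qed
   finally show "norm (sphere_integral R ?B) \<le> e" by simp
  qed
 qed
qed

lemma tent_integral_bound:
 fixes F :: "real \<Rightarrow> complex"
 assumes F: "integrable lborel (\<lambda>s. tent s *\<^sub>R F s)" "\<And>s. \<bar>s\<bar> < 1 \<Longrightarrow> norm (F s) \<le> e"
 shows "norm (LBINT s. tent s *\<^sub>R F s) \<le> e"
proof -
 have "norm (LBINT s. tent s *\<^sub>R F s) \<le> (LBINT s. tent s * e)"
 proof (rule integral_norm_bound_integral[OF F(1)])
  show "integrable lborel (\<lambda>s. tent s * e)" using integrable_tent by simp
  show "norm (tent s *\<^sub>R F s) \<le> tent s * e" for s
   using F(2)[of s] tent_nonneg[of s] tent_eq_0[of s] by (cases "\<bar>s\<bar> < 1") (auto intro: mult_left_mono)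
 qed
 then show ?thesis by (simp add: integral_tent)
qed

lemma defect_even: "defect k \<epsilon> (x - y) = defect k \<epsilon> (y - x)"
 by (simp add: defect_def rho_def norm_minus_commute)

lemma continuous_defect: "\<epsilon> \<noteq> 0 \<Longrightarrow> continuous_on UNIV (defect k \<epsilon>)"
proof -
 assume e: "\<epsilon> \<noteq> 0"
 have "continuous_on UNIV (\<lambda>z. - (\<Sum>i\<in>UNIV. ddhelm k \<epsilon> i i z) - of_real (k\<^sup>2) * helm k \<epsilon> z)"
 proof (intro continuous_intros)
  show "continuous_on UNIV (ddhelm k \<epsilon> i i)" for i
   using C1_on_pderiv_continuous[OF C1_on_dhelm[of UNIV \<epsilon> k i], of i] e by (simp add: pderiv_dhelm cong: continuous_on_cong)
  show "continuous_on UNIV (helm k \<epsilon>)" using C1_on_continuous[OF C1_on_helm[of UNIV \<epsilon> k]] e by simp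
 qed
 then show ?thesis by (rule continuous_on_eq) (simp add: helm_laplace e)
qed

text \<open>
 Green's identity with the regularized kernel centred at \<open>x\<close>: the smoothed solution equals a boundary
 form on a far shell, which is small uniformly in \<open>\<epsilon>\<close>.
\<close>

lemma radiating_entire_cutoff_small:
 fixes u :: "real^3 \<Rightarrow> complex"
 assumes k: "0 < k" and w: "weak_helmholtz (of_real (k\<^sup>2)) u g (\<lambda>\<phi>. 0)" and ext: "C1_on {x. a < norm x} u" and a: "0 \<le> a"
  and som: "sommerfeld k u" and e: "0 < e" and q: "0 \<le> q"
 shows "\<exists>R. q + 1 < R \<and> (\<forall>x \<epsilon>. norm x \<le> q \<longrightarrow> 0 < \<epsilon> \<longrightarrow> \<epsilon> \<le> 1 \<longrightarrow>
   norm (LBINT z. defect k \<epsilon> (x - z) * (u z * cutoff R 1 z)) \<le> e)"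
proof -
 obtain M where M: "\<forall>\<^sub>F R in at_top. sphere_integral R (\<lambda>x. (norm (u x))\<^sup>2) \<le> M"
  using radiating_bounded[OF k w ext a som] by blast
 obtain R0 where R0: "\<And>R v. R0 \<le> R \<Longrightarrow> C1_on {x. a < norm x} v \<Longrightarrow> (\<And>x. norm x = R \<Longrightarrow> norm (v x) \<le> 1 / R \<and> norm (rderiv v x - \<i> * of_real k * v x) \<le> rad k q / R\<^sup>2) \<Longrightarrow>
   norm (sphere_integral R (\<lambda>x. rderiv u x * v x - u x * rderiv v x)) \<le> e"
  using radiating_boundary_form_small[OF ext a som M e, of "rad k q"] unfolding eventually_at_top_linorder by blast
 define R where "R = max (max R0 (2 * (q + 1))) a + 2"
 have R: "R0 \<le> R + s" "2 * (q + 1) \<le> R + s" if "\<bar>s\<bar> < 1" for s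
  using that unfolding R_def by linarith+
 have R': "a < R - 1" "q + 1 < R"
 proof -
  show "a < R - 1" unfolding R_def by linarith
  have "q + 1 \<le> 2 * (q + 1)" using q by simp
  then show "q + 1 < R" unfolding R_def by linarith
 qed
 show ?thesis
 proof (intro exI[of _ R] conjI allI impI)
  show "q + 1 < R" by (rule R')
  fix x :: "real^3" and \<epsilon> :: real assume x: "norm x \<le> q" and \<epsilon>: "0 < \<epsilon>" "\<epsilon> \<le> 1"
  have \<epsilon>0: "\<epsilon> \<noteq> 0" using \<epsilon> by simp
  let ?v = "\<lambda>z. helm k \<epsilon> (z - x)"
  let ?G = "\<lambda>z. rderiv u z * ?v z - u z * rderiv ?v z"
  have v: "C1_on UNIV ?v" by (rule C1_on_helm_shift[OF \<epsilon>0])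
  have pv: "pderiv_at i ?v = (\<lambda>z. dhelm k \<epsilon> i (z - x))" for i by (rule HOL.ext) (rule pderiv_helm_shift[OF \<epsilon>0])
  have v2: "C1_on UNIV (pderiv_at i ?v)" for i unfolding pv by (rule C1_on_dhelm_shift[OF \<epsilon>0])
  have vA: "C1_on {z. a < norm z} ?v" by (rule C1_on_subset[OF v subset_UNIV])
  have lap: "(\<Sum>i\<in>UNIV. pderiv_at i (pderiv_at i ?v) z) + of_real (k\<^sup>2) * ?v z = - defect k \<epsilon> (x - z)" for z
   unfolding pv pderiv_dhelm_shift[OF \<epsilon>0] using helm_laplace[of \<epsilon> "z - x" k] \<epsilon>0 by (simp add: defect_even[of k \<epsilon> x z])
  have "(LBINT z. u z * (cutoff R 1 z * (- defect k \<epsilon> (x - z)))) = - (LBINT z. shell R 1 (norm z) *\<^sub>R ?G z)"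
   using green_weak[OF w ext a _ R'(1) v v2] unfolding lap by simp
  moreover have "(LBINT z. u z * (cutoff R 1 z * (- defect k \<epsilon> (x - z)))) = - (LBINT z. defect k \<epsilon> (x - z) * (u z * cutoff R 1 z))"
   unfolding integral_minus[symmetric] by (intro integral_cong refl) simp
  ultimately have eq: "(LBINT z. defect k \<epsilon> (x - z) * (u z * cutoff R 1 z)) = (LBINT z. shell R 1 (norm z) *\<^sub>R ?G z)"
   by simp
  have "integrable lborel (\<lambda>z. shell R 1 (norm z) *\<^sub>R ?G z)"
  proof (rule shell_integrable[where a=a and b="R + 2"])
   show "continuous_on {z. a < norm z \<and> norm z < R + 2} ?G"
    by (rule continuous_on_subset[where s="{z. a < norm z}"])
     (intro continuous_intros C1_on_continuous[OF ext] C1_on_continuous[OF vA] continuous_rderiv[OF ext] continuous_rderiv[OF vA], use a in auto)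
  qed (use a R' in auto)
  from shell_polar[OF _ _ this] R' q have sp: "(LBINT z. shell R 1 (norm z) *\<^sub>R ?G z) = (LBINT s. tent s *\<^sub>R sphere_integral (R + s) ?G)"
    "integrable lborel (\<lambda>s. tent s *\<^sub>R sphere_integral (R + s) ?G)" by simp_all
  show "norm (LBINT z. defect k \<epsilon> (x - z) * (u z * cutoff R 1 z)) \<le> e"
   unfolding eq sp(1)
  proof (rule tent_integral_bound[OF sp(2)])
   fix s :: real assume s: "\<bar>s\<bar> < 1"
   show "norm (sphere_integral (R + s) ?G) \<le> e"
   proof (rule R0[OF R(1)[OF s] vA])
    fix z :: "real^3" assume z: "norm z = R + s"
    have z2: "2 * (q + 1) \<le> norm z" using R(2)[OF s] z by simp
    have "rderiv ?v z = (\<Sum>i\<in>UNIV. complex_of_real (z $ i / norm z) * dhelm k \<epsilon> i (z - x))"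
     unfolding rderiv_sum[OF C1_on_differentiable[OF v UNIV_I]] pv by (rule refl)
    then show "norm (?v z) \<le> 1 / (R + s) \<and> norm (rderiv ?v z - \<i> * of_real k * ?v z) \<le> rad k q / (R + s)\<^sup>2"
     using radiation_kernel[OF less_imp_le[OF k] x less_imp_le[OF \<epsilon>(1)] \<epsilon>(2) z2] unfolding z by simp
   qed
  qed
 qed
qed

text \<open>
 Letting \<open>\<epsilon>\<close> tend to 0 after integrating over a box, so that the smoothing falls on the indicator of
 the box, where the convergence is dominated.
\<close>

lemma radiating_entire_box_integral_small:
 fixes u :: "real^3 \<Rightarrow> complex"
 assumes k: "0 < k" and w: "weak_helmholtz (of_real (k\<^sup>2)) u g (\<lambda>\<phi>. 0)" and ext: "C1_on {x. a < norm x} u" and a: "0 \<le> a"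
  and som: "sommerfeld k u" and e: "0 < e"
 shows "norm (LBINT x. indicator (box p p') x *\<^sub>R u x) \<le> e * measure lborel (box p p')"
proof -
 let ?Q = "box p p'"
 let ?\<theta> = "\<lambda>x. complex_of_real (indicator ?Q x)"
 obtain q where q: "\<And>x. x \<in> ?Q \<Longrightarrow> norm x \<le> q" "0 \<le> q"
  using bounded_pos[THEN iffD1, OF bounded_box[of p p']] by (meson less_imp_le)
 obtain R where R: "q + 1 < R" and small: "\<And>x \<epsilon>. norm x \<le> q \<Longrightarrow> 0 < \<epsilon> \<Longrightarrow> \<epsilon> \<le> 1 \<Longrightarrow>
   norm (LBINT z. defect k \<epsilon> (x - z) * (u z * cutoff R 1 z)) \<le> e"
  using radiating_entire_cutoff_small[OF k w ext a som e q(2)] by blast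
 have R1: "1 < R" using R q(2) by simp
 let ?f = "\<lambda>z. u z * cutoff R 1 z"
 have Lu: "L1loc u" by (rule weak_helmholtzD(1)[OF w])
 have cc: "continuous_on UNIV (cutoff R 1)" by (rule C1_on_continuous[OF cutoff_C1(1)]) (use R1 in auto)
 have c0: "cutoff R 1 x = 0" if "R + 1 < norm x" for x using that by (simp add: cutoff_eq_0)
 have fi: "integrable lborel ?f" by (rule L1loc_mult_continuous[OF Lu cc c0])
 have \<theta>m[measurable]: "?\<theta> \<in> borel_measurable borel" by measurable
 have \<theta>b: "norm (?\<theta> x) \<le> 1" for x by (simp add: indicator_def)
 have \<theta>D: "?\<theta> x = 0" if "q < norm x" for x using that q(1)[of x] by (auto simp: indicator_def)
 note eps = eps_seq(1) eps_seq(2) eps_seq(3)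
 let ?J = "\<lambda>n y. (LBINT x. defect k (eps_seq n) (x - y) * ?\<theta> x)"
 have fub: "(LBINT x. (LBINT y. defect k (eps_seq n) (x - y) * ?f y) * ?\<theta> x) = (LBINT y. ?f y * ?J n y)" for n
 proof -
  have e0: "eps_seq n \<noteq> 0" using eps_seq(2)[of n] by simp
  obtain L where L: "\<And>z. z \<in> cball 0 (q + (R + 1)) \<Longrightarrow> norm (defect k (eps_seq n) z) \<le> L"
   using bounded_on_compact[OF compact_cball continuous_on_subset[OF continuous_defect[OF e0] subset_UNIV]] by blast
  show ?thesis
  proof (rule kernel_fubini(1)[OF defect_measurable fi \<theta>m, where c="\<bar>L\<bar> * measure lborel ?Q"])
   fix y assume "?f y \<noteq> 0"
   then have y: "norm y \<le> R + 1" using c0[of y] by (auto simp: not_less[symmetric])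
   have "(NN x. ennreal (norm (defect k (eps_seq n) (x - y) * ?\<theta> x))) \<le> (NN x. ennreal \<bar>L\<bar> * indicator ?Q x)"
   proof (rule nn_integral_mono)
    fix x show "ennreal (norm (defect k (eps_seq n) (x - y) * ?\<theta> x)) \<le> ennreal \<bar>L\<bar> * indicator ?Q x"
    proof (cases "x \<in> ?Q")
     case True
     have "norm (x - y) \<le> q + (R + 1)" using norm_triangle_ineq4[of x y] q(1)[OF True] y by linarith
     then have "norm (defect k (eps_seq n) (x - y)) \<le> \<bar>L\<bar>" using L[of "x - y"] by simp
     then show ?thesis using True by (simp add: norm_mult ennreal_leI)
    qed simp
   qed
   also have "\<dots> = ennreal \<bar>L\<bar> * emeasure lborel ?Q" by (rule nn_integral_cmult_indicator) simp
   also have "\<dots> = ennreal (\<bar>L\<bar> * measure lborel ?Q)"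
   proof -
    have "emeasure lborel ?Q = ennreal (measure lborel ?Q)"
     by (rule emeasure_eq_ennreal_measure) (use emeasure_lborel_box_finite[of p p'] in auto)
    then show ?thesis by (simp only: ennreal_mult[OF abs_ge_zero measure_nonneg])
   qed
   finally show "(NN x. ennreal (norm (defect k (eps_seq n) (x - y) * ?\<theta> x))) \<le> ennreal (\<bar>L\<bar> * measure lborel ?Q)" .
  qed
 qed
 have bound: "norm (LBINT y. ?f y * ?J n y) \<le> e * measure lborel ?Q" for n
 proof -
  have "norm (LBINT x. (LBINT y. defect k (eps_seq n) (x - y) * ?f y) * ?\<theta> x) \<le> (LBINT x. e * indicator ?Q x)"
  proof (rule order_trans[OF integral_norm_bound integral_mono'])
   show "integrable lborel (\<lambda>x. e * indicator ?Q x)" by (intro integrable_mult_right integrable_real_indicator emeasure_lborel_box_finite) simp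
   show "norm ((LBINT y. defect k (eps_seq n) (x - y) * ?f y) * ?\<theta> x) \<le> e * indicator ?Q x" for x
    using small[OF q(1)[of x] eps_seq(2,3)] by (simp add: indicator_def norm_mult)
   show "0 \<le> e * indicator ?Q x" for x :: "real^3" using e by simp
  qed
  then show ?thesis unfolding fub by simp
 qed
 have "(\<lambda>n. (LBINT y. ?f y * ?J n y)) \<longlonglongrightarrow> (LBINT y. ?f y * ?\<theta> y)"
 proof (rule integral_dominated_convergence)
  let ?C = "\<lambda>y. defect_const k (\<bar>q\<bar> + norm y + 1) * 1 * (4 * pi / 3)"
  have "integrable lborel (\<lambda>y. u y * (cutoff R 1 y * complex_of_real (?C y)))"
   by (rule L1loc_mult_continuous[OF Lu, where D="R + 1"]) (auto intro!: continuous_intros cc simp: c0 defect_const_def)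
  then show "integrable lborel (\<lambda>y. norm (u y * (cutoff R 1 y * complex_of_real (?C y))))" by (rule integrable_norm)
  show "AE y in lborel. norm (?f y * ?J n y) \<le> norm (u y * (cutoff R 1 y * complex_of_real (?C y)))" for n
  proof (rule AE_I2)
   fix y
   have "norm (?J n y) \<le> ?C y"
    by (rule defect_approximate_identity(2)[OF \<theta>m \<theta>b \<theta>D less_imp_le[OF k] eps])
   then have "norm (?J n y) \<le> norm (complex_of_real (?C y))" by (simp only: norm_of_real)
   then have "norm (?f y) * norm (?J n y) \<le> norm (?f y) * norm (complex_of_real (?C y))" by (rule mult_left_mono) simp
   then show "norm (?f y * ?J n y) \<le> norm (u y * (cutoff R 1 y * complex_of_real (?C y)))" by (simp only: norm_mult mult.assoc)
  qed
  show "AE y in lborel. (\<lambda>n. ?f y * ?J n y) \<longlonglongrightarrow> ?f y * ?\<theta> y"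
  proof -
   have "AE y in lborel. y \<notin> frontier ?Q"
    using negligible_convex_frontier[OF convex_box(2)[of p p']] unfolding negligible_iff_null_sets
    by (intro AE_not_in) (auto simp: null_sets_completion_iff)
   then show ?thesis
   proof eventually_elim
    case (elim y)
    have "isCont ?\<theta> y"
    proof (cases "y \<in> ?Q")
     case True
     have "\<forall>\<^sub>F x in nhds y. ?\<theta> x = 1" using eventually_nhds_in_open[OF open_box True] by eventually_elim simp
     then show ?thesis by (rule isCont_cong[THEN iffD2]) simp
    next
     case False
     then have "y \<in> - closure ?Q" using elim by (simp add: frontier_def interior_open open_box)
     from eventually_nhds_in_open[OF open_Compl[OF closed_closure] this] have "\<forall>\<^sub>F x in nhds y. x \<in> - closure ?Q" .
     then have "\<forall>\<^sub>F x in nhds y. ?\<theta> x = 0" by eventually_elim (use closure_subset in \<open>auto simp: indicator_def\<close>)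
     then show ?thesis by (rule isCont_cong[THEN iffD2]) simp
    qed
    from defect_approximate_identity(1)[OF \<theta>m \<theta>b \<theta>D less_imp_le[OF k] eps this]
    show ?case by (intro tendsto_mult tendsto_const)
   qed
  qed
  have um: "u \<in> borel_measurable borel" using Lu by (simp add: L1loc_def)
  show "(\<lambda>y. ?f y * ?\<theta> y) \<in> borel_measurable lborel"
   using borel_measurable_integrable[OF fi] by measurable
  show "(\<lambda>y. ?f y * ?J n y) \<in> borel_measurable lborel" for n
  proof (rule borel_measurable_times[OF borel_measurable_integrable[OF fi]])
   have "?J n \<in> borel_measurable borel" by (rule lborel.borel_measurable_lebesgue_integral) measurable
   then show "?J n \<in> borel_measurable lborel" by simp
  qed
 qed
 from LIMSEQ_le_const2[OF tendsto_norm[OF this]] bound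
 have "norm (LBINT y. ?f y * ?\<theta> y) \<le> e * measure lborel ?Q" by blast
 also have "(LBINT y. ?f y * ?\<theta> y) = (LBINT x. indicator ?Q x *\<^sub>R u x)"
 proof (intro integral_cong refl)
  fix y
  have "cutoff R 1 y = 1" if "y \<in> ?Q" using q(1)[OF that] R by (intro cutoff_eq_1) auto
  then show "?f y * ?\<theta> y = indicator ?Q y *\<^sub>R u y" by (auto simp: indicator_def)
 qed
 finally show ?thesis .
qed

lemma radiating_entire_zero:
 fixes u :: "real^3 \<Rightarrow> complex"
 assumes k: "0 < k" and w: "weak_helmholtz (of_real (k\<^sup>2)) u g (\<lambda>\<phi>. 0)" and ext: "C1_on {x. a < norm x} u" and a: "0 \<le> a"
  and som: "sommerfeld k u"
 shows "AE x in lborel. u x = 0"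
proof -
 have Lu: "L1loc u" by (rule weak_helmholtzD(1)[OF w])
 have "AE x in lborel. x \<in> UNIV \<longrightarrow> u x = 0"
 proof (rule AE_zero_on_open_if_box_integrals_zero[OF open_UNIV])
  show "u \<in> borel_measurable borel" using Lu by (simp add: L1loc_def)
  fix p p' :: "real^3"
  obtain q where q: "\<And>x. x \<in> cbox p p' \<Longrightarrow> norm x \<le> q"
   using bounded_iff[THEN iffD1, OF bounded_cbox[of p p']] by blast
  have "integrable lborel (\<lambda>x. u x * complex_of_real (indicator (cbox p p') x))"
   by (rule L1loc_mult_integrable[OF Lu, where M=1 and D=q]) (use q in \<open>force simp: indicator_def\<close>)+
  then show "integrable lborel (\<lambda>x. indicator (cbox p p') x *\<^sub>R u x)" by (simp add: scaleR_conv_of_real mult.commute)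
  let ?I = "(LBINT x. indicator (box p p') x *\<^sub>R u x)" and ?m = "measure lborel (box p p')"
  have "norm ?I \<le> 0"
  proof (rule field_le_epsilon)
   fix e :: real assume e: "0 < e"
   have "norm ?I \<le> e / (?m + 1) * ?m"
    by (rule radiating_entire_box_integral_small[OF k w ext a som]) (use e in \<open>auto intro!: divide_pos_pos add_nonneg_pos\<close>)
   also have "\<dots> = e * (?m / (?m + 1))" by simp
   also have "\<dots> \<le> e * 1" using e by (intro mult_left_mono) (auto simp: divide_le_eq add_nonneg_pos)
   finally show "norm ?I \<le> 0 + e" by simp
  qed
  then show "?I = 0" by simp
 qed
 then show ?thesis by simp
qed

lemma L1loc_diff:
 assumes "L1loc u" "L1loc v"
 shows "L1loc (\<lambda>x. u x - v x)"
 using assms unfolding L1loc_def scaleR_diff_right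
 by (auto intro!: borel_measurable_diff integrable_diff)

lemma weak_helmholtz_diff:
 assumes u: "weak_helmholtz \<kappa> u g l" and v: "weak_helmholtz \<kappa> v h m"
 shows "weak_helmholtz \<kappa> (\<lambda>x. u x - v x) (\<lambda>i x. g i x - h i x) (\<lambda>\<phi>. l \<phi> - m \<phi>)"
 unfolding weak_helmholtz_def
proof (intro conjI allI impI)
 note U = weak_helmholtzD[OF u] and V = weak_helmholtzD[OF v]
 show "L1loc (\<lambda>x. u x - v x)" "L1loc (\<lambda>x. g i x - h i x)" for i
  by (intro L1loc_diff U(1,2) V(1,2))+
 fix \<phi> assume \<phi>: "test_fun \<phi>"
 have e: "(LBINT x. (p x - q x) * r x) = (LBINT x. p x * r x) - (LBINT x. q x * r x)"
  if "integrable lborel (\<lambda>x. p x * r x)" "integrable lborel (\<lambda>x. q x * r x)" for p q r :: "real^3 \<Rightarrow> complex"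
  unfolding left_diff_distrib by (rule integral_diff[OF that])
 show "(LBINT x. (u x - v x) * pderiv_at i \<phi> x) = - (LBINT x. (g i x - h i x) * \<phi> x)" for i
  unfolding e[OF L1loc_test_fun(2)[OF U(1) \<phi>] L1loc_test_fun(2)[OF V(1) \<phi>]] e[OF L1loc_test_fun(1)[OF U(2) \<phi>] L1loc_test_fun(1)[OF V(2) \<phi>]]
   U(3)[OF \<phi>] V(3)[OF \<phi>] by simp
 show "(\<Sum>i\<in>UNIV. (LBINT x. (g i x - h i x) * pderiv_at i \<phi> x)) = \<kappa> * (LBINT x. (u x - v x) * \<phi> x) + (l \<phi> - m \<phi>)"
  unfolding e[OF L1loc_test_fun(2)[OF U(2) \<phi>] L1loc_test_fun(2)[OF V(2) \<phi>]] e[OF L1loc_test_fun(1)[OF U(1) \<phi>] L1loc_test_fun(1)[OF V(1) \<phi>]]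
   sum_subtractf U(4)[OF \<phi>] V(4)[OF \<phi>] by (simp add: algebra_simps)
qed

lemma pderiv_at_diff:
 assumes "f differentiable (at x)" "g differentiable (at x)"
 shows "pderiv_at i (\<lambda>x. f x - g x) x = pderiv_at i f x - pderiv_at i g x"
 unfolding pderiv_at_def frechet_derivative_works[THEN iffD1, OF assms(1), THEN has_derivative_diff,
  OF frechet_derivative_works[THEN iffD1, OF assms(2)], THEN frechet_derivative_at, symmetric] by (rule refl)

lemma C1_on_diff:
 assumes f: "C1_on S f" and g: "C1_on S g"
 shows "C1_on S (\<lambda>x. f x - g x)"
 unfolding C1_on_def
proof (intro conjI allI ballI)
 show "(\<lambda>x. f x - g x) differentiable (at x)" if "x \<in> S" for x
  using C1_on_differentiable[OF f that] C1_on_differentiable[OF g that] by (rule differentiable_diff)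
 show "continuous_on S (pderiv_at i (\<lambda>x. f x - g x))" for i
  by (rule continuous_on_eq[OF continuous_on_diff[OF C1_on_pderiv_continuous[OF f, of i] C1_on_pderiv_continuous[OF g, of i]]])
   (simp add: pderiv_at_diff C1_on_differentiable[OF f] C1_on_differentiable[OF g])
qed

lemma sommerfeld_diff:
 fixes u v :: "real^3 \<Rightarrow> complex"
 assumes u: "C1_on {x. a < norm x} u" "sommerfeld k u" and v: "C1_on {x. a < norm x} v" "sommerfeld k v" and a: "0 \<le> a"
 shows "sommerfeld k (\<lambda>x. u x - v x)"
 unfolding sommerfeld_def
proof (rule tendsto_sandwich[OF _ _ tendsto_const])
 let ?w = "\<lambda>x. u x - v x"
 let ?S = "\<lambda>u x. (norm (rderiv u x - \<i> * of_real k * u x))\<^sup>2"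
 have ci: "integrable S2_measure (\<lambda>y. ?S f (R *\<^sub>R y))" if f: "C1_on {x. a < norm x} f" and R: "a < R" for f R
  by (rule continuous_S2_integrable[OF sphere_continuous[OF _ R a]])
   (intro continuous_intros C1_on_continuous[OF f] continuous_rderiv[OF f], use a in simp)
 have pt: "?S ?w x \<le> 2 * ?S u x + 2 * ?S v x" if x: "a < norm x" for x
 proof -
  have d: "u differentiable (at x)" "v differentiable (at x)" "?w differentiable (at x)"
   using x C1_on_differentiable[OF u(1)] C1_on_differentiable[OF v(1)] C1_on_differentiable[OF C1_on_diff[OF u(1) v(1)]] by auto
  have "rderiv ?w x - \<i> * of_real k * ?w x = (rderiv u x - \<i> * of_real k * u x) - (rderiv v x - \<i> * of_real k * v x)"
   unfolding rderiv_sum[OF d(1)] rderiv_sum[OF d(2)] rderiv_sum[OF d(3)] pderiv_at_diff[OF d(1,2)] right_diff_distrib sum_subtractf by simp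
  moreover have "(norm (p - q))\<^sup>2 \<le> 2 * (norm p)\<^sup>2 + 2 * (norm q)\<^sup>2" for p q :: complex
  proof -
   have "(norm (p - q))\<^sup>2 \<le> (norm p + norm q)\<^sup>2" by (rule power_mono[OF norm_triangle_ineq4]) simp
   moreover have "0 \<le> (norm p - norm q)\<^sup>2" by simp
   ultimately show ?thesis by (simp add: power2_eq_square algebra_simps)
  qed
  ultimately show ?thesis by simp
 qed
 show "\<forall>\<^sub>F R in at_top. 0 \<le> sphere_integral R (?S ?w)"
  unfolding sphere_integral_def real_scaleR_def by (intro always_eventually allI mult_nonneg_nonneg integral_nonneg) auto
 show "\<forall>\<^sub>F R in at_top. sphere_integral R (?S ?w) \<le> 2 * sphere_integral R (?S u) + 2 * sphere_integral R (?S v)"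
  using eventually_gt_at_top[of a]
 proof eventually_elim
  case (elim R)
  have "(\<integral>y. ?S ?w (R *\<^sub>R y) \<partial>S2_measure) \<le> (\<integral>y. 2 * ?S u (R *\<^sub>R y) + 2 * ?S v (R *\<^sub>R y) \<partial>S2_measure)"
  proof (intro integral_mono_AE AE_I2 integrable_add integrable_mult_right ci elim u v C1_on_diff)
   fix y :: "real^3" assume "y \<in> space S2_measure"
   then have "a < norm (R *\<^sub>R y)" using elim a by (simp add: space_S2_measure)
   then show "?S ?w (R *\<^sub>R y) \<le> 2 * ?S u (R *\<^sub>R y) + 2 * ?S v (R *\<^sub>R y)" by (rule pt)
  qed
  also have "\<dots> = 2 * (\<integral>y. ?S u (R *\<^sub>R y) \<partial>S2_measure) + 2 * (\<integral>y. ?S v (R *\<^sub>R y) \<partial>S2_measure)"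
   by (simp only: integral_add[OF integrable_mult_right[OF ci[OF u(1) elim]] integrable_mult_right[OF ci[OF v(1) elim]]] integral_mult_right_zero)
  finally have "R\<^sup>2 * (\<integral>y. ?S ?w (R *\<^sub>R y) \<partial>S2_measure) \<le> R\<^sup>2 * (2 * (\<integral>y. ?S u (R *\<^sub>R y) \<partial>S2_measure) + 2 * (\<integral>y. ?S v (R *\<^sub>R y) \<partial>S2_measure))"
   by (rule mult_left_mono) simp
  then show ?case by (simp only: sphere_integral_def real_scaleR_def distrib_left mult.left_commute[of "R\<^sup>2" 2])
 qed
 have "((\<lambda>R. 2 * sphere_integral R (?S u) + 2 * sphere_integral R (?S v)) \<longlongrightarrow> 2 * 0 + 2 * 0) at_top"
  by (intro tendsto_intros u(2)[unfolded sommerfeld_def] v(2)[unfolded sommerfeld_def])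
 then show "((\<lambda>R. 2 * sphere_integral R (?S u) + 2 * sphere_integral R (?S v)) \<longlongrightarrow> 0) at_top" by simp
qed

lemma radiating_solution_eq_pot:
 fixes u f :: "real^3 \<Rightarrow> complex"
 assumes k: "0 < k" and f: "sqint f" "\<And>y. b < norm y \<Longrightarrow> f y = 0" and b: "0 \<le> b"
  and w: "weak_helmholtz (of_real (k\<^sup>2)) u g (\<lambda>\<phi>. (LBINT y. f y * \<phi> y))" and ext: "C1_on {x. b < norm x} u" and som: "sommerfeld k u"
 shows "AE x in lborel. u x = pot k f x"
proof -
 have k0: "0 \<le> k" using k by simp
 have fi: "integrable lborel f" by (rule sqint_supp_integrable[OF f])
 have pe: "C1_on {x. b < norm x} (pot k f)" by (rule pot_C1(1)[OF k0 fi open_exterior]) (simp add: f(2))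
 have ps: "sommerfeld k (pot k f)" by (rule pot_sommerfeld[OF k0 fi f(2) b])
 have "weak_helmholtz (of_real (k\<^sup>2)) (\<lambda>x. u x - pot k f x) (\<lambda>i x. g i x - dpot k i f x) (\<lambda>\<phi>. 0)"
  using weak_helmholtz_diff[OF w pot_weak_helmholtz[OF k0 f]] by simp
 from radiating_entire_zero[OF k this C1_on_diff[OF ext pe] b sommerfeld_diff[OF ext som pe ps b]]
 show ?thesis by simp
qed

lemma far_field_of_eq_integral:
 fixes u f :: "real^3 \<Rightarrow> complex"
 assumes f: "\<And>y. b < norm y \<Longrightarrow> f y = 0" and b: "0 \<le> b" "b < R"
  and w: "weak_helmholtz (of_real (k\<^sup>2)) u g (\<lambda>\<phi>. (LBINT y. f y * \<phi> y))" and ext: "C1_on {x. b < norm x} u" and xh: "norm xh = 1"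
 shows "far_field_of k R u xh = of_real (1 / (4 * pi)) * (LBINT y. f y * plane_wave k (- xh) y)"
proof -
 let ?v = "plane_wave k (- xh)"
 have v: "(\<lambda>z. exp (- \<i> * of_real (k * (xh \<bullet> z)))) = ?v"
  by (rule HOL.ext) (simp add: plane_wave_def inner_commute)
 have "sphere_integral R (\<lambda>x. rderiv u x * ?v x - u x * rderiv ?v x) = - (LBINT y. f y * ?v y)"
 proof (rule green_sphere[OF w ext b C1_on_plane_wave C1_on_pderiv_plane_wave])
  show "(\<Sum>i\<in>UNIV. pderiv_at i (pderiv_at i ?v) x) = - of_real (k\<^sup>2) * ?v x" for x
   by (rule plane_wave_laplace) (use xh in simp)
  show "(LBINT y. f y * (?v y * cutoff R' \<delta> y)) = (LBINT y. f y * ?v y)" if "0 < \<delta>" "b < R' - \<delta>" for R' \<delta>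
  proof (intro integral_cong refl)
   fix y show "f y * (?v y * cutoff R' \<delta> y) = f y * ?v y"
    using f[of y] cutoff_eq_1[OF that(1), of y R'] that by (cases "b < norm y") auto
  qed
 qed
 moreover have "sphere_integral R (\<lambda>x. u x * rderiv ?v x - rderiv u x * ?v x) = - sphere_integral R (\<lambda>x. rderiv u x * ?v x - u x * rderiv ?v x)"
  unfolding sphere_integral_def scaleR_minus_right[symmetric] integral_minus[symmetric] by simp
 moreover have "far_field_of k R u xh = of_real (1 / (4 * pi)) * sphere_integral R (\<lambda>x. u x * rderiv ?v x - rderiv u x * ?v x)"
  unfolding far_field_of_def v[unfolded fun_eq_iff, rule_format] v by (rule refl)
 ultimately show ?thesis by (simp only: minus_minus)
qed

section \<open>The Lippmann--Schwinger equation\<close>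

definition cut :: "(real^3) set \<Rightarrow> (real^3 \<Rightarrow> complex) \<Rightarrow> real^3 \<Rightarrow> complex" where
 "cut B f x = (if x \<in> B then f x else 0)"

lemma cut_measurable [measurable]: "B \<in> sets borel \<Longrightarrow> f \<in> borel_measurable borel \<Longrightarrow> cut B f \<in> borel_measurable borel"
 unfolding cut_def[abs_def] by (rule measurable_If_set) auto

lemma cut_in: "x \<in> B \<Longrightarrow> cut B f x = f x" and cut_out: "x \<notin> B \<Longrightarrow> cut B f x = 0"
 by (simp_all add: cut_def)

lemma sqint_cut: "B \<in> sets borel \<Longrightarrow> sqint f \<Longrightarrow> sqint (cut B f)"
proof -
 assume B: "B \<in> sets borel" and f: "sqint f"
 have "cut B f = (\<lambda>x. complex_of_real (indicator B x) * f x)" by (rule HOL.ext) (simp add: cut_def)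
 then show ?thesis using sqint_mult_bounded[OF f, of "\<lambda>x. complex_of_real (indicator B x)" 1] B by (simp add: indicator_def)
qed

lemma L2loc_sqint_cut:
 assumes f: "L2loc f" and B: "B \<in> sets borel" "B \<subseteq> cball 0 b"
 shows "sqint (cut B f)"
 unfolding sqint_def
proof
 have fm: "f \<in> borel_measurable borel" using f by (simp add: L2loc_def)
 then show m: "cut B f \<in> borel_measurable lborel" using cut_measurable[OF B(1)] by simp
 have "integrable lborel (\<lambda>x. indicator (cball 0 b) x *\<^sub>R (norm (f x))\<^sup>2)"
  using f compact_cball[of "0 :: real^3" b] unfolding L2loc_def set_integrable_def by blast
 then show "integrable lborel (\<lambda>x. (norm (cut B f x))\<^sup>2)"
 proof (rule integrable_bound)
  show "(\<lambda>x. (norm (cut B f x))\<^sup>2) \<in> borel_measurable lborel" using m by measurable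
  show "AE x in lborel. norm ((norm (cut B f x))\<^sup>2) \<le> norm (indicator (cball 0 b) x *\<^sub>R (norm (f x))\<^sup>2)"
  proof (rule AE_I2)
   fix x show "norm ((norm (cut B f x))\<^sup>2) \<le> norm (indicator (cball 0 b) x *\<^sub>R (norm (f x))\<^sup>2)"
    using B(2) by (cases "x \<in> B") (auto simp: cut_in cut_out)
  qed
 qed
qed

lemma pot_cong_AE:
 assumes "AE y in lborel. f y = g y" "f \<in> borel_measurable borel" "g \<in> borel_measurable borel"
 shows "pot k f = pot k g"
proof
 fix x
 have [measurable]: "f \<in> borel_measurable borel" "g \<in> borel_measurable borel" by fact+
 show "pot k f x = pot k g x" unfolding pot_def
  by (rule integral_cong_AE) (use assms(1) in \<open>auto elim!: eventually_mono\<close>)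
qed

lemma AE_kernel_integrable:
 assumes k: "0 \<le> k" and f: "sqint f" "\<And>y. b < norm y \<Longrightarrow> f y = 0"
 shows "AE x in lborel. norm x \<le> D \<longrightarrow> integrable lborel (\<lambda>y. helm k 0 (x - y) * f y)"
proof -
 define P where "P = \<bar>D\<bar> + \<bar>b\<bar> + 1"
 have P: "D + b < P" "0 \<le> P" unfolding P_def by linarith+
 have [measurable]: "f \<in> borel_measurable borel" using f(1) by (simp add: sqint_def)
 let ?n = "\<lambda>x. (NN y. ennreal (norm (helm k 0 (x - y) * f y)))"
 have nm: "?n \<in> borel_measurable borel"
  by (rule lborel.borel_measurable_nn_integral) measurable
 have "(NN x. indicator (cball 0 D) x * (?n x)\<^sup>2) \<noteq> \<infinity>"
  using pot_young(1)[OF k f P] by (auto simp: top_unique)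
 then have "AE x in lborel. indicator (cball 0 D) x * (?n x)\<^sup>2 \<noteq> \<infinity>"
  using nm by (intro nn_integral_PInf_AE) measurable
 then show ?thesis
 proof eventually_elim
  case (elim x)
  show ?case
  proof
   assume x: "norm x \<le> D"
   have "?n x \<noteq> top"
   proof
    assume "?n x = top"
    then show False using elim x by (simp add: power2_eq_square)
   qed
   then have "?n x < \<infinity>" by (simp add: less_top)
   then show "integrable lborel (\<lambda>y. helm k 0 (x - y) * f y)" by (intro integrableI_bounded) (simp, measurable)
  qed
 qed
qed

definition green :: "real \<Rightarrow> (real^3) set \<Rightarrow> hl2 \<Rightarrow> hl2" where
 "green k B f = abs_hl2 (cut B (pot k (cut B (rep_hl2 f))))"

lemma sqint_measurable: "sqint f \<Longrightarrow> f \<in> borel_measurable borel"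
 by (simp add: sqint_def)

lemma cut_outside: "B \<subseteq> cball 0 b \<Longrightarrow> b < norm y \<Longrightarrow> cut B f y = 0"
 by (auto simp: cut_def)

lemma sqint_green:
 assumes k: "0 \<le> k" and B: "B \<in> sets borel" "B \<subseteq> cball 0 b" and f: "sqint f"
 shows "sqint (cut B (pot k (cut B f)))"
 by (rule L2loc_sqint_cut[OF pot_L2loc(1)[OF k sqint_cut[OF B(1) f] cut_outside[OF B(2)]] B])

lemma green_abs:
 assumes B: "B \<in> sets borel" and f: "sqint f"
 shows "green k B (abs_hl2 f) = abs_hl2 (cut B (pot k (cut B f)))"
proof -
 have "pot k (cut B (rep_hl2 (abs_hl2 f))) = pot k (cut B f)"
 proof (rule pot_cong_AE)
  show "AE y in lborel. cut B (rep_hl2 (abs_hl2 f)) y = cut B f y"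
   using hl2_rep_abs[OF f] by eventually_elim (simp add: cut_def)
 qed (auto intro!: sqint_cut B sqint_measurable f hl2_rep)
 then show ?thesis by (simp add: green_def)
qed

lemma bounded_linear_green:
 assumes k: "0 \<le> k" and B: "B \<in> sets borel" "B \<subseteq> cball 0 b" and b: "0 \<le> b"
 shows "bounded_linear (green k B)"
proof (rule bounded_linear_intro)
 note sg = sqint_green[OF k B]
 show "green k B (f + g) = green k B f + green k B g" for f g
 proof -
  let ?f = "rep_hl2 f" and ?g = "rep_hl2 g"
  have "f + g = abs_hl2 (\<lambda>x. ?f x + ?g x)" using hl2_add_abs[OF hl2_rep hl2_rep, of f g] by (simp add: hl2_abs_rep)
  then have "green k B (f + g) = abs_hl2 (cut B (pot k (cut B (\<lambda>x. ?f x + ?g x))))"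
   using green_abs[OF B(1) sqint_add[OF hl2_rep hl2_rep]] by simp
  also have "\<dots> = abs_hl2 (\<lambda>x. cut B (pot k (cut B ?f)) x + cut B (pot k (cut B ?g)) x)"
  proof (rule hl2_eq_iff[THEN iffD2])
   show "sqint (cut B (pot k (cut B (\<lambda>x. ?f x + ?g x))))" by (intro sg sqint_add hl2_rep)
   show "sqint (\<lambda>x. cut B (pot k (cut B ?f)) x + cut B (pot k (cut B ?g)) x)" by (intro sqint_add sg hl2_rep)
   have "AE x in lborel. norm x \<le> b \<longrightarrow> integrable lborel (\<lambda>y. helm k 0 (x - y) * cut B ?f y)"
    "AE x in lborel. norm x \<le> b \<longrightarrow> integrable lborel (\<lambda>y. helm k 0 (x - y) * cut B ?g y)"
    by (rule AE_kernel_integrable[OF k sqint_cut[OF B(1) hl2_rep] cut_outside[OF B(2)]], assumption)+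
   then show "AE x in lborel. cut B (pot k (cut B (\<lambda>x. ?f x + ?g x))) x = cut B (pot k (cut B ?f)) x + cut B (pot k (cut B ?g)) x"
   proof eventually_elim
    case (elim x)
    show ?case
    proof (cases "x \<in> B")
     case True
     then have n: "norm x \<le> b" using B(2) by auto
     have "helm k 0 (x - y) * cut B (\<lambda>x. ?f x + ?g x) y = helm k 0 (x - y) * cut B ?f y + helm k 0 (x - y) * cut B ?g y" for y
      by (simp add: cut_def distrib_left)
     then show ?thesis using True elim n by (simp add: cut_def[of B "pot k _"] pot_def)
    qed (simp add: cut_def)
   qed
  qed
  also have "\<dots> = green k B f + green k B g" unfolding green_def by (rule hl2_add_abs[OF sg[OF hl2_rep] sg[OF hl2_rep], symmetric])
  finally show ?thesis .
 qed
 show "green k B (r *\<^sub>R f) = r *\<^sub>R green k B f" for r f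
 proof -
  let ?f = "rep_hl2 f"
  have "r *\<^sub>R f = abs_hl2 (\<lambda>x. r *\<^sub>R ?f x)" using hl2_scaleR_abs[OF hl2_rep, of r f] by (simp add: hl2_abs_rep)
  then have "green k B (r *\<^sub>R f) = abs_hl2 (cut B (pot k (cut B (\<lambda>x. r *\<^sub>R ?f x))))"
   using green_abs[OF B(1) sqint_scaleR[OF hl2_rep]] by simp
  also have "cut B (pot k (cut B (\<lambda>x. r *\<^sub>R ?f x))) = (\<lambda>x. r *\<^sub>R cut B (pot k (cut B ?f)) x)"
  proof
   fix x
   have "pot k (cut B (\<lambda>x. r *\<^sub>R ?f x)) x = r *\<^sub>R pot k (cut B ?f) x"
    unfolding pot_def integral_scaleR_right[symmetric]
    by (intro integral_cong refl) (simp add: cut_def)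
   then show "cut B (pot k (cut B (\<lambda>x. r *\<^sub>R ?f x))) x = r *\<^sub>R cut B (pot k (cut B ?f)) x" by (simp add: cut_def[of B "pot k _"])
  qed
  finally show ?thesis unfolding green_def by (simp only: hl2_scaleR_abs[OF sg[OF hl2_rep]])
 qed
 show "norm (green k B f) \<le> norm f * \<bar>young_const k (2 * b + 1)\<bar>" for f
 proof -
  let ?f = "rep_hl2 f" and ?Y = "young_const k (2 * b + 1)"
  have P: "b + b < 2 * b + 1" "0 \<le> 2 * b + 1" using b by auto
  note y = pot_young[OF k sqint_cut[OF B(1) hl2_rep] cut_outside[OF B(2)] P]
  have "(LBINT x. (norm (cut B (pot k (cut B ?f)) x))\<^sup>2) \<le> (LBINT x. indicator (cball 0 b) x * (norm (pot k (cut B ?f) x))\<^sup>2)"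
   by (rule integral_mono'[OF y(2)]) (use B(2) in \<open>auto simp: cut_def[of B "pot k _"] indicator_def\<close>)
  also have "\<dots> \<le> ?Y\<^sup>2 * (LBINT y. (norm (cut B ?f y))\<^sup>2)" by (rule y(4))
  also have "\<dots> \<le> ?Y\<^sup>2 * (LBINT y. (norm (?f y))\<^sup>2)"
   by (intro mult_left_mono integral_mono') (use hl2_rep[of f] in \<open>auto simp: cut_def sqint_def\<close>)
  finally have "sqrt (LBINT x. (norm (cut B (pot k (cut B ?f)) x))\<^sup>2) \<le> sqrt (?Y\<^sup>2 * (LBINT y. (norm (?f y))\<^sup>2))"
   by (rule real_sqrt_le_mono)
  then show ?thesis unfolding green_def hl2_norm_abs[OF sg[OF hl2_rep]] hl2_norm_rep[of f] by (simp add: real_sqrt_mult mult.commute)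
 qed
qed

lemma mulop_abs: "sqint f \<Longrightarrow> mulop a (abs_hl2 f) = abs_hl2 (\<lambda>x. rep_linf a x * f x)"
 unfolding mulop_rep
 by (rule hl2_eq_iff[THEN iffD2]) (auto intro!: sqint_linf_mult hl2_rep elim!: eventually_mono[OF hl2_rep_abs])

definition mulB :: "linf \<Rightarrow> hl2 \<Rightarrow>\<^sub>L hl2" where
 "mulB a = Blinfun (mulop a)"

lemma mulB_apply: "blinfun_apply (mulB a) f = mulop a f"
 unfolding mulB_def
 by (simp add: bounded_linear_Blinfun_apply bounded_bilinear.bounded_linear_right[OF bounded_bilinear_mulop])

lemma bounded_linear_mulB: "bounded_linear mulB"
proof -
 interpret bounded_bilinear mulop by (rule bounded_bilinear_mulop)
 obtain C where C: "C > 0" "\<And>a f. norm (mulop a f) \<le> norm a * norm f * C" using pos_bounded by blast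
 show ?thesis
 proof (rule bounded_linear_intro)
  show "mulB (a + b) = mulB a + mulB b" for a b
   by (rule blinfun_eqI) (simp add: mulB_apply blinfun.add_left add_left)
  show "mulB (r *\<^sub>R a) = r *\<^sub>R mulB a" for r a
   by (rule blinfun_eqI) (simp add: mulB_apply blinfun.scaleR_left scaleR_left)
  show "norm (mulB a) \<le> norm a * C" for a
  proof (rule norm_blinfun_bound)
   show "norm (mulB a f) \<le> norm a * C * norm f" for f
    using C(2)[of a f] by (simp add: mulB_apply mult.assoc mult.commute[of C])
  qed (use C in simp)
 qed
qed

definition greenB :: "real \<Rightarrow> (real^3) set \<Rightarrow> hl2 \<Rightarrow>\<^sub>L hl2" where
 "greenB k B = Blinfun (green k B)"

text \<open>
 The contrast \<open>n - 1\<close> in \<open>B\<close>, with value \<open>\<i>\<close> off \<open>B\<close>; for \<open>n\<close> vanishing off \<open>B\<close> it is affine in \<open>n\<close>.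
\<close>

definition contrast :: "(real^3) set \<Rightarrow> linf \<Rightarrow> linf" where
 "contrast B n = n + abs_linf (\<lambda>x. if x \<in> B then - 1 else \<i>)"

definition ls_op :: "real \<Rightarrow> (real^3) set \<Rightarrow> linf \<Rightarrow> hl2 \<Rightarrow>\<^sub>L hl2" where
 "ls_op k B n = id_blinfun - k\<^sup>2 *\<^sub>R (greenB k B o\<^sub>L mulB (contrast B n))"

lemma contrast_rep:
 assumes B: "B \<in> sets borel" and n: "n \<in> Linf_on B"
 shows "AE x in lborel. rep_linf (contrast B n) x = (if x \<in> B then rep_linf n x - 1 else \<i>)"
proof -
 let ?e = "\<lambda>x. if x \<in> B then - 1 else \<i>"
 have "linf_fun ?e" unfolding linf_fun_def using B by (auto intro!: exI[of _ 1])
 from linf_rep_abs[OF this] linf_add_rep[of n "abs_linf ?e"] n[unfolded Linf_on_def, simplified]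
 show ?thesis unfolding contrast_def by eventually_elim auto
qed

lemma contrast_Im:
 assumes B: "B \<in> sets borel" and n: "n \<in> admissible B"
 shows "\<exists>l>0. AE x in lborel. l \<le> Im (rep_linf (contrast B n) x)"
proof -
 obtain m where m: "m > 0" "AE x in lborel. x \<in> B \<longrightarrow> m \<le> Im (rep_linf n x)" and nB: "n \<in> Linf_on B"
  using n by (auto simp: admissible_def)
 have "AE x in lborel. min m 1 \<le> Im (rep_linf (contrast B n) x)"
  using contrast_rep[OF B nB] m(2) by eventually_elim auto
 then show ?thesis using m(1) by (intro exI[of _ "min m 1"]) auto
qed

lemma ls_op_apply:
 assumes k: "0 \<le> k" and B: "B \<in> sets borel" "B \<subseteq> cball 0 b" and b: "0 \<le> b"
 shows "ls_op k B n f = f - k\<^sup>2 *\<^sub>R green k B (mulop (contrast B n) f)"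
 unfolding ls_op_def
 by (simp add: blinfun.diff_left blinfun.scaleR_left mulB_apply greenB_def bounded_linear_Blinfun_apply[OF bounded_linear_green[OF k B b]])

text \<open>
 The identity part of the operator contributes \<open>Im a\<close> and the potential part the nonnegative form
 \<open>Im (G (a f), a f)\<close>.
\<close>

lemma ls_op_coercive:
 assumes k: "0 < k" and B: "B \<in> sets borel" "B \<subseteq> cball 0 b" and b: "0 \<le> b"
  and l: "AE x in lborel. l \<le> Im (rep_linf (contrast B n) x)" "0 < l"
 shows "l * (norm f)\<^sup>2 \<le> inner (mulop (abs_linf (\<lambda>x. \<i> * cnj (rep_linf (contrast B n) x))) (ls_op k B n f)) f"
proof -
 have k0: "0 \<le> k" using k by simp
 let ?a = "rep_linf (contrast B n)" and ?f = "rep_hl2 f"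
 let ?b = "\<lambda>x. \<i> * cnj (?a x)"
 let ?h = "cut B (\<lambda>x. ?a x * ?f x)"
 let ?p = "cut B (pot k ?h)"
 have lf: "linf_fun ?b"
 proof -
  have "linf_fun ?a" by (rule linf_rep)
  then have "linf_fun (\<lambda>x. cnj (?a x))" unfolding linf_fun_def by (auto intro!: borel_measurable_cnj)
  then show ?thesis by (rule linf_fun_mult)
 qed
 note af = sqint_linf_mult[OF hl2_rep[of f], of "contrast B n"]
 have hs: "sqint ?h" by (rule sqint_cut[OF B(1) af])
 have h0: "b < norm y \<Longrightarrow> ?h y = 0" for y by (rule cut_outside[OF B(2)])
 have ps: "sqint ?p" by (rule sqint_green[OF k0 B af])
 have "ls_op k B n f = abs_hl2 ?f - k\<^sup>2 *\<^sub>R abs_hl2 ?p"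
  unfolding ls_op_apply[OF k0 B b] mulop_rep green_abs[OF B(1) af] hl2_abs_rep by (rule refl)
 also have "\<dots> = abs_hl2 (\<lambda>x. ?f x - k\<^sup>2 *\<^sub>R ?p x)"
  unfolding hl2_scaleR_abs[OF ps] by (rule hl2_diff_abs[OF hl2_rep sqint_scaleR[OF ps]])
 finally have L: "ls_op k B n f = abs_hl2 (\<lambda>x. ?f x - k\<^sup>2 *\<^sub>R ?p x)" .
 have s1: "sqint (\<lambda>x. ?f x - k\<^sup>2 *\<^sub>R ?p x)" by (intro sqint_diff hl2_rep sqint_scaleR ps)
 have "mulop (abs_linf ?b) (ls_op k B n f) = abs_hl2 (\<lambda>x. rep_linf (abs_linf ?b) x * (?f x - k\<^sup>2 *\<^sub>R ?p x))"
  unfolding L by (rule mulop_abs[OF s1])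
 then have "cinner (mulop (abs_linf ?b) (ls_op k B n f)) f = (LBINT x. rep_linf (abs_linf ?b) x * (?f x - k\<^sup>2 *\<^sub>R ?p x) * cnj (?f x))"
  using cinner_abs[OF sqint_linf_mult[OF s1] hl2_rep[of f]] by (simp add: hl2_abs_rep)
 also have "\<dots> = (LBINT x. \<i> * (cnj (?a x) * ?f x * cnj (?f x)) - (\<i> * of_real (k\<^sup>2)) * (pot k ?h x * cnj (?h x)))"
 proof (rule integral_cong_AE)
  show "AE x in lborel. rep_linf (abs_linf ?b) x * (?f x - k\<^sup>2 *\<^sub>R ?p x) * cnj (?f x) = \<i> * (cnj (?a x) * ?f x * cnj (?f x)) - (\<i> * of_real (k\<^sup>2)) * (pot k ?h x * cnj (?h x))"
   using linf_rep_abs[OF lf]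
  proof eventually_elim
   case (elim x)
   show ?case unfolding elim
    by (cases "x \<in> B") (simp_all only: cut_in cut_out not_False_eq_True scaleR_conv_of_real, simp_all add: algebra_simps)
  qed
  have [measurable]: "?f \<in> borel_measurable borel" "rep_linf g \<in> borel_measurable borel" "pot k ?h \<in> borel_measurable borel" "?h \<in> borel_measurable borel" "?p \<in> borel_measurable borel" for g
   using sqint_measurable[OF hl2_rep[of f]] linf_rep[of g] pot_measurable(1)[OF sqint_measurable[OF hs]] sqint_measurable[OF hs] sqint_measurable[OF ps]
   by (auto simp: linf_fun_def)
  show "(\<lambda>x. rep_linf (abs_linf ?b) x * (?f x - k\<^sup>2 *\<^sub>R ?p x) * cnj (?f x)) \<in> borel_measurable lborel"
   "(\<lambda>x. \<i> * (cnj (?a x) * ?f x * cnj (?f x)) - (\<i> * of_real (k\<^sup>2)) * (pot k ?h x * cnj (?h x))) \<in> borel_measurable lborel"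
   by measurable
 qed
 also have "\<dots> = \<i> * (LBINT x. cnj (?a x) * ?f x * cnj (?f x)) - (\<i> * of_real (k\<^sup>2)) * (LBINT x. pot k ?h x * cnj (?h x))"
 proof -
  have i1: "integrable lborel (\<lambda>x. cnj (?a x) * ?f x * cnj (?f x))"
  proof -
   have "integrable lborel (\<lambda>x. cnj (?a x * ?f x) * ?f x)" by (rule sqint_integrable_mult[OF sqint_cnj[OF af] hl2_rep])
   then show ?thesis by (simp add: mult_ac)
  qed
  have i2: "integrable lborel (\<lambda>x. pot k ?h x * cnj (?h x))"
  proof -
   have "integrable lborel (\<lambda>x. ?p x * cnj (?h x))" by (rule sqint_integrable_mult[OF ps sqint_cnj[OF hs]])
   moreover have "?p x * cnj (?h x) = pot k ?h x * cnj (?h x)" for x by (simp add: cut_def)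
   ultimately show ?thesis by simp
  qed
  show ?thesis by (simp only: integral_diff[OF integrable_mult_right[OF i1] integrable_mult_right[OF i2]] integral_mult_right_zero)
 qed
 finally have "inner (mulop (abs_linf ?b) (ls_op k B n f)) f = - Im (LBINT x. cnj (?a x) * ?f x * cnj (?f x)) + k\<^sup>2 * Im (LBINT x. pot k ?h x * cnj (?h x))"
  unfolding inner_hl2_def by simp
 also have "\<dots> \<ge> - Im (LBINT x. cnj (?a x) * ?f x * cnj (?f x))"
  using pot_positive[OF k hs h0 b] by simp
 also (xtrans) have "- Im (LBINT x. cnj (?a x) * ?f x * cnj (?f x)) \<ge> l * (norm f)\<^sup>2"
 proof -
  have i1: "integrable lborel (\<lambda>x. cnj (?a x) * ?f x * cnj (?f x))"
  proof -
   have "integrable lborel (\<lambda>x. cnj (?a x * ?f x) * ?f x)" by (rule sqint_integrable_mult[OF sqint_cnj[OF af] hl2_rep])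
   then show ?thesis by (simp add: mult_ac)
  qed
  have e: "- Im (cnj (?a x) * ?f x * cnj (?f x)) = Im (?a x) * (norm (?f x))\<^sup>2" for x
  proof -
   have "cnj (?a x) * ?f x * cnj (?f x) = cnj (?a x) * of_real ((norm (?f x))\<^sup>2)"
    by (simp only: mult.assoc complex_norm_square)
   then have "- Im (cnj (?a x) * ?f x * cnj (?f x)) = - Im (cnj (?a x) * of_real ((norm (?f x))\<^sup>2))" by (simp only:)
   also have "\<dots> = Im (?a x) * (norm (?f x))\<^sup>2" by (simp add: complex_is_Real_iff)
   finally show ?thesis .
  qed
  have i2: "integrable lborel (\<lambda>x. Im (?a x) * (norm (?f x))\<^sup>2)"
   using integrable_minus[OF integrable_Im[OF i1]] unfolding e .
  have "l * (norm f)\<^sup>2 = (LBINT x. l * (norm (?f x))\<^sup>2)"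
   unfolding hl2_norm_rep by (simp add: real_sqrt_pow2 integral_nonneg)
  also have "\<dots> \<le> (LBINT x. Im (?a x) * (norm (?f x))\<^sup>2)"
  proof (rule integral_mono_AE[OF _ i2])
   show "integrable lborel (\<lambda>x. l * (norm (?f x))\<^sup>2)" using hl2_rep[of f] by (simp add: sqint_def)
   show "AE x in lborel. l * (norm (?f x))\<^sup>2 \<le> Im (?a x) * (norm (?f x))\<^sup>2"
    using l(1) by eventually_elim (simp add: mult_right_mono)
  qed
  also have "\<dots> = - Im (LBINT x. cnj (?a x) * ?f x * cnj (?f x))"
   unfolding e[symmetric] by (simp only: integral_minus integral_Im[OF i1])
  finally show ?thesis .
 qed
 finally show ?thesis .
qed

text \<open>
 Multiplication by \<open>\<i> * cnj a\<close> is injective, so solving the coercive equation solves the original one.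
\<close>

lemma ls_op_invertible:
 assumes k: "0 < k" and B: "B \<in> sets borel" "B \<subseteq> cball 0 b" and b: "0 \<le> b" and n: "n \<in> admissible B"
 shows "\<exists>S. ls_op k B n o\<^sub>L S = id_blinfun \<and> S o\<^sub>L ls_op k B n = id_blinfun"
proof -
 obtain l where l: "0 < l" "AE x in lborel. l \<le> Im (rep_linf (contrast B n) x)" using contrast_Im[OF B(1) n] by blast
 let ?b = "\<lambda>x. \<i> * cnj (rep_linf (contrast B n) x)"
 let ?m = "mulop (abs_linf ?b)"
 let ?L = "blinfun_apply (ls_op k B n)"
 interpret m: bounded_linear ?m by (rule bounded_bilinear.bounded_linear_right[OF bounded_bilinear_mulop])
 have lf: "linf_fun ?b"
 proof -
  have "linf_fun (rep_linf (contrast B n))" by (rule linf_rep)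
  then have "linf_fun (\<lambda>x. cnj (rep_linf (contrast B n) x))" unfolding linf_fun_def by (auto intro!: borel_measurable_cnj)
  then show ?thesis by (rule linf_fun_mult)
 qed
 note coer = ls_op_coercive[OF k B b l(2,1)]
 have bl: "bounded_linear (\<lambda>f. ?m (?L f))" by (rule bounded_linear_compose[OF m.bounded_linear_axioms blinfun.bounded_linear_right])
 have m0: "g = 0" if "?m g = 0" for g
 proof -
  have "abs_hl2 (\<lambda>x. rep_linf (abs_linf ?b) x * rep_hl2 g x) = abs_hl2 (\<lambda>x. 0)"
   using that by (simp add: mulop_rep zero_hl2_def)
  then have "AE x in lborel. rep_linf (abs_linf ?b) x * rep_hl2 g x = 0"
   using hl2_eq_iff[OF sqint_linf_mult[OF hl2_rep] sqint_zero] by blast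
  then have "AE x in lborel. rep_hl2 g x = 0"
   using linf_rep_abs[OF lf] l(2) by eventually_elim (use l(1) in auto)
  then have "abs_hl2 (rep_hl2 g) = abs_hl2 (\<lambda>x. 0)" by (rule hl2_eq_iff[THEN iffD2, OF hl2_rep sqint_zero])
  then show ?thesis by (simp add: hl2_abs_rep zero_hl2_def)
 qed
 obtain M where M: "M > 0" "\<And>f. norm (?m f) \<le> norm f * M" using m.pos_bounded by blast
 have low: "l * norm f \<le> M * norm (?L f)" for f
 proof (cases "f = 0")
  case False
  have "l * (norm f)\<^sup>2 \<le> inner (?m (?L f)) f" by (rule coer)
  also have "\<dots> \<le> norm (?m (?L f)) * norm f" by (rule norm_cauchy_schwarz)
  also have "\<dots> \<le> (norm (?L f) * M) * norm f" by (intro mult_right_mono M(2)) simp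
  finally have "(l * norm f) * norm f \<le> (M * norm (?L f)) * norm f" by (simp add: power2_eq_square mult_ac)
  then show ?thesis using False by simp
 qed (use M in simp)
 have surj: "\<exists>x. ?L x = y" for y
 proof -
  obtain x where "?m (?L x) = ?m y" using lax_milgram[OF bl l(1) coer, of "?m y"] by blast
  then have "?m (?L x - y) = 0" by (simp add: m.diff)
  then have "?L x = y" using m0[of "?L x - y"] by simp
  then show ?thesis by blast
 qed
 have inj: "x = y" if "?L x = ?L y" for x y
 proof -
  have "l * norm (x - y) \<le> 0" using low[of "x - y"] that by (simp add: blinfun.diff_right)
  then show ?thesis using l(1) by (simp add: mult_le_0_iff)
 qed
 define s where "s y = (SOME x. ?L x = y)" for y
 have Ls: "?L (s y) = y" for y unfolding s_def by (rule someI_ex[OF surj])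
 have sL: "s (?L x) = x" for x by (rule inj[OF Ls])
 have "bounded_linear s"
 proof (rule bounded_linear_intro)
  show "s (x + y) = s x + s y" for x y by (rule inj) (simp add: blinfun.add_right Ls)
  show "s (r *\<^sub>R x) = r *\<^sub>R s x" for r x by (rule inj) (simp add: blinfun.scaleR_right Ls)
  show "norm (s x) \<le> norm x * (M / l)" for x
   using low[of "s x"] l(1) by (simp add: Ls pos_le_divide_eq mult_ac)
 qed
 then have "blinfun_apply (Blinfun s) = s" by (rule bounded_linear_Blinfun_apply)
 then show ?thesis
  by (intro exI[of _ "Blinfun s"] conjI blinfun_eqI) (simp_all add: Ls sL)
qed

definition ls_inv :: "real \<Rightarrow> (real^3) set \<Rightarrow> linf \<Rightarrow> hl2 \<Rightarrow>\<^sub>L hl2" where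
 "ls_inv k B n = (SOME S. ls_op k B n o\<^sub>L S = id_blinfun \<and> S o\<^sub>L ls_op k B n = id_blinfun)"

lemma ls_inv:
 assumes "0 < k" "B \<in> sets borel" "B \<subseteq> cball 0 b" "0 \<le> b" "n \<in> admissible B"
 shows "ls_op k B n o\<^sub>L ls_inv k B n = id_blinfun" "ls_inv k B n o\<^sub>L ls_op k B n = id_blinfun"
 using someI_ex[OF ls_op_invertible[OF assms]] unfolding ls_inv_def by auto

definition ls_deriv :: "real \<Rightarrow> (real^3) set \<Rightarrow> linf \<Rightarrow> hl2 \<Rightarrow>\<^sub>L hl2" where
 "ls_deriv k B h = - (k\<^sup>2 *\<^sub>R (greenB k B o\<^sub>L mulB h))"

lemma bounded_linear_ls_deriv: "bounded_linear (ls_deriv k B)"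
 unfolding ls_deriv_def
 by (intro bounded_linear_minus bounded_linear_const_scaleR bounded_linear_compose[OF bounded_bilinear.bounded_linear_right[OF bounded_bilinear_blinfun_compose] bounded_linear_mulB])

lemma ls_op_diff: "ls_op k B x - ls_op k B y = ls_deriv k B (x - y)"
proof -
 interpret m: bounded_linear mulB by (rule bounded_linear_mulB)
 have "mulB (contrast B x) = mulB (contrast B y) + mulB (x - y)" unfolding m.add[symmetric] by (simp add: contrast_def add.commute)
 then show ?thesis
  unfolding ls_op_def ls_deriv_def by (simp add: bounded_bilinear.add_right[OF bounded_bilinear_blinfun_compose] scaleR_add_right)
qed

lemma ls_inv_has_derivative:
 assumes "0 < k" "B \<in> sets borel" "B \<subseteq> cball 0 b" "0 \<le> b" "n \<in> admissible B"
 shows "(ls_inv k B has_derivative (\<lambda>h. - (ls_inv k B n o\<^sub>L (ls_deriv k B h o\<^sub>L ls_inv k B n)))) (at n within admissible B)"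
 by (rule has_derivative_blinfun_inverse[OF ls_inv(1)[OF assms(1-4)] ls_inv(2)[OF assms(1-4)] bounded_linear_ls_deriv ls_op_diff assms(5)])

section \<open>Scattered fields and the Lippmann--Schwinger equation\<close>

lemma weak_helmholtz_scale:
 assumes w: "weak_helmholtz \<kappa> u g (\<lambda>\<phi>. 0)"
 shows "weak_helmholtz \<kappa> (\<lambda>x. c * u x) (\<lambda>i x. c * g i x) (\<lambda>\<phi>. 0)"
proof -
 note W = weak_helmholtzD[OF w]
 have L: "L1loc (\<lambda>x. c * f x)" if "L1loc f" for f
  using that unfolding L1loc_def by (auto simp: mult_scaleR_right[symmetric] simp del: mult_scaleR_right)
 show ?thesis unfolding weak_helmholtz_def
  using W by (auto intro!: L simp: mult.assoc sum_distrib_left[symmetric] mult.left_commute[of \<kappa>])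
qed

lemma weak_helmholtz_plane_wave:
 assumes d: "norm d = 1"
 shows "weak_helmholtz (of_real (k\<^sup>2)) (plane_wave k d) (\<lambda>i. pderiv_at i (plane_wave k d)) (\<lambda>\<phi>. 0)"
 unfolding weak_helmholtz_def
proof (intro conjI allI impI)
 let ?p = "plane_wave k d"
 note c = C1_on_plane_wave[of UNIV k d] and c2 = C1_on_pderiv_plane_wave[of UNIV _ k d]
 show "L1loc ?p" "L1loc (pderiv_at i ?p)" for i
  by (intro L1loc_continuous C1_on_continuous[OF c] C1_on_continuous[OF c2])+
 fix \<phi> assume \<phi>: "test_fun \<phi>"
 note ibp = integration_by_parts[OF \<phi> _ open_UNIV subset_UNIV]
 show "(LBINT x. ?p x * pderiv_at i \<phi> x) = - (LBINT x. pderiv_at i ?p x * \<phi> x)" for i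
  by (rule ibp(1)[OF c])
 have "(\<Sum>i\<in>UNIV. (LBINT x. pderiv_at i ?p x * pderiv_at i \<phi> x)) = - (\<Sum>i\<in>UNIV. (LBINT x. pderiv_at i (pderiv_at i ?p) x * \<phi> x))"
  unfolding ibp(1)[OF c2] by (rule sum_negf)
 also have "(\<Sum>i\<in>UNIV. (LBINT x. pderiv_at i (pderiv_at i ?p) x * \<phi> x)) = (LBINT x. (\<Sum>i\<in>UNIV. pderiv_at i (pderiv_at i ?p) x * \<phi> x))"
  by (rule integral_sum[symmetric]) (rule ibp(3)[OF c2])
 also have "\<dots> = (LBINT x. - of_real (k\<^sup>2) * (?p x * \<phi> x))"
  unfolding sum_distrib_right[symmetric] plane_wave_laplace[OF d] mult.assoc by (rule refl)
 finally show "(\<Sum>i\<in>UNIV. (LBINT x. pderiv_at i ?p x * pderiv_at i \<phi> x)) = of_real (k\<^sup>2) * (LBINT x. ?p x * \<phi> x) + 0"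
  unfolding integral_mult_right_zero by simp
qed

lemma L2loc_continuous:
 assumes "continuous_on UNIV f"
 shows "L2loc f"
 unfolding L2loc_def
proof (intro conjI allI impI)
 show "f \<in> borel_measurable lborel" using borel_measurable_continuous_onI[OF assms] by simp
 show "set_integrable lborel S (\<lambda>x. (norm (f x))\<^sup>2)" if "compact S" for S
  by (rule borel_integrable_compact[OF that, folded set_integrable_def]) (intro continuous_intros continuous_on_subset[OF assms], auto)
qed

lemma L2loc_diff:
 assumes p: "L2loc p" and q: "L2loc q"
 shows "L2loc (\<lambda>x. p x - q x)"
 unfolding L2loc_def
proof (intro conjI allI impI)
 have m[measurable]: "p \<in> borel_measurable lborel" "q \<in> borel_measurable lborel" using assms by (auto simp: L2loc_def)
 show "(\<lambda>x. p x - q x) \<in> borel_measurable lborel" by measurable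
 fix S :: "(real^3) set" assume S: "compact S"
 have [measurable]: "S \<in> sets lborel" using S by (simp add: compact_imp_closed)
 have "integrable lborel (\<lambda>x. 2 * (indicator S x *\<^sub>R (norm (p x))\<^sup>2) + 2 * (indicator S x *\<^sub>R (norm (q x))\<^sup>2))"
  using p q S unfolding L2loc_def set_integrable_def
  by (intro integrable_add integrable_mult_right) auto
 then show "set_integrable lborel S (\<lambda>x. (norm (p x - q x))\<^sup>2)" unfolding set_integrable_def
 proof (rule integrable_bound)
  show "(\<lambda>x. indicator S x *\<^sub>R (norm (p x - q x))\<^sup>2) \<in> borel_measurable lborel" by measurable
  have "(norm (p x - q x))\<^sup>2 \<le> 2 * (norm (p x))\<^sup>2 + 2 * (norm (q x))\<^sup>2" for x
  proof -
   have "(norm (p x - q x))\<^sup>2 \<le> (norm (p x) + norm (q x))\<^sup>2" by (rule power_mono[OF norm_triangle_ineq4]) simp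
   moreover have "0 \<le> (norm (p x) - norm (q x))\<^sup>2" by simp
   ultimately show ?thesis by (simp add: power2_eq_square algebra_simps)
  qed
  then show "AE x in lborel. norm (indicator S x *\<^sub>R (norm (p x - q x))\<^sup>2) \<le> norm (2 * (indicator S x *\<^sub>R (norm (p x))\<^sup>2) + 2 * (indicator S x *\<^sub>R (norm (q x))\<^sup>2))"
   by (intro AE_I2) (auto simp: indicator_def)
 qed
qed

text \<open>
 The total field satisfies the Helmholtz equation of the homogeneous medium with this right-hand side.
\<close>

definition source :: "real \<Rightarrow> (real^3) set \<Rightarrow> linf \<Rightarrow> (real^3 \<Rightarrow> complex) \<Rightarrow> real^3 \<Rightarrow> complex" where
 "source k B n u = cut B (\<lambda>x. of_real (k\<^sup>2) * ((rep_linf n x - 1) * u x))"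

lemma source_measurable: "B \<in> sets borel \<Longrightarrow> u \<in> borel_measurable borel \<Longrightarrow> source k B n u \<in> borel_measurable borel"
 unfolding source_def using linf_rep[of n] by (intro cut_measurable borel_measurable_times borel_measurable_diff) (auto simp: linf_fun_def)

lemma helmholtz_solution_iff:
 assumes B: "B \<in> sets borel"
 shows "helmholtz_solution k (extend_by_one B n) u \<longleftrightarrow>
  (\<exists>g. L2loc u \<and> (\<forall>i. L2loc (g i)) \<and> weak_helmholtz (of_real (k\<^sup>2)) u g (\<lambda>\<phi>. (LBINT x. source k B n u x * \<phi> x)))"
proof -
 have *: "(LBINT x. (\<Sum>i\<in>UNIV. g i x * pderiv_at i \<phi> x)) = (\<Sum>i\<in>UNIV. (LBINT x. g i x * pderiv_at i \<phi> x))
   \<and> of_real (k\<^sup>2) * (LBINT x. extend_by_one B n x * u x * \<phi> x) = of_real (k\<^sup>2) * (LBINT x. u x * \<phi> x) + (LBINT x. source k B n u x * \<phi> x)"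
  if u: "L2loc u" and g: "\<And>i. L2loc (g i)" and \<phi>: "test_fun \<phi>" for g \<phi>
 proof
  show "(LBINT x. (\<Sum>i\<in>UNIV. g i x * pderiv_at i \<phi> x)) = (\<Sum>i\<in>UNIV. (LBINT x. g i x * pderiv_at i \<phi> x))"
   by (rule integral_sum) (rule L1loc_test_fun(2)[OF L2loc_imp_L1loc[OF g] \<phi>])
  have iu: "integrable lborel (\<lambda>x. u x * \<phi> x)" by (rule L1loc_test_fun(1)[OF L2loc_imp_L1loc[OF u] \<phi>])
  have um: "u \<in> borel_measurable borel" using u by (simp add: L2loc_def)
  have pm: "\<phi> \<in> borel_measurable borel" by (rule borel_measurable_continuous_onI[OF test_funD(2)[OF \<phi>]])
  have iS: "integrable lborel (\<lambda>x. source k B n u x * \<phi> x)"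
  proof (rule integrable_bound)
   let ?M = "k\<^sup>2 * (norm n + 1)"
   show "integrable lborel (\<lambda>x. of_real ?M * (u x * \<phi> x))" by (rule integrable_mult_right[OF iu])
   show "(\<lambda>x. source k B n u x * \<phi> x) \<in> borel_measurable lborel"
    unfolding measurable_lborel1 measurable_lborel2 by (rule borel_measurable_times[OF source_measurable[OF B um, of k n] pm])
   show "AE x in lborel. norm (source k B n u x * \<phi> x) \<le> norm (of_real ?M * (u x * \<phi> x))"
    using linf_AE_le_norm[of n]
   proof eventually_elim
    case (elim x)
    have "norm (rep_linf n x - 1) \<le> norm n + 1" using norm_triangle_ineq4[of "rep_linf n x" 1] elim by simp
    then have "k\<^sup>2 * norm (rep_linf n x - 1) * (norm (u x) * norm (\<phi> x)) \<le> ?M * (norm (u x) * norm (\<phi> x))"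
     by (intro mult_right_mono mult_left_mono) auto
    moreover have "norm (of_real ?M * (u x * \<phi> x)) = ?M * (norm (u x) * norm (\<phi> x))"
     by (simp only: norm_mult norm_of_real) (simp add: abs_mult)
    ultimately show ?case by (cases "x \<in> B") (simp_all add: source_def cut_in cut_out norm_mult norm_power mult_ac)
   qed
  qed
  have "of_real (k\<^sup>2) * (LBINT x. extend_by_one B n x * u x * \<phi> x) = (LBINT x. of_real (k\<^sup>2) * (u x * \<phi> x) + source k B n u x * \<phi> x)"
   unfolding integral_mult_right_zero[symmetric]
   by (intro integral_cong refl) (simp add: extend_by_one_def source_def cut_def algebra_simps)
  also have "\<dots> = of_real (k\<^sup>2) * (LBINT x. u x * \<phi> x) + (LBINT x. source k B n u x * \<phi> x)"
   by (simp only: integral_add[OF integrable_mult_right[OF iu] iS] integral_mult_right_zero)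
  finally show "of_real (k\<^sup>2) * (LBINT x. extend_by_one B n x * u x * \<phi> x) = of_real (k\<^sup>2) * (LBINT x. u x * \<phi> x) + (LBINT x. source k B n u x * \<phi> x)" .
 qed
 show ?thesis unfolding helmholtz_solution_def H1loc_def weak_helmholtz_def
 proof (rule ex_cong1)
  fix g :: "3 \<Rightarrow> real^3 \<Rightarrow> complex"
  let ?H = "L2loc u \<and> (\<forall>i. L2loc (g i))"
  show "((L2loc u \<and> (\<forall>i. L2loc (g i)) \<and> (\<forall>\<phi> i. test_fun \<phi> \<longrightarrow> (LBINT x. u x * pderiv_at i \<phi> x) = - (LBINT x. g i x * \<phi> x))) \<and>
    (\<forall>\<phi>. test_fun \<phi> \<longrightarrow> (LBINT x. (\<Sum>i\<in>UNIV. g i x * pderiv_at i \<phi> x)) = of_real (k\<^sup>2) * (LBINT x. extend_by_one B n x * u x * \<phi> x))) =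
   (L2loc u \<and> (\<forall>i. L2loc (g i)) \<and> L1loc u \<and> (\<forall>i. L1loc (g i)) \<and> (\<forall>\<phi> i. test_fun \<phi> \<longrightarrow> (LBINT x. u x * pderiv_at i \<phi> x) = - (LBINT x. g i x * \<phi> x)) \<and>
    (\<forall>\<phi>. test_fun \<phi> \<longrightarrow> (\<Sum>i\<in>UNIV. LBINT x. g i x * pderiv_at i \<phi> x) = of_real (k\<^sup>2) * (LBINT x. u x * \<phi> x) + (LBINT x. source k B n u x * \<phi> x)))"
  proof (cases ?H)
   case True
   then have L: "L2loc u" "\<And>i. L2loc (g i)" by auto
   show ?thesis using L * [OF L] by (auto simp: L2loc_imp_L1loc)
  qed auto
 qed
qed

definition incident :: "real \<Rightarrow> (real^3) set \<Rightarrow> real^3 \<Rightarrow> hl2" where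
 "incident k B d = abs_hl2 (cut B (plane_wave k d))"

lemma sqint_incident: "B \<in> sets borel \<Longrightarrow> B \<subseteq> cball 0 b \<Longrightarrow> sqint (cut B (plane_wave k d))"
 by (rule L2loc_sqint_cut[OF L2loc_continuous[OF continuous_plane_wave]])

lemma source_sqint:
 assumes u: "sqint (cut B u)"
 shows "sqint (source k B n u)"
proof -
 have e: "source k B n u = (\<lambda>x. of_real (k\<^sup>2) * (rep_linf n x * cut B u x - cut B u x))"
  by (rule HOL.ext) (simp add: source_def cut_def algebra_simps)
 show ?thesis unfolding e by (intro sqint_cmult sqint_diff sqint_linf_mult u)
qed

lemma pot_cmult: "pot k (\<lambda>x. c * f x) x = c * pot k f x"
 unfolding pot_def integral_mult_right_zero[symmetric] by (intro integral_cong refl) simp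

lemma source_cut: "source k B n (cut B u) = source k B n u"
 by (rule HOL.ext) (simp add: source_def cut_def)

lemma source_outside: "B \<subseteq> cball 0 b \<Longrightarrow> b < norm y \<Longrightarrow> source k B n u y = 0"
 unfolding source_def by (rule cut_outside)

lemma ls_op_eq_incident_iff:
 assumes k: "0 < k" and B: "B \<in> sets borel" "B \<subseteq> cball 0 b" "0 \<le> b" and n: "n \<in> Linf_on B" and v: "sqint v"
 shows "ls_op k B n (abs_hl2 v) = incident k B d \<longleftrightarrow>
  (AE x in lborel. v x = (if x \<in> B then plane_wave k d x + pot k (source k B n v) x else 0))"
proof -
 have k0: "0 \<le> k" using k by simp
 let ?a = "rep_linf (contrast B n)"
 let ?p = "cut B (pot k (cut B (\<lambda>x. ?a x * v x)))"
 note av = sqint_linf_mult[OF v, of "contrast B n"]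
 have ps: "sqint ?p" by (rule sqint_green[OF k0 B(1,2) av])
 have "pot k (source k B n v) = pot k (\<lambda>x. of_real (k\<^sup>2) * cut B (\<lambda>x. ?a x * v x) x)"
 proof (rule pot_cong_AE)
  show "AE y in lborel. source k B n v y = of_real (k\<^sup>2) * cut B (\<lambda>x. ?a x * v x) y"
   using contrast_rep[OF B(1) n] by eventually_elim (auto simp: source_def cut_def)
  show "source k B n v \<in> borel_measurable borel" by (rule source_measurable[OF B(1) sqint_measurable[OF v]])
  show "(\<lambda>x. of_real (k\<^sup>2) * cut B (\<lambda>x. ?a x * v x) x) \<in> borel_measurable borel"
   by (intro borel_measurable_times borel_measurable_const cut_measurable[OF B(1) sqint_measurable[OF av]])
 qed
 then have ks: "pot k (source k B n v) x = of_real (k\<^sup>2) * pot k (cut B (\<lambda>x. ?a x * v x)) x" for x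
  by (simp only: pot_cmult)
 have eq: "(v x - k\<^sup>2 *\<^sub>R ?p x = cut B (plane_wave k d) x) = (v x = (if x \<in> B then plane_wave k d x + pot k (source k B n v) x else 0))" for x
  unfolding ks by (cases "x \<in> B") (simp_all only: cut_in cut_out not_False_eq_True scaleR_conv_of_real if_True if_False, simp_all add: diff_eq_eq)
 have L: "ls_op k B n (abs_hl2 v) = abs_hl2 (\<lambda>x. v x - k\<^sup>2 *\<^sub>R ?p x)"
  unfolding ls_op_apply[OF k0 B] mulop_abs[OF v] green_abs[OF B(1) av] hl2_scaleR_abs[OF ps] by (rule hl2_diff_abs[OF v sqint_scaleR[OF ps]])
 show ?thesis
  unfolding L incident_def hl2_eq_iff[OF sqint_diff[OF v sqint_scaleR[OF ps]] sqint_incident[OF B(1,2)]] eq by (rule refl)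
qed

lemma weak_helmholtz_cong:
 assumes "weak_helmholtz \<kappa> u g l" "\<And>\<phi>. test_fun \<phi> \<Longrightarrow> l \<phi> = m \<phi>"
 shows "weak_helmholtz \<kappa> u g m"
 using assms unfolding weak_helmholtz_def by simp

lemma scattered_field_exists:
 assumes k: "0 < k" and B: "B \<in> sets borel" "B \<subseteq> cball 0 b" "0 \<le> b" and n: "n \<in> admissible B" and d: "norm d = 1"
 shows "scattered_field k B (extend_by_one B n) d (pot k (source k B n (rep_hl2 (ls_inv k B n (incident k B d)))))"
proof -
 have k0: "0 \<le> k" using k by simp
 have nB: "n \<in> Linf_on B" using n by (simp add: admissible_def)
 let ?v = "rep_hl2 (ls_inv k B n (incident k B d))"
 let ?f = "source k B n ?v"
 let ?u = "\<lambda>x. plane_wave k d x + pot k ?f x"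
 have fs: "sqint ?f" by (intro source_sqint sqint_cut B hl2_rep)
 have f0: "\<And>y. b < norm y \<Longrightarrow> ?f y = 0" by (rule source_outside[OF B(2)])
 have fi: "integrable lborel ?f" by (rule sqint_supp_integrable[OF fs f0])
 have "(ls_op k B n o\<^sub>L ls_inv k B n) (incident k B d) = incident k B d"
  unfolding ls_inv(1)[OF k B n] by simp
 then have "ls_op k B n (abs_hl2 ?v) = incident k B d" by (simp add: hl2_abs_rep)
 then have v: "AE x in lborel. ?v x = (if x \<in> B then ?u x else 0)"
  unfolding ls_op_eq_incident_iff[OF k B nB hl2_rep] .
 have sf: "AE x in lborel. source k B n ?u x = ?f x"
  using v by eventually_elim (auto simp: source_def cut_def)
 have pL: "L2loc (pot k ?f)" "\<And>i. L2loc (dpot k i ?f)" by (rule pot_L2loc[OF k0 fs f0], assumption)+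
 let ?w = "\<lambda>x. - 1 * plane_wave k d x" and ?dw = "\<lambda>i x. - 1 * pderiv_at i (plane_wave k d) x"
 have wL: "L2loc ?w" "\<And>i. L2loc (?dw i)"
  by (intro L2loc_continuous continuous_intros continuous_plane_wave C1_on_continuous[OF C1_on_pderiv_plane_wave])+
 have ue: "(\<lambda>x. pot k ?f x - ?w x) = ?u" by (rule HOL.ext) simp
 have uL: "L2loc ?u" using L2loc_diff[OF pL(1) wL(1)] unfolding ue .
 have wh: "weak_helmholtz (of_real (k\<^sup>2)) ?u (\<lambda>i x. dpot k i ?f x - ?dw i x) (\<lambda>\<phi>. (LBINT y. ?f y * \<phi> y) - 0)"
  using weak_helmholtz_diff[OF pot_weak_helmholtz[OF k0 fs f0] weak_helmholtz_scale[OF weak_helmholtz_plane_wave[OF d], of k "- 1"]] unfolding ue .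
 have "weak_helmholtz (of_real (k\<^sup>2)) ?u (\<lambda>i x. dpot k i ?f x - ?dw i x) (\<lambda>\<phi>. (LBINT x. source k B n ?u x * \<phi> x))"
 proof (rule weak_helmholtz_cong[OF wh])
  fix \<phi> assume \<phi>: "test_fun \<phi>"
  have pm: "\<phi> \<in> borel_measurable borel" by (rule borel_measurable_continuous_onI[OF test_funD(2)[OF \<phi>]])
  have um: "?u \<in> borel_measurable borel" using uL by (simp add: L2loc_def)
  have "(LBINT y. ?f y * \<phi> y) = (LBINT x. source k B n ?u x * \<phi> x)"
  proof (rule integral_cong_AE)
   show "AE x in lborel. ?f x * \<phi> x = source k B n ?u x * \<phi> x" using sf by eventually_elim simp
   show "(\<lambda>x. ?f x * \<phi> x) \<in> borel_measurable lborel" unfolding measurable_lborel1 measurable_lborel2 by (rule borel_measurable_times[OF sqint_measurable[OF fs] pm])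
   show "(\<lambda>x. source k B n ?u x * \<phi> x) \<in> borel_measurable lborel" unfolding measurable_lborel1 measurable_lborel2 by (rule borel_measurable_times[OF source_measurable[OF B(1) um, of k n] pm])
  qed
  then show "(LBINT y. ?f y * \<phi> y) - 0 = (LBINT x. source k B n ?u x * \<phi> x)" by simp
 qed
 then have "helmholtz_solution k (extend_by_one B n) ?u"
  unfolding helmholtz_solution_iff[OF B(1)]
  by (intro exI[where x="\<lambda>i x. dpot k i ?f x - ?dw i x"] conjI allI uL L2loc_diff[OF pL(2) wL(2)])
 moreover have "C1_on (- closure B) (pot k ?f)"
  by (rule pot_C1(1)[OF k0 fi]) (use closure_subset[of B] in \<open>auto simp: source_def cut_def\<close>)
 moreover have "sommerfeld k (pot k ?f)" by (rule pot_sommerfeld[OF k0 fi f0 B(3)])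
 ultimately show ?thesis by (simp add: scattered_field_def)
qed

text \<open>
 The computation holds for every scattered field, which makes the choice in \<open>far_field\<close> irrelevant.
\<close>

lemma scattered_field_far_field:
 assumes k: "0 < k" and B: "B \<in> sets borel" "B \<subseteq> cball 0 b" "0 \<le> b" and n: "n \<in> admissible B" and d: "norm d = 1"
  and s: "scattered_field k B (extend_by_one B n) d us" and R: "b < R" and xh: "norm xh = 1"
 shows "far_field_of k R us xh = of_real (k\<^sup>2 / (4 * pi)) * cinner (mulop (contrast B n) (ls_inv k B n (incident k B d))) (incident k B xh)"
proof -
 let ?c = "cinner (mulop (contrast B n) (ls_inv k B n (incident k B d))) (incident k B xh)"
 have k0: "0 \<le> k" using k by simp
 have nB: "n \<in> Linf_on B" using n by (simp add: admissible_def)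
 let ?u = "\<lambda>x. plane_wave k d x + us x"
 let ?f = "source k B n ?u"
 obtain g where uL: "L2loc ?u" and w: "weak_helmholtz (of_real (k\<^sup>2)) ?u g (\<lambda>\<phi>. (LBINT x. ?f x * \<phi> x))"
  using s unfolding scattered_field_def helmholtz_solution_iff[OF B(1)] by blast
 have us: "sqint (cut B ?u)" by (rule L2loc_sqint_cut[OF uL B(1,2)])
 have fs: "sqint ?f" by (rule source_sqint[OF us])
 have f0: "\<And>y. b < norm y \<Longrightarrow> ?f y = 0" by (rule source_outside[OF B(2)])
 have wu: "weak_helmholtz (of_real (k\<^sup>2)) us (\<lambda>i x. g i x - pderiv_at i (plane_wave k d) x) (\<lambda>\<phi>. (LBINT x. ?f x * \<phi> x))"
  using weak_helmholtz_diff[OF w weak_helmholtz_plane_wave[OF d]] by simp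
 have "closure B \<subseteq> cball 0 b" by (rule closure_minimal[OF B(2) closed_cball])
 then have ext: "C1_on {x. b < norm x} us"
  using s unfolding scattered_field_def by (auto elim!: C1_on_subset)
 have som: "sommerfeld k us" using s by (simp add: scattered_field_def)
 have up: "AE x in lborel. us x = pot k ?f x" by (rule radiating_solution_eq_pot[OF k fs f0 B(3) wu ext som])
 have "AE x in lborel. cut B ?u x = (if x \<in> B then plane_wave k d x + pot k (source k B n (cut B ?u)) x else 0)"
  unfolding source_cut using up by eventually_elim (auto simp: cut_in cut_out)
 then have "ls_op k B n (abs_hl2 (cut B ?u)) = incident k B d"
  unfolding ls_op_eq_incident_iff[OF k B nB us] .
 then have "ls_inv k B n (incident k B d) = (ls_inv k B n o\<^sub>L ls_op k B n) (abs_hl2 (cut B ?u))" by simp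
 then have v: "ls_inv k B n (incident k B d) = abs_hl2 (cut B ?u)" unfolding ls_inv(2)[OF k B n] by simp
 have au: "sqint (\<lambda>x. rep_linf (contrast B n) x * cut B ?u x)" by (rule sqint_linf_mult[OF us])
 have um: "?u \<in> borel_measurable borel" using uL by (simp add: L2loc_def)
 have "?c = (LBINT x. rep_linf (contrast B n) x * cut B ?u x * cnj (cut B (plane_wave k xh) x))"
  unfolding v unfolding mulop_abs[OF us] incident_def by (rule cinner_abs[OF au sqint_incident[OF B(1,2)]])
 then have "of_real (k\<^sup>2) * ?c =
   (LBINT x. of_real (k\<^sup>2) * (rep_linf (contrast B n) x * cut B ?u x * cnj (cut B (plane_wave k xh) x)))"
  by (simp only: integral_mult_right_zero)
 also have "\<dots> = (LBINT x. ?f x * plane_wave k (- xh) x)"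
 proof (rule integral_cong_AE)
  show "AE x in lborel. of_real (k\<^sup>2) * (rep_linf (contrast B n) x * cut B ?u x * cnj (cut B (plane_wave k xh) x)) = ?f x * plane_wave k (- xh) x"
   using contrast_rep[OF B(1) nB] by eventually_elim (auto simp: source_def cut_def cnj_plane_wave)
  show "(\<lambda>x. of_real (k\<^sup>2) * (rep_linf (contrast B n) x * cut B ?u x * cnj (cut B (plane_wave k xh) x))) \<in> borel_measurable lborel"
   unfolding measurable_lborel1 measurable_lborel2 by (rule borel_measurable_times[OF borel_measurable_const borel_measurable_times[OF sqint_measurable[OF au] borel_measurable_cnj[OF sqint_measurable[OF sqint_incident[OF B(1,2)]]]]])
  show "(\<lambda>x. ?f x * plane_wave k (- xh) x) \<in> borel_measurable lborel"
   unfolding measurable_lborel1 measurable_lborel2 by (rule borel_measurable_times[OF source_measurable[OF B(1) um, of k n] borel_measurable_continuous_onI[OF continuous_plane_wave]])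
 qed
 finally have X: "of_real (k\<^sup>2) * ?c = (LBINT x. ?f x * plane_wave k (- xh) x)" .
 have "far_field_of k R us xh = of_real (1 / (4 * pi)) * (of_real (k\<^sup>2) * ?c)"
  unfolding X by (rule far_field_of_eq_integral[OF f0 B(3) R wu ext xh])
 also have "\<dots> = of_real (1 / (4 * pi) * k\<^sup>2) * ?c"
  by (simp only: of_real_mult mult.assoc)
 also have "1 / (4 * pi) * k\<^sup>2 = k\<^sup>2 / (4 * pi)" by simp
 finally show ?thesis .
qed

lemma far_field_eq:
 assumes k: "0 < k" and \<rho>: "0 < \<rho>" and B: "B = ball c \<rho>" and n: "n \<in> admissible B" and d: "norm d = 1" and xh: "norm xh = 1"
 shows "far_field k B (extend_by_one B n) xh d = of_real (k\<^sup>2 / (4 * pi)) * cinner (mulop (contrast B n) (ls_inv k B n (incident k B d))) (incident k B xh)"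
proof -
 define b where "b = norm c + \<rho>"
 have Bs: "B \<in> sets borel" and Bb: "B \<subseteq> cball 0 b" and b: "0 \<le> b"
 proof -
  show "B \<in> sets borel" "0 \<le> b" using \<rho> by (auto simp: B b_def)
  show "B \<subseteq> cball 0 b"
  proof
   fix x assume "x \<in> B"
   then have "norm (x - c) < \<rho>" by (simp add: B dist_norm norm_minus_commute)
   then show "x \<in> cball 0 b" using norm_triangle_ineq[of "x - c" c] by (simp add: b_def)
  qed
 qed
 define R where "R = (SOME R. 0 < R \<and> closure B \<subseteq> ball 0 R)"
 have "\<exists>R. 0 < R \<and> closure B \<subseteq> ball 0 R"
 proof (intro exI conjI)
  show "0 < b + 1" using b by simp
  have "closure B \<subseteq> cball 0 b" by (rule closure_minimal[OF Bb closed_cball])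
  then show "closure B \<subseteq> ball 0 (b + 1)" by auto
 qed
 then have R: "0 < R" "closure B \<subseteq> ball 0 R" unfolding R_def by (rule someI2_ex, simp)+
 have bR: "b < R"
 proof -
  define w where "w = (if c = 0 then axis 1 1 else c /\<^sub>R norm c)"
  have w: "norm w = 1" "c = norm c *\<^sub>R w" by (auto simp: w_def)
  have cl: "closure B = cball c \<rho>" using \<rho> by (simp add: B)
  have "c + \<rho> *\<^sub>R w \<in> cball c \<rho>" using w \<rho> by (simp add: dist_norm)
  then have "c + \<rho> *\<^sub>R w \<in> ball 0 R" using R(2) unfolding cl by blast
  moreover have "c + \<rho> *\<^sub>R w = b *\<^sub>R w" by (subst w(2)) (simp add: b_def scaleR_add_left)
  ultimately show ?thesis using w(1) b by simp
 qed
 have s: "scattered_field k B (extend_by_one B n) d (SOME us. scattered_field k B (extend_by_one B n) d us)"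
  by (rule someI[where P="scattered_field k B (extend_by_one B n) d", OF scattered_field_exists[OF k Bs Bb b n d]])
 show ?thesis unfolding far_field_def R_def[symmetric]
  by (rule scattered_field_far_field[OF k Bs Bb b n d s bR xh])
qed

section \<open>The far-field map and its derivative\<close>

lemma norm_plane_wave_diff: "norm (plane_wave k d x - plane_wave k d' x) \<le> \<bar>k\<bar> * norm x * norm (d - d')"
proof -
 define s where "s = k * (x \<bullet> d)"
 define t where "t = k * (x \<bullet> d')"
 have "exp (\<i> * of_real s) - exp (\<i> * of_real t) = exp (\<i> * of_real t) * (exp (\<i> * of_real (s - t)) - 1)"
  by (simp add: right_diff_distrib exp_add[symmetric] distrib_left[symmetric] del: of_real_diff) (simp add: of_real_add[symmetric] del: of_real_add of_real_diff)
 then have "norm (plane_wave k d x - plane_wave k d' x) = norm (exp (\<i> * of_real (s - t)) - 1)"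
  by (simp add: plane_wave_def s_def t_def norm_mult)
 also have "\<dots> = 2 * \<bar>sin ((s - t) / 2)\<bar>" by (rule dist_exp_i_1)
 also have "\<dots> \<le> 2 * \<bar>(s - t) / 2\<bar>" by (intro mult_left_mono abs_sin_x_le_abs_x) simp
 also have "\<dots> = \<bar>k\<bar> * \<bar>x \<bullet> (d - d')\<bar>" by (simp add: s_def t_def inner_diff_right abs_mult[symmetric] right_diff_distrib)
 also have "\<dots> \<le> \<bar>k\<bar> * (norm x * norm (d - d'))" by (intro mult_left_mono Cauchy_Schwarz_ineq2) simp
 finally show ?thesis by (simp add: mult.assoc)
qed

lemma norm_abs_hl2_cut_le:
 assumes B: "B \<in> sets borel" "B \<subseteq> cball 0 b" and f: "sqint f" "\<And>x. x \<in> B \<Longrightarrow> norm (f x) \<le> c" "\<And>x. x \<notin> B \<Longrightarrow> f x = 0" and c: "0 \<le> c"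
 shows "norm (abs_hl2 f) \<le> c * sqrt (measure lborel (cball (0 :: real^3) b))"
proof -
 have "(LBINT x. (norm (f x))\<^sup>2) \<le> (LBINT x. c\<^sup>2 * indicator (cball (0 :: real^3) b) x)"
 proof (rule integral_mono')
  show "integrable lborel (\<lambda>x :: real^3. c\<^sup>2 * indicator (cball 0 b) x)"
   by (intro integrable_mult_right integrable_real_indicator emeasure_bounded_finite bounded_cball) simp
  show "(norm (f x))\<^sup>2 \<le> c\<^sup>2 * indicator (cball 0 b) x" for x
   using f(2,3)[of x] B(2) by (cases "x \<in> B") (auto simp: indicator_def intro!: power_mono)
  show "0 \<le> c\<^sup>2 * indicator (cball 0 b) x" for x :: "real^3" by simp
 qed
 also have "\<dots> = c\<^sup>2 * measure lborel (cball (0 :: real^3) b)" by simp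
 finally have "sqrt (LBINT x. (norm (f x))\<^sup>2) \<le> sqrt (c\<^sup>2 * measure lborel (cball (0 :: real^3) b))" by (rule real_sqrt_le_mono)
 then show ?thesis unfolding hl2_norm_abs[OF f(1)] using c by (simp add: real_sqrt_mult)
qed

lemma norm_incident_le:
 assumes B: "B \<in> sets borel" "B \<subseteq> cball 0 b"
 shows "norm (incident k B d) \<le> sqrt (measure lborel (cball (0 :: real^3) b))"
 using norm_abs_hl2_cut_le[OF B sqint_incident[OF B, of k d], where c=1] by (simp add: incident_def cut_in cut_out)

lemma continuous_incident:
 assumes B: "B \<in> sets borel" "B \<subseteq> cball 0 b" and b: "0 \<le> b"
 shows "continuous_on UNIV (incident k B)"
proof -
 define C where "C = \<bar>k\<bar> * b * sqrt (measure lborel (cball (0 :: real^3) b))"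
 have "dist (incident k B d) (incident k B d') \<le> C * dist d d'" for d d'
 proof -
  let ?f = "\<lambda>x. cut B (plane_wave k d) x - cut B (plane_wave k d') x"
  have "norm (abs_hl2 ?f) \<le> (\<bar>k\<bar> * b * norm (d - d')) * sqrt (measure lborel (cball (0 :: real^3) b))"
  proof (rule norm_abs_hl2_cut_le[OF B])
   show "sqint ?f" by (intro sqint_diff sqint_incident[OF B])
   show "norm (?f x) \<le> \<bar>k\<bar> * b * norm (d - d')" if "x \<in> B" for x
   proof -
    have "norm x \<le> b" using that B(2) by auto
    then have "\<bar>k\<bar> * norm x * norm (d - d') \<le> \<bar>k\<bar> * b * norm (d - d')" by (intro mult_right_mono mult_left_mono) auto
    then show ?thesis using norm_plane_wave_diff[of k d x d'] that by (simp add: cut_in)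
   qed
  qed (use b in \<open>auto simp: cut_out\<close>)
  then show ?thesis unfolding incident_def dist_norm hl2_diff_abs[OF sqint_incident[OF B] sqint_incident[OF B]] by (simp add: C_def mult_ac)
 qed
 then have "C-lipschitz_on UNIV (incident k B)"
  by (intro lipschitz_onI) (auto simp: C_def b)
 then show ?thesis by (rule lipschitz_on_continuous_on)
qed

lemma norm_cinner_half: "norm (cinner f g) \<le> ((norm f)\<^sup>2 + (norm g)\<^sup>2) / 2"
proof -
 let ?f = "rep_hl2 f" and ?g = "rep_hl2 g"
 have i: "integrable lborel (\<lambda>x. ?f x * cnj (?g x))" by (rule sqint_integrable_mult[OF hl2_rep sqint_cnj[OF hl2_rep]])
 have s: "integrable lborel (\<lambda>x. (norm (?f x))\<^sup>2)" "integrable lborel (\<lambda>x. (norm (?g x))\<^sup>2)"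
  using hl2_rep[of f] hl2_rep[of g] by (auto simp: sqint_def)
 have "cinner f g = (LBINT x. ?f x * cnj (?g x))"
  using cinner_abs[OF hl2_rep hl2_rep, of f g] by (simp add: hl2_abs_rep)
 also have "norm \<dots> \<le> (LBINT x. ((norm (?f x))\<^sup>2 + (norm (?g x))\<^sup>2) / 2)"
  using s mult_le_half_squares by (intro integral_norm_bound_integral i) (auto simp: norm_mult)
 also have "\<dots> = ((norm f)\<^sup>2 + (norm g)\<^sup>2) / 2"
  using s by (simp add: hl2_norm_rep real_sqrt_pow2 integral_nonneg)
 finally show ?thesis .
qed

lemma cinner_scaleR_right: "cinner f (r *\<^sub>R g) = r *\<^sub>R cinner f g"
 using cinner_scaleR_left[of r g f] by (simp add: cinner_commute[of f] scaleR_conv_of_real)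

lemma norm_cinner_le: "norm (cinner f g) \<le> norm f * norm g"
proof (cases "f = 0 \<or> g = 0")
 case True
 then show ?thesis using cinner_scaleR_left[of 0 f g] cinner_scaleR_right[of f 0 g] by auto
next
 case False
 have "norm (cinner (f /\<^sub>R norm f) (g /\<^sub>R norm g)) \<le> 1"
  using norm_cinner_half[of "f /\<^sub>R norm f" "g /\<^sub>R norm g"] False by simp
 then have "norm (cinner f g) / (norm f * norm g) \<le> 1"
  by (simp add: cinner_scaleR_left cinner_scaleR_right divide_inverse mult_ac)
 then show ?thesis using False by (simp add: pos_divide_le_eq)
qed

lemma bounded_bilinear_cinner: "bounded_bilinear cinner"
proof
 show "cinner (f + g) h = cinner f h + cinner g h" for f g h by (rule cinner_add_left)
 show "cinner f (g + h) = cinner f g + cinner f h" for f g h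
  using cinner_add_left[of g h f] by (simp add: cinner_commute[of f])
 show "cinner (r *\<^sub>R f) g = r *\<^sub>R cinner f g" "cinner f (r *\<^sub>R g) = r *\<^sub>R cinner f g" for r f g
  by (rule cinner_scaleR_left cinner_scaleR_right)+
 show "\<exists>K. \<forall>f g. norm (cinner f g) \<le> norm f * norm g * K"
  using norm_cinner_le by (intro exI[of _ 1]) simp
qed

definition pattern_fun :: "real \<Rightarrow> (real^3) set \<Rightarrow> (hl2 \<Rightarrow>\<^sub>L hl2) \<Rightarrow> (real^3) \<times> (real^3) \<Rightarrow> complex" where
 "pattern_fun k B A = (\<lambda>(xh, d). of_real (k\<^sup>2 / (4 * pi)) * cinner (A (incident k B d)) (incident k B xh))"

text \<open>
 The far field depends on the medium only through an operator on \<open>B\<close>, and linearly on that operator.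
\<close>

definition pattern :: "real \<Rightarrow> (real^3) set \<Rightarrow> (hl2 \<Rightarrow>\<^sub>L hl2) \<Rightarrow> l2" where
 "pattern k B A = abs_l2 (pattern_fun k B A)"

definition pattern_const :: "real \<Rightarrow> real \<Rightarrow> real" where
 "pattern_const k b = k\<^sup>2 / (4 * pi) * measure lborel (cball (0 :: real^3) b)"

lemma norm_pattern_fun_le:
 assumes B: "B \<in> sets borel" "B \<subseteq> cball 0 b"
 shows "norm (pattern_fun k B A p) \<le> pattern_const k b * norm A"
proof -
 let ?m = "measure lborel (cball (0 :: real^3) b)"
 obtain xh d where p: "p = (xh, d)" by (cases p)
 have "norm (cinner (A (incident k B d)) (incident k B xh)) \<le> norm (A (incident k B d)) * norm (incident k B xh)" by (rule norm_cinner_le)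
 also have "\<dots> \<le> (norm A * norm (incident k B d)) * norm (incident k B xh)" by (intro mult_right_mono norm_blinfun) simp
 also have "\<dots> \<le> (norm A * sqrt ?m) * sqrt ?m" by (intro mult_mono mult_left_mono norm_incident_le[OF B]) auto
 also have "\<dots> = norm A * ?m" by (simp add: mult.assoc)
 finally have "k\<^sup>2 / (4 * pi) * norm (cinner (A (incident k B d)) (incident k B xh)) \<le> k\<^sup>2 / (4 * pi) * (norm A * ?m)"
  by (rule mult_left_mono) simp
 then show ?thesis unfolding pattern_fun_def pattern_const_def p by (simp add: norm_mult norm_divide norm_power mult_ac)
qed

lemma finite_S2S2: "finite_measure S2S2"
 by (rule finite_measure_pair_measure) (rule S2.finite_measure_axioms)+

lemma pattern_fun_l2:
 assumes B: "B \<in> sets borel" "B \<subseteq> cball 0 b" and b: "0 \<le> b"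
 shows "l2_fun (pattern_fun k B A)"
 unfolding l2_fun_def
proof
 note ci = continuous_incident[OF B b, of k]
 have 1: "fst \<in> borel_measurable S2S2" "snd \<in> borel_measurable S2S2"
  by (rule measurable_compose[OF measurable_fst id_S2_measurable], rule measurable_compose[OF measurable_snd id_S2_measurable])
 have "continuous_on UNIV (\<lambda>p. of_real (k\<^sup>2 / (4 * pi)) * cinner (A (incident k B (snd p))) (incident k B (fst p)))"
  by (intro continuous_on_mult continuous_on_const bounded_bilinear.continuous_on[OF bounded_bilinear_cinner]
   blinfun.continuous_on continuous_on_compose2[OF ci] continuous_on_snd continuous_on_fst continuous_on_id) auto
 from borel_measurable_continuous_Pair[OF 1 this]
 show m: "pattern_fun k B A \<in> borel_measurable S2S2" by (simp add: pattern_fun_def case_prod_beta)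
 interpret finite_measure S2S2 by (rule finite_S2S2)
 show "integrable S2S2 (\<lambda>p. (norm (pattern_fun k B A p))\<^sup>2)"
  by (rule integrable_const_bound[where B="(pattern_const k b * norm A)\<^sup>2"])
   (use m norm_pattern_fun_le[OF B] in \<open>auto intro!: AE_I2 power_mono\<close>)
qed

lemma bounded_linear_pattern:
 assumes B: "B \<in> sets borel" "B \<subseteq> cball 0 b" and b: "0 \<le> b"
 shows "bounded_linear (pattern k B)"
proof (rule bounded_linear_intro)
 note l = pattern_fun_l2[OF B b, of k]
 note r = l2_rel_def l
 interpret bounded_bilinear cinner by (rule bounded_bilinear_cinner)
 show "pattern k B (A + A') = pattern k B A + pattern k B A'" for A A'
 proof -
  have "pattern k B A + pattern k B A' = abs_l2 (\<lambda>p. pattern_fun k B A p + pattern_fun k B A' p)"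
   unfolding pattern_def by (rule plus_l2.abs_eq) (simp_all add: r)
  also have "(\<lambda>p. pattern_fun k B A p + pattern_fun k B A' p) = pattern_fun k B (A + A')"
   by (auto simp: pattern_fun_def fun_eq_iff blinfun.add_left add_left distrib_left)
  finally show ?thesis by (simp add: pattern_def)
 qed
 show "pattern k B (c *\<^sub>R A) = c *\<^sub>R pattern k B A" for c A
 proof -
  have "c *\<^sub>R pattern k B A = abs_l2 (\<lambda>p. c *\<^sub>R pattern_fun k B A p)"
   unfolding pattern_def by (rule scaleR_l2.abs_eq) (simp_all add: r)
  also have "(\<lambda>p. c *\<^sub>R pattern_fun k B A p) = pattern_fun k B (c *\<^sub>R A)"
   by (auto simp: pattern_fun_def fun_eq_iff blinfun.scaleR_left scaleR_left)
  finally show ?thesis by (simp add: pattern_def)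
 qed
 interpret finite_measure S2S2 by (rule finite_S2S2)
 show "norm (pattern k B A) \<le> norm A * (pattern_const k b * sqrt (measure S2S2 (space S2S2)))" for A
 proof -
  have pc: "0 \<le> pattern_const k b" by (simp add: pattern_const_def)
  have "(\<integral>p. (norm (pattern_fun k B A p))\<^sup>2 \<partial>S2S2) \<le> (\<integral>p. (pattern_const k b * norm A)\<^sup>2 \<partial>S2S2)"
   using l[of A] norm_pattern_fun_le[OF B] by (intro integral_mono_AE AE_I2 power_mono) (auto simp: l2_fun_def)
  also have "\<dots> = (pattern_const k b * norm A)\<^sup>2 * measure S2S2 (space S2S2)" by simp
  finally have "sqrt (\<integral>p. (norm (pattern_fun k B A p))\<^sup>2 \<partial>S2S2) \<le> sqrt ((pattern_const k b * norm A)\<^sup>2 * measure S2S2 (space S2S2))"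
   by (rule real_sqrt_le_mono)
  then show ?thesis unfolding pattern_def l2_norm_abs[OF l] using pc by (simp add: real_sqrt_mult mult_ac)
 qed
qed

lemma ball_bounds:
 fixes c :: "real^3"
 assumes "0 < \<rho>"
 shows "ball c \<rho> \<in> sets borel" "ball c \<rho> \<subseteq> cball 0 (norm c + \<rho>)" "0 \<le> norm c + \<rho>"
proof -
 show "ball c \<rho> \<subseteq> cball 0 (norm c + \<rho>)"
 proof
  fix x assume "x \<in> ball c \<rho>"
  then have "norm (x - c) < \<rho>" by (simp add: dist_norm norm_minus_commute)
  then show "x \<in> cball 0 (norm c + \<rho>)" using norm_triangle_ineq[of "x - c" c] by simp
 qed
qed (use assms in auto)

lemma far_field_map_eq:
 assumes k: "0 < k" and \<rho>: "0 < \<rho>" and B: "B = ball c \<rho>" and n: "n \<in> admissible B"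
 shows "far_field_map k B n = pattern k B (mulB (contrast B n) o\<^sub>L ls_inv k B n)"
proof -
 let ?F = "\<lambda>(xh, d). far_field k B (extend_by_one B n) xh d" and ?P = "pattern_fun k B (mulB (contrast B n) o\<^sub>L ls_inv k B n)"
 have eq: "?F p = ?P p" if "p \<in> space S2S2" for p
  using that far_field_eq[OF k \<rho> B n, of "snd p" "fst p"]
  by (auto simp: space_pair_measure space_S2_measure pattern_fun_def mulB_apply)
 have P: "l2_fun ?P" unfolding B by (rule pattern_fun_l2[OF ball_bounds[OF \<rho>]])
 have "l2_fun ?F"
  using P eq unfolding l2_fun_def by (simp cong: measurable_cong integrable_cong)
 then have "l2_rel ?F ?P" using P eq by (auto simp: l2_rel_def)
 then show ?thesis unfolding far_field_map_def pattern_def by (rule Quotient_rel_abs[OF Quotient_l2])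
qed

definition born_op :: "real \<Rightarrow> (real^3) set \<Rightarrow> linf \<Rightarrow> linf \<Rightarrow> hl2 \<Rightarrow>\<^sub>L hl2" where
 "born_op k B n h = (mulB (contrast B n) o\<^sub>L - (ls_inv k B n o\<^sub>L (ls_deriv k B h o\<^sub>L ls_inv k B n))) + (mulB h o\<^sub>L ls_inv k B n)"

text \<open>
 The derivative of the far-field map: the product rule for contrast times resolvent.
\<close>

definition born :: "real \<Rightarrow> (real^3) set \<Rightarrow> linf \<Rightarrow> linf \<Rightarrow> l2" where
 "born k B n h = pattern k B (born_op k B n h)"

lemma far_field_map_has_derivative:
 assumes k: "0 < k" and \<rho>: "0 < \<rho>" and B: "B = ball c \<rho>" and n: "n \<in> admissible B"
 shows "(far_field_map k B has_derivative born k B n) (at n within admissible B)"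
proof -
 note bb = ball_bounds[OF \<rho>, of c, folded B]
 have "(contrast B has_derivative (\<lambda>h. h)) (at n within admissible B)"
  unfolding contrast_def[abs_def] by (auto intro!: derivative_eq_intros)
 from bounded_linear.has_derivative[OF bounded_linear_mulB this]
 have 1: "((\<lambda>n. mulB (contrast B n)) has_derivative (\<lambda>h. mulB h)) (at n within admissible B)" .
 have 2: "(ls_inv k B has_derivative (\<lambda>h. - (ls_inv k B n o\<^sub>L (ls_deriv k B h o\<^sub>L ls_inv k B n)))) (at n within admissible B)"
  by (rule ls_inv_has_derivative[OF k bb n])
 from bounded_linear.has_derivative[OF bounded_linear_pattern[OF bb, of k] bounded_bilinear.FDERIV[OF bounded_bilinear_blinfun_compose 1 2]]
 have "((\<lambda>n. pattern k B (mulB (contrast B n) o\<^sub>L ls_inv k B n)) has_derivative born k B n) (at n within admissible B)"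
  unfolding born_def[abs_def] born_op_def .
 then show ?thesis by (rule has_derivative_transform[OF n, rotated]) (rule far_field_map_eq[OF k \<rho> B])
qed

text \<open>
 A derivative within a set is determined along every direction that stays in the set for a short time.
\<close>

lemma has_derivative_unique_in_direction:
 fixes F :: "'a::real_normed_vector \<Rightarrow> 'b::real_normed_vector"
 assumes D: "(F has_derivative D) (at x within A)" and D': "(F has_derivative D') (at x within A)"
  and e: "0 < e" and A: "\<And>t. 0 \<le> t \<Longrightarrow> t \<le> e \<Longrightarrow> x + t *\<^sub>R w \<in> A"
 shows "D w = D' w"
proof -
 define p where "p t = x + t *\<^sub>R w" for t :: real
 have p: "(p has_derivative (\<lambda>t. t *\<^sub>R w)) (at 0 within {0..e})"
  unfolding p_def by (auto intro!: derivative_eq_intros)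
 have sub: "p ` {0..e} \<subseteq> A" using A by (auto simp: p_def)
 have v: "((\<lambda>t. F (p t)) has_vector_derivative L w) (at 0 within {0..e})" if L: "(F has_derivative L) (at x within A)" for L
 proof -
  have "(F has_derivative L) (at (p 0) within p ` {0..e})" using has_derivative_subset[OF L sub] by (simp add: p_def)
  from has_derivative_in_compose[OF p this]
  have "((\<lambda>t. F (p t)) has_derivative (\<lambda>t. L (t *\<^sub>R w))) (at 0 within {0..e})" .
  then show ?thesis
   unfolding has_vector_derivative_def by (simp add: linear_scale[OF has_derivative_linear[OF L]])
 qed
 show ?thesis
 proof (rule vector_derivative_unique_within[OF _ v[OF D] v[OF D']])
  show "at 0 within {0..e} \<noteq> bot" using e by (simp add: trivial_limit_within islimpt_Icc)
 qed
qed

lemma admissible_absorbs: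
 assumes n: "n \<in> admissible B" and w: "w \<in> Linf_on B"
 shows "\<exists>e>0. \<forall>t. 0 \<le> t \<longrightarrow> t \<le> e \<longrightarrow> n + t *\<^sub>R w \<in> admissible B"
proof -
 obtain m where m: "m > 0" "AE x in lborel. x \<in> B \<longrightarrow> m \<le> Im (rep_linf n x)" and nB: "n \<in> Linf_on B"
  using n by (auto simp: admissible_def)
 define e where "e = m / (2 * (norm w + 1))"
 have pos: "0 < 2 * (norm w + 1)" by (simp add: add_nonneg_pos)
 then have e: "0 < e" using m(1) unfolding e_def by (rule divide_pos_pos[rotated])
 have ew: "e * norm w \<le> m / 2"
 proof -
  have "e * norm w \<le> e * (norm w + 1)" using e by (intro mult_left_mono) auto
  also have "\<dots> = m / 2"
  proof -
   have "norm w + 1 \<noteq> 0" using norm_ge_zero[of w] by linarith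
   moreover have "m / (2 * z) * z = m / 2" if "z \<noteq> 0" for z :: real using that by simp
   ultimately show ?thesis unfolding e_def by blast
  qed
  finally show ?thesis .
 qed
 have "n + t *\<^sub>R w \<in> admissible B" if t: "0 \<le> t" "t \<le> e" for t
 proof -
  have r: "AE x in lborel. rep_linf (n + t *\<^sub>R w) x = rep_linf n x + t *\<^sub>R rep_linf w x"
   using linf_add_rep[of n "t *\<^sub>R w"] linf_scaleR_rep[of t w] by eventually_elim simp
  have "n + t *\<^sub>R w \<in> Linf_on B"
   using r nB w unfolding Linf_on_def mem_Collect_eq by eventually_elim auto
  moreover have "AE x in lborel. x \<in> B \<longrightarrow> m / 2 \<le> Im (rep_linf (n + t *\<^sub>R w) x)"
   using r m(2) linf_AE_le_norm[of w]
  proof eventually_elim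
   case (elim x)
   have "\<bar>Im (rep_linf w x)\<bar> \<le> norm w" using abs_Im_le_cmod[of "rep_linf w x"] elim(3) by linarith
   then have "t * \<bar>Im (rep_linf w x)\<bar> \<le> e * norm w" using t e by (intro mult_mono) auto
   then have "\<bar>t * Im (rep_linf w x)\<bar> \<le> m / 2" using ew t by (simp add: abs_mult)
   then show ?case using elim by auto
  qed
  ultimately show ?thesis using m(1) unfolding admissible_def by (auto intro!: exI[of _ "m / 2"])
 qed
 then show ?thesis using e by blast
qed

lemma far_field_deriv:
 assumes k: "0 < k" and \<rho>: "0 < \<rho>" and B: "B = ball c \<rho>" and n: "n \<in> admissible B"
 shows "(far_field_map k B has_derivative far_field_deriv k B n) (at n within admissible B)"
  and "w \<in> Linf_on B \<Longrightarrow> far_field_deriv k B n w = born k B n w"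
proof -
 note d = far_field_map_has_derivative[OF k \<rho> B n]
 show D: "(far_field_map k B has_derivative far_field_deriv k B n) (at n within admissible B)"
  unfolding far_field_deriv_def frechet_derivative_works[symmetric] using d by (rule differentiableI)
 assume "w \<in> Linf_on B"
 then obtain e where "0 < e" "\<And>t. 0 \<le> t \<Longrightarrow> t \<le> e \<Longrightarrow> n + t *\<^sub>R w \<in> admissible B" using admissible_absorbs[OF n] by blast
 then show "far_field_deriv k B n w = born k B n w" by (rule has_derivative_unique_in_direction[OF D d])
qed

lemma continuous_born_op:
 assumes k: "0 < k" and \<rho>: "0 < \<rho>" and B: "B = ball c \<rho>"
 shows "continuous_on (admissible B \<times> UNIV) (\<lambda>(n, h). born_op k B n h)"
proof -
 note bb = ball_bounds[OF \<rho>, of c, folded B]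
 have S: "continuous_on (admissible B) (ls_inv k B)"
  by (rule has_derivative_continuous_on) (rule ls_inv_has_derivative[OF k bb])
 have S': "continuous_on (admissible B \<times> (UNIV :: linf set)) (\<lambda>p. ls_inv k B (fst p))"
  by (rule continuous_on_compose2[OF S continuous_on_fst[OF continuous_on_id]]) auto
 have c: "continuous_on (admissible B \<times> (UNIV :: linf set)) (\<lambda>p. contrast B (fst p))"
  unfolding contrast_def by (intro continuous_intros)
 show ?thesis unfolding born_op_def case_prod_beta
  by (intro continuous_on_add continuous_on_minus
   bounded_bilinear.continuous_on[OF bounded_bilinear_blinfun_compose] bounded_linear.continuous_on[OF bounded_linear_mulB]
   bounded_linear.continuous_on[OF bounded_linear_ls_deriv] S' c continuous_on_snd continuous_on_id)
qed

section \<open>Stability with finitely many measurements\<close>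

theorem theorem6:
 fixes k \<rho> C :: real and c :: "real^3" and B :: "(real^3) set"
  and W K :: "linf set" and Q :: "nat \<Rightarrow> l2 \<Rightarrow> l2"
 assumes "k > 0"
  and "\<rho> > 0" and "B = ball c \<rho>"
  and "W \<subseteq> Linf_on B"
  and "cvec.subspace W" and "\<exists>S. finite S \<and> W = cvec.span S"
  and "K \<subseteq> W \<inter> admissible B" and "convex K" and "compact K"
  and "\<And>N. bounded_linear (Q N)"
  and "\<And>N a f. Q N (a *\<^sub>C f) = a *\<^sub>C Q N f"
  and "\<And>N f g. cinner_l2 (Q N f) g = cinner_l2 f (Q N g)"
  and "\<And>f. (\<lambda>N. Q N f) \<longlonglongrightarrow> f"
  and "C > 0"
  and "\<And>n1 n2. n1 \<in> K \<Longrightarrow> n2 \<in> K \<Longrightarrow>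
   norm (n1 - n2) \<le> C * norm (far_field_map k B n1 - far_field_map k B n2)"
 shows "(\<exists>N. \<forall>n1\<in>K. \<forall>n2\<in>K. norm (n1 - n2) \<le>
    2 * C * norm (Q N (far_field_map k B n1) - Q N (far_field_map k B n2))) \<and>
  (\<exists>N. (SUP \<xi>\<in>K. opnorm_on W (\<lambda>w. far_field_deriv k B \<xi> w - Q N (far_field_deriv k B \<xi> w)))
    \<le> ennreal (1 / (2 * C))) \<and>
  (\<forall>N. (SUP \<xi>\<in>K. opnorm_on W (\<lambda>w. far_field_deriv k B \<xi> w - Q N (far_field_deriv k B \<xi> w)))
    \<le> ennreal (1 / (2 * C)) \<longrightarrow>
   (\<forall>n1\<in>K. \<forall>n2\<in>K. norm (n1 - n2) \<le>
    2 * C * norm (Q N (far_field_map k B n1) - Q N (far_field_map k B n2))))"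
proof -
 note k = assms(1) and \<rho> = assms(2) and B = assms(3) and W = assms(4)
 note Q = assms(10) and Qlim = assms(13) and C = assms(14) and stab = assms(15)
 let ?F = "far_field_map k B" and ?D = "far_field_deriv k B"
 have KW: "K \<subseteq> W" and KA: "K \<subseteq> admissible B" using assms(7) by auto
 have small: "\<exists>N. (SUP \<xi>\<in>K. opnorm_on W (\<lambda>w. ?D \<xi> w - Q N (?D \<xi> w))) \<le> ennreal (1 / (2 * C))"
 proof -
  obtain S where S: "finite S" "W = cvec.span S" using assms(6) by blast
  have "compact (W \<inter> cball 0 1)" unfolding S(2) by (rule compact_span_Int_cball[OF S(1)])
  then have cp: "compact (K \<times> (W \<inter> cball 0 1))" by (rule compact_Times[OF assms(9)])
  have "continuous_on (K \<times> (W \<inter> cball 0 1)) (\<lambda>(n, h). born_op k B n h)"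
   by (rule continuous_on_subset[OF continuous_born_op[OF k \<rho> B]]) (use KA in auto)
  then have cpt: "compact ((\<lambda>(n, h). born_op k B n h) ` (K \<times> (W \<inter> cball 0 1)))" by (rule compact_continuous_image[OF _ cp])
  have bl: "bounded_linear (pattern k B)" unfolding B by (rule bounded_linear_pattern[OF ball_bounds[OF \<rho>]])
  have "0 < 1 / (2 * C)" using C by simp
  then obtain N where N: "\<forall>A\<in>(\<lambda>(n, h). born_op k B n h) ` (K \<times> (W \<inter> cball 0 1)). norm (pattern k B A - Q N (pattern k B A)) \<le> 1 / (2 * C)"
   using strong_convergence_uniform_on_compact[OF bounded_linear_compose[OF Q bl] Qlim bl cpt] by blast
  have "(SUP \<xi>\<in>K. opnorm_on W (\<lambda>w. ?D \<xi> w - Q N (?D \<xi> w))) \<le> ennreal (1 / (2 * C))"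
   unfolding opnorm_on_def
  proof (intro SUP_least ennreal_leI)
   fix \<xi> w assume \<xi>: "\<xi> \<in> K" and w: "w \<in> {w \<in> W. norm w \<le> 1}"
   have "?D \<xi> w = born k B \<xi> w" using far_field_deriv(2)[OF k \<rho> B, of \<xi> w] \<xi> w KA W by auto
   then show "norm (?D \<xi> w - Q N (?D \<xi> w)) \<le> 1 / (2 * C)" using N \<xi> w by (auto simp: born_def)
  qed
  then show ?thesis by blast
 qed
 have imp: "norm (n1 - n2) \<le> 2 * C * norm (Q N (?F n1) - Q N (?F n2))"
  if N: "(SUP \<xi>\<in>K. opnorm_on W (\<lambda>w. ?D \<xi> w - Q N (?D \<xi> w))) \<le> ennreal (1 / (2 * C))" and n: "n1 \<in> K" "n2 \<in> K" for N n1 n2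
 proof -
  interpret Q: bounded_linear "Q N" by (rule Q)
  let ?w = "n1 - n2"
  have ww: "r *\<^sub>R ?w \<in> W" for r
   using cvec.subspace_scale[OF assms(5) cvec.subspace_diff[OF assms(5)], of n1 n2 "of_real r"] n KW by (auto simp: scaleC_of_real)
  have der: "((\<lambda>x. ?F x - Q N (?F x)) has_derivative (\<lambda>w. ?D \<xi> w - Q N (?D \<xi> w))) (at \<xi> within admissible B)" if "\<xi> \<in> K" for \<xi>
   by (intro has_derivative_diff Q.has_derivative far_field_deriv(1)[OF k \<rho> B]) (use that KA in auto)
  have "norm ((?F n1 - Q N (?F n1)) - (?F n2 - Q N (?F n2))) \<le> 1 / (2 * C) * norm ?w"
  proof (rule norm_diff_le_along_segment[OF der KA assms(8) n(2,1)])
   fix \<xi> assume \<xi>: "\<xi> \<in> K"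
   show "norm (?D \<xi> ?w - Q N (?D \<xi> ?w)) \<le> 1 / (2 * C) * norm ?w"
   proof (rule norm_le_of_opnorm_on[where W=W])
    show "opnorm_on W (\<lambda>w. ?D \<xi> w - Q N (?D \<xi> w)) \<le> ennreal (1 / (2 * C))"
     by (rule order_trans[OF SUP_upper[OF \<xi>] N])
    show "bounded_linear (\<lambda>w. ?D \<xi> w - Q N (?D \<xi> w))" by (rule has_derivative_bounded_linear[OF der[OF \<xi>]])
    show "?w \<in> W" using ww[of 1] by simp
   qed (use C ww in auto)
  qed
  moreover have "(?F n1 - Q N (?F n1)) - (?F n2 - Q N (?F n2)) = (?F n1 - ?F n2) - (Q N (?F n1) - Q N (?F n2))" by simp
  ultimately have "norm (?F n1 - ?F n2) \<le> norm (Q N (?F n1) - Q N (?F n2)) + 1 / (2 * C) * norm ?w"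
   using norm_triangle_ineq2[of "?F n1 - ?F n2" "Q N (?F n1) - Q N (?F n2)"] by simp
  then have "C * norm (?F n1 - ?F n2) \<le> C * (norm (Q N (?F n1) - Q N (?F n2)) + 1 / (2 * C) * norm ?w)"
   using C by (intro mult_left_mono) auto
  then have "norm ?w \<le> C * norm (Q N (?F n1) - Q N (?F n2)) + norm ?w / 2"
   using stab[OF n] C by (simp add: distrib_left)
  then show ?thesis by simp
 qed
 show ?thesis using small imp by blast
qed

end
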